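(* Let $W=\{W(h):h\in\mathfrak{H}\}$ be an isonormal Gaussian process over a real separable Hilbert space $\mathfrak{H}$. Let $N_0\ge 1$ be an integer, let $(q_i)_{i\ge1}$ be integers in $\{1,\dots,N_0\}$, and let $f_{ij}\in\mathfrak{H}^{\odot q_i}$ ($i,j\ge 1$). Put $X_{ij}=I_{q_i}(f_{ij})$, and assume that the random variables $X_{ij}$ are independent (not necessarily identically distributed) and that there is a real number $m_4$ such that for all $i,j$, $$\mathbb{E}(X_{ij}^2)=q_i!\,\|f_{ij}\|^2_{\mathfrak{H}^{\otimes q_i}}=1,\qquad \mathbb{E}(X_{ij}^4)=m_4 .$$ For $n,d\ge 1$ let $\mathcal{X}_{n,d}=(X_{ij})_{1\le i\le n,\,1\le j\le d}$, let $$\mathcal{W}_{n,d}=\tfrac1d\,\mathcal{X}_{n,d}\mathcal{X}_{n,d}^{T}-\mathcal{I}_n,\qquad \widetilde{\mathcal{W}}_{n,d}=\sqrt d\,\mathcal{W}_{n,d},$$ where $\mathcal{I}_n$ is the $n\times n$ identity matrix. Let $\mathcal{Z}_n=(Z_{ij})_{1\le i,j\le n}$ be the symmetric random matrix such that the entries $\{Z_{ij}: i\le j\}$ are independent, $Z_{ii}\sim N(0,m_4-1)$ for $1\le i\le n$, $Z_{ij}\sim N(0,1)$ for $1\le i<j\le n$, and $Z_{ij}=Z_{ji}$ for $j<i$. Then for every $n\ge1$, $\widetilde{\mathcal{W}}_{n,d}$ converges in distribution componentwise to $\mathcal{Z}_n$ as $d\to\infty$. Moreover, there exists a constant $C>0$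 (not depending on $n$ or $d$) such that for every $n,d\ge1$, $$d_W(\widetilde{\mathcal{W}}_{n,d},\mathcal{Z}_n)\le C\sqrt{\frac{n^3}{d}} .$$
   Context: An isonormal Gaussian process over $\mathfrak{H}$ is a centered Gaussian family $\{W(h):h\in\mathfrak{H}\}$ with $\mathbb{E}(W(h)W(g))=\langle h,g\rangle_{\mathfrak{H}}$. $\mathfrak{H}^{\odot q}$ is the $q$-th symmetric tensor power of $\mathfrak{H}$, and $I_q$ is the multiple Wiener(-Itô) integral of order $q$ with respect to $W$, normalized by $\mathbb{E}(I_q(f)I_p(g))=\mathbf{1}_{\{p=q\}}\,q!\,\langle f,g\rangle_{\mathfrak{H}^{\otimes q}}$ for symmetric $f,g$. For random matrices $\mathcal{X},\mathcal{Y}$ with values in the space $\mathcal{M}_n(\mathbb{R})$ of real $n\times n$ matrices, the Wasserstein distance is $$d_W(\mathcal{X},\mathcal{Y})=\sup_{\|g\|_{\mathrm{Lip}}\le1}|\mathbb{E}(g(\mathcal{X}))-\mathbb{E}(g(\mathcal{Y}))|,$$ the supremum being over $g:\mathcal{M}_n(\mathbb{R})\to\mathbb{R}$ with $\|g\|_{\mathrm{Lip}}=\sup_{A\ne B}\frac{|g(A)-g(B)|}{\|A-B\|_{\mathrm{HS}}}$, where $\|\cdot\|_{\mathrm{HS}}$ is the Hilbert–Schmidt norm. *)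

theory Defs
  imports "HOL-Probability.Probability" "Jordan_Normal_Form.Matrix"
begin

section \<open>Gaussian variables and isonormal processes\<close>

text \<open>The variance may be zero, in which case the law is a point mass.\<close>

definition gaussian_rv :: "'w measure \<Rightarrow> ('w \<Rightarrow> real) \<Rightarrow> real \<Rightarrow> real \<Rightarrow> bool" where
  "gaussian_rv M Y \<mu> v \<longleftrightarrow>
     Y \<in> borel_measurable M \<and> 0 \<le> v \<and>
     (if v = 0 then AE \<omega> in M. Y \<omega> = \<mu>
      else distributed M lborel Y (normal_density \<mu> (sqrt v)))"

definition isonormal_process ::
  "'w measure \<Rightarrow> ('h::{real_inner,polish_space} \<Rightarrow> 'w \<Rightarrow> real) \<Rightarrow> bool" where
  "isonormal_process M W \<longleftrightarrow>
     prob_space M \<and>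
     (\<forall>A c. finite A \<longrightarrow> (\<exists>v. gaussian_rv M (\<lambda>\<omega>. \<Sum>h\<in>A. c h * W h \<omega>) 0 v)) \<and>
     (\<forall>g h. (\<integral>\<omega>. W g \<omega> * W h \<omega> \<partial>M) = inner g h)"


section \<open>Tensor powers of a Hilbert space\<close>

definition orthonormal_basis :: "'h::real_inner set \<Rightarrow> bool" where
  "orthonormal_basis B \<longleftrightarrow>
     pairwise Linear_Algebra.orthogonal B \<and> (\<forall>b\<in>B. norm b = 1) \<and> closure (span B) = UNIV"

lemma orthonormal_basis_exists:
  "\<exists>B :: 'h::{real_inner,polish_space} set. orthonormal_basis B"
proof -
  obtain D :: "'h set" where D: "countable D" "\<And>X. open X \<Longrightarrow> X \<noteq> {} \<Longrightarrow> \<exists>d\<in>D. d \<in> X"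
    using countable_dense_exists by blast
  from D(2)[of UNIV] have "D \<noteq> {}" by auto
  define d where "d = from_nat_into D"
  have range_d: "range d = D"
    using D(1) \<open>D \<noteq> {}\<close> by (simp add: d_def)
  define S where "S = rec_nat ({} :: 'h set)
    (\<lambda>n S. insert (d n - (\<Sum>b\<in>S. (inner b (d n) / inner b b) *\<^sub>R b)) S)"
  have S_0: "S 0 = {}" by (simp add: S_def)
  have S_Suc: "S (Suc n) =
    insert (d n - (\<Sum>b\<in>S n. (inner b (d n) / inner b b) *\<^sub>R b)) (S n)" for n
    by (simp add: S_def)
  have fin: "finite (S n)" for n by (induction n) (auto simp: S_0 S_Suc)
  have orth: "pairwise Linear_Algebra.orthogonal (S n)" for n
  proof (induction n)
    case 0
    show ?case by (simp add: S_0)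
  next
    case (Suc n)
    let ?u = "d n - (\<Sum>b\<in>S n. (inner b (d n) / inner b b) *\<^sub>R b)"
    have "inner a ?u = 0" if a: "a \<in> S n" for a
    proof -
      have "(\<Sum>b\<in>S n. (inner b (d n) / inner b b) * inner a b) =
            (\<Sum>b\<in>S n. if b = a then inner a (d n) else 0)"
      proof (rule sum.cong)
        fix b assume "b \<in> S n"
        with Suc a have "b \<noteq> a \<Longrightarrow> inner a b = 0"
          by (auto simp: pairwise_def Linear_Algebra.orthogonal_def)
        then show "(inner b (d n) / inner b b) * inner a b =
            (if b = a then inner a (d n) else 0)"
          by auto
      qed simp
      also have "\<dots> = inner a (d n)"
        using fin a by simp
      finally show ?thesis
        by (simp add: inner_diff_right inner_sum_right)
    qed
    with Suc show ?case
      by (auto simp: S_Suc pairwise_insert Linear_Algebra.orthogonal_def inner_commute)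
  qed
  have mono_S: "S m \<subseteq> S n" if "m \<le> n" for m n
    using that by (rule lift_Suc_mono_le[of S, rotated]) (auto simp: S_Suc)
  define U where "U = (\<Union>n. S n)"
  have orth_U: "pairwise Linear_Algebra.orthogonal U"
  proof (rule pairwiseI)
    fix x y assume "x \<in> U" "y \<in> U" "x \<noteq> y"
    then obtain m n where "x \<in> S m" "y \<in> S n" by (auto simp: U_def)
    then have "x \<in> S (max m n)" "y \<in> S (max m n)"
      using mono_S[of m "max m n"] mono_S[of n "max m n"] by auto
    with orth[of "max m n"] \<open>x \<noteq> y\<close> show "Linear_Algebra.orthogonal x y"
      by (auto simp: pairwise_def)
  qed
  define B where "B = (\<lambda>x. x /\<^sub>R norm x) ` (U - {0})"
  have "x \<in> span B" if "x \<in> U" for x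
  proof (cases "x = 0")
    case True
    then show ?thesis by (simp add: span_zero)
  next
    case False
    with that have "x /\<^sub>R norm x \<in> B" by (auto simp: B_def)
    then have "norm x *\<^sub>R (x /\<^sub>R norm x) \<in> span B"
      by (intro span_mul span_base)
    with False show ?thesis by simp
  qed
  then have span_U: "span U \<subseteq> span B"
    by (intro span_minimal) auto
  have "d n \<in> span U" for n
  proof -
    let ?s = "\<Sum>b\<in>S n. (inner b (d n) / inner b b) *\<^sub>R b"
    have "d n - ?s \<in> U" using S_Suc[of n] unfolding U_def by blast
    then have "d n - ?s \<in> span U" by (rule span_base)
    moreover have "?s \<in> span U"
      by (intro span_sum span_mul span_base) (auto simp: U_def)
    ultimately have "(d n - ?s) + ?s \<in> span U"
      by (rule span_add)
    then show ?thesis by simp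
  qed
  then have "D \<subseteq> span B" using range_d span_U by auto
  moreover have "closure D = UNIV"
  proof -
    have "- closure D = {}"
      using D(2)[of "- closure D"] closure_subset[of D] by auto
    then show ?thesis by auto
  qed
  ultimately have "closure (span B) = UNIV"
    using closure_mono by blast
  moreover have "pairwise Linear_Algebra.orthogonal B"
    using orth_U by (auto simp: B_def pairwise_def Linear_Algebra.orthogonal_def)
  moreover have "\<forall>b\<in>B. norm b = 1" by (auto simp: B_def)
  ultimately show ?thesis unfolding orthonormal_basis_def by blast
qed

definition onb :: "'h::{real_inner,polish_space} set" where
  "onb = (SOME B. orthonormal_basis B)"

lemma orthonormal_basis_onb: "orthonormal_basis onb"
  unfolding onb_def by (rule someI_ex) (rule orthonormal_basis_exists)

text \<open>
  The Hilbert tensor power of order \<open>q\<close> is realized as the space of Hilbert--Schmidt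
  \<open>q\<close>-linear forms: the elementary tensor of \<open>h\<^sub>1, \<dots>, h\<^sub>q\<close> is the form sending
  \<open>(x\<^sub>1, \<dots>, x\<^sub>q)\<close> to the product of the inner products of \<open>h\<^sub>k\<close> and \<open>x\<^sub>k\<close>. Arguments
  are lists of length \<open>q\<close>, and a form is zero on all other lists, so that it is
  determined by its values on the relevant arguments. The value of the norm does not depend
  on the orthonormal basis.
\<close>

definition multi_indices :: "nat \<Rightarrow> 'h::{real_inner,polish_space} list set" where
  "multi_indices q = {bs. set bs \<subseteq> onb \<and> length bs = q}"

definition tensor_power :: "nat \<Rightarrow> ('h::{real_inner,polish_space} list \<Rightarrow> real) set" where
  "tensor_power q = {f.
     (\<forall>xs. length xs \<noteq> q \<longrightarrow> f xs = 0) \<and>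
     (\<forall>xs k. length xs = q \<longrightarrow> k < q \<longrightarrow> linear (\<lambda>x. f (xs[k := x]))) \<and>
     (\<exists>K. \<forall>xs. length xs = q \<longrightarrow> \<bar>f xs\<bar> \<le> K * (\<Prod>x\<leftarrow>xs. norm x)) \<and>
     (\<lambda>bs. (f bs)\<^sup>2) summable_on multi_indices q}"

definition sym_tensor_power :: "nat \<Rightarrow> ('h::{real_inner,polish_space} list \<Rightarrow> real) set" where
  "sym_tensor_power q =
     {f \<in> tensor_power q. \<forall>xs ys. mset xs = mset ys \<longrightarrow> f xs = f ys}"

definition tensor_norm :: "nat \<Rightarrow> ('h::{real_inner,polish_space} list \<Rightarrow> real) \<Rightarrow> real" where
  "tensor_norm q f = sqrt (\<Sum>\<^sub>\<infinity>bs\<in>multi_indices q. (f bs)\<^sup>2)"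

definition pure_power :: "nat \<Rightarrow> 'h::real_inner \<Rightarrow> 'h list \<Rightarrow> real" where
  "pure_power q h xs = (if length xs = q then \<Prod>x\<leftarrow>xs. inner h x else 0)"


section \<open>Multiple Wiener--Ito integrals\<close>

text \<open>The probabilists' Hermite polynomials.\<close>

fun hermite :: "nat \<Rightarrow> real \<Rightarrow> real" where
  "hermite 0 x = 1"
| "hermite (Suc 0) x = x"
| "hermite (Suc (Suc n)) x = x * hermite (Suc n) x - real (Suc n) * hermite n x"

text \<open>
  \<open>is_multiple_integral M W q f Y\<close> says that \<open>Y\<close> is a version of \<open>I\<^sub>q(f)\<close>. The map \<open>I\<^sub>q\<close> is
  the continuous linear extension to the symmetric tensor power, with values in \<open>L\<^sup>2\<close>, of
  the map that sends the \<open>q\<close>-th tensor power of a unit vector \<open>h\<close> to the \<open>q\<close>-th Hermite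
  polynomial at \<open>W(h)\<close>; thus the graph of \<open>I\<^sub>q\<close> is the closure of its graph over linear
  combinations of powers of unit vectors. This normalization gives
  \<open>E(I\<^sub>q(f)\<^sup>2) = q! \<parallel>f\<parallel>\<^sup>2\<close>, so that \<open>Y\<close> is determined almost surely.
\<close>

definition is_multiple_integral ::
  "'w measure \<Rightarrow> ('h::{real_inner,polish_space} \<Rightarrow> 'w \<Rightarrow> real) \<Rightarrow> nat \<Rightarrow>
    ('h list \<Rightarrow> real) \<Rightarrow> ('w \<Rightarrow> real) \<Rightarrow> bool" where
  "is_multiple_integral M W q f Y \<longleftrightarrow>
     f \<in> sym_tensor_power q \<and>
     Y \<in> borel_measurable M \<and> integrable M (\<lambda>\<omega>. (Y \<omega>)\<^sup>2) \<and>
     (\<forall>\<epsilon>>0. \<exists>A c. finite A \<and> A \<subseteq> sphere 0 1 \<and>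
        tensor_norm q (\<lambda>xs. f xs - (\<Sum>h\<in>A. c h * pure_power q h xs)) < \<epsilon> \<and>
        (\<integral>\<omega>. (Y \<omega> - (\<Sum>h\<in>A. c h * hermite q (W h \<omega>)))\<^sup>2 \<partial>M) < \<epsilon>)"


section \<open>Random matrices\<close>

definition hs_norm :: "real mat \<Rightarrow> real" where
  "hs_norm A = sqrt (\<Sum>i<dim_row A. \<Sum>j<dim_col A. (A $$ (i, j))\<^sup>2)"

definition lip_norm :: "nat \<Rightarrow> (real mat \<Rightarrow> real) \<Rightarrow> ennreal" where
  "lip_norm n g =
     (SUP (A, B) \<in> {(A, B). A \<in> carrier_mat n n \<and> B \<in> carrier_mat n n \<and> A \<noteq> B}.
        ennreal (\<bar>g A - g B\<bar> / hs_norm (A - B)))"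

definition wasserstein ::
  "nat \<Rightarrow> 'a measure \<Rightarrow> ('a \<Rightarrow> real mat) \<Rightarrow> 'b measure \<Rightarrow> ('b \<Rightarrow> real mat) \<Rightarrow> ennreal" where
  "wasserstein n M \<X> N \<Y> =
     (SUP g \<in> {g. lip_norm n g \<le> 1}.
        ennreal \<bar>(\<integral>\<omega>. g (\<X> \<omega>) \<partial>M) - (\<integral>\<omega>. g (\<Y> \<omega>) \<partial>N)\<bar>)"

text \<open>Rows and columns are numbered from 0, as everywhere in the matrix library.\<close>

definition data_matrix :: "(nat \<Rightarrow> nat \<Rightarrow> 'w \<Rightarrow> real) \<Rightarrow> nat \<Rightarrow> nat \<Rightarrow> 'w \<Rightarrow> real mat" where
  "data_matrix X n d \<omega> = mat n d (\<lambda>(i, j). X i j \<omega>)"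

definition wishart :: "(nat \<Rightarrow> nat \<Rightarrow> 'w \<Rightarrow> real) \<Rightarrow> nat \<Rightarrow> nat \<Rightarrow> 'w \<Rightarrow> real mat" where
  "wishart X n d \<omega> =
     (1 / real d) \<cdot>\<^sub>m (data_matrix X n d \<omega> * transpose_mat (data_matrix X n d \<omega>)) - 1\<^sub>m n"

definition rescaled_wishart :: "(nat \<Rightarrow> nat \<Rightarrow> 'w \<Rightarrow> real) \<Rightarrow> nat \<Rightarrow> nat \<Rightarrow> 'w \<Rightarrow> real mat" where
  "rescaled_wishart X n d \<omega> = sqrt (real d) \<cdot>\<^sub>m wishart X n d \<omega>"

definition gaussian_sym_matrix ::
  "'z measure \<Rightarrow> nat \<Rightarrow> real \<Rightarrow> ('z \<Rightarrow> real mat) \<Rightarrow> bool" where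
  "gaussian_sym_matrix N n m4 Z \<longleftrightarrow>
     prob_space N \<and>
     (\<forall>\<omega>\<in>space N. Z \<omega> \<in> carrier_mat n n) \<and>
     (\<forall>\<omega>\<in>space N. \<forall>i<n. \<forall>j<i. Z \<omega> $$ (i, j) = Z \<omega> $$ (j, i)) \<and>
     prob_space.indep_vars N (\<lambda>_. borel) (\<lambda>(i, j) \<omega>. Z \<omega> $$ (i, j)) {(i, j). i \<le> j \<and> j < n} \<and>
     (\<forall>i<n. gaussian_rv N (\<lambda>\<omega>. Z \<omega> $$ (i, i)) 0 (m4 - 1)) \<and>
     (\<forall>i j. i < j \<longrightarrow> j < n \<longrightarrow> gaussian_rv N (\<lambda>\<omega>. Z \<omega> $$ (i, j)) 0 1)"

end

theory Submission
  imports Defs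
begin

text \<open>
  Each entry is an \<open>L\<^sup>2\<close> limit of polynomials of bounded degree in finitely many independent standard
  Gaussians, and hypercontractivity bounds all moments in question uniformly along the approximation.
  For such a polynomial \<open>Y\<close>, the covariance identity
  \<open>Cov (F, G) = \<integral> cos t E \<langle>\<nabla>F (z), \<nabla>G (z sin t + z' cos t)\<rangle> dt\<close> over \<open>[0, \<pi>/2]\<close> (with \<open>z'\<close> a copy of \<open>z\<close>)
  yields Stein kernels \<open>T\<close> of \<open>Y\<close> and \<open>S\<close> of \<open>Y\<^sup>2 - 1\<close>, with moments bounded in terms of the degree.
  Interpolating between the rescaled covariance matrix and the Gaussian matrix along a quarter circle
  and integrating by parts on both sides leaves a matrix of centred averages of kernels. An entry of this
  matrix has variance \<open>O(1/d)\<close>, and all but \<open>O(n\<^sup>3)\<close> of the \<open>O(n\<^sup>4)\<close> entries vanish because they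
  involve disjoint rows; together with the Lipschitz bound for the (smoothed) test function this gives
  \<open>\<surd>(n\<^sup>3/d)\<close>. The same bound for the test functions \<open>cos (t A\<^sub>i\<^sub>j)\<close> and \<open>sin (t A\<^sub>i\<^sub>j)\<close> gives convergence
  of the characteristic functions of the entries.
\<close>

text \<open>The test function is only Lipschitz, so nothing bounds its Hessian, although the
  integrations by parts produce one. The Gaussian part of the interpolation resolves this: each
  second-order term is an average of a first derivative times a Gaussian coordinate. Moving these
  coordinates onto the matrix of kernel deviations, Cauchy-Schwarz leaves the Lipschitz constant
  times the Hilbert-Schmidt norm of that matrix; the smoothing parameter does not enter and can tend
  to 0. Dividing by the standard deviations of the Gaussian entries requires m4 > 1, which has to be
  proved: with m4 = 1 an entry would be a random sign, and Stein's identity excludes this. A kernel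
  is not conditioned on its variable but lives with a second Gaussian copy and a random angle on a
  larger space; this suffices because only test functions of the variable occur. Finally,
  approximants of independent multiple integrals need not be independent, so they are coupled on a
  product of copies of the original space, where the distances in L^2 persist.\<close>

lemmas integral_sum = Bochner_Integration.integral_sum
  and integrable_sum = Bochner_Integration.integrable_sum
  and integral_cong = Bochner_Integration.integral_cong
  and integrable_bound = Bochner_Integration.integrable_bound
  and integrable_add = Bochner_Integration.integrable_add
  and integrable_diff = Bochner_Integration.integrable_diff
  and integral_add = Bochner_Integration.integral_add
  and integral_diff = Bochner_Integration.integral_diff
  and integral_divide_zero = Bochner_Integration.integral_divide_zero

declare [[show_markup = false]]

abbreviation std_normal :: "real measure" where "std_normal \<equiv> std_normal_distribution"
abbreviation borels :: "'i set \<Rightarrow> ('i \<Rightarrow> real) measure" where "borels I \<equiv> PiM I (\<lambda>_. borel)"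

section \<open>Differentiation under the integral sign\<close>

text \<open>The mean value theorem dominates the difference quotients by \<open>h\<close>, and
  \<open>f' t0\<close> inherits measurability from them as a pointwise limit.\<close>

lemma has_real_derivative_integral:
  fixes f f' :: "real \<Rightarrow> 'a \<Rightarrow> real"
  assumes d: "0 < \<delta>"
    and int: "\<And>t. \<bar>t - t0\<bar> < \<delta> \<Longrightarrow> integrable M (f t)"
    and der: "\<And>t x. \<bar>t - t0\<bar> < \<delta> \<Longrightarrow> x \<in> space M \<Longrightarrow> ((\<lambda>s. f s x) has_real_derivative f' t x) (at t)"
    and bd: "\<And>t x. \<bar>t - t0\<bar> < \<delta> \<Longrightarrow> x \<in> space M \<Longrightarrow> \<bar>f' t x\<bar> \<le> h x"
    and h: "integrable M h"
  shows "integrable M (f' t0)"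
    and "((\<lambda>t. \<integral>x. f t x \<partial>M) has_real_derivative (\<integral>x. f' t0 x \<partial>M)) (at t0)"
proof -
  define B where "B = ball t0 \<delta>"
  have B: "t \<in> B \<longleftrightarrow> \<bar>t - t0\<bar> < \<delta>" for t by (auto simp: B_def dist_real_def)
  have q: "\<bar>(f s x - f t0 x) / (s - t0)\<bar> \<le> h x" if "s \<in> B" "s \<noteq> t0" "x \<in> space M" for s x
  proof -
    have "norm (f s x - f t0 x) \<le> h x * norm (s - t0)"
    proof (rule field_differentiable_bound[where S=B and f'="\<lambda>t. f' t x"])
      show "convex B" by (simp add: B_def)
      show "((\<lambda>s. f s x) has_field_derivative f' z x) (at z within B)" if "z \<in> B" for z
        using der[of z x] that \<open>x \<in> space M\<close> by (auto simp: B intro: has_field_derivative_at_within)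
      show "norm (f' z x) \<le> h x" if "z \<in> B" for z
        using bd[of z x] that \<open>x \<in> space M\<close> by (auto simp: B)
    qed (use that d in \<open>auto simp: B\<close>)
    with that show ?thesis by (simp add: abs_divide divide_le_eq)
  qed
  have lim: "(\<lambda>n. (f (X n) x - f t0 x) / (X n - t0)) \<longlonglongrightarrow> f' t0 x"
    if X: "\<forall>n. X n \<in> B - {t0}" "X \<longlonglongrightarrow> t0" and x: "x \<in> space M" for X x
  proof -
    have "((\<lambda>s. (f s x - f t0 x) / (s - t0)) \<longlongrightarrow> f' t0 x) (at t0)"
      using der[of t0 x] x d by (simp add: has_field_derivative_iff)
    then show ?thesis
      using X unfolding tendsto_at_iff_sequentially comp_def by auto
  qed
  have main: "integrable M (f' t0) \<and>
      (\<lambda>n. (\<integral>x. f (X n) x \<partial>M - \<integral>x. f t0 x \<partial>M) / (X n - t0)) \<longlonglongrightarrow> (\<integral>x. f' t0 x \<partial>M)"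
    if X: "\<forall>n. X n \<in> B - {t0}" "X \<longlonglongrightarrow> t0" for X
  proof -
    let ?q = "\<lambda>n x. (f (X n) x - f t0 x) / (X n - t0)"
    have iX: "integrable M (f (X n))" "integrable M (f t0)" for n
      using int[of "X n"] int[of t0] X(1) d by (auto simp: B)
    then have m: "?q n \<in> borel_measurable M" for n by auto
    have m': "f' t0 \<in> borel_measurable M"
      by (rule borel_measurable_LIMSEQ_real[of M ?q, OF _ m]) (use lim X in auto)
    have b: "AE x in M. norm (?q n x) \<le> h x" for n
      using q X(1) by auto
    have l: "AE x in M. (\<lambda>n. ?q n x) \<longlonglongrightarrow> f' t0 x"
      using lim X by auto
    have "integrable M (f' t0)"
      by (rule integrable_dominated_convergence[OF m' m h l b])
    moreover have "(\<lambda>n. \<integral>x. ?q n x \<partial>M) \<longlonglongrightarrow> (\<integral>x. f' t0 x \<partial>M)"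
      by (rule integral_dominated_convergence[OF m' m h l b])
    moreover have "(\<integral>x. ?q n x \<partial>M) = (\<integral>x. f (X n) x \<partial>M - \<integral>x. f t0 x \<partial>M) / (X n - t0)" for n
      using iX by (subst integral_divide_zero) (subst integral_diff, auto)
    ultimately show ?thesis by (simp only:)
  qed
  \<comment> \<open>The shift by 2 keeps already \<open>X 0\<close> strictly inside the ball of
    radius \<open>\<delta>\<close>.\<close>
  define X where "X n = t0 + \<delta> / real (n + 2)" for n
  have "(\<lambda>n. \<delta> / real (n + 2)) \<longlonglongrightarrow> 0"
    by (rule LIMSEQ_ignore_initial_segment[OF lim_const_over_n])
  then have "X \<longlonglongrightarrow> t0" unfolding X_def using tendsto_add[OF tendsto_const[of t0]] by fastforce
  moreover have "X n \<in> B - {t0}" for n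
    using d by (auto simp: B X_def divide_less_eq)
  ultimately show "integrable M (f' t0)" using main by blast
  have "((\<lambda>s. (\<integral>x. f s x \<partial>M - \<integral>x. f t0 x \<partial>M) / (s - t0)) \<longlongrightarrow> (\<integral>x. f' t0 x \<partial>M)) (at t0 within B)"
    unfolding tendsto_at_iff_sequentially comp_def using main by blast
  moreover have "at t0 within B = at t0" using d by (intro at_within_open) (auto simp: B_def)
  ultimately show "((\<lambda>t. \<integral>x. f t x \<partial>M) has_real_derivative (\<integral>x. f' t0 x \<partial>M)) (at t0)"
    by (simp add: has_field_derivative_iff)
qed

section \<open>Standard Gaussian measures on finite products\<close>

definition gam :: "'i set \<Rightarrow> ('i \<Rightarrow> real) measure" where
  "gam I = PiM I (\<lambda>_. std_normal)"

text \<open>Functions of exponential growth in the coordinates from \<open>I\<close>, a class closed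
  under products and under multiplication by shift densities. They are defined on all of
  \<open>'i \<Rightarrow> real\<close>, with dependence on \<open>I\<close> alone as a clause, so
  that affine substitutions and enlargements of \<open>I\<close> need no restriction of the
  argument.\<close>

definition nice :: "'i set \<Rightarrow> (('i \<Rightarrow> real) \<Rightarrow> real) \<Rightarrow> bool" where
  "nice I G \<longleftrightarrow> G \<in> borel_measurable (borels UNIV) \<and>
     (\<forall>u v. (\<forall>i\<in>I. u i = v i) \<longrightarrow> G u = G v) \<and>
     (\<exists>a b. 0 \<le> a \<and> 0 \<le> b \<and> (\<forall>u. \<bar>G u\<bar> \<le> a * exp (b * (\<Sum>i\<in>I. \<bar>u i\<bar>))))"

lemma prob_std: "prob_space std_normal"
  by (rule prob_space_normal_density) simp

lemma product_prob_std: "product_prob_space (\<lambda>_::'i. std_normal)"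
  by (rule product_prob_spaceI) (rule prob_std)

lemma product_sigma_finite_std: "product_sigma_finite (\<lambda>_::'i. std_normal)"
  using product_prob_std by (rule product_prob_space.axioms)

lemma prob_gam: "prob_space (gam I)"
  unfolding gam_def by (intro prob_space_PiM prob_std)

lemma sets_gam: "sets (gam I) = sets (borels I)"
  unfolding gam_def by (intro sets_PiM_cong) auto

lemma space_gam: "space (gam I) = (\<Pi>\<^sub>E i\<in>I. UNIV)"
  by (simp add: gam_def space_PiM)

text \<open>Every index is allowed: outside \<open>I\<close> the points of the space take the
  constant value \<open>undefined\<close>.\<close>

lemma measurable_gam_component [measurable]: "(\<lambda>z. z i) \<in> borel_measurable (gam I)"
proof (cases "i \<in> I")
  case True
  then show ?thesis unfolding measurable_cong_sets[OF sets_gam refl] by measurable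
next
  case False
  then have "\<And>z. z \<in> space (gam I) \<Longrightarrow> z i = undefined"
    by (auto simp: space_gam PiE_def extensional_def)
  then have "(\<lambda>z. z i) \<in> borel_measurable (gam I) \<longleftrightarrow> (\<lambda>_. undefined :: real) \<in> borel_measurable (gam I)"
    by (rule measurable_cong)
  then show ?thesis by simp
qed

lemma niceI:
  assumes "G \<in> borel_measurable (borels UNIV)"
    and "\<And>u v. (\<And>i. i \<in> I \<Longrightarrow> u i = v i) \<Longrightarrow> G u = G v"
    and "0 \<le> a" "0 \<le> b" "\<And>u. \<bar>G u\<bar> \<le> a * exp (b * (\<Sum>i\<in>I. \<bar>u i\<bar>))"
  shows "nice I G"
  unfolding nice_def
proof (intro conjI allI impI)
  show "G u = G v" if "\<forall>i\<in>I. u i = v i" for u v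
    using that by (intro assms(2)) blast
  show "\<exists>a b. 0 \<le> a \<and> 0 \<le> b \<and> (\<forall>u. \<bar>G u\<bar> \<le> a * exp (b * (\<Sum>i\<in>I. \<bar>u i\<bar>)))"
    using assms(3-) by blast
qed (fact assms)

lemma nice_auxI:
  assumes "\<And>u. \<bar>G u\<bar> \<le> a * exp (b * (\<Sum>i\<in>I. \<bar>u i\<bar>))"
    and "\<And>u v. (\<And>i. i \<in> I \<Longrightarrow> u i = v i) \<Longrightarrow> G u = G v"
    and "G \<in> borel_measurable (borels UNIV)" "0 \<le> a" "0 \<le> b"
  shows "nice I G"
  using assms(3,2,4,5,1) by (rule niceI)

lemma nice_borel: "nice I G \<Longrightarrow> G \<in> borel_measurable (borels UNIV)"
  unfolding nice_def by blast

lemma nice_measurable: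
  assumes "nice I G" "\<And>i. (\<lambda>x. V x i) \<in> borel_measurable M"
  shows "(\<lambda>x. G (V x)) \<in> borel_measurable M"
proof -
  have "V \<in> measurable M (borels UNIV)"
    using assms(2) by (intro measurable_PiM_single') auto
  from measurable_compose[OF this nice_borel[OF assms(1)]] show ?thesis .
qed

lemma nice_measurable_gam [measurable]: "nice I G \<Longrightarrow> G \<in> borel_measurable (gam J)"
  using nice_measurable[of I G "\<lambda>x. x" "gam J"] by simp

lemma nice_bound:
  assumes "nice I G"
  obtains a b where "0 \<le> a" "0 \<le> b" "\<And>u. \<bar>G u\<bar> \<le> a * exp (b * (\<Sum>i\<in>I. \<bar>u i\<bar>))"
  using assms unfolding nice_def by blast

lemma nice_cong: "nice I G \<Longrightarrow> (\<And>i. i \<in> I \<Longrightarrow> u i = v i) \<Longrightarrow> G u = G v"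
  unfolding nice_def by blast

lemma nice_const [simp]: "nice I (\<lambda>_. c)"
  by (rule niceI[where a="\<bar>c\<bar>" and b=0]) auto

lemma sum_abs_nonneg: "0 \<le> (\<Sum>i\<in>I. \<bar>u i :: real\<bar>)" by (simp add: sum_nonneg)

lemma nice_var:
  assumes "finite I" "i \<in> I" shows "nice I (\<lambda>u. u i)"
proof (rule niceI[where a=1 and b=1])
  fix u :: "'a \<Rightarrow> real"
  have "\<bar>u i\<bar> \<le> (\<Sum>i\<in>I. \<bar>u i\<bar>)" using assms by (intro member_le_sum) auto
  also have "\<dots> \<le> exp (\<Sum>i\<in>I. \<bar>u i\<bar>)" using exp_ge_add_one_self[of "\<Sum>i\<in>I. \<bar>u i\<bar>"] by linarith
  finally show "\<bar>u i\<bar> \<le> 1 * exp (1 * (\<Sum>i\<in>I. \<bar>u i\<bar>))" by simp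
qed (use assms(2) in auto)

lemma nice_add:
  assumes "nice I F" "nice I G" shows "nice I (\<lambda>u. F u + G u)"
proof -
  obtain a b where F: "0 \<le> a" "0 \<le> b" "\<And>u. \<bar>F u\<bar> \<le> a * exp (b * (\<Sum>i\<in>I. \<bar>u i\<bar>))"
    using nice_bound[OF assms(1)] by blast
  obtain c d where G: "0 \<le> c" "0 \<le> d" "\<And>u. \<bar>G u\<bar> \<le> c * exp (d * (\<Sum>i\<in>I. \<bar>u i\<bar>))"
    using nice_bound[OF assms(2)] by blast
  have "\<bar>F u + G u\<bar> \<le> (a + c) * exp ((b + d) * (\<Sum>i\<in>I. \<bar>u i\<bar>))" for u
  proof -
    have "exp (b * (\<Sum>i\<in>I. \<bar>u i\<bar>)) \<le> exp ((b + d) * (\<Sum>i\<in>I. \<bar>u i\<bar>))"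
      "exp (d * (\<Sum>i\<in>I. \<bar>u i\<bar>)) \<le> exp ((b + d) * (\<Sum>i\<in>I. \<bar>u i\<bar>))"
      using F G sum_abs_nonneg[of u I] by (auto intro!: mult_right_mono)
    then have "a * exp (b * (\<Sum>i\<in>I. \<bar>u i\<bar>)) + c * exp (d * (\<Sum>i\<in>I. \<bar>u i\<bar>)) \<le> (a + c) * exp ((b + d) * (\<Sum>i\<in>I. \<bar>u i\<bar>))"
      using F G by (simp add: distrib_right add_mono mult_left_mono)
    with F(3)[of u] G(3)[of u] show ?thesis by linarith
  qed
  moreover have "F u + G u = F v + G v" if "\<And>i. i \<in> I \<Longrightarrow> u i = v i" for u v
    using nice_cong[OF assms(1), of u v] nice_cong[OF assms(2), of u v] that by simp
  moreover have "(\<lambda>u. F u + G u) \<in> borel_measurable (borels UNIV)"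
    using assms[THEN nice_borel] by measurable
  moreover have "0 \<le> a + c" "0 \<le> b + d" using F G by auto
  ultimately show ?thesis by (rule nice_auxI)
qed

lemma nice_mult:
  assumes "nice I F" "nice I G" shows "nice I (\<lambda>u. F u * G u)"
proof -
  obtain a b where F: "0 \<le> a" "0 \<le> b" "\<And>u. \<bar>F u\<bar> \<le> a * exp (b * (\<Sum>i\<in>I. \<bar>u i\<bar>))"
    using nice_bound[OF assms(1)] by blast
  obtain c d where G: "0 \<le> c" "0 \<le> d" "\<And>u. \<bar>G u\<bar> \<le> c * exp (d * (\<Sum>i\<in>I. \<bar>u i\<bar>))"
    using nice_bound[OF assms(2)] by blast
  have "\<bar>F u * G u\<bar> \<le> (a * c) * exp ((b + d) * (\<Sum>i\<in>I. \<bar>u i\<bar>))" for u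
  proof -
    have "\<bar>F u * G u\<bar> \<le> (a * exp (b * (\<Sum>i\<in>I. \<bar>u i\<bar>))) * (c * exp (d * (\<Sum>i\<in>I. \<bar>u i\<bar>)))"
      unfolding abs_mult using F G by (intro mult_mono) auto
    also have "\<dots> = (a * c) * exp ((b + d) * (\<Sum>i\<in>I. \<bar>u i\<bar>))"
      by (simp add: exp_add distrib_right)
    finally show ?thesis .
  qed
  moreover have "F u * G u = F v * G v" if "\<And>i. i \<in> I \<Longrightarrow> u i = v i" for u v
    using nice_cong[OF assms(1), of u v] nice_cong[OF assms(2), of u v] that by simp
  moreover have "(\<lambda>u. F u * G u) \<in> borel_measurable (borels UNIV)"
    using assms[THEN nice_borel] by measurable
  moreover have "0 \<le> a * c" "0 \<le> b + d" using F G by auto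
  ultimately show ?thesis by (rule nice_auxI)
qed

lemma nice_sum: "(\<And>a. a \<in> A \<Longrightarrow> nice I (F a)) \<Longrightarrow> nice I (\<lambda>u. \<Sum>a\<in>A. F a u)"
  by (induction A rule: infinite_finite_induct) (auto intro: nice_add)

lemma nice_power: "nice I F \<Longrightarrow> nice I (\<lambda>u. F u ^ k)"
  by (induction k) (auto intro: nice_mult)

lemma nice_affine:
  fixes s :: "'i \<Rightarrow> real"
  assumes fin: "finite I" and G: "nice I G"
  shows "nice I (\<lambda>z. G (\<lambda>i. c i + s i * z i))"
proof -
  obtain a b where ab: "0 \<le> a" "0 \<le> b" "\<And>u. \<bar>G u\<bar> \<le> a * exp (b * (\<Sum>i\<in>I. \<bar>u i\<bar>))"
    using nice_bound[OF G] by blast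
  define S where "S = (\<Sum>i\<in>I. \<bar>s i\<bar>)"
  define C where "C = (\<Sum>i\<in>I. \<bar>c i\<bar>)"
  have SC: "0 \<le> S" "0 \<le> C" by (auto simp: S_def C_def sum_nonneg)
  have "\<bar>G (\<lambda>i. c i + s i * z i)\<bar> \<le> (a * exp (b * C)) * exp ((b * S) * (\<Sum>i\<in>I. \<bar>z i\<bar>))" for z
  proof -
    have "(\<Sum>i\<in>I. \<bar>c i + s i * z i\<bar>) \<le> (\<Sum>i\<in>I. \<bar>c i\<bar> + S * \<bar>z i\<bar>)"
    proof (rule sum_mono)
      fix i assume i: "i \<in> I"
      have "\<bar>c i + s i * z i\<bar> \<le> \<bar>c i\<bar> + \<bar>s i\<bar> * \<bar>z i\<bar>"
        by (metis abs_mult abs_triangle_ineq)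
      also have "\<bar>s i\<bar> * \<bar>z i\<bar> \<le> S * \<bar>z i\<bar>"
        unfolding S_def using i fin by (intro mult_right_mono member_le_sum) auto
      finally show "\<bar>c i + s i * z i\<bar> \<le> \<bar>c i\<bar> + S * \<bar>z i\<bar>" by simp
    qed
    also have "\<dots> = C + S * (\<Sum>i\<in>I. \<bar>z i\<bar>)" by (simp add: C_def sum.distrib sum_distrib_left)
    finally have "b * (\<Sum>i\<in>I. \<bar>c i + s i * z i\<bar>) \<le> b * C + b * S * (\<Sum>i\<in>I. \<bar>z i\<bar>)"
      using ab(2) by (metis distrib_left mult.assoc mult_left_mono)
    then have "a * exp (b * (\<Sum>i\<in>I. \<bar>c i + s i * z i\<bar>)) \<le> a * (exp (b * C) * exp (b * S * (\<Sum>i\<in>I. \<bar>z i\<bar>)))"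
      using ab(1) by (intro mult_left_mono) (auto simp flip: exp_add)
    with ab(3)[of "\<lambda>i. c i + s i * z i"] show ?thesis by (simp add: mult.assoc)
  qed
  moreover have "G (\<lambda>i. c i + s i * u i) = G (\<lambda>i. c i + s i * v i)" if "\<And>i. i \<in> I \<Longrightarrow> u i = v i" for u v
    using that by (intro nice_cong[OF G]) auto
  moreover have "(\<lambda>z. G (\<lambda>i. c i + s i * z i)) \<in> borel_measurable (borels UNIV)"
    by (rule nice_measurable[OF G]) measurable
  moreover have "0 \<le> a * exp (b * C)" "0 \<le> b * S" using ab SC by auto
  ultimately show ?thesis by (rule nice_auxI)
qed

lemma integrable_std_exp: "integrable std_normal (\<lambda>x. exp (b * \<bar>x\<bar>))"
proof -
  have e: "std_normal_density x * exp (c * x) = exp (c\<^sup>2 / 2) * normal_density c 1 x" for c x :: real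
  proof -
    have "- x\<^sup>2 / 2 + c * x = c\<^sup>2 / 2 + - (x - c)\<^sup>2 / 2" by (simp add: power2_eq_square field_simps)
    then have "exp (- x\<^sup>2 / 2) * exp (c * x) = exp (c\<^sup>2 / 2) * exp (- (x - c)\<^sup>2 / 2)"
      by (metis exp_add)
    then show ?thesis by (simp add: normal_density_def)
  qed
  have "integrable lborel (\<lambda>x. std_normal_density x * exp (c * x))" for c
    unfolding e by simp
  then have i: "integrable std_normal (\<lambda>x. exp (c * x))" for c
    by (subst integrable_density) auto
  show ?thesis
  proof (rule integrable_bound[of _ "\<lambda>x. exp (b * x) + exp ((-b) * x)"])
    show "integrable std_normal (\<lambda>x. exp (b * x) + exp ((-b) * x))"
      by (intro integrable_add i)
    have "exp (b * \<bar>x\<bar>) \<le> exp (b * x) + exp ((-b) * x)" for x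
      by (cases "x \<ge> 0") simp_all
    then show "AE x in std_normal. norm (exp (b * \<bar>x\<bar>)) \<le> norm (exp (b * x) + exp ((-b) * x))"
      by (auto simp: add_nonneg_nonneg)
  qed simp
qed

lemma integrable_gam_exp:
  assumes "finite I" shows "integrable (gam I) (\<lambda>z. exp (b * (\<Sum>i\<in>I. \<bar>z i\<bar>)))"
proof -
  interpret product_prob_space "\<lambda>_::'a. std_normal" by (rule product_prob_std)
  have "integrable (gam I) (\<lambda>z. \<Prod>i\<in>I. exp (b * \<bar>z i\<bar>))"
    unfolding gam_def using assms integrable_std_exp by (rule product_integrable_prod)
  then show ?thesis using assms by (simp add: exp_sum sum_distrib_left)
qed

lemma integrable_gam_bound:
  assumes "finite I" "f \<in> borel_measurable (gam I)" "\<And>z. \<bar>f z\<bar> \<le> a * exp (b * (\<Sum>i\<in>I. \<bar>z i\<bar>))"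
  shows "integrable (gam I) f"
proof (rule integrable_bound)
  show "integrable (gam I) (\<lambda>z. a * exp (b * (\<Sum>i\<in>I. \<bar>z i\<bar>)))"
    using integrable_gam_exp[OF assms(1)] by simp
  show "AE z in gam I. norm (f z) \<le> norm (a * exp (b * (\<Sum>i\<in>I. \<bar>z i\<bar>)))"
    using assms(3) by (auto intro: order_trans[OF _ abs_ge_self])
qed (rule assms)

lemma nice_integrable:
  assumes "finite I" "nice I G" shows "integrable (gam I) G"
proof -
  obtain a b where ab: "\<And>u. \<bar>G u\<bar> \<le> a * exp (b * (\<Sum>i\<in>I. \<bar>u i\<bar>))"
    using nice_bound[OF assms(2)] by blast
  show ?thesis by (rule integrable_gam_bound[OF assms(1) nice_measurable_gam[OF assms(2)] ab])
qed

section \<open>Cameron-Martin shifts and Gaussian integration by parts\<close>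

lemma distr_std_shift:
  "distr std_normal borel (\<lambda>x. v + x) =
     density std_normal (\<lambda>x. ennreal (exp (v * x - v\<^sup>2 / 2)))"
proof -
  interpret prob_space std_normal by (rule prob_std)
  have "distributed std_normal lborel (\<lambda>x. x) std_normal_density"
    by (auto simp: distributed_def distr_id2)
  from normal_density_affine[OF this, of 1 v]
  have "distributed std_normal lborel (\<lambda>x. v + x) (normal_density v 1)" by simp
  then have "distr std_normal lborel (\<lambda>x. v + x) = density lborel (normal_density v 1)"
    by (simp add: distributed_def)
  moreover have "normal_density v 1 x = std_normal_density x * exp (v * x - v\<^sup>2 / 2)" for x
  proof -
    have "- (x - v)\<^sup>2 / 2 = - x\<^sup>2 / 2 + (v * x - v\<^sup>2 / 2)" by (simp add: power2_eq_square field_simps)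
    then have "exp (- (x - v)\<^sup>2 / 2) = exp (- x\<^sup>2 / 2) * exp (v * x - v\<^sup>2 / 2)" by (metis exp_add)
    then show ?thesis by (simp add: normal_density_def)
  qed
  moreover have "distr std_normal lborel (\<lambda>x. v + x) = distr std_normal borel (\<lambda>x. v + x)"
    by (rule distr_cong) auto
  ultimately show ?thesis
    by (simp add: density_density_eq ennreal_mult')
qed

text \<open>The Cameron-Martin formula in finite dimension: on boxes, both measures agree with the
  product of the shifted one-dimensional laws.\<close>

lemma distr_gam_shift:
  assumes fin: "finite I"
  shows "distr (gam I) (borels I) (\<lambda>z. \<lambda>i\<in>I. v i + z i) =
    density (gam I) (\<lambda>z. ennreal (exp (\<Sum>i\<in>I. v i * z i - (v i)\<^sup>2 / 2)))"
proof -
  interpret std: product_prob_space "\<lambda>_::'a. std_normal" by (rule product_prob_std)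
  define N where "N i = distr std_normal borel (\<lambda>x. v i + x)" for i
  have prob_N: "prob_space (N i)" for i
    unfolding N_def by (rule prob_space.prob_space_distr[OF prob_std]) auto
  interpret N: product_prob_space N
    by (rule product_prob_spaceI) (rule prob_N)
  have sN: "sets (PiM I N) = sets (borels I)"
    by (intro sets_PiM_cong) (auto simp: N_def)
  have m: "(\<lambda>z. \<lambda>i\<in>I. v i + z i) \<in> measurable (gam I) (borels I)"
    by (intro measurable_restrict) measurable
  have "distr (gam I) (borels I) (\<lambda>z. \<lambda>i\<in>I. v i + z i) = PiM I N"
  proof (rule N.PiM_eqI[OF fin])
    fix A assume A: "\<And>i. i \<in> I \<Longrightarrow> A i \<in> sets (N i)"
    then have A': "A i \<in> sets borel" if "i \<in> I" for i using that by (auto simp: N_def)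
    have "emeasure (distr (gam I) (borels I) (\<lambda>z. \<lambda>i\<in>I. v i + z i)) (Pi\<^sub>E I A) =
       emeasure (gam I) ((\<lambda>z. \<lambda>i\<in>I. v i + z i) -` (Pi\<^sub>E I A) \<inter> space (gam I))"
      using A' by (intro emeasure_distr m sets_PiM_I_finite fin) auto
    also have "(\<lambda>z. \<lambda>i\<in>I. v i + z i) -` (Pi\<^sub>E I A) \<inter> space (gam I) = Pi\<^sub>E I (\<lambda>i. (\<lambda>x. v i + x) -` A i)"
      by (auto simp: space_gam PiE_def extensional_def Pi_def)
    also have "emeasure (gam I) \<dots> = (\<Prod>i\<in>I. emeasure std_normal ((\<lambda>x. v i + x) -` A i))"
      unfolding gam_def
    proof (intro std.emeasure_PiM fin)
      fix i assume "i \<in> I"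
      from A'[OF this] have "(\<lambda>x. v i + x) -` A i \<inter> space borel \<in> sets borel"
        by (intro measurable_sets[of _ borel borel]) auto
      then show "(\<lambda>x. v i + x) -` A i \<in> sets std_normal" by simp
    qed
    also have "\<dots> = (\<Prod>i\<in>I. emeasure (N i) (A i))"
      by (intro prod.cong refl) (auto simp: N_def emeasure_distr A')
    finally show "emeasure (distr (gam I) (borels I) (\<lambda>z. \<lambda>i\<in>I. v i + z i)) (Pi\<^sub>E I A) =
      (\<Prod>i\<in>I. emeasure (N i) (A i))" .
  qed (simp add: sN)
  also have "\<dots> = density (gam I) (\<lambda>z. ennreal (exp (\<Sum>i\<in>I. v i * z i - (v i)\<^sup>2 / 2)))"
  proof (rule N.PiM_eqI[OF fin, symmetric])
    show "sets (density (gam I) (\<lambda>z. ennreal (exp (\<Sum>i\<in>I. v i * z i - (v i)\<^sup>2 / 2)))) = sets (PiM I N)"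
      by (simp add: sN sets_gam)
    fix A assume A: "\<And>i. i \<in> I \<Longrightarrow> A i \<in> sets (N i)"
    then have A': "A i \<in> sets borel" if "i \<in> I" for i using that by (auto simp: N_def)
    have std_meas: "f \<in> borel_measurable std_normal \<longleftrightarrow> f \<in> borel_measurable borel" for f :: "real \<Rightarrow> ennreal"
      by (rule arg_cong[where f="\<lambda>S. f \<in> S"], rule measurable_cong_sets) auto
    have meas: "(\<lambda>x. ennreal (exp (v i * x - (v i)\<^sup>2 / 2)) * indicator (A i) x) \<in> borel_measurable std_normal"
      if "i \<in> I" for i
      unfolding std_meas
      by (rule borel_measurable_times_ennreal[OF _ borel_measurable_indicator[OF A'[OF that]]]) measurable
    have bx: "Pi\<^sub>E I A \<in> sets (gam I)"
      unfolding sets_gam using A' by (intro sets_PiM_I_finite fin) auto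
    have "emeasure (density (gam I) (\<lambda>z. ennreal (exp (\<Sum>i\<in>I. v i * z i - (v i)\<^sup>2 / 2)))) (Pi\<^sub>E I A) =
       (\<integral>\<^sup>+z. ennreal (exp (\<Sum>i\<in>I. v i * z i - (v i)\<^sup>2 / 2)) * indicator (Pi\<^sub>E I A) z \<partial>gam I)"
      by (rule emeasure_density) (use bx in measurable)
    also have "\<dots> = (\<integral>\<^sup>+z. (\<Prod>i\<in>I. ennreal (exp (v i * z i - (v i)\<^sup>2 / 2)) * indicator (A i) (z i)) \<partial>gam I)"
    proof (intro nn_integral_cong)
      fix z assume z: "z \<in> space (gam I)"
      have "indicator (Pi\<^sub>E I A) z = (\<Prod>i\<in>I. indicator (A i) (z i) :: ennreal)"
      proof (cases "z \<in> Pi\<^sub>E I A")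
        case True
        then show ?thesis by (auto intro!: prod.neutral[symmetric] simp: PiE_def Pi_def)
      next
        case False
        with z obtain i where "i \<in> I" "z i \<notin> A i" by (auto simp: space_gam PiE_def Pi_def)
        with fin have "(\<Prod>i\<in>I. indicator (A i) (z i) :: ennreal) = 0"
          by (intro prod_zero bexI[of _ i]) auto
        with False show ?thesis by simp
      qed
      then show "ennreal (exp (\<Sum>i\<in>I. v i * z i - (v i)\<^sup>2 / 2)) * indicator (Pi\<^sub>E I A) z =
         (\<Prod>i\<in>I. ennreal (exp (v i * z i - (v i)\<^sup>2 / 2)) * indicator (A i) (z i))"
        using fin by (simp add: prod.distrib exp_sum prod_ennreal)
    qed
    also have "\<dots> = (\<Prod>i\<in>I. \<integral>\<^sup>+x. ennreal (exp (v i * x - (v i)\<^sup>2 / 2)) * indicator (A i) x \<partial>std_normal)"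
      unfolding gam_def using meas by (rule std.product_nn_integral_prod[OF fin])
    also have "\<dots> = (\<Prod>i\<in>I. emeasure (N i) (A i))"
    proof (rule prod.cong[OF refl])
      fix i assume "i \<in> I"
      show "(\<integral>\<^sup>+x. ennreal (exp (v i * x - (v i)\<^sup>2 / 2)) * indicator (A i) x \<partial>std_normal) = emeasure (N i) (A i)"
        unfolding N_def distr_std_shift
        by (rule emeasure_density[symmetric]) (use A'[OF \<open>i \<in> I\<close>] in \<open>simp_all add: std_meas\<close>)
    qed
    finally show "emeasure (density (gam I) (\<lambda>z. ennreal (exp (\<Sum>i\<in>I. v i * z i - (v i)\<^sup>2 / 2)))) (Pi\<^sub>E I A) =
      (\<Prod>i\<in>I. emeasure (N i) (A i))" .
  qed
  finally show ?thesis .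
qed

lemma gam_shift:
  assumes fin: "finite I" and G: "nice I G"
  shows "(\<integral>z. G (\<lambda>i. v i + z i) \<partial>gam I) = (\<integral>z. exp (\<Sum>i\<in>I. v i * z i - (v i)\<^sup>2 / 2) * G z \<partial>gam I)"
proof -
  \<comment> \<open>The image measure lives on extensional functions on \<open>I\<close>. Filling
    the other coordinates with 0 makes the integrand measurable there and changes no value of
    \<open>G\<close>.\<close>
  let ?g = "\<lambda>u. G (\<lambda>i. if i \<in> I then u i else 0)"
  have eq: "G u = ?g u" for u by (rule nice_cong[OF G]) auto
  have m: "(\<lambda>z. \<lambda>i\<in>I. v i + z i) \<in> measurable (gam I) (borels I)"
    by (intro measurable_restrict) measurable
  have g: "?g \<in> borel_measurable (borels I)"
  proof (rule nice_measurable[OF G])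
    fix i show "(\<lambda>x. if i \<in> I then x i else 0) \<in> borel_measurable (borels I)"
      by (cases "i \<in> I") auto
  qed
  have "(\<integral>z. G (\<lambda>i. v i + z i) \<partial>gam I) = (\<integral>z. ?g (\<lambda>i\<in>I. v i + z i) \<partial>gam I)"
    by (intro integral_cong nice_cong[OF G]) auto
  also have "\<dots> = (\<integral>u. ?g u \<partial>distr (gam I) (borels I) (\<lambda>z. \<lambda>i\<in>I. v i + z i))"
    by (rule integral_distr[symmetric, OF m g])
  also have "\<dots> = (\<integral>z. exp (\<Sum>i\<in>I. v i * z i - (v i)\<^sup>2 / 2) * ?g z \<partial>gam I)"
    unfolding distr_gam_shift[OF fin]
    by (subst integral_density) (use g in \<open>auto simp: measurable_cong_sets[OF sets_gam refl]\<close>)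
  finally show ?thesis using eq by simp
qed

text \<open>The shift formula moves the curve from the argument of \<open>G\<close> into the
  Gaussian density. Only the density is differentiated, so \<open>G\<close> may be non-smooth; this
  is the source of every gain of a derivative below.\<close>

lemma has_derivative_gam_curve:
  fixes y y' :: "'i \<Rightarrow> real \<Rightarrow> real"
  assumes fin: "finite I" and G: "nice I G"
    and der: "\<And>i t. i \<in> I \<Longrightarrow> (y i has_real_derivative y' i t) (at t)"
    and cont: "\<And>i. i \<in> I \<Longrightarrow> isCont (y' i) t0"
  shows "((\<lambda>t. \<integral>z. G (\<lambda>i. y i t + z i) \<partial>gam I) has_real_derivative
           (\<Sum>i\<in>I. y' i t0 * (\<integral>z. G (\<lambda>i. y i t0 + z i) * z i \<partial>gam I))) (at t0)"
proof -
  \<comment> \<open>Logarithm of the shifted density relative to the standard one; \<open>w'\<close>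
    is its derivative in \<open>t\<close>.\<close>
  define w where "w t z = (\<Sum>i\<in>I. y i t * z i - (y i t)\<^sup>2 / 2)" for t and z :: "'i \<Rightarrow> real"
  define w' where "w' t z = (\<Sum>i\<in>I. y' i t * (z i - y i t))" for t and z :: "'i \<Rightarrow> real"
  obtain a b where ab: "0 \<le> a" "0 \<le> b" "\<And>u. \<bar>G u\<bar> \<le> a * exp (b * (\<Sum>i\<in>I. \<bar>u i\<bar>))"
    using nice_bound[OF G] by blast
  have "\<exists>\<delta>>0. \<forall>t. \<bar>t - t0\<bar> < \<delta> \<longrightarrow> (\<forall>i\<in>I. \<bar>y i t - y i t0\<bar> < 1 \<and> \<bar>y' i t - y' i t0\<bar> < 1)"
  proof -
    have "eventually (\<lambda>t. \<forall>i\<in>I. \<bar>y i t - y i t0\<bar> < 1 \<and> \<bar>y' i t - y' i t0\<bar> < 1) (nhds t0)"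
    proof (intro eventually_ball_finite fin ballI eventually_conj)
      fix i assume i: "i \<in> I"
      have "isCont (y i) t0" using der[OF i] DERIV_isCont by blast
      then have "(y i \<longlongrightarrow> y i t0) (nhds t0)" using isCont_def tendsto_at_iff_tendsto_nhds by blast
      from tendstoD[OF this, of 1] show "eventually (\<lambda>t. \<bar>y i t - y i t0\<bar> < 1) (nhds t0)"
        by (simp add: dist_real_def)
      have "(y' i \<longlongrightarrow> y' i t0) (nhds t0)" using cont[OF i] isCont_def tendsto_at_iff_tendsto_nhds by blast
      from tendstoD[OF this, of 1] show "eventually (\<lambda>t. \<bar>y' i t - y' i t0\<bar> < 1) (nhds t0)"
        by (simp add: dist_real_def)
    qed
    then show ?thesis by (auto simp: eventually_nhds_metric dist_real_def)
  qed
  then obtain \<delta> where \<delta>: "\<delta> > 0" "\<And>t i. \<bar>t - t0\<bar> < \<delta> \<Longrightarrow> i \<in> I \<Longrightarrow> \<bar>y i t - y i t0\<bar> < 1 \<and> \<bar>y' i t - y' i t0\<bar> < 1"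
    by blast
  \<comment> \<open>Bounds all \<open>y i\<close> and \<open>y' i\<close> on the
    \<open>\<delta>\<close>-neighbourhood; the \<open>+ 1\<close> absorbs their variation
    there.\<close>
  define c where "c = (\<Sum>i\<in>I. \<bar>y i t0\<bar> + \<bar>y' i t0\<bar>) + 1"
  have c: "c \<ge> 1" by (auto simp: c_def sum_nonneg)
  have cb: "\<bar>y i t\<bar> \<le> c" "\<bar>y' i t\<bar> \<le> c" if "\<bar>t - t0\<bar> < \<delta>" "i \<in> I" for t i
  proof -
    have "\<bar>y i t0\<bar> + \<bar>y' i t0\<bar> \<le> (\<Sum>i\<in>I. \<bar>y i t0\<bar> + \<bar>y' i t0\<bar>)"
      using fin that by (intro member_le_sum) auto
    then show "\<bar>y i t\<bar> \<le> c" "\<bar>y' i t\<bar> \<le> c" using \<delta>(2)[OF that] unfolding c_def by auto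
  qed
  have wb: "w t z \<le> c * (\<Sum>i\<in>I. \<bar>z i\<bar>)" if "\<bar>t - t0\<bar> < \<delta>" for t z
  proof -
    have "w t z \<le> (\<Sum>i\<in>I. c * \<bar>z i\<bar>)" unfolding w_def
    proof (rule sum_mono)
      fix i assume "i \<in> I"
      have "y i t * z i \<le> \<bar>y i t\<bar> * \<bar>z i\<bar>" by (metis abs_ge_self abs_mult)
      also have "\<dots> \<le> c * \<bar>z i\<bar>" using cb[OF that \<open>i \<in> I\<close>] by (intro mult_right_mono) auto
      finally show "y i t * z i - (y i t)\<^sup>2 / 2 \<le> c * \<bar>z i\<bar>"
        using zero_le_power2[of "y i t"] by linarith
    qed
    then show ?thesis by (simp add: sum_distrib_left)
  qed
  have w'b: "\<bar>w' t z\<bar> \<le> c * exp ((\<Sum>i\<in>I. \<bar>z i\<bar>) + real (card I) * c)" if "\<bar>t - t0\<bar> < \<delta>" for t z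
  proof -
    have "\<bar>w' t z\<bar> \<le> (\<Sum>i\<in>I. \<bar>y' i t * (z i - y i t)\<bar>)" unfolding w'_def by (rule sum_abs)
    also have "\<dots> \<le> (\<Sum>i\<in>I. c * (\<bar>z i\<bar> + c))"
    proof (rule sum_mono)
      fix i assume i: "i \<in> I"
      show "\<bar>y' i t * (z i - y i t)\<bar> \<le> c * (\<bar>z i\<bar> + c)"
        unfolding abs_mult using cb[OF that i] c by (intro mult_mono) auto
    qed
    also have "\<dots> = c * ((\<Sum>i\<in>I. \<bar>z i\<bar>) + real (card I) * c)"
      by (simp add: sum_distrib_left[symmetric] sum.distrib)
    also have "\<dots> \<le> c * exp ((\<Sum>i\<in>I. \<bar>z i\<bar>) + real (card I) * c)"
      using c exp_ge_add_one_self[of "(\<Sum>i\<in>I. \<bar>z i\<bar>) + real (card I) * c"]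
      by (intro mult_left_mono) linarith+
    finally show ?thesis .
  qed
  let ?h = "\<lambda>z. (a * c * exp (real (card I) * c)) * exp ((b + c + 1) * (\<Sum>i\<in>I. \<bar>z i\<bar>))"
  have mw [measurable]: "w t \<in> borel_measurable (gam I)" "w' t \<in> borel_measurable (gam I)" for t
    unfolding w_def w'_def by measurable
  have mG [measurable]: "G \<in> borel_measurable (gam I)" using G by (rule nice_measurable_gam)
  have 1: "integrable (gam I) (\<lambda>z. exp (w t z) * G z)" if t: "\<bar>t - t0\<bar> < \<delta>" for t
  proof (rule integrable_gam_bound[OF fin, where a=a and b="b + c"])
    fix z
    have "\<bar>exp (w t z) * G z\<bar> \<le> exp (c * (\<Sum>i\<in>I. \<bar>z i\<bar>)) * (a * exp (b * (\<Sum>i\<in>I. \<bar>z i\<bar>)))"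
      unfolding abs_mult using wb[OF t] ab(3) by (intro mult_mono) auto
    then show "\<bar>exp (w t z) * G z\<bar> \<le> a * exp ((b + c) * (\<Sum>i\<in>I. \<bar>z i\<bar>))"
      by (simp add: distrib_right exp_add mult_ac)
  qed measurable
  have 2: "((\<lambda>s. exp (w s z) * G z) has_real_derivative (exp (w t z) * w' t z * G z)) (at t)" for t z
  proof -
    have "((\<lambda>s. w s z) has_real_derivative w' t z) (at t)"
      unfolding w_def w'_def
      by (auto intro!: derivative_eq_intros der sum.cong simp: algebra_simps)
    then show ?thesis by (auto intro!: derivative_eq_intros)
  qed
  have 3: "\<bar>exp (w t z) * w' t z * G z\<bar> \<le> ?h z" if t: "\<bar>t - t0\<bar> < \<delta>" for t z
  proof -
    have "\<bar>exp (w t z) * w' t z * G z\<bar> \<le> exp (c * (\<Sum>i\<in>I. \<bar>z i\<bar>)) *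
       (c * exp ((\<Sum>i\<in>I. \<bar>z i\<bar>) + real (card I) * c)) * (a * exp (b * (\<Sum>i\<in>I. \<bar>z i\<bar>)))"
      unfolding abs_mult using wb[OF t] ab(3) w'b[OF t] c by (intro mult_mono) auto
    then show ?thesis
      by (simp add: distrib_right exp_add mult_ac)
  qed
  have 4: "integrable (gam I) ?h" using integrable_gam_exp[OF fin] by simp
  have D: "((\<lambda>t. \<integral>z. exp (w t z) * G z \<partial>gam I) has_real_derivative
          (\<integral>z. exp (w t0 z) * w' t0 z * G z \<partial>gam I)) (at t0)"
    by (rule has_real_derivative_integral(2)[where f="\<lambda>t z. exp (w t z) * G z" and f'="\<lambda>t z. exp (w t z) * w' t z * G z" and h="?h", OF \<delta>(1) 1 2 3 4])
  have "nice I (\<lambda>z. y' i t0 * (z i - y i t0))" if i: "i \<in> I" for i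
    using nice_mult[OF nice_const[of I "y' i t0"] nice_add[OF nice_var[OF fin i] nice_const[of I "- y i t0"]]]
    by simp
  from nice_mult[OF G nice_sum[of I I, OF this]]
  have N: "nice I (\<lambda>z. G z * (\<Sum>i\<in>I. y' i t0 * (z i - y i t0)))" .
  \<comment> \<open>Shifting back turns the factor \<open>z i - y i t0\<close> into
    \<open>z i\<close>.\<close>
  have "(\<integral>z. exp (w t0 z) * w' t0 z * G z \<partial>gam I) =
        (\<integral>z. exp (\<Sum>i\<in>I. y i t0 * z i - (y i t0)\<^sup>2 / 2) * (G z * (\<Sum>i\<in>I. y' i t0 * (z i - y i t0))) \<partial>gam I)"
    by (simp add: w_def w'_def mult_ac)
  also have "\<dots> = (\<integral>z. G (\<lambda>i. y i t0 + z i) * (\<Sum>i\<in>I. y' i t0 * z i) \<partial>gam I)"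
    unfolding gam_shift[OF fin N, of "\<lambda>i. y i t0", symmetric] by simp
  also have "\<dots> = (\<integral>z. (\<Sum>i\<in>I. y' i t0 * (G (\<lambda>i. y i t0 + z i) * z i)) \<partial>gam I)"
    by (simp only: sum_distrib_left mult.assoc mult.left_commute[of "G _"])
  also have "\<dots> = (\<Sum>i\<in>I. y' i t0 * (\<integral>z. G (\<lambda>i. y i t0 + z i) * z i \<partial>gam I))"
  proof (subst integral_sum)
    fix i assume i: "i \<in> I"
    have "nice I (\<lambda>z. G (\<lambda>i. y i t0 + z i) * z i)"
      using nice_mult[OF nice_affine[OF fin G, of "\<lambda>i. y i t0" "\<lambda>_. 1"] nice_var[OF fin i]] by simp
    then show "integrable (gam I) (\<lambda>z. y' i t0 * (G (\<lambda>i. y i t0 + z i) * z i))"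
      using nice_integrable[OF fin] by auto
  qed simp
  finally show ?thesis
    using D by (simp add: w_def gam_shift[OF fin G])
qed

text \<open>Translate \<open>z\<close> in direction \<open>a\<close> and differentiate at 0 in two
  ways: on the density, which gives \<open>z a * G z\<close>, and under the integral, which gives
  \<open>G'\<close>.\<close>

lemma gam_ibp:
  assumes fin: "finite I" and a: "a \<in> I" and G: "nice I G" and G': "nice I G'"
    and der: "\<And>u. ((\<lambda>t. G (u(a := t))) has_real_derivative G' u) (at (u a))"
  shows "(\<integral>z. z a * G z \<partial>gam I) = (\<integral>z. G' z \<partial>gam I)"
proof -
  let ?y = "\<lambda>i t. if i = a then t else (0::real)"
  let ?y' = "\<lambda>i (t::real). if i = a then 1 else (0::real)"
  have "((\<lambda>t. \<integral>z. G (\<lambda>i. ?y i t + z i) \<partial>gam I) has_real_derivative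
           (\<Sum>i\<in>I. ?y' i 0 * (\<integral>z. G (\<lambda>i. ?y i 0 + z i) * z i \<partial>gam I))) (at 0)"
    by (rule has_derivative_gam_curve[OF fin G]) (auto intro!: derivative_eq_intros)
  moreover have "(\<Sum>i\<in>I. ?y' i 0 * (\<integral>z. G (\<lambda>i. ?y i 0 + z i) * z i \<partial>gam I)) = (\<integral>z. z a * G z \<partial>gam I)"
  proof -
    have "(\<lambda>i. ?y i 0 + z i) = z" for z :: "'a \<Rightarrow> real" by auto
    then show ?thesis using fin a by (simp add: if_distrib[of "\<lambda>c. c * _"] mult.commute cong: if_cong)
  qed
  ultimately have D1: "((\<lambda>t. \<integral>z. G (\<lambda>i. ?y i t + z i) \<partial>gam I) has_real_derivative
           (\<integral>z. z a * G z \<partial>gam I)) (at 0)" by simp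
  have yz: "(\<lambda>i. ?y i t + z i) = z(a := z a + t)" for t and z :: "'a \<Rightarrow> real" by auto
  obtain c b where cb: "0 \<le> c" "0 \<le> b" "\<And>u. \<bar>G' u\<bar> \<le> c * exp (b * (\<Sum>i\<in>I. \<bar>u i\<bar>))"
    using nice_bound[OF G'] by blast
  have D2: "((\<lambda>t. \<integral>z. G (\<lambda>i. ?y i t + z i) \<partial>gam I) has_real_derivative
           (\<integral>z. G' (\<lambda>i. ?y i 0 + z i) \<partial>gam I)) (at 0)"
  proof (rule has_real_derivative_integral(2)[where \<delta>=1 and f="\<lambda>t z. G (\<lambda>i. ?y i t + z i)" and
        f'="\<lambda>t z. G' (\<lambda>i. ?y i t + z i)" and h="\<lambda>z. (c * exp b) * exp (b * (\<Sum>i\<in>I. \<bar>z i\<bar>))"])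
    fix t :: real
    assume t: "\<bar>t - 0\<bar> < 1"
    show "integrable (gam I) (\<lambda>z. G (\<lambda>i. ?y i t + z i))"
      using nice_integrable[OF fin nice_affine[OF fin G, of "\<lambda>i. ?y i t" "\<lambda>_. 1"]] by simp
    fix z :: "'a \<Rightarrow> real"
    assume "z \<in> space (gam I)"
    have "((\<lambda>s. G ((z(a := z a + t))(a := z a + s))) has_real_derivative G' (z(a := z a + t)) * 1) (at t)"
      by (rule DERIV_chain'[where f="\<lambda>s. z a + s" and g="\<lambda>s. G ((z(a := z a + t))(a := s))"])
         (use der[of "z(a := z a + t)"] in \<open>auto intro!: derivative_eq_intros\<close>)
    then show "((\<lambda>s. G (\<lambda>i. ?y i s + z i)) has_real_derivative G' (\<lambda>i. ?y i t + z i)) (at t)"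
      unfolding yz by simp
    have "(\<Sum>i\<in>I. \<bar>?y i t + z i\<bar>) \<le> (\<Sum>i\<in>I. \<bar>z i\<bar> + (if i = a then 1 else 0))"
    proof (rule sum_mono)
      show "\<bar>?y i t + z i\<bar> \<le> \<bar>z i\<bar> + (if i = a then 1 else 0)" for i
        using t by (cases "i = a") simp_all
    qed
    also have "\<dots> = (\<Sum>i\<in>I. \<bar>z i\<bar>) + 1" using fin a by (simp add: sum.distrib)
    finally have "b * (\<Sum>i\<in>I. \<bar>?y i t + z i\<bar>) \<le> b * ((\<Sum>i\<in>I. \<bar>z i\<bar>) + 1)"
      using cb(2) by (intro mult_left_mono)
    then have "c * exp (b * (\<Sum>i\<in>I. \<bar>?y i t + z i\<bar>)) \<le> c * exp (b * ((\<Sum>i\<in>I. \<bar>z i\<bar>) + 1))"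
      using cb(1) by (intro mult_left_mono) auto
    with cb(3)[of "\<lambda>i. ?y i t + z i"]
    show "\<bar>G' (\<lambda>i. ?y i t + z i)\<bar> \<le> (c * exp b) * exp (b * (\<Sum>i\<in>I. \<bar>z i\<bar>))"
      by (simp add: distrib_left exp_add mult_ac)
  next
    show "integrable (gam I) (\<lambda>z. (c * exp b) * exp (b * (\<Sum>i\<in>I. \<bar>z i\<bar>)))"
      using integrable_gam_exp[OF fin] by simp
  qed simp
  have "(\<lambda>i. ?y i 0 + z i) = z" for z :: "'a \<Rightarrow> real" by auto
  with D2 have "((\<lambda>t. \<integral>z. G (\<lambda>i. ?y i t + z i) \<partial>gam I) has_real_derivative
           (\<integral>z. G' z \<partial>gam I)) (at 0)" by simp
  from DERIV_unique[OF D1 this] show ?thesis .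
qed

section \<open>Polynomials in Gaussian variables\<close>

inductive pol :: "'i set \<Rightarrow> nat \<Rightarrow> (('i \<Rightarrow> real) \<Rightarrow> real) \<Rightarrow> bool" for I where
  const: "pol I q (\<lambda>_. c)"
| var: "i \<in> I \<Longrightarrow> pol I q p \<Longrightarrow> pol I (Suc q) (\<lambda>x. x i * p x)"
| add: "pol I q p \<Longrightarrow> pol I q r \<Longrightarrow> pol I q (\<lambda>x. p x + r x)"

lemma pol_mono: "pol I q p \<Longrightarrow> q \<le> r \<Longrightarrow> pol I r p"
proof (induction arbitrary: r rule: pol.induct)
  case (var i q p)
  then obtain r' where "r = Suc r'" "q \<le> r'" by (cases r) auto
  with var show ?case by (auto intro: pol.var)
qed (auto intro: pol.const pol.add)

lemma pol_subset: "pol I q p \<Longrightarrow> I \<subseteq> J \<Longrightarrow> pol J q p"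
  by (induction rule: pol.induct) (auto intro: pol.intros)

lemma pol_nice: "pol I q p \<Longrightarrow> finite I \<Longrightarrow> nice I p"
  by (induction rule: pol.induct) (auto intro: nice_add nice_mult nice_var)

lemma pol_cmult: "pol I q p \<Longrightarrow> pol I q (\<lambda>x. c * p x)"
proof (induction rule: pol.induct)
  case (var i q p)
  from pol.var[OF var.hyps(1) var.IH] show ?case by (simp add: mult.left_commute)
next
  case (add q p r)
  from pol.add[OF add.IH] show ?case by (simp add: distrib_left)
qed (rule pol.const)

lemma pol_mult: "pol I q p \<Longrightarrow> pol I r s \<Longrightarrow> pol I (q + r) (\<lambda>x. p x * s x)"
proof (induction rule: pol.induct)
  case (const q c)
  then show ?case by (intro pol_cmult) (auto intro: pol_mono)
next
  case (var i q p)
  from pol.var[OF var.hyps(1) var.IH[OF var.prems]] show ?case by (simp add: mult.assoc)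
next
  case (add q p r)
  from pol.add[OF add.IH(1)[OF add.prems] add.IH(2)[OF add.prems]]
  show ?case by (simp add: distrib_right)
qed

lemma pol_sum: "(\<And>a. a \<in> A \<Longrightarrow> pol I q (f a)) \<Longrightarrow> pol I q (\<lambda>x. \<Sum>a\<in>A. f a x)"
  by (induction A rule: infinite_finite_induct) (auto intro: pol.intros)

lemma pol_power: "pol I q p \<Longrightarrow> pol I (k * q) (\<lambda>x. p x ^ k)"
  by (induction k) (auto intro: pol.const pol_mult)

lemma pol_proj: "i \<in> I \<Longrightarrow> pol I 1 (\<lambda>x. x i)"
  using pol.var[of i I 0 "\<lambda>_. 1"] pol.const[of I 0 1] by simp

section \<open>Hermite expansions in one variable and orthogonality\<close>

lemma pol_hermite:
  assumes "pol I 1 L" shows "pol I n (\<lambda>x. hermite n (L x))"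
proof (induction n rule: induct_nat_012)
  case (ge2 n)
  have "pol I (1 + Suc n) (\<lambda>x. L x * hermite (Suc n) (L x))"
    by (rule pol_mult[OF assms ge2(2)])
  then have 1: "pol I (Suc (Suc n)) (\<lambda>x. L x * hermite (Suc n) (L x))" by simp
  have 2: "pol I (Suc (Suc n)) (\<lambda>x. - real (Suc n) * hermite n (L x))"
    by (rule pol_mono[OF pol_cmult[OF ge2(1)]]) simp
  from pol.add[OF 1 2] show ?case by (simp add: algebra_simps)
qed (use assms in \<open>auto intro: pol.const\<close>)

text \<open>The three-term recurrence without case distinction: at \<open>n = 0\<close> the
  truncated \<open>n - 1\<close> is multiplied by zero.\<close>

lemma hermite_mult: "x * hermite n x = hermite (Suc n) x + real n * hermite (n - 1) x"
  by (cases n) simp_all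

lemma DERIV_hermite: "(hermite n has_real_derivative real n * hermite (n - 1) x) (at x)"
proof (induction n rule: induct_nat_012)
  case 0
  have "hermite 0 = (\<lambda>x. 1)" by auto
  then show ?case by simp
next
  case 1
  have "hermite (Suc 0) = (\<lambda>x. x)" by auto
  then show ?case by simp
next
  case (ge2 n)
  have h: "hermite (Suc (Suc n)) = (\<lambda>x. x * hermite (Suc n) x - real (Suc n) * hermite n x)" by auto
  have "((\<lambda>x. x * hermite (Suc n) x - real (Suc n) * hermite n x) has_real_derivative
     (1 * hermite (Suc n) x + real (Suc n) * hermite (Suc n - 1) x * x) - real (Suc n) * (real n * hermite (n - 1) x)) (at x)"
    by (intro DERIV_diff DERIV_mult DERIV_cmult DERIV_ident ge2)
  also have "(1 * hermite (Suc n) x + real (Suc n) * hermite (Suc n - 1) x * x) - real (Suc n) * (real n * hermite (n - 1) x) =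
     hermite (Suc n) x + real (Suc n) * (x * hermite n x - real n * hermite (n - 1) x)"
    by (simp add: algebra_simps)
  also have "x * hermite n x - real n * hermite (n - 1) x = hermite (Suc n) x"
    by (simp add: hermite_mult)
  also have "hermite (Suc n) x + real (Suc n) * hermite (Suc n) x = real (Suc (Suc n)) * hermite (Suc (Suc n) - 1) x"
    by (simp add: algebra_simps)
  finally show ?case unfolding h .
qed

text \<open>This drives the inductions over the variables: singling out \<open>i\<close>, the
  coefficient of the \<open>k\<close>-th Hermite polynomial is a polynomial in the others that has
  lost \<open>k\<close> degrees. The clause for \<open>k > q\<close> is separate because the
  truncated degree \<open>q - k\<close> would still allow constants, and it permits shifting the
  summation index.\<close>

lemma pol_hermite_expansion:
  assumes "pol (insert i I) q P"
  shows "\<exists>A. (\<forall>k. pol I (q - k) (A k)) \<and> (\<forall>k>q. A k = (\<lambda>_. 0)) \<and>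
      (\<forall>x. P x = (\<Sum>k\<le>q. hermite k (x i) * A k x))"
  using assms
proof (induction rule: pol.induct)
  case (const q c)
  have "(\<Sum>k\<le>q. hermite k (x i) * (if k = 0 then c else 0)) = c" for x :: "'a \<Rightarrow> real"
    by (subst sum.mono_neutral_right[of _ "{0}"]) auto
  then show ?case
    by (intro exI[of _ "\<lambda>k _. if k = 0 then c else 0"]) (auto intro: pol.const)
next
  case (add q p r)
  then obtain A B where "\<forall>k. pol I (q - k) (A k)" "\<forall>k>q. A k = (\<lambda>_. 0)" "\<forall>x. p x = (\<Sum>k\<le>q. hermite k (x i) * A k x)"
    "\<forall>k. pol I (q - k) (B k)" "\<forall>k>q. B k = (\<lambda>_. 0)" "\<forall>x. r x = (\<Sum>k\<le>q. hermite k (x i) * B k x)"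
    by blast
  then show ?case
    by (intro exI[of _ "\<lambda>k x. A k x + B k x"]) (auto intro: pol.add simp: distrib_left sum.distrib)
next
  case (var j q p)
  then obtain A where A: "\<And>k. pol I (q - k) (A k)" "\<And>k. k > q \<Longrightarrow> A k = (\<lambda>_. 0)"
    "\<And>x. p x = (\<Sum>k\<le>q. hermite k (x i) * A k x)" by blast
  show ?case
  proof (cases "j = i")
    case False
    with var have j: "j \<in> I" by auto
    have "pol I (Suc q - k) (\<lambda>x. x j * A k x)" for k
    proof (cases "k \<le> q")
      case True
      with pol.var[OF j A(1)[of k]] show ?thesis by (simp add: Suc_diff_le)
    next
      case False
      then show ?thesis by (auto simp: A(2) intro: pol.const)
    qed
    then show ?thesis
      by (intro exI[of _ "\<lambda>k x. x j * A k x"]) (auto simp: A(2,3) sum_distrib_left mult_ac)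
  next
    case [simp]: True
    \<comment> \<open>Multiplication by \<open>x i\<close> sends degree \<open>k - 1\<close> up and
      degree \<open>k + 1\<close> down to degree \<open>k\<close>; the two terms are read off from
      \<open>hermite_mult\<close>.\<close>
    define B where "B k x = (case k of 0 \<Rightarrow> 0 | Suc m \<Rightarrow> A m x) + real (Suc k) * A (Suc k) x" for k x
    have "pol I (Suc q - k) (B k)" for k
    proof -
      have 1: "pol I (Suc q - k) (\<lambda>x. case k of 0 \<Rightarrow> 0 | Suc m \<Rightarrow> A m x)"
      proof (cases k)
        case (Suc m)
        then show ?thesis using A(1)[of m] by simp
      qed (auto intro: pol.const)
      have 2: "pol I (Suc q - k) (\<lambda>x. real (Suc k) * A (Suc k) x)"
        by (rule pol_mono[OF pol_cmult[OF A(1)]]) simp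
      show ?thesis using pol.add[OF 1 2] by (simp add: B_def[abs_def])
    qed
    moreover have "\<forall>k>Suc q. B k = (\<lambda>_. 0)"
      by (auto simp: B_def A(2) fun_eq_iff split: nat.split)
    moreover have "x j * p x = (\<Sum>k\<le>Suc q. hermite k (x i) * B k x)" for x
    proof -
      have "x j * p x = (\<Sum>k\<le>q. hermite (Suc k) (x i) * A k x) + (\<Sum>k\<le>q. real k * hermite (k - 1) (x i) * A k x)"
        unfolding A(3) sum_distrib_left sum.distrib[symmetric]
      proof (intro sum.cong refl)
        fix k
        have "x j * (hermite k (x i) * A k x) = (x i * hermite k (x i)) * A k x" by simp
        then show "x j * (hermite k (x i) * A k x) = hermite (Suc k) (x i) * A k x + real k * hermite (k - 1) (x i) * A k x"
          by (simp only: hermite_mult distrib_right)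
      qed
      also have "(\<Sum>k\<le>q. real k * hermite (k - 1) (x i) * A k x) = (\<Sum>k\<le>Suc (Suc q). real k * hermite (k - 1) (x i) * A k x)"
        by (simp add: A(2))
      also have "\<dots> = (\<Sum>k\<le>Suc q. real (Suc k) * hermite k (x i) * A (Suc k) x)"
        by (subst sum.atMost_Suc_shift) simp
      also have "(\<Sum>k\<le>q. hermite (Suc k) (x i) * A k x) = (\<Sum>k\<le>Suc q. hermite k (x i) * (case k of 0 \<Rightarrow> 0 | Suc m \<Rightarrow> A m x))"
        by (subst sum.atMost_Suc_shift) simp
      finally show ?thesis
        by (simp only: B_def distrib_left sum.distrib) (simp add: mult_ac)
    qed
    ultimately show ?thesis by blast
  qed
qed

lemma nice_subset:
  assumes "nice I G" "I \<subseteq> J" "finite J" shows "nice J G"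
proof -
  obtain a b where ab: "0 \<le> a" "0 \<le> b" "\<And>u. \<bar>G u\<bar> \<le> a * exp (b * (\<Sum>i\<in>I. \<bar>u i\<bar>))"
    using nice_bound[OF assms(1)] by blast
  have "\<bar>G u\<bar> \<le> a * exp (b * (\<Sum>i\<in>J. \<bar>u i\<bar>))" for u
  proof -
    have "(\<Sum>i\<in>I. \<bar>u i\<bar>) \<le> (\<Sum>i\<in>J. \<bar>u i\<bar>)" using assms by (intro sum_mono2) auto
    then have "a * exp (b * (\<Sum>i\<in>I. \<bar>u i\<bar>)) \<le> a * exp (b * (\<Sum>i\<in>J. \<bar>u i\<bar>))"
      using ab by (intro mult_left_mono) (auto intro: mult_left_mono)
    with ab(3)[of u] show ?thesis by linarith
  qed
  moreover have "G u = G v" if "\<And>i. i \<in> J \<Longrightarrow> u i = v i" for u v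
    using that assms(2) by (intro nice_cong[OF assms(1)]) auto
  ultimately show ?thesis using nice_borel[OF assms(1)] ab(1,2) by (rule nice_auxI)
qed

lemma gam_insert:
  assumes fin: "finite I" and i: "i \<notin> I" and h: "nice {i} (\<lambda>z. h (z i))" and A: "nice I A"
  shows "(\<integral>z. h (z i) * A z \<partial>gam (insert i I)) = (\<integral>x. h x \<partial>std_normal) * (\<integral>z. A z \<partial>gam I)"
proof -
  interpret product_sigma_finite "\<lambda>_. std_normal" by (rule product_sigma_finite_std)
  have "nice (insert i I) (\<lambda>z. h (z i) * A z)"
    using fin by (intro nice_mult nice_subset[OF h] nice_subset[OF A]) auto
  then have "integrable (gam (insert i I)) (\<lambda>z. h (z i) * A z)"
    using fin by (intro nice_integrable) auto
  then have "(\<integral>z. h (z i) * A z \<partial>gam (insert i I)) =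
    (\<integral>x. (\<integral>y. h ((x(i := y)) i) * A (x(i := y)) \<partial>std_normal) \<partial>gam I)"
    unfolding gam_def by (rule product_integral_insert[OF fin i])
  also have "\<dots> = (\<integral>x. (\<integral>y. h y * A x \<partial>std_normal) \<partial>gam I)"
  proof (intro integral_cong refl)
    fix x y
    have "A (x(i := y)) = A x" using i by (intro nice_cong[OF A]) auto
    then show "h ((x(i := y)) i) * A (x(i := y)) = h y * A x" by simp
  qed
  finally show ?thesis by simp
qed

lemma gam_singleton:
  assumes "f \<in> borel_measurable borel"
  shows "(\<integral>z. f (z i) \<partial>gam {i}) = (\<integral>x. f x \<partial>std_normal :: real)"
proof -
  interpret product_sigma_finite "\<lambda>_. std_normal" by (rule product_sigma_finite_std)
  show ?thesis unfolding gam_def by (rule product_integral_singleton) (use assms in simp)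
qed

lemma hermite_borel [measurable]: "hermite n \<in> borel_measurable borel"
  by (rule borel_measurable_continuous_onI)
     (meson DERIV_hermite DERIV_isCont continuous_at_imp_continuous_on)

lemma nice_hermite: "nice {i} (\<lambda>z. hermite k (z i))"
  by (rule pol_nice[OF pol_hermite[OF pol_proj]]) auto

text \<open>Integration by parts gives a recursion that lowers both indices at once, down to the
  case of index 0. The one-point index type \<open>unit\<close> makes \<open>gam_ibp\<close>
  available in one dimension.\<close>

lemma hermite_orthogonal:
  "(\<integral>x. hermite j x * hermite k x \<partial>std_normal) = (if j = k then fact k else 0)"
proof -
  define c where "c j k = (\<integral>x. hermite j x * hermite k x \<partial>std_normal)" for j k
  let ?u = "()"
  have c: "c j k = (\<integral>z. hermite j (z ?u) * hermite k (z ?u) \<partial>gam {?u})" for j k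
    unfolding c_def by (rule gam_singleton[symmetric, of "\<lambda>x. hermite j x * hermite k x"]) measurable
  have N: "nice {?u} (\<lambda>z. hermite j (z ?u) * hermite k (z ?u))" for j k
    by (intro nice_mult nice_hermite)
  have I: "integrable (gam {?u}) (\<lambda>z. hermite j (z ?u) * hermite k (z ?u))" for j k
    by (intro nice_integrable N) auto
  have rec: "c (Suc j) k = real k * c j (k - 1)" for j k
  proof -
    let ?G = "\<lambda>z. hermite j (z ?u) * hermite k (z ?u)"
    let ?G' = "\<lambda>z. real j * (hermite (j - 1) (z ?u) * hermite k (z ?u)) + real k * (hermite j (z ?u) * hermite (k - 1) (z ?u))"
    have "(\<integral>z. z ?u * ?G z \<partial>gam {?u}) = (\<integral>z. ?G' z \<partial>gam {?u})"
    proof (rule gam_ibp)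
      show "nice {?u} ?G'" by (intro nice_add nice_mult nice_const nice_hermite)
      fix w :: "unit \<Rightarrow> real"
      show "((\<lambda>t. hermite j ((w(?u := t)) ?u) * hermite k ((w(?u := t)) ?u)) has_real_derivative ?G' w) (at (w ?u))"
        by (auto intro!: derivative_eq_intros DERIV_hermite simp: algebra_simps)
    qed (auto intro: N)
    moreover have "(\<integral>z. ?G' z \<partial>gam {?u}) = real j * c (j - 1) k + real k * c j (k - 1)"
      unfolding c using I by simp
    moreover have "(\<integral>z. z ?u * ?G z \<partial>gam {?u}) = c (Suc j) k + real j * c (j - 1) k"
    proof -
      have "z ?u * ?G z = hermite (Suc j) (z ?u) * hermite k (z ?u) + real j * (hermite (j - 1) (z ?u) * hermite k (z ?u))" for z
        unfolding mult.assoc[symmetric] hermite_mult by (simp add: distrib_right)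
      then show ?thesis unfolding c using I by simp
    qed
    ultimately show ?thesis by simp
  qed
  have sym: "c j k = c k j" for j k unfolding c_def by (simp add: mult.commute)
  have c00: "c 0 0 = 1" unfolding c using prob_space.prob_space[OF prob_gam[of "{?u}"]] by simp
  have "c j k = (if j = k then fact k else 0)"
  proof (induction j arbitrary: k)
    case 0
    show ?case
    proof (cases k)
      case (Suc m)
      have "c 0 (Suc m) = c (Suc m) 0" by (rule sym)
      then show ?thesis using rec[of m 0] Suc by simp
    qed (use c00 in simp)
  next
    case (Suc j)
    show ?case
    proof (cases k)
      case 0
      then show ?thesis using rec[of j k] by simp
    next
      case (Suc m)
      then show ?thesis using rec[of j k] Suc.IH[of m] by simp
    qed
  qed
  then show ?thesis by (simp add: c_def)
qed

text \<open>Parseval's identity in the variable \<open>i\<close>, with coefficients depending on the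
  other variables.\<close>

lemma gam_hermite_bilinear:
  assumes fin: "finite I" and i: "i \<notin> I" and A: "\<And>k. nice I (A k)" and B: "\<And>k. nice I (B k)"
  shows "(\<integral>z. (\<Sum>k\<le>q. hermite k (z i) * A k z) * (\<Sum>k\<le>q. hermite k (z i) * B k z) \<partial>gam (insert i I)) =
     (\<Sum>k\<le>q. fact k * (\<integral>z. A k z * B k z \<partial>gam I))"
proof -
  have H: "nice {i} (\<lambda>z. hermite j (z i) * hermite k (z i))" for j k
    by (intro nice_mult nice_hermite)
  have AB: "nice I (\<lambda>z. A j z * B k z)" for j k using A B by (rule nice_mult)
  have int: "integrable (gam (insert i I)) (\<lambda>z. (hermite j (z i) * hermite k (z i)) * (A j z * B k z))" for j k
    using fin by (intro nice_integrable nice_mult nice_subset[OF H] nice_subset[OF AB]) auto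
  have "(\<integral>z. (\<Sum>k\<le>q. hermite k (z i) * A k z) * (\<Sum>k\<le>q. hermite k (z i) * B k z) \<partial>gam (insert i I)) =
    (\<integral>z. (\<Sum>j\<le>q. \<Sum>k\<le>q. (hermite j (z i) * hermite k (z i)) * (A j z * B k z)) \<partial>gam (insert i I))"
    unfolding sum_product by (intro integral_cong refl sum.cong) (simp add: mult_ac)
  also have "\<dots> = (\<Sum>j\<le>q. \<Sum>k\<le>q. (\<integral>z. (hermite j (z i) * hermite k (z i)) * (A j z * B k z) \<partial>gam (insert i I)))"
    by (subst integral_sum, intro integrable_sum int,
        intro sum.cong refl integral_sum int)
  also have "\<dots> = (\<Sum>j\<le>q. \<Sum>k\<le>q. (if j = k then fact k * (\<integral>z. A j z * B k z \<partial>gam I) else 0))"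
    by (intro sum.cong refl)
       (simp add: gam_insert[where h="\<lambda>x. hermite _ x * hermite _ x", OF fin i H AB] hermite_orthogonal)
  also have "\<dots> = (\<Sum>k\<le>q. fact k * (\<integral>z. A k z * B k z \<partial>gam I))"
    by (intro sum.cong refl) simp
  finally show ?thesis .
qed

section \<open>Moment inequalities and hypercontractivity\<close>

lemma Cauchy_Schwarz_integral:
  fixes f g :: "'a \<Rightarrow> real"
  assumes m: "f \<in> borel_measurable M" "g \<in> borel_measurable M"
    and i: "integrable M (\<lambda>x. (f x)\<^sup>2)" "integrable M (\<lambda>x. (g x)\<^sup>2)"
  shows "integrable M (\<lambda>x. f x * g x)"
    and "(\<integral>x. f x * g x \<partial>M)\<^sup>2 \<le> (\<integral>x. (f x)\<^sup>2 \<partial>M) * (\<integral>x. (g x)\<^sup>2 \<partial>M)"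
proof -
  show fg: "integrable M (\<lambda>x. f x * g x)"
  proof (rule integrable_bound)
    show "integrable M (\<lambda>x. (f x)\<^sup>2 + (g x)\<^sup>2)" using i by simp
    have "\<bar>f x * g x\<bar> \<le> (f x)\<^sup>2 + (g x)\<^sup>2" for x
    proof -
      have "0 \<le> (\<bar>f x\<bar> - \<bar>g x\<bar>)\<^sup>2" by simp
      then have "2 * \<bar>f x * g x\<bar> \<le> (f x)\<^sup>2 + (g x)\<^sup>2" by (simp add: power2_diff abs_mult)
      then show ?thesis by linarith
    qed
    then show "AE x in M. norm (f x * g x) \<le> norm ((f x)\<^sup>2 + (g x)\<^sup>2)" by simp
  qed (use m in measurable)
  define a b c where "a = (\<integral>x. (f x)\<^sup>2 \<partial>M)" "b = (\<integral>x. f x * g x \<partial>M)" "c = (\<integral>x. (g x)\<^sup>2 \<partial>M)"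
  have ac: "0 \<le> a" "0 \<le> c" by (auto simp: a_b_c_def)
  have *: "0 \<le> a - 2 * t * b + t\<^sup>2 * c" for t
  proof -
    have "0 \<le> (\<integral>x. (f x - t * g x)\<^sup>2 \<partial>M)" by simp
    also have "\<dots> = (\<integral>x. (f x)\<^sup>2 - 2 * t * (f x * g x) + t\<^sup>2 * (g x)\<^sup>2 \<partial>M)"
      by (simp add: power2_eq_square algebra_simps)
    also have "\<dots> = a - 2 * t * b + t\<^sup>2 * c"
      using i fg by (simp add: a_b_c_def)
    finally show ?thesis .
  qed
  have "b\<^sup>2 \<le> a * c"
  proof (cases "c = 0")
    case True
    have "b = 0"
    proof (rule ccontr)
      assume "b \<noteq> 0"
      \<comment> \<open>With \<open>c = 0\<close> the quadratic is affine in \<open>t\<close>, and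
        this choice gives it the value -1.\<close>
      then show False using *[of "(a + 1) / (2 * b)"] True by simp
    qed
    then show ?thesis using ac by simp
  next
    case False
    then have "c > 0" using ac by simp
    have "0 \<le> a - 2 * (b / c) * b + (b / c)\<^sup>2 * c" by (rule *)
    also have "\<dots> = a - b\<^sup>2 / c" using \<open>c > 0\<close> by (simp add: power2_eq_square field_simps)
    finally show ?thesis using \<open>c > 0\<close> by (simp add: field_simps)
  qed
  then show "(\<integral>x. f x * g x \<partial>M)\<^sup>2 \<le> (\<integral>x. (f x)\<^sup>2 \<partial>M) * (\<integral>x. (g x)\<^sup>2 \<partial>M)"
    by (simp add: a_b_c_def)
qed

lemma Cauchy_Schwarz_bound:
  fixes f g :: "'a \<Rightarrow> real"
  assumes m: "f \<in> borel_measurable M" "g \<in> borel_measurable M"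
    and i: "integrable M (\<lambda>x. (f x)\<^sup>2)" "integrable M (\<lambda>x. (g x)\<^sup>2)"
    and b: "(\<integral>x. (f x)\<^sup>2 \<partial>M) \<le> c\<^sup>2" "(\<integral>x. (g x)\<^sup>2 \<partial>M) \<le> d\<^sup>2" "0 \<le> c" "0 \<le> d"
  shows "(\<integral>x. f x * g x \<partial>M) \<le> c * d"
proof -
  have "(\<integral>x. f x * g x \<partial>M)\<^sup>2 \<le> (\<integral>x. (f x)\<^sup>2 \<partial>M) * (\<integral>x. (g x)\<^sup>2 \<partial>M)"
    by (rule Cauchy_Schwarz_integral(2)[OF m i])
  also have "\<dots> \<le> c\<^sup>2 * d\<^sup>2" by (rule mult_mono[OF b(1,2)]) simp_all
  also have "\<dots> = (c * d)\<^sup>2" by (simp only: power_mult_distrib)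
  finally show ?thesis by (rule power2_le_imp_le) (simp add: b)
qed

lemma power4_sum_le:
  fixes r :: "'a \<Rightarrow> real"
  shows "(\<Sum>k\<in>S. r k) ^ 4 \<le> real (card S) ^ 3 * (\<Sum>k\<in>S. r k ^ 4)"
proof -
  have sq: "(\<Sum>k\<in>S. r k)\<^sup>2 \<le> real (card S) * (\<Sum>k\<in>S. (r k)\<^sup>2)" for r :: "'a \<Rightarrow> real"
    using sum_squared_le_sum_of_squares[of r S] by (simp add: mult.commute)
  have "(\<Sum>k\<in>S. r k) ^ 4 = ((\<Sum>k\<in>S. r k)\<^sup>2)\<^sup>2" by simp
  also have "\<dots> \<le> (real (card S) * (\<Sum>k\<in>S. (r k)\<^sup>2))\<^sup>2"
    by (intro power_mono sq) simp
  also have "\<dots> = (real (card S))\<^sup>2 * (\<Sum>k\<in>S. (r k)\<^sup>2)\<^sup>2" by (simp add: power_mult_distrib)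
  also have "\<dots> \<le> (real (card S))\<^sup>2 * (real (card S) * (\<Sum>k\<in>S. ((r k)\<^sup>2)\<^sup>2))"
    by (intro mult_left_mono sq) simp
  finally show ?thesis by (simp add: power2_eq_square power3_eq_cube power4_eq_xxxx mult.assoc)
qed

lemma pol_integrable: "finite I \<Longrightarrow> pol I q p \<Longrightarrow> integrable (gam I) p"
  by (intro nice_integrable pol_nice)

lemma hermite_4_nonneg: "0 \<le> (\<integral>x. hermite k x ^ 4 \<partial>std_normal)"
  by simp

lemma gam_square_expansion:
  assumes fin: "finite I" and i: "i \<notin> I" and A: "\<And>k. nice I (A k)"
    and P: "\<And>z. P z = (\<Sum>k\<le>q. hermite k (z i) * A k z)"
  shows "(\<integral>z. (P z)\<^sup>2 \<partial>gam (insert i I)) = (\<Sum>k\<le>q. fact k * (\<integral>z. (A k z)\<^sup>2 \<partial>gam I))"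
  using gam_hermite_bilinear[OF fin i A A, where q=q] by (simp add: P power2_eq_square)

text \<open>Write \<open>P = A 0 + R\<close>. Every coefficient in \<open>R\<close> has lost at
  least one degree, so the induction hypothesis is better by a factor \<open>1 / r\<close> in the
  mixed term and by \<open>1 / r^2\<close> in the fourth moment of \<open>R\<close>. This gain pays
  for the combinatorial constants, and the term with \<open>A 0\<close> cubed vanishes by
  orthogonality. Hence the constant does not deteriorate when a variable is added.\<close>

lemma hypercontractive_step:
  fixes r M :: real
  assumes fin: "finite I" and i: "i \<notin> I" and q: "q \<le> Q"
    and M: "\<And>k. k \<le> Q \<Longrightarrow> (\<integral>x. hermite k x ^ 4 \<partial>std_normal) \<le> M"
    and r: "4 \<le> r" "3 * real Q ^ 3 * M \<le> r"
    and A: "\<And>k. pol I (q - k) (A k)"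
    and IH: "\<And>k. k \<le> q \<Longrightarrow> (\<integral>z. A k z ^ 4 \<partial>gam I) \<le> r ^ (2 * (q - k)) * (\<integral>z. (A k z)\<^sup>2 \<partial>gam I)\<^sup>2"
    and P: "\<And>z. P z = (\<Sum>k\<le>q. hermite k (z i) * A k z)"
  shows "(\<integral>z. P z ^ 4 \<partial>gam (insert i I)) \<le> r ^ (2 * q) * (\<integral>z. (P z)\<^sup>2 \<partial>gam (insert i I))\<^sup>2"
proof -
  let ?J = "insert i I"
  define \<alpha> where "\<alpha> k = (\<integral>z. (A k z)\<^sup>2 \<partial>gam I)" for k
  define s where "s = (\<Sum>k\<in>{1..q}. fact k * \<alpha> k)"
  have \<alpha>: "0 \<le> \<alpha> k" for k by (simp add: \<alpha>_def)
  have s: "0 \<le> s" unfolding s_def using \<alpha> by (intro sum_nonneg) simp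
  have r0: "0 < r" "1 \<le> r" using r by auto
  have M0: "0 \<le> M" using order_trans[OF hermite_4_nonneg[of 0] M[of 0]] by simp
  have nA: "nice I (A k)" for k using A fin by (rule pol_nice)
  define R where "R z = (\<Sum>k\<in>{1..q}. hermite k (z i) * A k z)" for z
  have split: "(\<Sum>k\<le>q. f k) = f 0 + (\<Sum>k\<in>{1..q}. f k)" for f :: "nat \<Rightarrow> real"
    by (simp add: atMost_atLeast0 sum.atLeast_Suc_atMost)
  have PR: "P z = A 0 z + R z" for z unfolding P R_def by (simp add: split)
  have nH: "nice ?J (\<lambda>z. hermite k (z i))" for k using fin by (intro nice_subset[OF nice_hermite]) auto
  have nA': "nice ?J (A k)" for k using fin by (intro nice_subset[OF nA]) auto
  have nR: "nice ?J R" unfolding R_def by (intro nice_sum nice_mult nH nA')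
  have int: "nice ?J f \<Longrightarrow> integrable (gam ?J) f" for f using fin by (intro nice_integrable) auto
  have EP: "(\<integral>z. (P z)\<^sup>2 \<partial>gam ?J) = \<alpha> 0 + s"
    unfolding gam_square_expansion[OF fin i nA P] by (simp add: split s_def \<alpha>_def)
  have one: "(\<integral>z. f z \<partial>gam ?J) = (\<integral>z. f z \<partial>gam I)" if "nice I f" for f
    using gam_insert[OF fin i, of "\<lambda>_. 1" f] that prob_space.prob_space[OF prob_std] by simp
  have E40: "(\<integral>z. A 0 z ^ 4 \<partial>gam ?J) \<le> r ^ (2 * q) * (\<alpha> 0)\<^sup>2"
    unfolding one[OF nice_power[OF nA]] using IH[of 0] by (simp add: \<alpha>_def)
  have E31: "(\<integral>z. A 0 z ^ 3 * R z \<partial>gam ?J) = 0"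
  proof -
    \<comment> \<open>The cube of \<open>A 0\<close> has only the Hermite degree 0 in variable
      \<open>i\<close>, and \<open>R\<close> only positive ones, so Parseval gives 0.\<close>
    define B where "B k = (if k = 0 then \<lambda>z. A 0 z ^ 3 else (\<lambda>_. 0))" for k :: nat
    define C where "C k = (if k = 0 then (\<lambda>_. 0) else A k)" for k :: nat
    have "nice I (B k)" "nice I (C k)" for k
      by (auto simp: B_def C_def intro: nA nice_power)
    from gam_hermite_bilinear[OF fin i this, where q=q]
    have "(\<integral>z. (\<Sum>k\<le>q. hermite k (z i) * B k z) * (\<Sum>k\<le>q. hermite k (z i) * C k z) \<partial>gam ?J) =
       (\<Sum>k\<le>q. fact k * (\<integral>z. B k z * C k z \<partial>gam I))" .
    moreover have "(\<Sum>k\<le>q. fact k * (\<integral>z. B k z * C k z \<partial>gam I)) = 0"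
      by (intro sum.neutral) (auto simp: B_def C_def)
    moreover have "(\<Sum>k\<le>q. hermite k (z i) * B k z) = A 0 z ^ 3" for z
      unfolding split by (simp add: B_def)
    moreover have "(\<Sum>k\<le>q. hermite k (z i) * C k z) = R z" for z
      unfolding split R_def by (simp add: C_def)
    ultimately show ?thesis by simp
  qed
  have E22: "(\<integral>z. (A 0 z)\<^sup>2 * (R z)\<^sup>2 \<partial>gam ?J) \<le> r ^ (2 * q) / r * (\<alpha> 0 * s)"
  proof -
    define C where "C k = (if k = 0 then (\<lambda>_. 0) else (\<lambda>z. A 0 z * A k z))" for k :: nat
    have nC: "nice I (C k)" for k
      by (auto simp: C_def intro: nA nice_mult)
    have "A 0 z * R z = (\<Sum>k\<le>q. hermite k (z i) * C k z)" for z
      unfolding split R_def by (simp add: C_def sum_distrib_left mult_ac)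
    then have "(\<integral>z. (A 0 z * R z)\<^sup>2 \<partial>gam ?J) = (\<Sum>k\<le>q. fact k * (\<integral>z. (C k z)\<^sup>2 \<partial>gam I))"
      by (rule gam_square_expansion[OF fin i nC])
    also have "\<dots> = (\<Sum>k\<in>{1..q}. fact k * (\<integral>z. (A 0 z)\<^sup>2 * (A k z)\<^sup>2 \<partial>gam I))"
      unfolding split by (auto simp: C_def power_mult_distrib intro!: sum.cong)
    also have "\<dots> \<le> (\<Sum>k\<in>{1..q}. fact k * (r ^ (2 * q) / r * (\<alpha> 0 * \<alpha> k)))"
    proof (intro sum_mono mult_left_mono)
      fix k assume k: "k \<in> {1..q}"
      have m: "(\<lambda>z. (A j z)\<^sup>2) \<in> borel_measurable (gam I)" for j
        by (rule nice_measurable_gam[OF nice_power[OF nA]])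
      have i4: "integrable (gam I) (\<lambda>z. ((A j z)\<^sup>2)\<^sup>2)" for j
        using nice_integrable[OF fin nice_power[OF nA[of j], of 4]] by simp
      have "(\<integral>z. (A 0 z)\<^sup>2 * (A k z)\<^sup>2 \<partial>gam I) \<le> (r ^ q * \<alpha> 0) * (r ^ (q - k) * \<alpha> k)"
      proof (rule Cauchy_Schwarz_bound[OF m m i4 i4])
        show "(\<integral>z. ((A 0 z)\<^sup>2)\<^sup>2 \<partial>gam I) \<le> (r ^ q * \<alpha> 0)\<^sup>2"
          using IH[of 0] by (simp add: \<alpha>_def power_mult_distrib power_even_eq)
        show "(\<integral>z. ((A k z)\<^sup>2)\<^sup>2 \<partial>gam I) \<le> (r ^ (q - k) * \<alpha> k)\<^sup>2"
          using IH[of k] k by (simp add: \<alpha>_def power_mult_distrib power_even_eq)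
      qed (use r0 \<alpha> in auto)
      also have "\<dots> = (r ^ q * r ^ (q - k)) * (\<alpha> 0 * \<alpha> k)" by simp
      also have "\<dots> \<le> (r ^ (2 * q) / r) * (\<alpha> 0 * \<alpha> k)"
      proof (rule mult_right_mono)
        \<comment> \<open>The exponent is at most \<open>2 * q\<close> because \<open>k\<close> is
          at least 1; this is the factor \<open>1 / r\<close> gained.\<close>
        have "r * (r ^ q * r ^ (q - k)) = r ^ (Suc q + (q - k))" by (simp add: power_add)
        also have "\<dots> \<le> r ^ (2 * q)" using r0 k by (intro power_increasing) auto
        finally show "r ^ q * r ^ (q - k) \<le> r ^ (2 * q) / r" using r0 by (simp add: field_simps)
      qed (use \<alpha> in simp)
      finally show "(\<integral>z. (A 0 z)\<^sup>2 * (A k z)\<^sup>2 \<partial>gam I) \<le> r ^ (2 * q) / r * (\<alpha> 0 * \<alpha> k)" .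
    qed simp
    also have "\<dots> = r ^ (2 * q) / r * (\<alpha> 0 * s)"
      by (simp add: s_def sum_distrib_left mult_ac)
    finally show ?thesis by (simp add: power_mult_distrib)
  qed
  have E04: "(\<integral>z. R z ^ 4 \<partial>gam ?J) \<le> r ^ (2 * q) * (real Q ^ 3 * M / r\<^sup>2) * s\<^sup>2"
  proof -
    have n4: "nice ?J (\<lambda>z. (hermite k (z i) * A k z) ^ 4)" for k
      by (intro nice_power nice_mult nH nA')
    have "(\<integral>z. R z ^ 4 \<partial>gam ?J) \<le> (\<integral>z. real q ^ 3 * (\<Sum>k\<in>{1..q}. (hermite k (z i) * A k z) ^ 4) \<partial>gam ?J)"
    proof (rule integral_mono)
      show "integrable (gam ?J) (\<lambda>z. R z ^ 4)" by (intro int nice_power nR)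
      show "integrable (gam ?J) (\<lambda>z. real q ^ 3 * (\<Sum>k\<in>{1..q}. (hermite k (z i) * A k z) ^ 4))"
        by (intro int nice_mult nice_const nice_sum n4)
      show "R z ^ 4 \<le> real q ^ 3 * (\<Sum>k\<in>{1..q}. (hermite k (z i) * A k z) ^ 4)" for z
        unfolding R_def using power4_sum_le[of _ "{1..q}"] by simp
    qed
    also have "\<dots> = real q ^ 3 * (\<Sum>k\<in>{1..q}. (\<integral>z. (hermite k (z i) * A k z) ^ 4 \<partial>gam ?J))"
      using int[OF n4] by (simp add: integral_sum)
    also have "\<dots> \<le> real Q ^ 3 * (\<Sum>k\<in>{1..q}. M * (r ^ (2 * q) / r\<^sup>2) * (s * (fact k * \<alpha> k)))"
    proof (intro mult_mono power_mono sum_mono)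
      fix k assume k: "k \<in> {1..q}"
      have "(\<integral>z. (hermite k (z i) * A k z) ^ 4 \<partial>gam ?J) = (\<integral>x. hermite k x ^ 4 \<partial>std_normal) * (\<integral>z. A k z ^ 4 \<partial>gam I)"
        unfolding power_mult_distrib
        by (rule gam_insert[OF fin i]) (intro nice_power nice_hermite nA)+
      also have "\<dots> \<le> M * (r ^ (2 * (q - k)) * (\<alpha> k)\<^sup>2)"
        using k q IH[of k] M0 by (intro mult_mono M) (auto simp: \<alpha>_def)
      also have "\<dots> \<le> M * ((r ^ (2 * q) / r\<^sup>2) * (s * (fact k * \<alpha> k)))"
      proof (intro mult_left_mono mult_mono)
        have "r\<^sup>2 * r ^ (2 * (q - k)) = r ^ (2 + 2 * (q - k))" by (rule power_add[symmetric])
        also have "\<dots> \<le> r ^ (2 * q)"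
        proof (rule power_increasing)
          show "2 + 2 * (q - k) \<le> 2 * q" using k by auto
        qed (rule r0)
        finally show "r ^ (2 * (q - k)) \<le> r ^ (2 * q) / r\<^sup>2"
          using r0 by (simp add: pos_le_divide_eq mult.commute)
        \<comment> \<open>The chain \<open>\<alpha> k \<le> fact k * \<alpha> k \<le> s\<close>
          allows one factor to be bounded by \<open>s\<close> while the other keeps its weight, so
          that the sum over \<open>k\<close> is the square of \<open>s\<close>.\<close>
        have 1: "\<alpha> k \<le> fact k * \<alpha> k" using \<alpha>[of k] fact_ge_1[of k, where 'a=real]
          by (simp add: mult_le_cancel_right1)
        also have 2: "fact k * \<alpha> k \<le> s" unfolding s_def using k \<alpha> by (intro member_le_sum) auto
        finally have "\<alpha> k * \<alpha> k \<le> s * (fact k * \<alpha> k)" using 1 \<alpha> s by (intro mult_mono) auto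
        then show "(\<alpha> k)\<^sup>2 \<le> s * (fact k * \<alpha> k)" by (simp add: power2_eq_square)
      qed (use r0 M0 in auto)
      finally show "(\<integral>z. (hermite k (z i) * A k z) ^ 4 \<partial>gam ?J) \<le> M * (r ^ (2 * q) / r\<^sup>2) * (s * (fact k * \<alpha> k))"
        by (simp add: mult.assoc)
    qed (use q r0 M0 s \<alpha> in \<open>auto intro!: sum_nonneg\<close>)
    also have "\<dots> = r ^ (2 * q) * (real Q ^ 3 * M / r\<^sup>2) * s\<^sup>2"
    proof -
      have "(\<Sum>k\<in>{1..q}. s * (fact k * \<alpha> k)) = s * s"
        unfolding sum_distrib_left[symmetric] by (simp only: s_def)
      then have "(\<Sum>k\<in>{1..q}. M * (r ^ (2 * q) / r\<^sup>2) * (s * (fact k * \<alpha> k))) = M * (r ^ (2 * q) / r\<^sup>2) * (s * s)"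
        unfolding sum_distrib_left[symmetric] by simp
      then show ?thesis by (simp add: power2_eq_square)
    qed
    finally show ?thesis .
  qed
  have n: "nice ?J (\<lambda>z. A 0 z ^ 4)" "nice ?J (\<lambda>z. A 0 z ^ 3 * R z)"
    "nice ?J (\<lambda>z. (A 0 z)\<^sup>2 * (R z)\<^sup>2)" "nice ?J (\<lambda>z. R z ^ 4)"
    by (intro nice_mult nice_power nA' nR)+
  have nP: "nice ?J P" unfolding PR[abs_def] by (intro nice_add nA' nR)
  have "(\<integral>z. P z ^ 4 \<partial>gam ?J) \<le> (\<integral>z. A 0 z ^ 4 + 4 * (A 0 z ^ 3 * R z) + 8 * ((A 0 z)\<^sup>2 * (R z)\<^sup>2) + 3 * R z ^ 4 \<partial>gam ?J)"
  proof (rule integral_mono)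
    show "integrable (gam ?J) (\<lambda>z. P z ^ 4)" by (intro int nice_power nP)
    show "integrable (gam ?J) (\<lambda>z. A 0 z ^ 4 + 4 * (A 0 z ^ 3 * R z) + 8 * ((A 0 z)\<^sup>2 * (R z)\<^sup>2) + 3 * R z ^ 4)"
      by (intro int nice_add nice_mult nice_const nice_power nA' nR)
    fix z
    define a b where "a = A 0 z" "b = R z"
    \<comment> \<open>This square is the exact gap in the inequality below: it trades the term
      \<open>4 * a * b^3\<close> for \<open>2 * a^2 * b^2 + 2 * b^4\<close>.\<close>
    have "0 \<le> 2 * b\<^sup>2 * (a - b)\<^sup>2" by simp
    then have "(a + b) ^ 4 \<le> a ^ 4 + 4 * (a ^ 3 * b) + 8 * (a\<^sup>2 * b\<^sup>2) + 3 * b ^ 4"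
      by (simp add: power2_eq_square power3_eq_cube power4_eq_xxxx algebra_simps)
    then show "P z ^ 4 \<le> A 0 z ^ 4 + 4 * (A 0 z ^ 3 * R z) + 8 * ((A 0 z)\<^sup>2 * (R z)\<^sup>2) + 3 * R z ^ 4"
      by (simp add: PR a_b_def)
  qed
  also have "\<dots> = (\<integral>z. A 0 z ^ 4 \<partial>gam ?J) + 8 * (\<integral>z. (A 0 z)\<^sup>2 * (R z)\<^sup>2 \<partial>gam ?J) + 3 * (\<integral>z. R z ^ 4 \<partial>gam ?J)"
    using n[THEN int] E31 by simp
  also have "\<dots> \<le> r ^ (2 * q) * (\<alpha> 0)\<^sup>2 + 8 * (r ^ (2 * q) / r * (\<alpha> 0 * s)) + 3 * (r ^ (2 * q) * (real Q ^ 3 * M / r\<^sup>2) * s\<^sup>2)"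
    using E40 E22 E04 by linarith
  also have "\<dots> = r ^ (2 * q) * ((\<alpha> 0)\<^sup>2 + (8 / r) * (\<alpha> 0 * s) + (3 * real Q ^ 3 * M / r\<^sup>2) * s\<^sup>2)"
    by (simp add: algebra_simps)
  \<comment> \<open>The two lower bounds on \<open>r\<close> are made for this step: they reduce the
    bracket to the square of \<open>\<alpha> 0 + s\<close>, the second moment of
    \<open>P\<close>.\<close>
  also have "\<dots> \<le> r ^ (2 * q) * ((\<alpha> 0)\<^sup>2 + 2 * (\<alpha> 0 * s) + 1 * s\<^sup>2)"
  proof (intro mult_left_mono add_mono order_refl mult_right_mono)
    show "8 / r \<le> 2" using r by (simp add: field_simps)
    have "r * 1 \<le> r * r" using r0 by (intro mult_left_mono) auto
    then have "3 * real Q ^ 3 * M \<le> r\<^sup>2" using r(2) by (simp add: power2_eq_square)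
    then show "3 * real Q ^ 3 * M / r\<^sup>2 \<le> 1" using r0 by simp
  qed (use \<alpha> s r0 in auto)
  also have "\<dots> = r ^ (2 * q) * (\<integral>z. (P z)\<^sup>2 \<partial>gam ?J)\<^sup>2"
    unfolding EP by (simp add: power2_sum algebra_simps)
  finally show ?thesis .
qed

text \<open>Each degree costs a factor \<open>r^2\<close>, each variable costs nothing. The constant
  therefore depends on the degree alone, which is what survives a limit with growing
  \<open>I\<close>.\<close>

theorem hypercontractive4:
  fixes Q :: nat
  obtains K :: real where "1 \<le> K"
    "\<And>(I :: 'i set) P. finite I \<Longrightarrow> pol I Q P \<Longrightarrow> (\<integral>z. P z ^ 4 \<partial>gam I) \<le> K * (\<integral>z. (P z)\<^sup>2 \<partial>gam I)\<^sup>2"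
proof -
  define M where "M = (\<Sum>k\<le>Q. (\<integral>x. hermite k x ^ 4 \<partial>std_normal))"
  have M: "(\<integral>x. hermite k x ^ 4 \<partial>std_normal) \<le> M" if "k \<le> Q" for k
    unfolding M_def using that by (intro member_le_sum) (auto simp: hermite_4_nonneg)
  have M0: "0 \<le> M" unfolding M_def by (intro sum_nonneg) simp
  define r where "r = 4 + 3 * real Q ^ 3 * M"
  have r: "4 \<le> r" "3 * real Q ^ 3 * M \<le> r" using M0 by (auto simp: r_def)
  have main: "(\<integral>z. P z ^ 4 \<partial>gam I) \<le> r ^ (2 * q) * (\<integral>z. (P z)\<^sup>2 \<partial>gam I)\<^sup>2"
    if "finite I" "pol I q P" "q \<le> Q" for I :: "'i set" and q P
    using that
  proof (induction I arbitrary: q P rule: finite_induct)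
    case empty
    have N: "nice {} P" using empty.prems by (intro pol_nice) auto
    define c where "c = P (\<lambda>_. 0)"
    have P: "P z = c" for z unfolding c_def by (rule nice_cong[OF N]) auto
    have pr: "measure (gam {}) (space (gam {} :: ('i \<Rightarrow> real) measure)) = 1" by (rule prob_space.prob_space[OF prob_gam])
    have "1 * c ^ 4 \<le> r ^ (2 * q) * c ^ 4"
      using r by (intro mult_right_mono one_le_power) auto
    then show ?case using pr by (simp add: P)
  next
    case (insert i I)
    obtain A where A: "\<And>k. pol I (q - k) (A k)" "\<And>z. P z = (\<Sum>k\<le>q. hermite k (z i) * A k z)"
      using pol_hermite_expansion[OF insert.prems(1)] by blast
    show ?case
    proof (rule hypercontractive_step[OF insert.hyps(1,2) insert.prems(2) M r A(1) _ A(2)])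
      fix k assume "k \<le> q"
      show "(\<integral>z. A k z ^ 4 \<partial>gam I) \<le> r ^ (2 * (q - k)) * (\<integral>z. (A k z)\<^sup>2 \<partial>gam I)\<^sup>2"
        using insert.prems(2) by (intro insert.IH A(1)) simp
    qed
  qed
  show thesis
  proof (rule that)
    show "1 \<le> r ^ (2 * Q)" using r by (intro one_le_power) auto
  qed (use main in blast)
qed

text \<open>The fourth-moment bound is applied to the square of \<open>P\<close>, of degree
  \<open>2 * Q\<close>, and then to \<open>P\<close> itself.\<close>

lemma hypercontractive8:
  fixes Q :: nat
  obtains K :: real where "1 \<le> K"
    "\<And>(I :: 'i set) P. finite I \<Longrightarrow> pol I Q P \<Longrightarrow> (\<integral>z. P z ^ 8 \<partial>gam I) \<le> K * (\<integral>z. (P z)\<^sup>2 \<partial>gam I) ^ 4"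
proof -
  obtain K where K: "1 \<le> K"
    "\<And>(I :: 'i set) P. finite I \<Longrightarrow> pol I Q P \<Longrightarrow> (\<integral>z. P z ^ 4 \<partial>gam I) \<le> K * (\<integral>z. (P z)\<^sup>2 \<partial>gam I)\<^sup>2"
    by (rule hypercontractive4[of Q]) blast
  obtain L where L: "1 \<le> L"
    "\<And>(I :: 'i set) P. finite I \<Longrightarrow> pol I (2 * Q) P \<Longrightarrow> (\<integral>z. P z ^ 4 \<partial>gam I) \<le> L * (\<integral>z. (P z)\<^sup>2 \<partial>gam I)\<^sup>2"
    by (rule hypercontractive4[of "2 * Q"]) blast
  show thesis
  proof (rule that[of "L * K\<^sup>2"])
    show "1 \<le> L * K\<^sup>2" using K(1) L(1) by (metis mult_mono' mult_1 one_le_power zero_le_one)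
    fix I :: "'i set" and P assume I: "finite I" "pol I Q P"
    have "(\<integral>z. P z ^ 8 \<partial>gam I) = (\<integral>z. ((P z)\<^sup>2) ^ 4 \<partial>gam I)" by simp
    also have "\<dots> \<le> L * (\<integral>z. ((P z)\<^sup>2)\<^sup>2 \<partial>gam I)\<^sup>2"
      by (rule L(2)[OF I(1) pol_power[OF I(2)]])
    also have "\<dots> \<le> L * (K * (\<integral>z. (P z)\<^sup>2 \<partial>gam I)\<^sup>2)\<^sup>2"
      using K(2)[OF I] L(1) by (intro mult_left_mono power_mono) auto
    finally show "(\<integral>z. P z ^ 8 \<partial>gam I) \<le> L * K\<^sup>2 * (\<integral>z. (P z)\<^sup>2 \<partial>gam I) ^ 4"
      by (simp add: power_mult_distrib)
  qed
qed

text \<open>Asking for the derivative along every differentiable curve builds in the chain rule;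
  coordinate lines and Gaussian rotations are both special cases.\<close>

definition gradient_on :: "'i set \<Rightarrow> (('i \<Rightarrow> real) \<Rightarrow> real) \<Rightarrow> ('i \<Rightarrow> ('i \<Rightarrow> real) \<Rightarrow> real) \<Rightarrow> bool" where
  "gradient_on I P P' \<longleftrightarrow> (\<forall>(y :: 'i \<Rightarrow> real \<Rightarrow> real) y' t.
     (\<forall>i\<in>I. (y i has_real_derivative y' i) (at t)) \<longrightarrow>
     ((\<lambda>t. P (\<lambda>i. y i t)) has_real_derivative (\<Sum>i\<in>I. y' i * P' i (\<lambda>i. y i t))) (at t))"

lemma gradient_onD:
  "gradient_on I P P' \<Longrightarrow> (\<And>i. i \<in> I \<Longrightarrow> (y i has_real_derivative y' i) (at t)) \<Longrightarrow>
     ((\<lambda>t. P (\<lambda>i. y i t)) has_real_derivative (\<Sum>i\<in>I. y' i * P' i (\<lambda>i. y i t))) (at t)"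
  unfolding gradient_on_def by blast

lemma gradient_on_partial:
  assumes fin: "finite I" and a: "a \<in> I" and g: "gradient_on I P P'"
  shows "((\<lambda>t. P (u(a := t))) has_real_derivative P' a u) (at (u a))"
proof -
  have "((\<lambda>t. P (\<lambda>i. (u(a := t)) i)) has_real_derivative
      (\<Sum>i\<in>I. (if i = a then 1 else 0) * P' i (\<lambda>i. (u(a := u a)) i))) (at (u a))"
    by (rule gradient_onD[OF g, where y="\<lambda>i t. (u(a := t)) i"]) auto
  then show ?thesis using fin a by (simp add: if_distrib[of "\<lambda>c. c * _"] del: fun_upd_apply cong: if_cong)
qed

text \<open>The energy bound reflects that the number operator has eigenvalues at most
  \<open>q\<close> on polynomials of degree \<open>q\<close>. In the induction the Hermite degree
  \<open>k\<close> in variable \<open>i\<close> contributes weight \<open>k\<close>, the remaining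
  variables at most \<open>q - k\<close>, and the weights add up to \<open>q\<close>.\<close>

lemma pol_gradient:
  assumes "finite I" "pol I q P"
  shows "\<exists>P'. (\<forall>a. pol I q (P' a)) \<and> gradient_on I P P' \<and>
      (\<Sum>a\<in>I. \<integral>z. (P' a z)\<^sup>2 \<partial>gam I) \<le> real q * (\<integral>z. (P z)\<^sup>2 \<partial>gam I)"
  using assms
proof (induction I arbitrary: q P rule: finite_induct)
  case empty
  have N: "nice {} P" using empty.prems by (intro pol_nice) auto
  define c where "c = P (\<lambda>_. 0)"
  have P: "P = (\<lambda>_. c)" unfolding c_def by (intro ext nice_cong[OF N]) auto
  have "gradient_on {} P (\<lambda>_ _. 0)" unfolding gradient_on_def P by simp
  then show ?case by (intro exI[of _ "\<lambda>_ _. 0"]) (auto intro: pol.const)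
next
  case (insert i I)
  let ?J = "insert i I"
  note fin = insert.hyps(1) and i = insert.hyps(2)
  obtain A where A: "\<And>k. pol I (q - k) (A k)" "\<And>k. k > q \<Longrightarrow> A k = (\<lambda>_. 0)"
    and P: "\<And>z. P z = (\<Sum>k\<le>q. hermite k (z i) * A k z)"
    using pol_hermite_expansion[OF insert.prems] by blast
  have "\<forall>k. \<exists>A'. (\<forall>a. pol I (q - k) (A' a)) \<and> gradient_on I (A k) A' \<and>
      (\<Sum>a\<in>I. \<integral>z. (A' a z)\<^sup>2 \<partial>gam I) \<le> real (q - k) * (\<integral>z. (A k z)\<^sup>2 \<partial>gam I)"
    using insert.IH[OF A(1)] by blast
  from choice[OF this] obtain A' where A': "\<And>k a. pol I (q - k) (A' k a)" "\<And>k. gradient_on I (A k) (A' k)"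
      "\<And>k. (\<Sum>a\<in>I. \<integral>z. (A' k a z)\<^sup>2 \<partial>gam I) \<le> real (q - k) * (\<integral>z. (A k z)\<^sup>2 \<partial>gam I)" by blast
  have nA: "nice I (A k)" "nice I (A' k a)" for k a
    using A(1) A'(1) fin by (auto intro: pol_nice)
  \<comment> \<open>Coefficients of the partial derivative in \<open>i\<close>: differentiation
    lowers the Hermite degree, so degree \<open>k\<close> receives \<open>A (Suc k)\<close> with the
    factor \<open>Suc k\<close>.\<close>
  define B where "B k z = real (Suc k) * A (Suc k) z" for k z
  have nB: "nice I (B k)" for k unfolding B_def by (intro nice_mult nice_const nA)
  define P' where "P' a = (if a = i then (\<lambda>z. \<Sum>k\<le>q. hermite k (z i) * B k z)
      else (\<lambda>z. \<Sum>k\<le>q. hermite k (z i) * A' k a z))" for a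
  have Pi: "(\<Sum>k\<le>q. hermite k (z i) * B k z) = (\<Sum>k\<le>q. real k * hermite (k - 1) (z i) * A k z)" for z
  proof -
    have "(\<Sum>k\<le>q. real k * hermite (k - 1) (z i) * A k z) = (\<Sum>k\<le>Suc q. real k * hermite (k - 1) (z i) * A k z)"
      by (simp add: A(2))
    also have "\<dots> = (\<Sum>k\<le>q. real (Suc k) * hermite k (z i) * A (Suc k) z)"
      by (subst sum.atMost_Suc_shift) simp
    finally show ?thesis by (simp add: B_def mult_ac)
  qed
  have deg: "pol ?J q (\<lambda>z. hermite k (z i) * C z)" if "k \<le> q" "pol I (q - k) C" for k C
  proof -
    have "pol ?J (k + (q - k)) (\<lambda>z. hermite k (z i) * C z)"
      using that by (intro pol_mult pol_hermite pol_proj pol_subset[OF that(2)]) auto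
    then show ?thesis using that by simp
  qed
  have "pol ?J q (P' a)" for a
  proof (cases "a = i")
    case True
    have "pol I (q - k) (B k)" for k
      unfolding B_def by (rule pol_mono[OF pol_cmult[OF A(1)]]) simp
    then show ?thesis using True by (auto simp: P'_def intro!: pol_sum deg)
  next
    case False
    then show ?thesis by (auto simp: P'_def intro!: pol_sum deg A')
  qed
  moreover have "gradient_on ?J P P'"
    unfolding gradient_on_def
  proof (intro allI impI)
    fix y :: "'a \<Rightarrow> real \<Rightarrow> real" and y' t
    assume y: "\<forall>j\<in>?J. (y j has_real_derivative y' j) (at t)"
    define u where "u = (\<lambda>j. y j t)"
    have h: "((\<lambda>t. hermite k (y i t)) has_real_derivative (real k * hermite (k - 1) (u i)) * y' i) (at t)" for k
      unfolding u_def by (rule DERIV_chain2[OF DERIV_hermite]) (use y in auto)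
    have a: "((\<lambda>t. A k (\<lambda>j. y j t)) has_real_derivative (\<Sum>a\<in>I. y' a * A' k a u)) (at t)" for k
      unfolding u_def using y by (intro gradient_onD[OF A'(2)]) auto
    have "((\<lambda>t. \<Sum>k\<le>q. hermite k (y i t) * A k (\<lambda>j. y j t)) has_real_derivative
        (\<Sum>k\<le>q. (real k * hermite (k - 1) (u i)) * y' i * A k u + (\<Sum>a\<in>I. y' a * A' k a u) * hermite k (u i))) (at t)"
      using DERIV_mult[OF h a] unfolding u_def by (intro DERIV_sum) auto
    also have "(\<Sum>k\<le>q. (real k * hermite (k - 1) (u i)) * y' i * A k u + (\<Sum>a\<in>I. y' a * A' k a u) * hermite k (u i)) =
      (\<Sum>a\<in>?J. y' a * P' a u)"
    proof -
      have "(\<Sum>k\<le>q. (real k * hermite (k - 1) (u i)) * y' i * A k u) = y' i * P' i u"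
      proof -
        have P'i: "P' i u = (\<Sum>k\<le>q. real k * hermite (k - 1) (u i) * A k u)"
          using Pi[of u] by (simp add: P'_def)
        show ?thesis unfolding P'i sum_distrib_left by (intro sum.cong refl) simp
      qed
      moreover have "(\<Sum>k\<le>q. (\<Sum>a\<in>I. y' a * A' k a u) * hermite k (u i)) = (\<Sum>a\<in>I. y' a * P' a u)"
      proof -
        have "(\<Sum>k\<le>q. (\<Sum>a\<in>I. y' a * A' k a u) * hermite k (u i)) = (\<Sum>a\<in>I. \<Sum>k\<le>q. y' a * A' k a u * hermite k (u i))"
          unfolding sum_distrib_right by (rule sum.swap)
        also have "\<dots> = (\<Sum>a\<in>I. y' a * P' a u)"
        proof (rule sum.cong[OF refl])
          fix a assume "a \<in> I"
          with i have P'a: "P' a u = (\<Sum>k\<le>q. hermite k (u i) * A' k a u)" by (auto simp: P'_def)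
          show "(\<Sum>k\<le>q. y' a * A' k a u * hermite k (u i)) = y' a * P' a u"
            unfolding P'a sum_distrib_left by (intro sum.cong refl) simp
        qed
        finally show ?thesis .
      qed
      ultimately show ?thesis using fin i by (simp add: sum.distrib)
    qed
    finally show "((\<lambda>t. P (\<lambda>i. y i t)) has_real_derivative (\<Sum>i\<in>?J. y' i * P' i (\<lambda>i. y i t))) (at t)"
      by (simp add: P u_def)
  qed
  moreover have "(\<Sum>a\<in>?J. \<integral>z. (P' a z)\<^sup>2 \<partial>gam ?J) \<le> real q * (\<integral>z. (P z)\<^sup>2 \<partial>gam ?J)"
  proof -
    define \<alpha> where "\<alpha> k = (\<integral>z. (A k z)\<^sup>2 \<partial>gam I)" for k
    have "(\<integral>z. (P' i z)\<^sup>2 \<partial>gam ?J) = (\<Sum>k\<le>q. fact k * (\<integral>z. (B k z)\<^sup>2 \<partial>gam I))"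
      by (rule gam_square_expansion[OF fin i nB]) (simp add: P'_def)
    also have "\<dots> = (\<Sum>k\<le>q. real (Suc k) * (fact (Suc k) * \<alpha> (Suc k)))"
    proof (rule sum.cong[OF refl])
      fix k
      have "(\<integral>z. (B k z)\<^sup>2 \<partial>gam I) = (real (Suc k))\<^sup>2 * \<alpha> (Suc k)"
        unfolding B_def \<alpha>_def power_mult_distrib by simp
      moreover have "fact k * (real (Suc k))\<^sup>2 = real (Suc k) * fact (Suc k)"
        by (simp only: power2_eq_square fact_Suc of_nat_mult) simp
      ultimately show "fact k * (\<integral>z. (B k z)\<^sup>2 \<partial>gam I) = real (Suc k) * (fact (Suc k) * \<alpha> (Suc k))"
        by (metis mult.assoc)
    qed
    also have "\<dots> = (\<Sum>k\<le>Suc q. real k * (fact k * \<alpha> k))"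
      by (subst sum.atMost_Suc_shift) simp
    also have "\<dots> = (\<Sum>k\<le>q. real k * (fact k * \<alpha> k))"
      by (simp add: \<alpha>_def A(2))
    finally have 1: "(\<integral>z. (P' i z)\<^sup>2 \<partial>gam ?J) = (\<Sum>k\<le>q. real k * (fact k * \<alpha> k))" .
    have "(\<Sum>a\<in>I. \<integral>z. (P' a z)\<^sup>2 \<partial>gam ?J) = (\<Sum>a\<in>I. \<Sum>k\<le>q. fact k * (\<integral>z. (A' k a z)\<^sup>2 \<partial>gam I))"
    proof (rule sum.cong[OF refl])
      fix a assume "a \<in> I"
      with i have "P' a z = (\<Sum>k\<le>q. hermite k (z i) * A' k a z)" for z by (auto simp: P'_def)
      then show "(\<integral>z. (P' a z)\<^sup>2 \<partial>gam ?J) = (\<Sum>k\<le>q. fact k * (\<integral>z. (A' k a z)\<^sup>2 \<partial>gam I))"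
        by (rule gam_square_expansion[OF fin i nA(2)])
    qed
    also have "\<dots> = (\<Sum>k\<le>q. fact k * (\<Sum>a\<in>I. \<integral>z. (A' k a z)\<^sup>2 \<partial>gam I))"
      unfolding sum_distrib_left by (rule sum.swap)
    also have "\<dots> \<le> (\<Sum>k\<le>q. fact k * (real (q - k) * \<alpha> k))"
      unfolding \<alpha>_def by (intro sum_mono mult_left_mono A') simp
    finally have 2: "(\<Sum>a\<in>I. \<integral>z. (P' a z)\<^sup>2 \<partial>gam ?J) \<le> (\<Sum>k\<le>q. fact k * (real (q - k) * \<alpha> k))" .
    have "(\<Sum>k\<le>q. real k * (fact k * \<alpha> k)) + (\<Sum>k\<le>q. fact k * (real (q - k) * \<alpha> k)) = real q * (\<Sum>k\<le>q. fact k * \<alpha> k)"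
      unfolding sum.distrib[symmetric] sum_distrib_left
      by (intro sum.cong refl) (auto simp: of_nat_diff algebra_simps)
    also have "(\<Sum>k\<le>q. fact k * \<alpha> k) = (\<integral>z. (P z)\<^sup>2 \<partial>gam ?J)"
      unfolding \<alpha>_def by (rule gam_square_expansion[OF fin i nA(1) P, symmetric])
    finally show ?thesis using 1 2 fin i by simp
  qed
  ultimately show ?case by blast
qed

section \<open>The covariance identity along Gaussian rotations\<close>

definition gam2 :: "'i set \<Rightarrow> (('i \<Rightarrow> real) \<times> ('i \<Rightarrow> real)) measure" where
  "gam2 I = gam I \<Otimes>\<^sub>M gam I"

text \<open>Under independent standard \<open>z\<close> and \<open>z'\<close> the rotated point
  again has the law of \<open>z\<close>. Against the overview the angle is replaced by its
  complement: angle 0 gives \<open>z\<close>, angle pi/2 gives \<open>z'\<close>, and the weight of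
  the covariance identity becomes sin t.\<close>

definition rot :: "real \<Rightarrow> ('i \<Rightarrow> real) \<Rightarrow> ('i \<Rightarrow> real) \<Rightarrow> 'i \<Rightarrow> real" where
  "rot t z z' = (\<lambda>i. cos t * z i + sin t * z' i)"

text \<open>The exponential bound is uniform in the angle \<open>t\<close>.\<close>

definition tame :: "'i set \<Rightarrow> (real \<Rightarrow> ('i \<Rightarrow> real) \<Rightarrow> ('i \<Rightarrow> real) \<Rightarrow> real) \<Rightarrow> bool" where
  "tame I f \<longleftrightarrow>
     (\<lambda>p. f (fst p) (fst (snd p)) (snd (snd p))) \<in> borel_measurable (borel \<Otimes>\<^sub>M gam2 I) \<and>
     (\<exists>a b. 0 \<le> a \<and> 0 \<le> b \<and> (\<forall>t z z'. \<bar>f t z z'\<bar> \<le> a * exp (b * ((\<Sum>i\<in>I. \<bar>z i\<bar>) + (\<Sum>i\<in>I. \<bar>z' i\<bar>)))))"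

lemma tame_bound:
  assumes "tame I f"
  obtains a b where "0 \<le> a" "0 \<le> b"
    "\<And>t z z'. \<bar>f t z z'\<bar> \<le> a * exp (b * ((\<Sum>i\<in>I. \<bar>z i\<bar>) + (\<Sum>i\<in>I. \<bar>z' i\<bar>)))"
  using assms unfolding tame_def by blast

lemma tameI:
  assumes "(\<lambda>p. f (fst p) (fst (snd p)) (snd (snd p))) \<in> borel_measurable (borel \<Otimes>\<^sub>M gam2 I)"
    "0 \<le> a" "0 \<le> b" "\<And>t z z'. \<bar>f t z z'\<bar> \<le> a * exp (b * ((\<Sum>i\<in>I. \<bar>z i\<bar>) + (\<Sum>i\<in>I. \<bar>z' i\<bar>)))"
  shows "tame I f"
  unfolding tame_def using assms by blast

lemma tame_measurable: "tame I f \<Longrightarrow> (\<lambda>p. f (fst p) (fst (snd p)) (snd (snd p))) \<in> borel_measurable (borel \<Otimes>\<^sub>M gam2 I)"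
  unfolding tame_def by blast

lemma gam2_coords [measurable]:
  "(\<lambda>p. fst (snd p) i) \<in> borel_measurable (M \<Otimes>\<^sub>M gam2 I)" "(\<lambda>p. snd (snd p) i) \<in> borel_measurable (M \<Otimes>\<^sub>M gam2 I)"
proof -
  have 1: "snd \<in> measurable (M \<Otimes>\<^sub>M gam2 I) (gam I \<Otimes>\<^sub>M gam I)"
    unfolding gam2_def by (rule measurable_snd)
  show "(\<lambda>p. fst (snd p) i) \<in> borel_measurable (M \<Otimes>\<^sub>M gam2 I)"
    by (rule measurable_compose[OF measurable_compose[OF 1 measurable_fst] measurable_gam_component])
  show "(\<lambda>p. snd (snd p) i) \<in> borel_measurable (M \<Otimes>\<^sub>M gam2 I)"
    by (rule measurable_compose[OF measurable_compose[OF 1 measurable_snd] measurable_gam_component])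
qed

lemma fst_borel_pair [measurable]: "(fst :: real \<times> 'b \<Rightarrow> real) \<in> borel_measurable (borel \<Otimes>\<^sub>M N)"
  by (rule measurable_fst)

lemma tame_bounded:
  assumes "g \<in> borel_measurable borel" "\<And>t. \<bar>g t\<bar> \<le> c"
  shows "tame I (\<lambda>t z z'. g t)"
proof (rule tameI[where a="\<bar>c\<bar>" and b=0])
  show "(\<lambda>p. g (fst p)) \<in> borel_measurable (borel \<Otimes>\<^sub>M gam2 I)"
    by (rule measurable_compose[OF fst_borel_pair assms(1)])
qed (use assms(2) abs_ge_self[of c] in \<open>auto intro: order_trans\<close>)

lemma tame_const: "tame I (\<lambda>t z z'. c)"
  by (rule tame_bounded[where c="\<bar>c\<bar>"]) auto

lemma tame_cos: "tame I (\<lambda>t z z'. cos t)" by (rule tame_bounded[where c=1]) auto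
lemma tame_sin: "tame I (\<lambda>t z z'. sin t)" by (rule tame_bounded[where c=1]) auto

lemma tame_var1:
  assumes "finite I" "i \<in> I" shows "tame I (\<lambda>t z z'. z i)"
proof (rule tameI[where a=1 and b=1])
  fix z z' :: "'a \<Rightarrow> real"
  have "\<bar>z i\<bar> \<le> (\<Sum>i\<in>I. \<bar>z i\<bar>)" using assms by (intro member_le_sum) auto
  also have "\<dots> \<le> exp (1 * ((\<Sum>i\<in>I. \<bar>z i\<bar>) + (\<Sum>i\<in>I. \<bar>z' i\<bar>)))"
    using exp_ge_add_one_self[of "(\<Sum>i\<in>I. \<bar>z i\<bar>) + (\<Sum>i\<in>I. \<bar>z' i\<bar>)"] sum_abs_nonneg[of z' I] unfolding mult_1 by linarith
  finally show "\<bar>z i\<bar> \<le> 1 * exp (1 * ((\<Sum>i\<in>I. \<bar>z i\<bar>) + (\<Sum>i\<in>I. \<bar>z' i\<bar>)))" by simp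
qed (auto intro: gam2_coords)

lemma tame_var2:
  assumes "finite I" "i \<in> I" shows "tame I (\<lambda>t z z'. z' i)"
proof (rule tameI[where a=1 and b=1])
  fix z z' :: "'a \<Rightarrow> real"
  have "\<bar>z' i\<bar> \<le> (\<Sum>i\<in>I. \<bar>z' i\<bar>)" using assms by (intro member_le_sum) auto
  also have "\<dots> \<le> exp (1 * ((\<Sum>i\<in>I. \<bar>z i\<bar>) + (\<Sum>i\<in>I. \<bar>z' i\<bar>)))"
    using exp_ge_add_one_self[of "(\<Sum>i\<in>I. \<bar>z i\<bar>) + (\<Sum>i\<in>I. \<bar>z' i\<bar>)"] sum_abs_nonneg[of z I] unfolding mult_1 by linarith
  finally show "\<bar>z' i\<bar> \<le> 1 * exp (1 * ((\<Sum>i\<in>I. \<bar>z i\<bar>) + (\<Sum>i\<in>I. \<bar>z' i\<bar>)))" by simp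
qed (auto intro: gam2_coords)

lemma tame_add:
  assumes "tame I f" "tame I g" shows "tame I (\<lambda>t z z'. f t z z' + g t z z')"
proof -
  let ?S = "\<lambda>z z' :: 'a \<Rightarrow> real. (\<Sum>i\<in>I. \<bar>z i\<bar>) + (\<Sum>i\<in>I. \<bar>z' i\<bar>)"
  obtain a b where F: "0 \<le> a" "0 \<le> b" "\<And>t z z'. \<bar>f t z z'\<bar> \<le> a * exp (b * ?S z z')"
    using tame_bound[OF assms(1)] by blast
  obtain c d where G: "0 \<le> c" "0 \<le> d" "\<And>t z z'. \<bar>g t z z'\<bar> \<le> c * exp (d * ?S z z')"
    using tame_bound[OF assms(2)] by blast
  show ?thesis
  proof (rule tameI[where a="a + c" and b="b + d"])
    fix t z z'
    have S: "0 \<le> ?S z z'" by (simp add: sum_abs_nonneg add_nonneg_nonneg)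
    have "exp (b * ?S z z') \<le> exp ((b + d) * ?S z z')" "exp (d * ?S z z') \<le> exp ((b + d) * ?S z z')"
      using F(2) G(2) S by (auto intro!: mult_right_mono)
    then have "a * exp (b * ?S z z') + c * exp (d * ?S z z') \<le> (a + c) * exp ((b + d) * ?S z z')"
      using F(1) G(1) by (simp add: distrib_right add_mono mult_left_mono)
    with F(3)[of t z z'] G(3)[of t z z']
    show "\<bar>f t z z' + g t z z'\<bar> \<le> (a + c) * exp ((b + d) * ?S z z')" by linarith
  next
    show "(\<lambda>p. f (fst p) (fst (snd p)) (snd (snd p)) + g (fst p) (fst (snd p)) (snd (snd p))) \<in> borel_measurable (borel \<Otimes>\<^sub>M gam2 I)"
      using assms[THEN tame_measurable] by (rule borel_measurable_add)
  qed (use F(1,2) G(1,2) in auto)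
qed

lemma tame_mult:
  assumes "tame I f" "tame I g" shows "tame I (\<lambda>t z z'. f t z z' * g t z z')"
proof -
  let ?S = "\<lambda>z z' :: 'a \<Rightarrow> real. (\<Sum>i\<in>I. \<bar>z i\<bar>) + (\<Sum>i\<in>I. \<bar>z' i\<bar>)"
  obtain a b where F: "0 \<le> a" "0 \<le> b" "\<And>t z z'. \<bar>f t z z'\<bar> \<le> a * exp (b * ?S z z')"
    using tame_bound[OF assms(1)] by blast
  obtain c d where G: "0 \<le> c" "0 \<le> d" "\<And>t z z'. \<bar>g t z z'\<bar> \<le> c * exp (d * ?S z z')"
    using tame_bound[OF assms(2)] by blast
  show ?thesis
  proof (rule tameI[where a="a * c" and b="b + d"])
    fix t z z'
    have "\<bar>f t z z' * g t z z'\<bar> \<le> (a * exp (b * ?S z z')) * (c * exp (d * ?S z z'))"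
      unfolding abs_mult using F(1) by (intro mult_mono F(3) G(3)) auto
    also have "\<dots> = (a * c) * exp ((b + d) * ?S z z')" by (simp only: distrib_right exp_add mult_ac)
    finally show "\<bar>f t z z' * g t z z'\<bar> \<le> (a * c) * exp ((b + d) * ?S z z')" .
  next
    show "(\<lambda>p. f (fst p) (fst (snd p)) (snd (snd p)) * g (fst p) (fst (snd p)) (snd (snd p))) \<in> borel_measurable (borel \<Otimes>\<^sub>M gam2 I)"
      using assms[THEN tame_measurable] by (rule borel_measurable_times)
  qed (use F(1,2) G(1,2) in auto)
qed

lemma tame_sum: "(\<And>a. a \<in> A \<Longrightarrow> tame I (f a)) \<Longrightarrow> tame I (\<lambda>t z z'. \<Sum>a\<in>A. f a t z z')"
  by (induction A rule: infinite_finite_induct) (auto intro: tame_add tame_const)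

lemma tame_power: "tame I f \<Longrightarrow> tame I (\<lambda>t z z'. f t z z' ^ k)"
  by (induction k) (auto intro: tame_mult tame_const)

lemma tame_fst:
  assumes "nice I F" shows "tame I (\<lambda>t z z'. F z)"
proof -
  obtain a b where F: "0 \<le> a" "0 \<le> b" "\<And>u. \<bar>F u\<bar> \<le> a * exp (b * (\<Sum>i\<in>I. \<bar>u i\<bar>))"
    using nice_bound[OF assms] by blast
  show ?thesis
  proof (rule tameI[OF _ F(1,2)])
    show "(\<lambda>p. F (fst (snd p))) \<in> borel_measurable (borel \<Otimes>\<^sub>M gam2 I)"
      by (rule nice_measurable[OF assms gam2_coords(1)])
    fix z z' :: "'a \<Rightarrow> real"
    have "exp (b * (\<Sum>i\<in>I. \<bar>z i\<bar>)) \<le> exp (b * ((\<Sum>i\<in>I. \<bar>z i\<bar>) + (\<Sum>i\<in>I. \<bar>z' i\<bar>)))"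
      using F(2) sum_abs_nonneg[of z' I] by (simp add: distrib_left)
    then have "a * exp (b * (\<Sum>i\<in>I. \<bar>z i\<bar>)) \<le> a * exp (b * ((\<Sum>i\<in>I. \<bar>z i\<bar>) + (\<Sum>i\<in>I. \<bar>z' i\<bar>)))"
      using F(1) by (rule mult_left_mono)
    with F(3)[of z] show "\<bar>F z\<bar> \<le> a * exp (b * ((\<Sum>i\<in>I. \<bar>z i\<bar>) + (\<Sum>i\<in>I. \<bar>z' i\<bar>)))" by linarith
  qed
qed

lemma rot_abs_le: "\<bar>rot t z z' i\<bar> \<le> \<bar>z i\<bar> + \<bar>z' i\<bar>"
proof -
  have "\<bar>cos t * z i\<bar> \<le> 1 * \<bar>z i\<bar>" "\<bar>sin t * z' i\<bar> \<le> 1 * \<bar>z' i\<bar>"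
    unfolding abs_mult by (intro mult_right_mono; simp)+
  then show ?thesis unfolding rot_def by linarith
qed

lemma tame_rot:
  assumes "nice I F" shows "tame I (\<lambda>t z z'. F (rot t z z'))"
proof -
  obtain a b where F: "0 \<le> a" "0 \<le> b" "\<And>u. \<bar>F u\<bar> \<le> a * exp (b * (\<Sum>i\<in>I. \<bar>u i\<bar>))"
    using nice_bound[OF assms] by blast
  show ?thesis
  proof (rule tameI[OF _ F(1,2)])
    show "(\<lambda>p. F (rot (fst p) (fst (snd p)) (snd (snd p)))) \<in> borel_measurable (borel \<Otimes>\<^sub>M gam2 I)"
    proof (rule nice_measurable[OF assms])
      show "(\<lambda>p. rot (fst p) (fst (snd p)) (snd (snd p)) i) \<in> borel_measurable (borel \<Otimes>\<^sub>M gam2 I)" for i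
        unfolding rot_def by measurable
    qed
    fix t and z z' :: "'a \<Rightarrow> real"
    have "(\<Sum>i\<in>I. \<bar>rot t z z' i\<bar>) \<le> (\<Sum>i\<in>I. \<bar>z i\<bar>) + (\<Sum>i\<in>I. \<bar>z' i\<bar>)"
      unfolding sum.distrib[symmetric] by (intro sum_mono rot_abs_le)
    then have "b * (\<Sum>i\<in>I. \<bar>rot t z z' i\<bar>) \<le> b * ((\<Sum>i\<in>I. \<bar>z i\<bar>) + (\<Sum>i\<in>I. \<bar>z' i\<bar>))"
      using F(2) by (rule mult_left_mono)
    then have "a * exp (b * (\<Sum>i\<in>I. \<bar>rot t z z' i\<bar>)) \<le> a * exp (b * ((\<Sum>i\<in>I. \<bar>z i\<bar>) + (\<Sum>i\<in>I. \<bar>z' i\<bar>)))"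
      using F(1) by (intro mult_left_mono) simp_all
    with F(3)[of "rot t z z'"] show "\<bar>F (rot t z z')\<bar> \<le> a * exp (b * ((\<Sum>i\<in>I. \<bar>z i\<bar>) + (\<Sum>i\<in>I. \<bar>z' i\<bar>)))"
      by linarith
  qed
qed

lemma prob_gam2: "prob_space (gam2 I)"
  unfolding gam2_def by (intro prob_space_pair prob_gam)

lemma pair_sigma_finite_gam: "pair_sigma_finite (gam I) (gam J)"
proof -
  interpret A: prob_space "gam I" by (rule prob_gam)
  interpret B: prob_space "gam J" by (rule prob_gam)
  show ?thesis ..
qed

lemma integrable_gam2_exp:
  assumes fin: "finite I"
  shows "integrable (gam2 I) (\<lambda>p. exp (b * ((\<Sum>i\<in>I. \<bar>fst p i\<bar>) + (\<Sum>i\<in>I. \<bar>snd p i\<bar>))))"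
proof -
  interpret pair_sigma_finite "gam I" "gam I" by (rule pair_sigma_finite_gam)
  let ?e = "\<lambda>z. exp (b * (\<Sum>i\<in>I. \<bar>z i :: real\<bar>))"
  have e: "integrable (gam I) ?e" by (rule integrable_gam_exp[OF fin])
  have "integrable (gam I \<Otimes>\<^sub>M gam I) (\<lambda>p. ?e (fst p) * ?e (snd p))"
  proof (rule Fubini_integrable)
    show "(\<lambda>p. ?e (fst p) * ?e (snd p)) \<in> borel_measurable (gam I \<Otimes>\<^sub>M gam I)"
      using e by measurable
    have "(\<lambda>x. \<integral>y. norm (?e (fst (x, y)) * ?e (snd (x, y))) \<partial>gam I) = (\<lambda>x. ?e x * (\<integral>y. ?e y \<partial>gam I))"
      by (simp add: abs_mult)
    then show "integrable (gam I) (\<lambda>x. \<integral>y. norm (?e (fst (x, y)) * ?e (snd (x, y))) \<partial>gam I)"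
      using e by simp
    show "AE x in gam I. integrable (gam I) (\<lambda>y. ?e (fst (x, y)) * ?e (snd (x, y)))"
      using e by simp
  qed
  then show ?thesis unfolding gam2_def by (simp add: distrib_left exp_add)
qed

lemma tame_at_measurable:
  assumes "tame I f" shows "(\<lambda>p. f t (fst p) (snd p)) \<in> borel_measurable (gam2 I)"
proof -
  have "(\<lambda>p. (t, p)) \<in> measurable (gam2 I) (borel \<Otimes>\<^sub>M gam2 I)" by measurable
  from measurable_compose[OF this tame_measurable[OF assms]] show ?thesis by simp
qed

lemma tame_integrable:
  assumes fin: "finite I" and f: "tame I f" shows "integrable (gam2 I) (\<lambda>p. f t (fst p) (snd p))"
proof -
  obtain a b where F: "0 \<le> a" "0 \<le> b" "\<And>t z z'. \<bar>f t z z'\<bar> \<le> a * exp (b * ((\<Sum>i\<in>I. \<bar>z i\<bar>) + (\<Sum>i\<in>I. \<bar>z' i\<bar>)))"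
    using tame_bound[OF f] by blast
  show ?thesis
  proof (rule integrable_bound)
    show "integrable (gam2 I) (\<lambda>p. a * exp (b * ((\<Sum>i\<in>I. \<bar>fst p i\<bar>) + (\<Sum>i\<in>I. \<bar>snd p i\<bar>))))"
      using integrable_gam2_exp[OF fin] by simp
    show "AE p in gam2 I. norm (f t (fst p) (snd p)) \<le> norm (a * exp (b * ((\<Sum>i\<in>I. \<bar>fst p i\<bar>) + (\<Sum>i\<in>I. \<bar>snd p i\<bar>))))"
      using F(1,3) by (simp add: abs_mult)
  qed (rule tame_at_measurable[OF f])
qed

lemma tame_fubini:
  assumes fin: "finite I" and f: "tame I f"
  shows "(\<integral>p. f t (fst p) (snd p) \<partial>gam2 I) = (\<integral>z. (\<integral>z'. f t z z' \<partial>gam I) \<partial>gam I)"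
    and "(\<integral>p. f t (fst p) (snd p) \<partial>gam2 I) = (\<integral>z'. (\<integral>z. f t z z' \<partial>gam I) \<partial>gam I)"
proof -
  interpret pair_sigma_finite "gam I" "gam I" by (rule pair_sigma_finite_gam)
  have i: "integrable (gam I \<Otimes>\<^sub>M gam I) (\<lambda>p. f t (fst p) (snd p))"
    using tame_integrable[OF fin f] by (simp add: gam2_def)
  show "(\<integral>p. f t (fst p) (snd p) \<partial>gam2 I) = (\<integral>z. (\<integral>z'. f t z z' \<partial>gam I) \<partial>gam I)"
    using integral_fst'[OF i] by (simp add: gam2_def)
  show "(\<integral>p. f t (fst p) (snd p) \<partial>gam2 I) = (\<integral>z'. (\<integral>z. f t z z' \<partial>gam I) \<partial>gam I)"
    using integral_snd[of "\<lambda>x y. f t x y"] i by (simp add: gam2_def case_prod_beta')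
qed

text \<open>Integration by parts in both Gaussian vectors cancels the second derivatives of \<open>F\<close>.\<close>

lemma cov_deriv:
  assumes fin: "finite I"
    and F: "nice I F" "gradient_on I F F'" "\<And>a. nice I (F' a)"
    and F2: "\<And>a. gradient_on I (F' a) (F'' a)" "\<And>a b. nice I (F'' a b)"
    and P: "nice I \<Phi>" "\<And>a. nice I (\<Phi>' a)"
      "\<And>a u. a \<in> I \<Longrightarrow> ((\<lambda>t. \<Phi> (u(a := t))) has_real_derivative \<Phi>' a u) (at (u a))"
  shows "((\<lambda>t. \<integral>p. F (rot t (fst p) (snd p)) * \<Phi> (fst p) \<partial>gam2 I) has_real_derivative
     - sin t * (\<integral>p. (\<Sum>a\<in>I. F' a (rot t (fst p) (snd p)) * \<Phi>' a (fst p)) \<partial>gam2 I)) (at t)"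
proof -
  define f where "f t z z' = F (rot t z z') * \<Phi> z" for t and z z' :: "'a \<Rightarrow> real"
  define f' where "f' t z z' = (\<Sum>a\<in>I. (- sin t * z a + cos t * z' a) * F' a (rot t z z')) * \<Phi> z" for t and z z' :: "'a \<Rightarrow> real"
  have tf: "tame I f" unfolding f_def by (intro tame_mult tame_rot tame_fst F P)
  have tA: "tame I (\<lambda>t z z'. z a * (F' a (rot t z z') * \<Phi> z))"
    and tB: "tame I (\<lambda>t z z'. z' a * (F' a (rot t z z') * \<Phi> z))"
    and tD: "tame I (\<lambda>t z z'. F'' a a (rot t z z') * \<Phi> z)"
    and tE: "tame I (\<lambda>t z z'. F' a (rot t z z') * \<Phi>' a z)" if "a \<in> I" for a
    by (rule tame_mult[OF tame_var1[OF fin that] tame_mult[OF tame_rot[OF F(3)] tame_fst[OF P(1)]]],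
        rule tame_mult[OF tame_var2[OF fin that] tame_mult[OF tame_rot[OF F(3)] tame_fst[OF P(1)]]],
        rule tame_mult[OF tame_rot[OF F2(2)] tame_fst[OF P(1)]],
        rule tame_mult[OF tame_rot[OF F(3)] tame_fst[OF P(2)]])
  have f'_eq: "f' t z z' = (\<Sum>a\<in>I. (- sin t) * (z a * (F' a (rot t z z') * \<Phi> z)) + cos t * (z' a * (F' a (rot t z z') * \<Phi> z)))" for t z z'
    unfolding f'_def sum_distrib_right by (intro sum.cong refl) (simp add: algebra_simps)
  have tf': "tame I f'" unfolding f'_eq[abs_def]
  proof (intro tame_sum tame_add tame_mult[OF _ tA] tame_mult[OF _ tB])
    show "tame I (\<lambda>t z z'. - sin t)" using tame_mult[OF tame_const[of I "-1"] tame_sin] by simp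
  qed (auto intro: tame_cos)
  obtain a b where ab: "0 \<le> a" "0 \<le> b" "\<And>t z z'. \<bar>f' t z z'\<bar> \<le> a * exp (b * ((\<Sum>i\<in>I. \<bar>z i\<bar>) + (\<Sum>i\<in>I. \<bar>z' i\<bar>)))"
    using tame_bound[OF tf'] by blast
  have der: "((\<lambda>s. f s z z') has_real_derivative f' t z z') (at t)" for t z z'
  proof -
    have "((\<lambda>s. F (\<lambda>i. rot s z z' i)) has_real_derivative (\<Sum>i\<in>I. (- sin t * z i + cos t * z' i) * F' i (\<lambda>i. rot t z z' i))) (at t)"
      unfolding rot_def by (rule gradient_onD[OF F(2)]) (auto intro!: derivative_eq_intros)
    then show ?thesis unfolding f_def f'_def by (auto intro!: derivative_eq_intros)
  qed
  have D: "((\<lambda>t. \<integral>p. f t (fst p) (snd p) \<partial>gam2 I) has_real_derivative (\<integral>p. f' t (fst p) (snd p) \<partial>gam2 I)) (at t)"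
  proof (rule has_real_derivative_integral(2)[where \<delta>=1 and f="\<lambda>t p. f t (fst p) (snd p)" and f'="\<lambda>t p. f' t (fst p) (snd p)"
      and h="\<lambda>p. a * exp (b * ((\<Sum>i\<in>I. \<bar>fst p i\<bar>) + (\<Sum>i\<in>I. \<bar>snd p i\<bar>)))"])
    show "integrable (gam2 I) (\<lambda>p. a * exp (b * ((\<Sum>i\<in>I. \<bar>fst p i\<bar>) + (\<Sum>i\<in>I. \<bar>snd p i\<bar>))))"
      using integrable_gam2_exp[OF fin] by simp
    show "integrable (gam2 I) (\<lambda>p. f s (fst p) (snd p))" for s
      by (rule tame_integrable[OF fin tf])
  qed (use der ab(3) in auto)
  have A: "(\<integral>p. fst p a * (F' a (rot t (fst p) (snd p)) * \<Phi> (fst p)) \<partial>gam2 I) =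
     cos t * (\<integral>p. F'' a a (rot t (fst p) (snd p)) * \<Phi> (fst p) \<partial>gam2 I) + (\<integral>p. F' a (rot t (fst p) (snd p)) * \<Phi>' a (fst p) \<partial>gam2 I)"
    if a: "a \<in> I" for a
  proof -
    have rw: "rot t z z' = (\<lambda>i. sin t * z' i + cos t * z i)" for z z' :: "'a \<Rightarrow> real"
      by (simp add: rot_def add.commute)
    have n: "nice I (\<lambda>z. G (rot t z z'))" if "nice I G" for G z'
      unfolding rw by (rule nice_affine[OF fin that])
    have "(\<integral>z. z a * (F' a (rot t z z') * \<Phi> z) \<partial>gam I) = (\<integral>z. cos t * (F'' a a (rot t z z') * \<Phi> z) + F' a (rot t z z') * \<Phi>' a z \<partial>gam I)" for z'
    proof (rule gam_ibp[OF fin a])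
      show "nice I (\<lambda>z. F' a (rot t z z') * \<Phi> z)" by (rule nice_mult[OF n[OF F(3)] P(1)])
      show "nice I (\<lambda>z. cos t * (F'' a a (rot t z z') * \<Phi> z) + F' a (rot t z z') * \<Phi>' a z)"
        by (rule nice_add[OF nice_mult[OF nice_const nice_mult[OF n[OF F2(2)] P(1)]] nice_mult[OF n[OF F(3)] P(2)]])
      fix u :: "'a \<Rightarrow> real"
      have "((\<lambda>s. F' a (\<lambda>i. rot t (u(a := s)) z' i)) has_real_derivative
         (\<Sum>i\<in>I. (if i = a then cos t else 0) * F'' a i (\<lambda>i. rot t (u(a := u a)) z' i))) (at (u a))"
        by (rule gradient_onD[OF F2(1)]) (auto simp: rot_def intro!: derivative_eq_intros)
      then have "((\<lambda>s. F' a (rot t (u(a := s)) z')) has_real_derivative cos t * F'' a a (rot t u z')) (at (u a))"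
        using fin a by (simp add: if_distrib[of "\<lambda>c. c * _"] cong: if_cong)
      from DERIV_mult[OF this P(3)[OF a, of u]]
      show "((\<lambda>s. F' a (rot t (u(a := s)) z') * \<Phi> (u(a := s))) has_real_derivative
         cos t * (F'' a a (rot t u z') * \<Phi> u) + F' a (rot t u z') * \<Phi>' a u) (at (u a))"
        by (simp add: mult_ac)
    qed
    then have "(\<integral>p. fst p a * (F' a (rot t (fst p) (snd p)) * \<Phi> (fst p)) \<partial>gam2 I) =
       (\<integral>z'. (\<integral>z. cos t * (F'' a a (rot t z z') * \<Phi> z) + F' a (rot t z z') * \<Phi>' a z \<partial>gam I) \<partial>gam I)"
      using tame_fubini(2)[OF fin tA[OF a], of t] by simp
    also have "\<dots> = (\<integral>p. cos t * (F'' a a (rot t (fst p) (snd p)) * \<Phi> (fst p)) + F' a (rot t (fst p) (snd p)) * \<Phi>' a (fst p) \<partial>gam2 I)"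
      by (rule tame_fubini(2)[OF fin tame_add[OF tame_mult[OF tame_cos tD[OF a]] tE[OF a]], symmetric])
    also have "\<dots> = cos t * (\<integral>p. F'' a a (rot t (fst p) (snd p)) * \<Phi> (fst p) \<partial>gam2 I) + (\<integral>p. F' a (rot t (fst p) (snd p)) * \<Phi>' a (fst p) \<partial>gam2 I)"
      using tame_integrable[OF fin tD[OF a], of t] tame_integrable[OF fin tE[OF a], of t] by simp
    finally show ?thesis .
  qed
  have B: "(\<integral>p. snd p a * (F' a (rot t (fst p) (snd p)) * \<Phi> (fst p)) \<partial>gam2 I) =
     sin t * (\<integral>p. F'' a a (rot t (fst p) (snd p)) * \<Phi> (fst p) \<partial>gam2 I)"
    if a: "a \<in> I" for a
  proof -
    have n: "nice I (\<lambda>z'. G (rot t z z'))" if "nice I G" for G z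
      unfolding rot_def by (rule nice_affine[OF fin that])
    have "(\<integral>z'. z' a * (F' a (rot t z z') * \<Phi> z) \<partial>gam I) = (\<integral>z'. sin t * (F'' a a (rot t z z') * \<Phi> z) \<partial>gam I)" for z
    proof (rule gam_ibp[OF fin a])
      show "nice I (\<lambda>z'. F' a (rot t z z') * \<Phi> z)"
        by (rule nice_mult[OF n[OF F(3)] nice_const])
      show "nice I (\<lambda>z'. sin t * (F'' a a (rot t z z') * \<Phi> z))"
        by (rule nice_mult[OF nice_const nice_mult[OF n[OF F2(2)] nice_const]])
      fix u :: "'a \<Rightarrow> real"
      have "((\<lambda>s. F' a (\<lambda>i. rot t z (u(a := s)) i)) has_real_derivative
         (\<Sum>i\<in>I. (if i = a then sin t else 0) * F'' a i (\<lambda>i. rot t z (u(a := u a)) i))) (at (u a))"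
        by (rule gradient_onD[OF F2(1)]) (auto simp: rot_def intro!: derivative_eq_intros)
      then have "((\<lambda>s. F' a (rot t z (u(a := s)))) has_real_derivative sin t * F'' a a (rot t z u)) (at (u a))"
        using fin a by (simp add: if_distrib[of "\<lambda>c. c * _"] cong: if_cong)
      from DERIV_cmult_right[OF this, of "\<Phi> z"]
      show "((\<lambda>s. F' a (rot t z (u(a := s))) * \<Phi> z) has_real_derivative
         sin t * (F'' a a (rot t z u) * \<Phi> z)) (at (u a))"
        by (simp add: mult_ac)
    qed
    then have "(\<integral>p. snd p a * (F' a (rot t (fst p) (snd p)) * \<Phi> (fst p)) \<partial>gam2 I) =
       (\<integral>z. (\<integral>z'. sin t * (F'' a a (rot t z z') * \<Phi> z) \<partial>gam I) \<partial>gam I)"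
      using tame_fubini(1)[OF fin tB[OF a], of t] by simp
    also have "\<dots> = (\<integral>p. sin t * (F'' a a (rot t (fst p) (snd p)) * \<Phi> (fst p)) \<partial>gam2 I)"
      by (rule tame_fubini(1)[OF fin tame_mult[OF tame_sin tD[OF a]], symmetric])
    finally show ?thesis by simp
  qed
  have "(\<integral>p. f' t (fst p) (snd p) \<partial>gam2 I) = (\<Sum>a\<in>I. \<integral>p. ((- sin t) * (fst p a * (F' a (rot t (fst p) (snd p)) * \<Phi> (fst p))) +
      cos t * (snd p a * (F' a (rot t (fst p) (snd p)) * \<Phi> (fst p)))) \<partial>gam2 I)"
    unfolding f'_eq
    using tame_integrable[OF fin tA, of _ t] tame_integrable[OF fin tB, of _ t]
    by (intro integral_sum integrable_add integrable_mult_right) auto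
  also have "\<dots> = (\<Sum>a\<in>I. (- sin t) * (\<integral>p. F' a (rot t (fst p) (snd p)) * \<Phi>' a (fst p) \<partial>gam2 I))"
  proof (rule sum.cong[OF refl])
    fix a assume a: "a \<in> I"
    have "(\<integral>p. ((- sin t) * (fst p a * (F' a (rot t (fst p) (snd p)) * \<Phi> (fst p))) +
      cos t * (snd p a * (F' a (rot t (fst p) (snd p)) * \<Phi> (fst p)))) \<partial>gam2 I) =
      (- sin t) * (\<integral>p. fst p a * (F' a (rot t (fst p) (snd p)) * \<Phi> (fst p)) \<partial>gam2 I) +
      cos t * (\<integral>p. snd p a * (F' a (rot t (fst p) (snd p)) * \<Phi> (fst p)) \<partial>gam2 I)"
      using tame_integrable[OF fin tA[OF a], of t] tame_integrable[OF fin tB[OF a], of t]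
      by (subst integral_add) simp_all
    also have "\<dots> = (- sin t) * (\<integral>p. F' a (rot t (fst p) (snd p)) * \<Phi>' a (fst p) \<partial>gam2 I)"
      unfolding A[OF a] B[OF a] by (simp add: algebra_simps)
    finally show "(\<integral>p. ((- sin t) * (fst p a * (F' a (rot t (fst p) (snd p)) * \<Phi> (fst p))) +
      cos t * (snd p a * (F' a (rot t (fst p) (snd p)) * \<Phi> (fst p)))) \<partial>gam2 I) =
      (- sin t) * (\<integral>p. F' a (rot t (fst p) (snd p)) * \<Phi>' a (fst p) \<partial>gam2 I)" .
  qed
  also have "\<dots> = - sin t * (\<integral>p. (\<Sum>a\<in>I. F' a (rot t (fst p) (snd p)) * \<Phi>' a (fst p)) \<partial>gam2 I)"
    using tame_integrable[OF fin tE, of _ t]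
    by (subst integral_sum) (auto simp: sum_distrib_left)
  finally show ?thesis using D unfolding f_def by simp
qed

text \<open>With the constant function 1 as second factor the covariance derivative vanishes, so the
  mean is the same at every angle and can be read off at angle 0.\<close>

lemma integral_rot_pol:
  assumes fin: "finite I" and F: "pol I q F"
  shows "(\<integral>p. F (rot t (fst p) (snd p)) \<partial>gam2 I) = (\<integral>z. F z \<partial>gam I)"
proof -
  obtain F' where F': "\<And>a. pol I q (F' a)" "gradient_on I F F'" using pol_gradient[OF fin F] by blast
  have "\<forall>a. \<exists>F''. (\<forall>b. pol I q (F'' b)) \<and> gradient_on I (F' a) F''" using pol_gradient[OF fin F'(1)] by blast
  then obtain F'' where F'': "\<And>a b. pol I q (F'' a b)" "\<And>a. gradient_on I (F' a) (F'' a)" by metis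
  have n: "nice I F" "\<And>a. nice I (F' a)" "\<And>a b. nice I (F'' a b)"
    using F F' F'' fin by (auto intro: pol_nice)
  have "((\<lambda>t. \<integral>p. F (rot t (fst p) (snd p)) * 1 \<partial>gam2 I) has_real_derivative
     - sin t * (\<integral>p. (\<Sum>a\<in>I. F' a (rot t (fst p) (snd p)) * 0) \<partial>gam2 I)) (at t)" for t
    by (rule cov_deriv[OF fin n(1) F'(2) n(2) F''(2) n(3), where \<Phi>="\<lambda>_. 1" and \<Phi>'="\<lambda>_ _. 0"]) auto
  then have "(\<integral>p. F (rot t (fst p) (snd p)) \<partial>gam2 I) = (\<integral>p. F (rot 0 (fst p) (snd p)) \<partial>gam2 I)"
    by (intro DERIV_isconst_all) simp
  also have "\<dots> = (\<integral>p. F (fst p) \<partial>gam2 I)" by (simp add: rot_def)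
  also have "\<dots> = (\<integral>z. F z \<partial>gam I)"
    using tame_fubini(1)[OF fin tame_fst[OF n(1)]] prob_space.prob_space[OF prob_gam, of I] by simp
  finally show ?thesis .
qed

section \<open>The probability space and the integrated form of the covariance identity\<close>

definition sin_measure :: "real measure" where
  "sin_measure = density lborel (\<lambda>t. ennreal (indicator {0..pi/2} t * sin t))"

text \<open>The weight sin t on [0, pi/2] has mass 1. Sampling the angle from it turns the angular
  integral into an expectation, so that a Stein kernel becomes a random variable on one probability
  space together with \<open>z\<close>.\<close>

definition cov_space :: "'i set \<Rightarrow> (real \<times> ('i \<Rightarrow> real) \<times> ('i \<Rightarrow> real)) measure" where
  "cov_space I = sin_measure \<Otimes>\<^sub>M gam2 I"

lemma sets_sin_measure: "sets sin_measure = sets borel"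
  by (simp add: sin_measure_def)

lemma prob_sin_measure: "prob_space sin_measure"
proof (rule prob_spaceI)
  have "emeasure sin_measure (space sin_measure) = (\<integral>\<^sup>+t. ennreal (indicator {0..pi/2} t * sin t) \<partial>lborel)"
    unfolding sin_measure_def by (subst emeasure_density) auto
  also have "\<dots> = (\<integral>\<^sup>+t. ennreal (sin t) * indicator {0..pi/2} t \<partial>lborel)"
    by (intro nn_integral_cong) (auto split: split_indicator)
  also have "\<dots> = ennreal (- cos (pi/2) - (- cos 0))"
    by (rule nn_integral_FTC_Icc) (auto intro!: derivative_eq_intros sin_ge_zero)
  finally show "emeasure sin_measure (space sin_measure) = 1" by simp
qed

lemma prob_cov_space: "prob_space (cov_space I)"
  unfolding cov_space_def by (intro prob_space_pair prob_sin_measure prob_gam2)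

lemma sets_cov_space: "sets (cov_space I) = sets (borel \<Otimes>\<^sub>M gam2 I)"
  unfolding cov_space_def by (intro sets_pair_measure_cong sets_sin_measure refl)

lemma tame_measurable_cov:
  "tame I f \<Longrightarrow> (\<lambda>p. f (fst p) (fst (snd p)) (snd (snd p))) \<in> borel_measurable (cov_space I)"
  using tame_measurable by (simp add: measurable_cong_sets[OF sets_cov_space refl])

lemma pair_sigma_finite_cov: "pair_sigma_finite sin_measure (gam2 I)"
proof -
  interpret A: prob_space sin_measure by (rule prob_sin_measure)
  interpret B: prob_space "gam2 I" by (rule prob_gam2)
  show ?thesis ..
qed

lemma distr_cov_snd: "distr (cov_space I) (gam2 I) snd = gam2 I"
proof -
  interpret A: prob_space sin_measure by (rule prob_sin_measure)
  interpret B: prob_space "gam2 I" by (rule prob_gam2)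
  interpret pair_sigma_finite sin_measure "gam2 I" ..
  interpret S: pair_sigma_finite "gam2 I" sin_measure ..
  have "distr (cov_space I) (gam2 I) snd = distr (distr (gam2 I \<Otimes>\<^sub>M sin_measure) (sin_measure \<Otimes>\<^sub>M gam2 I) (\<lambda>(x, y). (y, x))) (gam2 I) snd"
    unfolding cov_space_def using distr_pair_swap by simp
  also have "\<dots> = distr (gam2 I \<Otimes>\<^sub>M sin_measure) (gam2 I) (snd \<circ> (\<lambda>(x, y). (y, x)))"
    by (rule distr_distr) measurable
  also have "snd \<circ> (\<lambda>(x, y). (y, x)) = (fst :: _ \<times> real \<Rightarrow> _)" by auto
  also have "distr (gam2 I \<Otimes>\<^sub>M sin_measure) (gam2 I) fst = gam2 I" by (rule A.distr_pair_fst)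
  finally show ?thesis .
qed

lemma distr_cov_first: "distr (cov_space I) (gam I) (\<lambda>p. fst (snd p)) = gam I"
proof -
  have "distr (cov_space I) (gam I) (fst \<circ> snd) = distr (distr (cov_space I) (gam2 I) snd) (gam I) fst"
    by (rule distr_distr[symmetric]) (auto simp: gam2_def cov_space_def)
  also have "\<dots> = distr (gam2 I) (gam I) fst" by (simp only: distr_cov_snd)
  also have "\<dots> = gam I" unfolding gam2_def by (rule prob_space.distr_pair_fst[OF prob_gam])
  finally show ?thesis by (simp add: comp_def)
qed

lemma first_measurable: "(\<lambda>p. fst (snd p)) \<in> measurable (cov_space I) (gam I)"
  unfolding cov_space_def gam2_def by measurable

lemma integral_cov_first:
  fixes F :: "('i \<Rightarrow> real) \<Rightarrow> real"
  assumes "F \<in> borel_measurable (gam I)"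
  shows "(\<integral>p. F (fst (snd p)) \<partial>cov_space I) = (\<integral>z. F z \<partial>gam I)"
    and "integrable (cov_space I) (\<lambda>p. F (fst (snd p))) \<longleftrightarrow> integrable (gam I) F"
  using integral_distr[OF first_measurable assms] integrable_distr_eq[OF first_measurable assms]
  unfolding distr_cov_first by auto

lemma tame_integrable_cov:
  assumes fin: "finite I" and f: "tame I f"
  shows "integrable (cov_space I) (\<lambda>p. f (fst p) (fst (snd p)) (snd (snd p)))"
proof -
  obtain a b where F: "0 \<le> a" "0 \<le> b" "\<And>t z z'. \<bar>f t z z'\<bar> \<le> a * exp (b * ((\<Sum>i\<in>I. \<bar>z i\<bar>) + (\<Sum>i\<in>I. \<bar>z' i\<bar>)))"
    using tame_bound[OF f] by blast
  let ?h = "\<lambda>p. a * exp (b * ((\<Sum>i\<in>I. \<bar>fst p i\<bar>) + (\<Sum>i\<in>I. \<bar>snd p i\<bar>)))"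
  have h: "integrable (gam2 I) ?h" using integrable_gam2_exp[OF fin] by simp
  have "snd \<in> measurable (cov_space I) (gam2 I)" unfolding cov_space_def by measurable
  then have "integrable (cov_space I) (\<lambda>p. ?h (snd p))"
    by (rule integrable_distr) (unfold distr_cov_snd, rule h)
  then show ?thesis
  proof (rule integrable_bound)
    show "AE p in cov_space I. norm (f (fst p) (fst (snd p)) (snd (snd p))) \<le> norm (?h (snd p))"
      using F(1,3) by (simp add: abs_mult)
  qed (rule tame_measurable_cov[OF f])
qed

lemma cov_space_fubini:
  assumes fin: "finite I" and f: "tame I f"
  shows "(\<integral>p. f (fst p) (fst (snd p)) (snd (snd p)) \<partial>cov_space I) = (\<integral>t. (\<integral>p. f t (fst p) (snd p) \<partial>gam2 I) \<partial>sin_measure)"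
    and "integrable sin_measure (\<lambda>t. \<integral>p. f t (fst p) (snd p) \<partial>gam2 I)"
proof -
  interpret pair_sigma_finite sin_measure "gam2 I" by (rule pair_sigma_finite_cov)
  have i: "integrable (sin_measure \<Otimes>\<^sub>M gam2 I) (\<lambda>p. f (fst p) (fst (snd p)) (snd (snd p)))"
    using tame_integrable_cov[OF fin f] by (simp add: cov_space_def)
  show "(\<integral>p. f (fst p) (fst (snd p)) (snd (snd p)) \<partial>cov_space I) = (\<integral>t. (\<integral>p. f t (fst p) (snd p) \<partial>gam2 I) \<partial>sin_measure)"
    using integral_fst'[OF i] by (simp add: cov_space_def)
  show "integrable sin_measure (\<lambda>t. \<integral>p. f t (fst p) (snd p) \<partial>gam2 I)"
    using integrable_fst'[OF i] by simp
qed

text \<open>Integrate \<open>cov_deriv\<close> over the quarter circle: at angle 0 both factors see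
  the same \<open>z\<close>, at angle pi/2 they see independent copies.\<close>

lemma covariance_formula:
  assumes fin: "finite I"
    and F: "nice I F" "gradient_on I F F'" "\<And>a. nice I (F' a)"
    and F2: "\<And>a. gradient_on I (F' a) (F'' a)" "\<And>a b. nice I (F'' a b)"
    and P: "nice I \<Phi>" "\<And>a. nice I (\<Phi>' a)"
      "\<And>a u. a \<in> I \<Longrightarrow> ((\<lambda>t. \<Phi> (u(a := t))) has_real_derivative \<Phi>' a u) (at (u a))"
  shows "(\<integral>p. (\<Sum>a\<in>I. F' a (rot (fst p) (fst (snd p)) (snd (snd p))) * \<Phi>' a (fst (snd p))) \<partial>cov_space I) =
     (\<integral>z. F z * \<Phi> z \<partial>gam I) - (\<integral>z. F z \<partial>gam I) * (\<integral>z. \<Phi> z \<partial>gam I)"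
proof -
  define g where "g t z z' = (\<Sum>a\<in>I. F' a (rot t z z') * \<Phi>' a z)" for t and z z' :: "'a \<Rightarrow> real"
  have tg: "tame I g" unfolding g_def
    by (rule tame_sum, rule tame_mult[OF tame_rot[OF F(3)] tame_fst[OF P(2)]])
  define E where "E t = (\<integral>p. g t (fst p) (snd p) \<partial>gam2 I)" for t
  define C where "C t = (\<integral>p. F (rot t (fst p) (snd p)) * \<Phi> (fst p) \<partial>gam2 I)" for t
  have tC: "tame I (\<lambda>t z z'. F (rot t z z') * \<Phi> z)"
    by (rule tame_mult[OF tame_rot[OF F(1)] tame_fst[OF P(1)]])
  have pr: "measure (gam I) (space (gam I)) = 1" by (rule prob_space.prob_space[OF prob_gam])
  have C0: "C 0 = (\<integral>z. F z * \<Phi> z \<partial>gam I)"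
    unfolding C_def tame_fubini(1)[OF fin tC] using pr by (simp add: rot_def)
  have C1: "C (pi/2) = (\<integral>z. F z \<partial>gam I) * (\<integral>z. \<Phi> z \<partial>gam I)"
    unfolding C_def tame_fubini(1)[OF fin tC] by (simp add: rot_def)
  have dC: "(C has_real_derivative - sin t * E t) (at t)" for t
    unfolding C_def E_def g_def by (rule cov_deriv[OF fin F F2 P])
  have "(\<integral>p. g (fst p) (fst (snd p)) (snd (snd p)) \<partial>cov_space I) = (\<integral>t. E t \<partial>sin_measure)"
    unfolding E_def by (rule cov_space_fubini(1)[OF fin tg])
  have iE: "integrable sin_measure E" unfolding E_def by (rule cov_space_fubini(2)[OF fin tg])
  then have [measurable]: "E \<in> borel_measurable borel"
    using borel_measurable_integrable[OF iE] by (simp add: measurable_cong_sets[OF sets_sin_measure refl])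
  have nn: "AE t in lborel. 0 \<le> indicator {0..pi/2} t * sin t"
  proof (rule AE_I2)
    show "0 \<le> indicator {0..pi/2} t * sin t" for t
      using sin_ge_zero[of t] pi_ge_zero by (cases "t \<in> {0..pi/2}") auto
  qed
  have iL: "integrable lborel (\<lambda>t. (indicator {0..pi/2} t * sin t) * E t)"
    using iE unfolding sin_measure_def by (subst (asm) integrable_density) (use nn in auto)
  then have sI: "set_integrable lborel {0..pi/2} (\<lambda>t. sin t * E t)"
    by (simp add: set_integrable_def mult.assoc)
  have "(\<integral>t. E t \<partial>sin_measure) = (\<integral>t. (indicator {0..pi/2} t * sin t) * E t \<partial>lborel)"
    unfolding sin_measure_def by (subst integral_density) (use nn in auto)
  also have "\<dots> = (LINT t : {0..pi/2} | lborel. sin t * E t)"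
    by (simp add: set_lebesgue_integral_def mult.assoc)
  also have "\<dots> = integral {0..pi/2} (\<lambda>t. sin t * E t)"
    by (rule set_borel_integral_eq_integral(2)[OF sI])
  also have "\<dots> = - C (pi/2) - (- C 0)"
  proof (rule integral_unique, rule fundamental_theorem_of_calculus)
    fix t assume "t \<in> {0..pi/2}"
    have "((\<lambda>t. - C t) has_real_derivative sin t * E t) (at t within {0..pi/2})"
      using DERIV_minus[OF dC[of t]] by (auto intro: has_field_derivative_at_within)
    then show "((\<lambda>t. - C t) has_vector_derivative sin t * E t) (at t within {0..pi/2})"
      by (simp add: has_real_derivative_iff_has_vector_derivative)
  qed simp
  finally show ?thesis
    using C0 C1 \<open>(\<integral>p. g (fst p) (fst (snd p)) (snd (snd p)) \<partial>cov_space I) = (\<integral>t. E t \<partial>sin_measure)\<close>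
    by (simp add: g_def)
qed

section \<open>Stein kernels of Gaussian polynomials\<close>

text \<open>Quadratic growth of the derivative is what the cubic test function in
  \<open>kurtosis_gt_one\<close> requires; the test functions of the interpolation grow more
  slowly.\<close>

definition stein_test :: "(real \<Rightarrow> real) \<Rightarrow> (real \<Rightarrow> real) \<Rightarrow> bool" where
  "stein_test \<phi> \<phi>' \<longleftrightarrow> (\<forall>x. (\<phi> has_real_derivative \<phi>' x) (at x)) \<and> (\<exists>c. \<forall>x. \<bar>\<phi>' x\<bar> \<le> c * (1 + x\<^sup>2))"

text \<open>\<open>T\<close> and \<open>S\<close> are Stein kernels for the variables \<open>Y\<close> and \<open>Y\<^sup>2 - 1\<close>, as random
  variables on a space that may be larger than the one generated by \<open>Y\<close>.\<close>

definition stein_pair :: "'a measure \<Rightarrow> ('a \<Rightarrow> real) \<Rightarrow> ('a \<Rightarrow> real) \<Rightarrow> ('a \<Rightarrow> real) \<Rightarrow> real \<Rightarrow> bool" where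
  "stein_pair \<Omega> Y T S B \<longleftrightarrow> prob_space \<Omega> \<and>
     Y \<in> borel_measurable \<Omega> \<and> T \<in> borel_measurable \<Omega> \<and> S \<in> borel_measurable \<Omega> \<and>
     integrable \<Omega> (\<lambda>x. Y x ^ 8) \<and> (\<integral>x. Y x ^ 8 \<partial>\<Omega>) \<le> B \<and>
     (\<integral>x. Y x \<partial>\<Omega>) = 0 \<and> (\<integral>x. (Y x)\<^sup>2 \<partial>\<Omega>) = 1 \<and>
     (\<forall>R \<in> {T, \<lambda>x. T x * Y x, S, \<lambda>x. S x * Y x}. integrable \<Omega> (\<lambda>x. (R x)\<^sup>2) \<and> (\<integral>x. (R x)\<^sup>2 \<partial>\<Omega>) \<le> B) \<and>
     (\<forall>\<phi> \<phi>'. stein_test \<phi> \<phi>' \<longrightarrow>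
        (\<integral>x. Y x * \<phi> (Y x) \<partial>\<Omega>) = (\<integral>x. T x * \<phi>' (Y x) \<partial>\<Omega>) \<and>
        (\<integral>x. ((Y x)\<^sup>2 - 1) * \<phi> (Y x) \<partial>\<Omega>) = (\<integral>x. S x * \<phi>' (Y x) \<partial>\<Omega>))"

lemma borel_measurable_derivative:
  fixes \<phi> \<phi>' :: "real \<Rightarrow> real"
  assumes "\<And>x. (\<phi> has_real_derivative \<phi>' x) (at x)"
  shows "\<phi> \<in> borel_measurable borel" "\<phi>' \<in> borel_measurable borel"
proof -
  show [measurable]: "\<phi> \<in> borel_measurable borel"
    by (intro borel_measurable_continuous_onI continuous_at_imp_continuous_on ballI DERIV_isCont[OF assms])
  show "\<phi>' \<in> borel_measurable borel"
  proof (rule borel_measurable_LIMSEQ_real)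
    fix x :: real
    have "(\<lambda>h. (\<phi> (x + h) - \<phi> x) / h) \<midarrow>0\<rightarrow> \<phi>' x" using assms by (simp add: DERIV_def)
    moreover have "filterlim (\<lambda>n. 1 / real (Suc n)) (at 0) sequentially"
      unfolding filterlim_at using lim_1_over_n[THEN LIMSEQ_Suc] by auto
    ultimately show "(\<lambda>n. (\<phi> (x + 1 / real (Suc n)) - \<phi> x) / (1 / real (Suc n))) \<longlonglongrightarrow> \<phi>' x"
      by (rule filterlim_compose)
  qed measurable
qed

lemma nice_dominated:
  assumes "nice I G" "f \<in> borel_measurable (borels UNIV)"
    "\<And>u v. (\<And>i. i \<in> I \<Longrightarrow> u i = v i) \<Longrightarrow> f u = f v" "\<And>u. \<bar>f u\<bar> \<le> G u"
  shows "nice I f"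
proof -
  obtain a b where ab: "0 \<le> a" "0 \<le> b" "\<And>u. \<bar>G u\<bar> \<le> a * exp (b * (\<Sum>i\<in>I. \<bar>u i\<bar>))"
    using nice_bound[OF assms(1)] by blast
  have "\<bar>f u\<bar> \<le> a * exp (b * (\<Sum>i\<in>I. \<bar>u i\<bar>))" for u
    using assms(4)[of u] ab(3)[of u] by linarith
  from this assms(3,2) ab(1,2) show ?thesis by (rule nice_auxI)
qed

lemma nice_compose:
  assumes P: "nice I P" and m: "g \<in> borel_measurable borel" and b: "\<And>x. \<bar>g x\<bar> \<le> c * (1 + x\<^sup>2)\<^sup>2"
  shows "nice I (\<lambda>u. g (P u))"
proof (rule nice_dominated[where G="\<lambda>u. c * (1 + (P u)\<^sup>2)\<^sup>2"])
  show "nice I (\<lambda>u. c * (1 + (P u)\<^sup>2)\<^sup>2)" by (intro nice_mult nice_const nice_power nice_add P)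
  show "(\<lambda>u. g (P u)) \<in> borel_measurable (borels UNIV)"
    by (rule measurable_compose[OF nice_borel[OF P] m])
  show "g (P u) = g (P v)" if "\<And>i. i \<in> I \<Longrightarrow> u i = v i" for u v
    using nice_cong[OF P that] by simp
qed (rule b)

lemma stein_test_derivative: "stein_test \<phi> \<phi>' \<Longrightarrow> (\<phi> has_real_derivative \<phi>' x) (at x)"
  unfolding stein_test_def by blast

lemma stein_test_growth:
  assumes "stein_test \<phi> \<phi>'"
  obtains c where "0 \<le> c" "\<And>x. \<bar>\<phi> x\<bar> \<le> c * (1 + x\<^sup>2)\<^sup>2" "\<And>x. \<bar>\<phi>' x\<bar> \<le> c * (1 + x\<^sup>2)\<^sup>2"
proof -
  obtain c where d: "\<And>x. (\<phi> has_real_derivative \<phi>' x) (at x)" and c: "\<And>x. \<bar>\<phi>' x\<bar> \<le> c * (1 + x\<^sup>2)"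
    using assms unfolding stein_test_def by blast
  have c0: "0 \<le> c" using c[of 0] by simp
  have sq: "1 \<le> 1 + x\<^sup>2" "1 + x\<^sup>2 \<le> (1 + x\<^sup>2)\<^sup>2" for x :: real
    by (auto simp: power2_eq_square intro!: mult_le_cancel_left1[THEN iffD2])
  have \<phi>: "\<bar>\<phi> x\<bar> \<le> (\<bar>\<phi> 0\<bar> + c) * (1 + x\<^sup>2)\<^sup>2" for x
  proof -
    have "norm (\<phi> x - \<phi> 0) \<le> (c * (1 + x\<^sup>2)) * norm (x - 0)"
    proof (rule field_differentiable_bound[where S="{-\<bar>x\<bar>..\<bar>x\<bar>}" and f'=\<phi>'])
      fix z assume z: "z \<in> {-\<bar>x\<bar>..\<bar>x\<bar>}"
      show "(\<phi> has_real_derivative \<phi>' z) (at z within {-\<bar>x\<bar>..\<bar>x\<bar>})"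
        by (rule has_field_derivative_at_within[OF d])
      have "z\<^sup>2 \<le> x\<^sup>2" using z by (intro abs_le_square_iff[THEN iffD1]) auto
      then have "c * (1 + z\<^sup>2) \<le> c * (1 + x\<^sup>2)" using c0 by (intro mult_left_mono) auto
      with c[of z] show "norm (\<phi>' z) \<le> c * (1 + x\<^sup>2)" by simp
    qed auto
    then have "\<bar>\<phi> x\<bar> \<le> \<bar>\<phi> 0\<bar> + c * (1 + x\<^sup>2) * \<bar>x\<bar>" by simp
    also have "\<bar>x\<bar> \<le> 1 + x\<^sup>2"
    proof -
      have "0 \<le> (\<bar>x\<bar> - 1)\<^sup>2" by simp
      then show ?thesis by (simp add: power2_diff)
    qed
    then have "c * (1 + x\<^sup>2) * \<bar>x\<bar> \<le> c * (1 + x\<^sup>2) * (1 + x\<^sup>2)" using c0 by (intro mult_left_mono) auto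
    also have "\<dots> = c * (1 + x\<^sup>2)\<^sup>2" by (simp add: power2_eq_square)
    also have "\<bar>\<phi> 0\<bar> \<le> \<bar>\<phi> 0\<bar> * (1 + x\<^sup>2)\<^sup>2" using sq[of x] by (simp add: mult_le_cancel_left1)
    finally show ?thesis by (simp add: distrib_right)
  qed
  show thesis
  proof (rule that[of "\<bar>\<phi> 0\<bar> + c"])
    show "\<bar>\<phi>' x\<bar> \<le> (\<bar>\<phi> 0\<bar> + c) * (1 + x\<^sup>2)\<^sup>2" for x
    proof -
      have "c * (1 + x\<^sup>2) \<le> (\<bar>\<phi> 0\<bar> + c) * (1 + x\<^sup>2)\<^sup>2" using sq[of x] c0 by (intro mult_mono) auto
      with c[of x] show ?thesis by linarith
    qed
  qed (use c0 \<phi> in auto)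
qed

lemma stein_test_nice:
  assumes "stein_test \<phi> \<phi>'" "nice I P"
  shows "nice I (\<lambda>u. \<phi> (P u))" "nice I (\<lambda>u. \<phi>' (P u))"
proof -
  obtain c where c: "\<And>x. \<bar>\<phi> x\<bar> \<le> c * (1 + x\<^sup>2)\<^sup>2" "\<And>x. \<bar>\<phi>' x\<bar> \<le> c * (1 + x\<^sup>2)\<^sup>2"
    using stein_test_growth[OF assms(1)] by blast
  note m = borel_measurable_derivative[OF stein_test_derivative[OF assms(1)]]
  show "nice I (\<lambda>u. \<phi> (P u))" by (rule nice_compose[OF assms(2) m(1) c(1)])
  show "nice I (\<lambda>u. \<phi>' (P u))" by (rule nice_compose[OF assms(2) m(2) c(2)])
qed

text \<open>In the covariance formula for \<open>F\<close> and the composition of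
  \<open>\<phi>\<close> with \<open>P\<close>, the chain rule releases the factor
  \<open>\<phi>' (P z)\<close> from the gradient sum. What remains is the kernel. The choices
  \<open>F = P\<close> and \<open>F = P^2\<close> yield \<open>T\<close> and
  \<open>S\<close>.\<close>

lemma kernel_identity:
  assumes fin: "finite I" and F: "pol I r F" "gradient_on I F F'" "\<And>a. pol I r (F' a)"
    and P: "pol I q P" "gradient_on I P P'" "\<And>a. pol I q (P' a)" and test: "stein_test \<phi> \<phi>'"
  shows "(\<integral>z. F z * \<phi> (P z) \<partial>gam I) - (\<integral>z. F z \<partial>gam I) * (\<integral>z. \<phi> (P z) \<partial>gam I) =
    (\<integral>p. (\<Sum>a\<in>I. F' a (rot (fst p) (fst (snd p)) (snd (snd p))) * P' a (fst (snd p))) * \<phi>' (P (fst (snd p))) \<partial>cov_space I)"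
proof -
  have "\<forall>a. \<exists>F''. (\<forall>b. pol I r (F'' b)) \<and> gradient_on I (F' a) F''" using pol_gradient[OF fin F(3)] by blast
  then obtain F'' where F'': "\<And>a b. pol I r (F'' a b)" "\<And>a. gradient_on I (F' a) (F'' a)" by metis
  note d = stein_test_derivative[OF test]
  have nP: "nice I P" "\<And>a. nice I (P' a)" using P fin by (auto intro: pol_nice)
  have "(\<integral>p. (\<Sum>a\<in>I. F' a (rot (fst p) (fst (snd p)) (snd (snd p))) * (\<phi>' (P (fst (snd p))) * P' a (fst (snd p)))) \<partial>cov_space I) =
     (\<integral>z. F z * \<phi> (P z) \<partial>gam I) - (\<integral>z. F z \<partial>gam I) * (\<integral>z. \<phi> (P z) \<partial>gam I)"
  proof (rule covariance_formula[OF fin pol_nice[OF F(1) fin] F(2) pol_nice[OF F(3) fin] F''(2) pol_nice[OF F''(1) fin]])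
    show "nice I (\<lambda>z. \<phi> (P z))" by (rule stein_test_nice(1)[OF test nP(1)])
    show "nice I (\<lambda>z. \<phi>' (P z) * P' a z)" for a by (rule nice_mult[OF stein_test_nice(2)[OF test nP(1)] nP(2)])
    fix a u assume a: "a \<in> I"
    have "(\<phi> has_real_derivative \<phi>' (P (u(a := u a)))) (at (P (u(a := u a))))" by (rule d)
    from DERIV_chain2[OF this gradient_on_partial[OF fin a P(2)]]
    show "((\<lambda>t. \<phi> (P (u(a := t)))) has_real_derivative \<phi>' (P u) * P' a u) (at (u a))" by simp
  qed
  then show ?thesis by (simp add: sum_distrib_right sum_distrib_left mult_ac)
qed

text \<open>Cauchy-Schwarz splits the integral into two eighth moments. The right-hand side is
  quadratic in the second moment of \<open>P\<close>, so that its square roots can be summed over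
  coordinates below.\<close>

lemma gam2_moment8_bound:
  assumes fin: "finite I" and e: "pol I q e" "(\<integral>z. (e z)\<^sup>2 \<partial>gam I) \<le> 1" and P: "pol I q P"
    and K: "1 \<le> K" "\<And>P. pol I q P \<Longrightarrow> (\<integral>z. P z ^ 8 \<partial>gam I) \<le> K * (\<integral>z. (P z)\<^sup>2 \<partial>gam I) ^ 4"
  shows "(\<integral>z. ((e z)\<^sup>2 * (P z)\<^sup>2)\<^sup>2 \<partial>gam I) \<le> K * (\<integral>z. (P z)\<^sup>2 \<partial>gam I)\<^sup>2"
proof -
  have n: "nice I e" "nice I P" using assms by (auto intro: pol_nice)
  have i8: "integrable (gam I) (\<lambda>z. (Q z ^ 4)\<^sup>2)" if "nice I Q" for Q :: "('a \<Rightarrow> real) \<Rightarrow> real"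
    by (intro nice_integrable[OF fin] nice_power that)
  have m: "(\<lambda>z. Q z ^ 4) \<in> borel_measurable (gam I)" if "nice I Q" for Q :: "('a \<Rightarrow> real) \<Rightarrow> real"
    by (rule nice_measurable_gam[OF nice_power[OF that]])
  define p where "p = (\<integral>z. (P z)\<^sup>2 \<partial>gam I)"
  have "(\<integral>z. e z ^ 4 * P z ^ 4 \<partial>gam I) \<le> sqrt K * (sqrt K * p\<^sup>2)"
  proof (rule Cauchy_Schwarz_bound[OF m[OF n(1)] m[OF n(2)] i8[OF n(1)] i8[OF n(2)]])
    have "(\<integral>z. e z ^ 8 \<partial>gam I) \<le> K * (\<integral>z. (e z)\<^sup>2 \<partial>gam I) ^ 4" by (rule K(2)[OF e(1)])
    also have "\<dots> \<le> K * 1" using e(2) K(1) by (intro mult_left_mono power_le_one) auto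
    finally show "(\<integral>z. (e z ^ 4)\<^sup>2 \<partial>gam I) \<le> (sqrt K)\<^sup>2" using K(1) by simp
    show "(\<integral>z. (P z ^ 4)\<^sup>2 \<partial>gam I) \<le> (sqrt K * p\<^sup>2)\<^sup>2"
      using K(2)[OF P] K(1) by (simp add: power_mult_distrib p_def)
  qed (use K(1) in auto)
  then show ?thesis using K(1) by (simp add: p_def power_mult_distrib flip: mult.assoc)
qed

text \<open>The factors \<open>e\<close> and \<open>e'\<close> are 1 or the polynomial itself, which
  covers \<open>T\<close>, \<open>T * Y\<close>, \<open>S\<close> and \<open>S * Y\<close> at once,
  up to a factor 2. Summand \<open>a\<close> has L^2 norm at most \<open>sqrt K\<close> times the
  second moment of \<open>P' a\<close>, and these moments sum to at most \<open>q\<close>; thus the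
  number of variables disappears.\<close>

lemma kernel_moment_bound:
  assumes fin: "finite I"
    and e: "pol I q e" "pol I q e'" "(\<integral>z. (e z)\<^sup>2 \<partial>gam I) \<le> 1" "(\<integral>z. (e' z)\<^sup>2 \<partial>gam I) \<le> 1"
    and P': "\<And>a. pol I q (P' a)" "(\<Sum>a\<in>I. \<integral>z. (P' a z)\<^sup>2 \<partial>gam I) \<le> real q"
    and K: "1 \<le> K" "\<And>P. pol I q P \<Longrightarrow> (\<integral>z. P z ^ 8 \<partial>gam I) \<le> K * (\<integral>z. (P z)\<^sup>2 \<partial>gam I) ^ 4"
  defines "R \<equiv> \<lambda>t z z'. (\<Sum>a\<in>I. (e (rot t z z') * P' a (rot t z z')) * (P' a z * e' z))"
  shows "tame I R"
    and "(\<integral>p. (R (fst p) (fst (snd p)) (snd (snd p)))\<^sup>2 \<partial>cov_space I) \<le> K * (real q)\<^sup>2"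
proof -
  have n: "nice I e" "nice I e'" "\<And>a. nice I (P' a)" using e P' fin by (auto intro: pol_nice)
  define U where "U a t z z' = (e (rot t z z') * P' a (rot t z z')) * (P' a z * e' z)" for a t and z z' :: "'a \<Rightarrow> real"
  define p where "p a = (\<integral>z. (P' a z)\<^sup>2 \<partial>gam I)" for a
  have p0: "0 \<le> p a" for a by (simp add: p_def)
  have tU: "tame I (U a)" for a unfolding U_def
    by (rule tame_mult[OF tame_mult[OF tame_rot[OF n(1)] tame_rot[OF n(3)]] tame_mult[OF tame_fst[OF n(3)] tame_fst[OF n(2)]]])
  show tR: "tame I R" unfolding R_def using tU unfolding U_def by (rule tame_sum)
  have U2: "(\<integral>p. (U a t (fst p) (snd p))\<^sup>2 \<partial>gam2 I) \<le> (sqrt K * p a)\<^sup>2" for a t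
  proof -
    let ?f = "\<lambda>z. (e z)\<^sup>2 * (P' a z)\<^sup>2" and ?g = "\<lambda>z. (e' z)\<^sup>2 * (P' a z)\<^sup>2"
    have t1: "tame I (\<lambda>t z z'. ?f (rot t z z'))"
      by (rule tame_rot[OF nice_mult[OF nice_power[OF n(1)] nice_power[OF n(3)]]])
    have t2: "tame I (\<lambda>t z z'. ?g z)"
      by (rule tame_fst[OF nice_mult[OF nice_power[OF n(2)] nice_power[OF n(3)]]])
    have polf: "pol I (2 * (2 * q + 2 * q)) (\<lambda>z. (?f z)\<^sup>2)"
      by (rule pol_power[OF pol_mult[OF pol_power[OF e(1)] pol_power[OF P'(1)]]])
    have "(\<integral>p. ?f (rot t (fst p) (snd p)) * ?g (fst p) \<partial>gam2 I) \<le> (sqrt K * p a) * (sqrt K * p a)"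
    proof (rule Cauchy_Schwarz_bound[OF tame_at_measurable[OF t1] tame_at_measurable[OF t2]
          tame_integrable[OF fin tame_power[OF t1]] tame_integrable[OF fin tame_power[OF t2]]])
      have "(\<integral>p. (?f (rot t (fst p) (snd p)))\<^sup>2 \<partial>gam2 I) = (\<integral>z. (?f z)\<^sup>2 \<partial>gam I)"
        by (rule integral_rot_pol[OF fin polf])
      also have "\<dots> \<le> K * (p a)\<^sup>2" unfolding p_def by (rule gam2_moment8_bound[OF fin e(1,3) P'(1) K])
      finally show "(\<integral>p. (?f (rot t (fst p) (snd p)))\<^sup>2 \<partial>gam2 I) \<le> (sqrt K * p a)\<^sup>2"
        using K(1) by (simp add: power_mult_distrib)
      have "(\<integral>p. (?g (fst p))\<^sup>2 \<partial>gam2 I) = (\<integral>z. (?g z)\<^sup>2 \<partial>gam I)"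
        unfolding tame_fubini(1)[OF fin tame_power[OF t2]]
        using prob_space.prob_space[OF prob_gam, of I] by simp
      also have "\<dots> \<le> K * (p a)\<^sup>2" unfolding p_def by (rule gam2_moment8_bound[OF fin e(2,4) P'(1) K])
      finally show "(\<integral>p. (?g (fst p))\<^sup>2 \<partial>gam2 I) \<le> (sqrt K * p a)\<^sup>2"
        using K(1) by (simp add: power_mult_distrib)
    qed (use p0 K(1) in auto)
    then show ?thesis by (simp add: U_def power_mult_distrib power2_eq_square mult_ac)
  qed
  have bd: "(\<integral>p. (R t (fst p) (snd p))\<^sup>2 \<partial>gam2 I) \<le> K * (real q)\<^sup>2" for t
  proof -
    have iU: "integrable (gam2 I) (\<lambda>p. U a t (fst p) (snd p) * U b t (fst p) (snd p))" for a b
      by (rule tame_integrable[OF fin tame_mult[OF tU tU]])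
    have "(\<integral>p. (R t (fst p) (snd p))\<^sup>2 \<partial>gam2 I) = (\<integral>p. (\<Sum>a\<in>I. \<Sum>b\<in>I. U a t (fst p) (snd p) * U b t (fst p) (snd p)) \<partial>gam2 I)"
      by (simp only: R_def U_def power2_eq_square sum_product)
    also have "\<dots> = (\<Sum>a\<in>I. \<Sum>b\<in>I. \<integral>p. U a t (fst p) (snd p) * U b t (fst p) (snd p) \<partial>gam2 I)"
      by (subst integral_sum, intro integrable_sum iU,
        intro sum.cong refl integral_sum iU)
    also have "\<dots> \<le> (\<Sum>a\<in>I. \<Sum>b\<in>I. (sqrt K * p a) * (sqrt K * p b))"
    proof (intro sum_mono)
      fix a b
      show "(\<integral>p. U a t (fst p) (snd p) * U b t (fst p) (snd p) \<partial>gam2 I) \<le> (sqrt K * p a) * (sqrt K * p b)"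
        by (rule Cauchy_Schwarz_bound[OF tame_at_measurable[OF tU] tame_at_measurable[OF tU]
          tame_integrable[OF fin tame_power[OF tU]] tame_integrable[OF fin tame_power[OF tU]] U2 U2])
          (use p0 K(1) in auto)
    qed
    also have "\<dots> = (sqrt K * (\<Sum>a\<in>I. p a))\<^sup>2"
      unfolding sum_distrib_left[of "sqrt K" p I] power2_eq_square sum_product by (rule refl)
    also have "\<dots> \<le> (sqrt K * real q)\<^sup>2"
      using P'(2) p0 K(1) by (intro power_mono mult_left_mono mult_nonneg_nonneg sum_nonneg) (auto simp: p_def)
    also have "\<dots> = K * (real q)\<^sup>2" using K(1) by (simp add: power_mult_distrib)
    finally show ?thesis .
  qed
  interpret S: prob_space sin_measure by (rule prob_sin_measure)
  have "(\<integral>p. (R (fst p) (fst (snd p)) (snd (snd p)))\<^sup>2 \<partial>cov_space I) = (\<integral>t. (\<integral>p. (R t (fst p) (snd p))\<^sup>2 \<partial>gam2 I) \<partial>sin_measure)"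
    by (rule cov_space_fubini(1)[OF fin tame_power[OF tR]])
  also have "\<dots> \<le> (\<integral>t. K * (real q)\<^sup>2 \<partial>sin_measure)"
    by (rule integral_mono[OF cov_space_fubini(2)[OF fin tame_power[OF tR]] _ bd]) simp
  finally show "(\<integral>p. (R (fst p) (fst (snd p)) (snd (snd p)))\<^sup>2 \<partial>cov_space I) \<le> K * (real q)\<^sup>2"
    using S.prob_space by simp
qed

theorem stein_pair_exists:
  fixes q :: nat
  obtains B :: real where "1 \<le> B"
    "\<And>(I :: 'i set) P. finite I \<Longrightarrow> pol I q P \<Longrightarrow> (\<integral>z. P z \<partial>gam I) = 0 \<Longrightarrow> (\<integral>z. (P z)\<^sup>2 \<partial>gam I) = 1 \<Longrightarrow>
       \<exists>T S. stein_pair (cov_space I) (\<lambda>p. P (fst (snd p))) T S B"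
proof -
  obtain K where K: "1 \<le> K"
    "\<And>(I :: 'i set) P. finite I \<Longrightarrow> pol I q P \<Longrightarrow> (\<integral>z. P z ^ 8 \<partial>gam I) \<le> K * (\<integral>z. (P z)\<^sup>2 \<partial>gam I) ^ 4"
    using hypercontractive8[of q] by blast
  \<comment> \<open>\<open>K\<close> bounds the eighth moment of \<open>Y\<close> and
    \<open>K * q^2\<close> the kernels of \<open>Y\<close>; the 4 is the square of the factor 2 in
    the gradient of the square of \<open>P\<close>.\<close>
  define B where "B = K + 4 * (K * (real q)\<^sup>2)"
  have B: "1 \<le> B" "K \<le> B" "K * (real q)\<^sup>2 \<le> B" "4 * (K * (real q)\<^sup>2) \<le> B"
    using K(1) by (auto simp: B_def intro: add_increasing2 add_increasing)
  show thesis
  proof (rule that[OF B(1)])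
    fix I :: "'i set" and P
    assume fin: "finite I" and P: "pol I q P" and m0: "(\<integral>z. P z \<partial>gam I) = 0" and m1: "(\<integral>z. (P z)\<^sup>2 \<partial>gam I) = 1"
    obtain P' where P': "\<And>a. pol I q (P' a)" "gradient_on I P P'"
        "(\<Sum>a\<in>I. \<integral>z. (P' a z)\<^sup>2 \<partial>gam I) \<le> real q * (\<integral>z. (P z)\<^sup>2 \<partial>gam I)"
      using pol_gradient[OF fin P] by blast
    have P'q: "(\<Sum>a\<in>I. \<integral>z. (P' a z)\<^sup>2 \<partial>gam I) \<le> real q" using P'(3) m1 by simp
    have one: "pol I q (\<lambda>_. 1)" "(\<integral>z. (1::real)\<^sup>2 \<partial>gam I) \<le> 1"
      using prob_space.prob_space[OF prob_gam, of I] by (auto intro: pol.const)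
    have P1: "(\<integral>z. (P z)\<^sup>2 \<partial>gam I) \<le> 1" using m1 by simp
    define R where "R e e' p = (\<Sum>a\<in>I. (e (rot (fst p) (fst (snd p)) (snd (snd p))) * P' a (rot (fst p) (fst (snd p)) (snd (snd p)))) *
       (P' a (fst (snd p)) * e' (fst (snd p))))" for e e' :: "('i \<Rightarrow> real) \<Rightarrow> real" and p :: "real \<times> ('i \<Rightarrow> real) \<times> ('i \<Rightarrow> real)"
    have Rm: "R e e' \<in> borel_measurable (cov_space I)" "integrable (cov_space I) (\<lambda>p. (R e e' p)\<^sup>2)"
      "(\<integral>p. (R e e' p)\<^sup>2 \<partial>cov_space I) \<le> K * (real q)\<^sup>2"
      if "pol I q e" "pol I q e'" "(\<integral>z. (e z)\<^sup>2 \<partial>gam I) \<le> 1" "(\<integral>z. (e' z)\<^sup>2 \<partial>gam I) \<le> 1" for e e'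
    proof -
      have k8: "(\<integral>z. Q z ^ 8 \<partial>gam I) \<le> K * (\<integral>z. (Q z)\<^sup>2 \<partial>gam I) ^ 4" if "pol I q Q" for Q
        by (rule K(2)[OF fin that])
      let ?R = "\<lambda>t z z'. (\<Sum>a\<in>I. (e (rot t z z') * P' a (rot t z z')) * (P' a z * e' z))"
      have k1: "tame I ?R" by (rule kernel_moment_bound(1)[OF fin that P'(1) P'q K(1) k8])
      have k2: "(\<integral>p. (?R (fst p) (fst (snd p)) (snd (snd p)))\<^sup>2 \<partial>cov_space I) \<le> K * (real q)\<^sup>2"
        by (rule kernel_moment_bound(2)[OF fin that P'(1) P'q K(1) k8])
      have R: "R e e' = (\<lambda>p. ?R (fst p) (fst (snd p)) (snd (snd p)))" by (rule ext) (simp only: R_def)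
      show "R e e' \<in> borel_measurable (cov_space I)" unfolding R by (rule tame_measurable_cov[OF k1])
      show "integrable (cov_space I) (\<lambda>p. (R e e' p)\<^sup>2)"
        unfolding R by (rule tame_integrable_cov[OF fin tame_power[OF k1]])
      show "(\<integral>p. (R e e' p)\<^sup>2 \<partial>cov_space I) \<le> K * (real q)\<^sup>2" unfolding R by (rule k2)
    qed
    define Y where "Y = (\<lambda>p :: real \<times> ('i \<Rightarrow> real) \<times> ('i \<Rightarrow> real). P (fst (snd p)))"
    define T where "T = R (\<lambda>_. 1) (\<lambda>_. 1)"
    define S where "S = (\<lambda>p. 2 * R P (\<lambda>_. 1) p)"
    have mP: "P \<in> borel_measurable (gam I)" using P fin by (intro nice_measurable_gam[of I] pol_nice)
    have Ym: "Y \<in> borel_measurable (cov_space I)" unfolding Y_def by (rule measurable_compose[OF first_measurable mP])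
    have int: "(\<integral>p. g (Y p) \<partial>cov_space I) = (\<integral>z. g (P z) \<partial>gam I)"
      "integrable (cov_space I) (\<lambda>p. g (Y p)) \<longleftrightarrow> integrable (gam I) (\<lambda>z. g (P z))"
      if "g \<in> borel_measurable borel" for g :: "real \<Rightarrow> real"
      unfolding Y_def
      by (rule integral_cov_first(1)[OF measurable_compose[OF mP that]],
          rule integral_cov_first(2)[OF measurable_compose[OF mP that]])
    have TY: "T p * Y p = R (\<lambda>_. 1) P p" for p
      unfolding T_def Y_def R_def by (simp add: sum_distrib_right mult.assoc)
    have SY: "S p * Y p = 2 * R P P p" for p
      unfolding S_def Y_def R_def by (simp add: sum_distrib_right mult.assoc)
    have "stein_pair (cov_space I) Y T S B"
      unfolding stein_pair_def
    proof (intro conjI ballI allI impI)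
      show "prob_space (cov_space I)" by (rule prob_cov_space)
      show "Y \<in> borel_measurable (cov_space I)" by (rule Ym)
      show "T \<in> borel_measurable (cov_space I)" unfolding T_def by (rule Rm(1)[OF one(1) one(1) one(2) one(2)])
      show "S \<in> borel_measurable (cov_space I)" unfolding S_def
        by (intro borel_measurable_times borel_measurable_const Rm(1)[OF P one(1) P1 one(2)])
      show "integrable (cov_space I) (\<lambda>x. Y x ^ 8)"
        by (subst int(2)[of "\<lambda>x. x ^ 8"]) (auto intro!: pol_integrable[OF fin pol_power[OF P]])
      show "(\<integral>x. Y x ^ 8 \<partial>cov_space I) \<le> B"
        using K(2)[OF fin P] B(2) by (subst int(1)[of "\<lambda>x. x ^ 8"]) (auto simp: m1)
      show "(\<integral>x. Y x \<partial>cov_space I) = 0" using int(1)[of "\<lambda>x. x"] m0 by simp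
      show "(\<integral>x. (Y x)\<^sup>2 \<partial>cov_space I) = 1" using int(1)[of "\<lambda>x. x\<^sup>2"] m1 by simp
    next
      fix Q assume "Q \<in> {T, \<lambda>x. T x * Y x, S, \<lambda>x. S x * Y x}"
      then consider "Q = R (\<lambda>_. 1) (\<lambda>_. 1)" | "Q = R (\<lambda>_. 1) P" | "Q = (\<lambda>p. 2 * R P (\<lambda>_. 1) p)" | "Q = (\<lambda>p. 2 * R P P p)"
        by (auto simp: TY SY) (auto simp: T_def S_def)
      then have both: "integrable (cov_space I) (\<lambda>x. (Q x)\<^sup>2) \<and> (\<integral>x. (Q x)\<^sup>2 \<partial>cov_space I) \<le> B"
      proof cases
        case 1
        show ?thesis unfolding 1 using Rm(2,3)[OF one(1) one(1) one(2) one(2)] B(3) by linarith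
      next
        case 2
        show ?thesis unfolding 2 using Rm(2,3)[OF one(1) P one(2) P1] B(3) by linarith
      next
        case 3
        show ?thesis unfolding 3 power_mult_distrib using Rm(2,3)[OF P one(1) P1 one(2)] B(4) by simp
      next
        case 4
        show ?thesis unfolding 4 power_mult_distrib using Rm(2,3)[OF P P P1 P1] B(4) by simp
      qed
      show "integrable (cov_space I) (\<lambda>x. (Q x)\<^sup>2)" by (rule conjunct1[OF both])
      show "(\<integral>x. (Q x)\<^sup>2 \<partial>cov_space I) \<le> B" by (rule conjunct2[OF both])
    next
      fix \<phi> \<phi>' assume test: "stein_test \<phi> \<phi>'"
      note d = stein_test_derivative[OF test]
      note [measurable] = borel_measurable_derivative[OF d]
      have nP: "nice I P" by (rule pol_nice[OF P fin])
      have nphi: "nice I (\<lambda>z. \<phi> (P z))"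
        by (rule stein_test_nice(1)[OF test nP])
      have "(\<integral>x. Y x * \<phi> (Y x) \<partial>cov_space I) = (\<integral>z. P z * \<phi> (P z) \<partial>gam I)"
        by (rule int(1)[of "\<lambda>x. x * \<phi> x"]) measurable
      then show "(\<integral>x. Y x * \<phi> (Y x) \<partial>cov_space I) = (\<integral>x. T x * \<phi>' (Y x) \<partial>cov_space I)"
        using kernel_identity[OF fin P P'(2,1) P P'(2,1) test] by (simp add: m0 T_def R_def Y_def)
      have 1: "(\<integral>x. ((Y x)\<^sup>2 - 1) * \<phi> (Y x) \<partial>cov_space I) = (\<integral>z. ((P z)\<^sup>2 - 1) * \<phi> (P z) \<partial>gam I)"
        by (rule int(1)[of "\<lambda>x. (x\<^sup>2 - 1) * \<phi> x"]) measurable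
      have 2: "(\<integral>z. ((P z)\<^sup>2 - 1) * \<phi> (P z) \<partial>gam I) = (\<integral>z. (P z)\<^sup>2 * \<phi> (P z) \<partial>gam I) - 1 * (\<integral>z. \<phi> (P z) \<partial>gam I)"
        using nice_integrable[OF fin nphi] nice_integrable[OF fin nice_mult[OF nice_power[OF nP] nphi], of 2]
        by (simp add: left_diff_distrib)
      have g2: "gradient_on I (\<lambda>z. (P z)\<^sup>2) (\<lambda>a z. 2 * (P z * P' a z))"
        unfolding gradient_on_def
      proof (intro allI impI)
        fix y :: "'i \<Rightarrow> real \<Rightarrow> real" and y' t assume y: "\<forall>i\<in>I. (y i has_real_derivative y' i) (at t)"
        have "((\<lambda>t. P (\<lambda>i. y i t)) has_real_derivative (\<Sum>i\<in>I. y' i * P' i (\<lambda>i. y i t))) (at t)"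
          using y by (intro gradient_onD[OF P'(2)]) auto
        from DERIV_power[OF this, of 2]
        show "((\<lambda>t. (P (\<lambda>i. y i t))\<^sup>2) has_real_derivative (\<Sum>i\<in>I. y' i * (2 * (P (\<lambda>i. y i t) * P' i (\<lambda>i. y i t))))) (at t)"
          by (simp add: sum_distrib_left mult_ac)
      qed
      have p2: "pol I (2 * q) (\<lambda>z. (P z)\<^sup>2)" by (rule pol_power[OF P])
      have p2': "pol I (2 * q) (\<lambda>z. 2 * (P z * P' a z))" for a
        by (rule pol_mono[OF pol_cmult[OF pol_mult[OF P P'(1)]]]) simp
      have "(\<integral>z. (P z)\<^sup>2 * \<phi> (P z) \<partial>gam I) - 1 * (\<integral>z. \<phi> (P z) \<partial>gam I) = (\<integral>x. S x * \<phi>' (Y x) \<partial>cov_space I)"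
        using kernel_identity[OF fin p2 g2 p2' P P'(2,1) test]
        by (simp add: m1 S_def R_def Y_def sum_distrib_left mult.assoc)
      then show "(\<integral>x. ((Y x)\<^sup>2 - 1) * \<phi> (Y x) \<partial>cov_space I) = (\<integral>x. S x * \<phi>' (Y x) \<partial>cov_space I)"
        using 1 2 by simp
    qed
    then show "\<exists>T S. stein_pair (cov_space I) (\<lambda>p. P (fst (snd p))) T S B"
      unfolding Y_def by blast
  qed
qed

section \<open>Gaussian smoothing of Lipschitz functions\<close>

text \<open>The Lipschitz condition for the Euclidean norm of the coordinates in \<open>I\<close>.
  As \<open>u\<close> and \<open>v\<close> are arbitrary outside \<open>I\<close>, it also forces
  \<open>G\<close> to depend on these coordinates only.\<close>

definition lip_on :: "'i set \<Rightarrow> real \<Rightarrow> (('i \<Rightarrow> real) \<Rightarrow> real) \<Rightarrow> bool" where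
  "lip_on I L G \<longleftrightarrow> (\<forall>u v. \<bar>G u - G v\<bar> \<le> L * sqrt (\<Sum>c\<in>I. (u c - v c)\<^sup>2))"

lemma sqrt_sum_squares_le: "sqrt (\<Sum>c\<in>I. (x c)\<^sup>2) \<le> (\<Sum>c\<in>I. \<bar>x c\<bar>)"
  using L2_set_le_sum_abs[of x I] by (simp add: L2_set_def)

lemma lip_on_le_sum:
  assumes "lip_on I L G" "0 \<le> L"
  shows "\<bar>G u - G v\<bar> \<le> L * (\<Sum>c\<in>I. \<bar>u c - v c\<bar>)"
proof -
  have "\<bar>G u - G v\<bar> \<le> L * sqrt (\<Sum>c\<in>I. (u c - v c)\<^sup>2)" using assms(1) by (simp add: lip_on_def)
  also have "\<dots> \<le> L * (\<Sum>c\<in>I. \<bar>u c - v c\<bar>)" using assms(2) by (intro mult_left_mono sqrt_sum_squares_le)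
  finally show ?thesis .
qed

lemma nice_abs:
  assumes "nice I F" shows "nice I (\<lambda>u. \<bar>F u\<bar>)"
proof -
  obtain a b where ab: "0 \<le> a" "0 \<le> b" "\<And>u. \<bar>F u\<bar> \<le> a * exp (b * (\<Sum>i\<in>I. \<bar>u i\<bar>))"
    using nice_bound[OF assms] by blast
  show ?thesis
  proof (rule niceI[OF _ _ ab(1,2)])
    show "(\<lambda>u. \<bar>F u\<bar>) \<in> borel_measurable (borels UNIV)" using nice_borel[OF assms] by measurable
    show "\<bar>F u\<bar> = \<bar>F v\<bar>" if "\<And>i. i \<in> I \<Longrightarrow> u i = v i" for u v
      by (rule arg_cong[where f=abs], rule nice_cong[OF assms that])
    show "\<bar>\<bar>F u\<bar>\<bar> \<le> a * exp (b * (\<Sum>i\<in>I. \<bar>u i\<bar>))" for u using ab(3)[of u] by simp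
  qed
qed

lemma lip_on_nice:
  assumes fin: "finite I" and m: "G \<in> borel_measurable (borels UNIV)" and L: "lip_on I L G" "0 \<le> L"
  shows "nice I G"
proof (rule nice_dominated[where G="\<lambda>u. \<bar>G (\<lambda>_. 0)\<bar> + L * (\<Sum>c\<in>I. \<bar>u c\<bar>)", OF _ m])
  show "nice I (\<lambda>u. \<bar>G (\<lambda>_. 0)\<bar> + L * (\<Sum>c\<in>I. \<bar>u c\<bar>))"
    by (intro nice_add[OF nice_const nice_mult[OF nice_const nice_sum]] nice_abs nice_var fin)
  show "G u = G v" if "\<And>i. i \<in> I \<Longrightarrow> u i = v i" for u v
  proof -
    have "(\<Sum>c\<in>I. \<bar>u c - v c\<bar>) = 0" using that by (intro sum.neutral) simp
    then show ?thesis using lip_on_le_sum[OF L, of u v] by simp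
  qed
  show "\<bar>G u\<bar> \<le> \<bar>G (\<lambda>_. 0)\<bar> + L * (\<Sum>c\<in>I. \<bar>u c\<bar>)" for u
    using lip_on_le_sum[OF L, of u "\<lambda>_. 0"] by simp
qed

text \<open>Smoothing with an independent Gaussian vector of standard deviations \<open>s\<close>.\<close>

definition smooth :: "'i set \<Rightarrow> ('i \<Rightarrow> real) \<Rightarrow> (('i \<Rightarrow> real) \<Rightarrow> real) \<Rightarrow> ('i \<Rightarrow> real) \<Rightarrow> real" where
  "smooth I s G u = (\<integral>z. G (\<lambda>c. u c + s c * z c) \<partial>gam I)"

text \<open>The partial derivative of \<open>smooth\<close> in coordinate \<open>b\<close>, with the
  derivative placed on the Gaussian density instead of on \<open>G\<close>.\<close>

definition smooth_grad :: "'i set \<Rightarrow> ('i \<Rightarrow> real) \<Rightarrow> (('i \<Rightarrow> real) \<Rightarrow> real) \<Rightarrow> 'i \<Rightarrow> ('i \<Rightarrow> real) \<Rightarrow> real" where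
  "smooth_grad I s G b u = (\<integral>z. G (\<lambda>c. u c + s c * z c) * z b \<partial>gam I) / s b"

lemma smooth_curve:
  fixes y y' :: "'i \<Rightarrow> real \<Rightarrow> real"
  assumes fin: "finite I" and G: "nice I G" and s: "\<And>c. c \<in> I \<Longrightarrow> 0 < s c"
    and der: "\<And>c t. c \<in> I \<Longrightarrow> (y c has_real_derivative y' c t) (at t)"
    and cont: "\<And>c. c \<in> I \<Longrightarrow> isCont (y' c) t0"
  shows "((\<lambda>t. smooth I s G (\<lambda>c. y c t)) has_real_derivative
     (\<Sum>c\<in>I. y' c t0 * smooth_grad I s G c (\<lambda>c. y c t0))) (at t0)"
proof -
  \<comment> \<open>In the coordinates \<open>u c / s c\<close> the noise is standard; this
    rescaling is the origin of the division in \<open>smooth_grad\<close>.\<close>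
  let ?G = "\<lambda>u. G (\<lambda>c. 0 + s c * u c)"
  have nG: "nice I ?G" by (rule nice_affine[OF fin G])
  have eq: "?G (\<lambda>c. x c / s c + z c) = G (\<lambda>c. x c + s c * z c)" for x z
  proof (rule nice_cong[OF G])
    fix c assume "c \<in> I"
    with s[of c] show "0 + s c * (x c / s c + z c) = x c + s c * z c" by (simp add: distrib_left)
  qed
  have "((\<lambda>t. \<integral>z. ?G (\<lambda>i. (y i t / s i) + z i) \<partial>gam I) has_real_derivative
           (\<Sum>i\<in>I. (y' i t0 / s i) * (\<integral>z. ?G (\<lambda>i. (y i t0 / s i) + z i) * z i \<partial>gam I))) (at t0)"
  proof (rule has_derivative_gam_curve[where y="\<lambda>i t. y i t / s i" and y'="\<lambda>i t. y' i t / s i", OF fin nG])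
    fix i t assume i: "i \<in> I"
    show "((\<lambda>t. y i t / s i) has_real_derivative y' i t / s i) (at t)" by (rule DERIV_cdivide[OF der[OF i]])
  next
    fix i assume i: "i \<in> I"
    show "isCont (\<lambda>t. y' i t / s i) t0" using s[OF i] by (intro continuous_divide cont[OF i] continuous_const) auto
  qed
  then show ?thesis unfolding smooth_def smooth_grad_def eq by simp
qed

lemma smooth_measurable:
  assumes fin: "finite I" and G: "nice I G"
  shows "smooth I s G \<in> borel_measurable (borels UNIV)"
    and "smooth_grad I s G b \<in> borel_measurable (borels UNIV)"
proof -
  interpret prob_space "gam I" by (rule prob_gam)
  let ?P = "borels UNIV :: ('a \<Rightarrow> real) measure"
  have c1: "(\<lambda>p. fst p c) \<in> borel_measurable (?P \<Otimes>\<^sub>M gam I)" for c by measurable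
  have c2: "(\<lambda>p. snd p c) \<in> borel_measurable (?P \<Otimes>\<^sub>M gam I)" for c by measurable
  have m1: "(\<lambda>p. G (\<lambda>c. fst p c + s c * snd p c)) \<in> borel_measurable (?P \<Otimes>\<^sub>M gam I)"
    by (rule nice_measurable[OF G]) (intro borel_measurable_add borel_measurable_times borel_measurable_const c1 c2)
  have m2: "(\<lambda>p. G (\<lambda>c. fst p c + s c * snd p c) * snd p b) \<in> borel_measurable (?P \<Otimes>\<^sub>M gam I)"
    by (rule borel_measurable_times[OF m1 c2])
  have "(\<lambda>u. \<integral>z. G (\<lambda>c. u c + s c * z c) \<partial>gam I) \<in> borel_measurable ?P"
    using m1 by (intro borel_measurable_lebesgue_integral) (simp add: case_prod_beta')
  then show "smooth I s G \<in> borel_measurable ?P" unfolding smooth_def[abs_def] .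
  have "(\<lambda>u. \<integral>z. G (\<lambda>c. u c + s c * z c) * z b \<partial>gam I) \<in> borel_measurable ?P"
    using m2 by (intro borel_measurable_lebesgue_integral) (simp add: case_prod_beta')
  then show "smooth_grad I s G b \<in> borel_measurable ?P" unfolding smooth_grad_def[abs_def]
    by (intro borel_measurable_divide borel_measurable_const)
qed

lemma smooth_cong:
  assumes G: "nice I G" and uv: "\<And>c. c \<in> I \<Longrightarrow> u c = v c"
  shows "smooth I s G u = smooth I s G v" "smooth_grad I s G b u = smooth_grad I s G b v"
proof -
  have "G (\<lambda>c. u c + s c * z c) = G (\<lambda>c. v c + s c * z c)" for z
    by (rule nice_cong[OF G]) (simp add: uv)
  then show "smooth I s G u = smooth I s G v" "smooth_grad I s G b u = smooth_grad I s G b v"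
    by (simp_all add: smooth_def smooth_grad_def)
qed

lemma smooth_lip:
  assumes fin: "finite I" and G: "nice I G" and L: "lip_on I L G"
  shows "lip_on I L (smooth I s G)"
  unfolding lip_on_def
proof (intro allI)
  fix u v :: "'a \<Rightarrow> real"
  interpret prob_space "gam I" by (rule prob_gam)
  have i: "integrable (gam I) (\<lambda>z. G (\<lambda>c. w c + s c * z c))" for w
    by (rule nice_integrable[OF fin nice_affine[OF fin G]])
  have "\<bar>smooth I s G u - smooth I s G v\<bar> = \<bar>\<integral>z. G (\<lambda>c. u c + s c * z c) - G (\<lambda>c. v c + s c * z c) \<partial>gam I\<bar>"
    unfolding smooth_def using i by simp
  also have "\<dots> \<le> (\<integral>z. \<bar>G (\<lambda>c. u c + s c * z c) - G (\<lambda>c. v c + s c * z c)\<bar> \<partial>gam I)" by (rule integral_abs_bound)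
  also have "\<dots> \<le> (\<integral>z. L * sqrt (\<Sum>c\<in>I. (u c - v c)\<^sup>2) \<partial>gam I)"
  proof (rule integral_mono)
    fix z
    have "\<bar>G (\<lambda>c. u c + s c * z c) - G (\<lambda>c. v c + s c * z c)\<bar> \<le> L * sqrt (\<Sum>c\<in>I. ((u c + s c * z c) - (v c + s c * z c))\<^sup>2)"
      using L unfolding lip_on_def by (rule allE[where x="\<lambda>c. u c + s c * z c"]) (erule allE)
    then show "\<bar>G (\<lambda>c. u c + s c * z c) - G (\<lambda>c. v c + s c * z c)\<bar> \<le> L * sqrt (\<Sum>c\<in>I. (u c - v c)\<^sup>2)" by simp
  qed (use i in \<open>auto intro!: integrable_abs\<close>)
  also have "\<dots> = L * sqrt (\<Sum>c\<in>I. (u c - v c)\<^sup>2)" using prob_space by simp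
  finally show "\<bar>smooth I s G u - smooth I s G v\<bar> \<le> L * sqrt (\<Sum>c\<in>I. (u c - v c)\<^sup>2)" .
qed

text \<open>The loss grows with the dimension, which is harmless: \<open>e\<close> tends to 0 while
  \<open>I\<close> stays fixed.\<close>

lemma smooth_close:
  assumes fin: "finite I" and G: "nice I G" and L: "lip_on I L G" "0 \<le> L" and e: "0 \<le> e"
  shows "\<bar>smooth I (\<lambda>_. e) G u - G u\<bar> \<le> L * e * (\<integral>z. (\<Sum>c\<in>I. \<bar>z c\<bar>) \<partial>gam I)"
proof -
  interpret prob_space "gam I" by (rule prob_gam)
  have i: "integrable (gam I) (\<lambda>z. G (\<lambda>c. u c + e * z c))"
    by (rule nice_integrable[OF fin nice_affine[OF fin G]])
  have n: "integrable (gam I) (\<lambda>z. (\<Sum>c\<in>I. \<bar>z c\<bar>))"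
    by (intro nice_integrable[OF fin] nice_sum nice_abs nice_var fin)
  have "\<bar>smooth I (\<lambda>_. e) G u - G u\<bar> = \<bar>\<integral>z. G (\<lambda>c. u c + e * z c) - G u \<partial>gam I\<bar>"
    unfolding smooth_def using i prob_space by simp
  also have "\<dots> \<le> (\<integral>z. \<bar>G (\<lambda>c. u c + e * z c) - G u\<bar> \<partial>gam I)" by (rule integral_abs_bound)
  also have "\<dots> \<le> (\<integral>z. (L * e) * (\<Sum>c\<in>I. \<bar>z c\<bar>) \<partial>gam I)"
  proof (rule integral_mono)
    show "integrable (gam I) (\<lambda>z. (L * e) * (\<Sum>c\<in>I. \<bar>z c\<bar>))" using n by simp
    fix z
    have "\<bar>G (\<lambda>c. u c + e * z c) - G u\<bar> \<le> L * (\<Sum>c\<in>I. \<bar>(u c + e * z c) - u c\<bar>)"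
      by (rule lip_on_le_sum[OF L])
    also have "\<dots> = (L * e) * (\<Sum>c\<in>I. \<bar>z c\<bar>)" using e by (simp add: abs_mult sum_distrib_left mult.assoc)
    finally show "\<bar>G (\<lambda>c. u c + e * z c) - G u\<bar> \<le> (L * e) * (\<Sum>c\<in>I. \<bar>z c\<bar>)" .
  qed (use i in \<open>auto intro!: integrable_abs\<close>)
  finally show ?thesis by simp
qed

lemma DERIV_lipschitz_bound:
  assumes "(f has_real_derivative D) (at t0)" "\<And>t. \<bar>f t - f t0\<bar> \<le> C * \<bar>t - t0\<bar>"
  shows "\<bar>D\<bar> \<le> C"
proof -
  have "((\<lambda>t. \<bar>(f t - f t0) / (t - t0)\<bar>) \<longlongrightarrow> \<bar>D\<bar>) (at t0)"
    using assms(1) unfolding has_field_derivative_iff by (rule tendsto_rabs)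
  then show ?thesis
  proof (rule tendsto_upperbound)
    show "eventually (\<lambda>t. \<bar>(f t - f t0) / (t - t0)\<bar> \<le> C) (at t0)"
      unfolding eventually_at_filter
    proof (rule always_eventually, intro allI impI)
      fix t assume "t \<noteq> t0"
      with assms(2)[of t] show "\<bar>(f t - f t0) / (t - t0)\<bar> \<le> C" by (simp add: abs_divide divide_le_eq)
    qed
  qed simp
qed

text \<open>Differentiate along the gradient itself: the directional derivative is the squared norm
  \<open>N\<close>, the Lipschitz condition bounds it by \<open>L * sqrt N\<close>. Bounding the
  coordinates separately would lose a factor of the dimension.\<close>

lemma smooth_grad_norm:
  assumes fin: "finite I" and G: "nice I G" and L: "lip_on I L G" "0 \<le> L" and s: "\<And>c. c \<in> I \<Longrightarrow> 0 < s c"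
  shows "(\<Sum>b\<in>I. (smooth_grad I s G b u)\<^sup>2) \<le> L\<^sup>2"
proof -
  define g where "g b = smooth_grad I s G b u" for b
  define N where "N = (\<Sum>b\<in>I. (g b)\<^sup>2)"
  have N0: "0 \<le> N" unfolding N_def by (simp add: sum_nonneg)
  have "((\<lambda>t. smooth I s G (\<lambda>c. u c + t * g c)) has_real_derivative
     (\<Sum>c\<in>I. g c * smooth_grad I s G c (\<lambda>c. u c + 0 * g c))) (at 0)"
    by (rule smooth_curve[where y="\<lambda>c t. u c + t * g c" and y'="\<lambda>c t. g c", OF fin G s])
       (auto intro!: derivative_eq_intros)
  then have D: "((\<lambda>t. smooth I s G (\<lambda>c. u c + t * g c)) has_real_derivative N) (at 0)"
    by (simp add: N_def g_def power2_eq_square)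
  have "\<bar>N\<bar> \<le> L * sqrt N"
  proof (rule DERIV_lipschitz_bound[OF D])
    fix t :: real
    have "\<bar>smooth I s G (\<lambda>c. u c + t * g c) - smooth I s G (\<lambda>c. u c + 0 * g c)\<bar> \<le>
       L * sqrt (\<Sum>c\<in>I. ((u c + t * g c) - (u c + 0 * g c))\<^sup>2)"
      using smooth_lip[OF fin G L(1), of s] unfolding lip_on_def by blast
    also have "(\<Sum>c\<in>I. ((u c + t * g c) - (u c + 0 * g c))\<^sup>2) = t\<^sup>2 * N"
      by (simp add: N_def power_mult_distrib sum_distrib_left)
    finally show "\<bar>smooth I s G (\<lambda>c. u c + t * g c) - smooth I s G (\<lambda>c. u c + 0 * g c)\<bar> \<le> L * sqrt N * \<bar>t - 0\<bar>"
      by (simp add: real_sqrt_mult mult_ac)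
  qed
  then have "sqrt N * sqrt N \<le> L * sqrt N" using N0 by simp
  then have "sqrt N \<le> L"
  proof (cases "N = 0")
    case False
    then have "0 < sqrt N" using N0 by simp
    with \<open>sqrt N * sqrt N \<le> L * sqrt N\<close> show ?thesis by (rule mult_right_le_imp_le)
  qed (use L(2) in simp)
  then have "(sqrt N)\<^sup>2 \<le> L\<^sup>2" using N0 by (intro power_mono) auto
  then show ?thesis using N0 by (simp add: N_def g_def)
qed

lemma smooth_grad_bounded:
  assumes "finite I" "nice I G" "lip_on I L G" "0 \<le> L" "\<And>c. c \<in> I \<Longrightarrow> 0 < s c" "b \<in> I"
  shows "\<bar>smooth_grad I s G b u\<bar> \<le> L"
proof -
  have "(smooth_grad I s G b u)\<^sup>2 \<le> (\<Sum>b\<in>I. (smooth_grad I s G b u)\<^sup>2)"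
    using assms(1,6) by (intro member_le_sum) auto
  also have "\<dots> \<le> L\<^sup>2" by (rule smooth_grad_norm[OF assms(1-5)])
  finally show ?thesis using assms(4) by (metis abs_le_square_iff abs_of_nonneg)
qed

lemma nice_bounded:
  assumes "f \<in> borel_measurable (borels UNIV)"
    "\<And>u v. (\<And>i. i \<in> I \<Longrightarrow> u i = v i) \<Longrightarrow> f u = f v" "\<And>u. \<bar>f u\<bar> \<le> L"
  shows "nice I f"
  by (rule nice_dominated[OF nice_const assms])

lemma gam_second_moment:
  assumes fin: "finite I" and ab: "a \<in> I" "b \<in> I"
  shows "(\<integral>z. z a * z b \<partial>gam I) = (if a = b then 1 else 0)"
proof -
  have "(\<integral>z. z a * z b \<partial>gam I) = (\<integral>z. (if a = b then 1 else 0) \<partial>gam I)"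
  proof (rule gam_ibp[OF fin ab(1) nice_var[OF fin ab(2)] nice_const])
    show "((\<lambda>t. (u(a := t)) b) has_real_derivative (if a = b then 1 else 0)) (at (u a))" for u
      by (cases "a = b") auto
  qed
  then show ?thesis using prob_space.prob_space[OF prob_gam, of I] by simp
qed

lemma gam_linear_square:
  assumes fin: "finite I"
  shows "(\<integral>z. (\<Sum>c\<in>I. x c * z c)\<^sup>2 \<partial>gam I) = (\<Sum>c\<in>I. (x c)\<^sup>2)"
proof -
  have i: "integrable (gam I) (\<lambda>z. (x a * x b) * (z a * z b))" if "a \<in> I" "b \<in> I" for a b
    by (intro nice_integrable[OF fin] nice_mult[OF nice_const nice_mult] nice_var fin that)
  have "(\<integral>z. (\<Sum>c\<in>I. x c * z c)\<^sup>2 \<partial>gam I) = (\<integral>z. (\<Sum>a\<in>I. \<Sum>b\<in>I. (x a * x b) * (z a * z b)) \<partial>gam I)"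
    unfolding power2_eq_square sum_product by (intro integral_cong refl sum.cong) simp
  also have "\<dots> = (\<Sum>a\<in>I. \<Sum>b\<in>I. \<integral>z. (x a * x b) * (z a * z b) \<partial>gam I)"
    using i by (subst integral_sum, intro integrable_sum, blast,
        intro sum.cong refl integral_sum, blast)
  also have "\<dots> = (\<Sum>a\<in>I. \<Sum>b\<in>I. if a = b then (x a)\<^sup>2 else 0)"
    by (intro sum.cong refl) (simp add: gam_second_moment[OF fin] power2_eq_square)
  also have "\<dots> = (\<Sum>c\<in>I. (x c)\<^sup>2)" using fin by (intro sum.cong refl) simp
  finally show ?thesis .
qed

text \<open>Bias and variance: the \<open>d\<close> diagonal terms contribute \<open>D / d\<close>
  after division by \<open>d^2\<close>, while for distinct indices only products of biases remain,
  together at most \<open>\<eta>^2\<close>.\<close>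

lemma mean_square_average:
  fixes r :: "nat \<Rightarrow> 'a \<Rightarrow> real" and d :: nat
  assumes M: "prob_space M" and d: "1 \<le> d"
    and m: "\<And>k. k < d \<Longrightarrow> r k \<in> borel_measurable M"
    and i: "\<And>k. k < d \<Longrightarrow> integrable M (\<lambda>x. (r k x)\<^sup>2)" and D: "\<And>k. k < d \<Longrightarrow> (\<integral>x. (r k x)\<^sup>2 \<partial>M) \<le> D"
    and unc: "\<And>k l. k < d \<Longrightarrow> l < d \<Longrightarrow> k \<noteq> l \<Longrightarrow> (\<integral>x. r k x * r l x \<partial>M) = (\<integral>x. r k x \<partial>M) * (\<integral>x. r l x \<partial>M)"
    and t: "\<And>k. k < d \<Longrightarrow> \<bar>(\<integral>x. r k x \<partial>M) - t\<bar> \<le> \<eta>"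
  shows "integrable M (\<lambda>x. ((\<Sum>k<d. r k x) / real d - t)\<^sup>2)"
    and "(\<integral>x. ((\<Sum>k<d. r k x) / real d - t)\<^sup>2 \<partial>M) \<le> D / real d + \<eta>\<^sup>2"
proof -
  interpret prob_space M by fact
  define e where "e k = (\<integral>x. r k x \<partial>M) - t" for k
  have i2: "integrable M (\<lambda>x. r k x * r l x)" if "k < d" "l < d" for k l
    by (rule Cauchy_Schwarz_integral(1)[OF m m i i]) (use that in auto)
  have i1: "integrable M (r k)" if "k < d" for k
  proof -
    have "integrable M (\<lambda>x. r k x * 1)"
      by (rule Cauchy_Schwarz_integral(1)[OF m[OF that] _ i[OF that]]) auto
    then show ?thesis by simp
  qed
  have i3: "integrable M (\<lambda>x. (r k x - t) * (r l x - t))" if "k < d" "l < d" for k l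
  proof -
    have "integrable M (\<lambda>x. r k x * r l x - t * r k x - t * r l x + t * t)"
      using i1 i2 that by (intro integrable_add integrable_diff integrable_mult_right) auto
    then show ?thesis by (simp add: algebra_simps)
  qed
  have val: "(\<integral>x. (r k x - t) * (r l x - t) \<partial>M) = (\<integral>x. r k x * r l x \<partial>M) - t * (\<integral>x. r k x \<partial>M) - t * (\<integral>x. r l x \<partial>M) + t * t"
    if "k < d" "l < d" for k l
  proof -
    have "(\<integral>x. (r k x - t) * (r l x - t) \<partial>M) = (\<integral>x. r k x * r l x - t * r k x - t * r l x + t * t \<partial>M)"
      by (intro integral_cong refl) (simp add: algebra_simps)
    also have "\<dots> = (\<integral>x. r k x * r l x \<partial>M) - t * (\<integral>x. r k x \<partial>M) - t * (\<integral>x. r l x \<partial>M) + t * t"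
      using i1 i2 that prob_space by simp
    finally show ?thesis .
  qed
  have sq: "((\<Sum>k<d. r k x) / real d - t)\<^sup>2 = (\<Sum>k<d. \<Sum>l<d. (r k x - t) * (r l x - t)) / (real d)\<^sup>2" for x
  proof -
    have "(\<Sum>k<d. r k x) / real d - t = (\<Sum>k<d. r k x - t) / real d"
      using d by (simp add: sum_subtractf field_simps)
    then show ?thesis by (simp only: power_divide power2_eq_square[of "\<Sum>k<d. _ k"] sum_product)
  qed
  show "integrable M (\<lambda>x. ((\<Sum>k<d. r k x) / real d - t)\<^sup>2)"
    unfolding sq using i3 by (intro integrable_divide integrable_sum) auto
  have "(\<integral>x. ((\<Sum>k<d. r k x) / real d - t)\<^sup>2 \<partial>M) = (\<Sum>k<d. \<Sum>l<d. \<integral>x. (r k x - t) * (r l x - t) \<partial>M) / (real d)\<^sup>2"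
  proof -
    have "(\<integral>x. (\<Sum>k<d. \<Sum>l<d. (r k x - t) * (r l x - t)) \<partial>M) = (\<Sum>k<d. \<Sum>l<d. \<integral>x. (r k x - t) * (r l x - t) \<partial>M)"
    proof (subst integral_sum)
      fix k assume "k \<in> {..<d}"
      then show "integrable M (\<lambda>x. \<Sum>l<d. (r k x - t) * (r l x - t))"
        by (intro integrable_sum i3) auto
    next
      show "(\<Sum>k<d. \<integral>x. (\<Sum>l<d. (r k x - t) * (r l x - t)) \<partial>M) = (\<Sum>k<d. \<Sum>l<d. \<integral>x. (r k x - t) * (r l x - t) \<partial>M)"
        by (intro sum.cong refl integral_sum i3) auto
    qed
    then show ?thesis unfolding sq by simp
  qed
  also have "\<dots> \<le> (\<Sum>k<d. \<Sum>l<d. (if k = l then D else 0) + \<eta>\<^sup>2) / (real d)\<^sup>2"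
  proof (intro divide_right_mono sum_mono)
    fix k l assume kl: "k \<in> {..<d}" "l \<in> {..<d}"
    show "(\<integral>x. (r k x - t) * (r l x - t) \<partial>M) \<le> (if k = l then D else 0) + \<eta>\<^sup>2"
    proof (cases "k = l")
      case True
      have e: "e k * e k \<le> \<eta>\<^sup>2"
        using t[of k] kl by (metis e_def abs_le_square_iff abs_ge_zero abs_of_nonneg lessThan_iff order_trans power2_eq_square)
      have "(\<integral>x. (r k x - t) * (r k x - t) \<partial>M) = (\<integral>x. (r k x)\<^sup>2 \<partial>M) - (\<integral>x. r k x \<partial>M)\<^sup>2 + e k * e k"
        using val[of k k] kl by (simp add: e_def power2_eq_square algebra_simps)
      also have "\<dots> \<le> D + \<eta>\<^sup>2" using D[of k] kl e by (smt (verit) lessThan_iff zero_le_power2)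
      finally show ?thesis using True by simp
    next
      case False
      have "(\<integral>x. (r k x - t) * (r l x - t) \<partial>M) = e k * e l"
        using val[of k l] unc[of k l] kl False by (simp add: e_def algebra_simps)
      also have "\<dots> \<le> \<bar>e k\<bar> * \<bar>e l\<bar>" by (metis abs_ge_self abs_mult)
      also have "\<dots> \<le> \<eta> * \<eta>"
        using t[of k] t[of l] kl by (intro mult_mono) (auto simp: e_def intro: order_trans[OF abs_ge_zero])
      finally show ?thesis using False by (simp add: power2_eq_square)
    qed
  qed simp
  also have "(\<Sum>k<d. \<Sum>l<d. (if k = l then D else 0) + \<eta>\<^sup>2) = (\<Sum>k<d. D + real d * \<eta>\<^sup>2)"
    by (intro sum.cong refl) (simp add: sum.distrib)
  also have "\<dots> / (real d)\<^sup>2 = D / real d + \<eta>\<^sup>2"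
  proof -
    have "real d \<noteq> 0" using d by simp
    moreover have "(\<Sum>k<d. D + real d * \<eta>\<^sup>2) = real d * (D + real d * \<eta>\<^sup>2)" by simp
    ultimately show ?thesis by (simp add: power2_eq_square add_divide_distrib)
  qed
  finally show "(\<integral>x. ((\<Sum>k<d. r k x) / real d - t)\<^sup>2 \<partial>M) \<le> D / real d + \<eta>\<^sup>2" .
qed

section \<open>The sample covariance matrix of an array with Stein kernels\<close>

lemma stein_test_id: "stein_test (\<lambda>x. x) (\<lambda>x. 1)"
  unfolding stein_test_def by (auto intro!: exI[of _ 1])

lemma stein_test_half_square: "stein_test (\<lambda>x. x\<^sup>2 / 2) (\<lambda>x. x)"
  unfolding stein_test_def
proof (intro conjI allI exI[of _ 1])
  fix x :: real
  show "((\<lambda>x. x\<^sup>2 / 2) has_real_derivative x) (at x)" by (auto intro!: derivative_eq_intros)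
  have "0 \<le> (\<bar>x\<bar> - 1)\<^sup>2" by simp
  then show "\<bar>x\<bar> \<le> 1 * (1 + x\<^sup>2)" by (simp add: power2_diff)
qed

lemma integrable_of_square:
  fixes f :: "'a \<Rightarrow> real"
  assumes "prob_space M" "f \<in> borel_measurable M" "integrable M (\<lambda>x. (f x)\<^sup>2)"
  shows "integrable M f"
proof -
  interpret prob_space M by fact
  have "integrable M (\<lambda>x. f x * 1)"
    by (rule Cauchy_Schwarz_integral(1)[OF assms(2) _ assms(3)]) auto
  then show ?thesis by simp
qed

lemma stein_pairD:
  assumes "stein_pair \<Omega> Y T S B"
  shows "prob_space \<Omega>" "Y \<in> borel_measurable \<Omega>" "T \<in> borel_measurable \<Omega>" "S \<in> borel_measurable \<Omega>"
    "integrable \<Omega> (\<lambda>x. Y x ^ 8)" "(\<integral>x. Y x ^ 8 \<partial>\<Omega>) \<le> B" "(\<integral>x. Y x \<partial>\<Omega>) = 0" "(\<integral>x. (Y x)\<^sup>2 \<partial>\<Omega>) = 1"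
    "integrable \<Omega> (\<lambda>x. (T x)\<^sup>2)" "(\<integral>x. (T x)\<^sup>2 \<partial>\<Omega>) \<le> B"
    "integrable \<Omega> (\<lambda>x. (T x * Y x)\<^sup>2)" "(\<integral>x. (T x * Y x)\<^sup>2 \<partial>\<Omega>) \<le> B"
    "integrable \<Omega> (\<lambda>x. (S x)\<^sup>2)" "(\<integral>x. (S x)\<^sup>2 \<partial>\<Omega>) \<le> B"
    "integrable \<Omega> (\<lambda>x. (S x * Y x)\<^sup>2)" "(\<integral>x. (S x * Y x)\<^sup>2 \<partial>\<Omega>) \<le> B"
proof -
  have R: "\<forall>R \<in> {T, \<lambda>x. T x * Y x, S, \<lambda>x. S x * Y x}. integrable \<Omega> (\<lambda>x. (R x)\<^sup>2) \<and> (\<integral>x. (R x)\<^sup>2 \<partial>\<Omega>) \<le> B"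
    using assms unfolding stein_pair_def by (elim conjE) assumption
  have r: "integrable \<Omega> (\<lambda>x. (T x)\<^sup>2) \<and> (\<integral>x. (T x)\<^sup>2 \<partial>\<Omega>) \<le> B"
    by (rule bspec[OF R, of T]) simp
  show "integrable \<Omega> (\<lambda>x. (T x)\<^sup>2)" by (rule conjunct1[OF r])
  show "(\<integral>x. (T x)\<^sup>2 \<partial>\<Omega>) \<le> B" by (rule conjunct2[OF r])
  have r: "integrable \<Omega> (\<lambda>x. (T x * Y x)\<^sup>2) \<and> (\<integral>x. (T x * Y x)\<^sup>2 \<partial>\<Omega>) \<le> B"
    by (rule bspec[OF R, of "\<lambda>x. T x * Y x"]) simp
  show "integrable \<Omega> (\<lambda>x. (T x * Y x)\<^sup>2)" by (rule conjunct1[OF r])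
  show "(\<integral>x. (T x * Y x)\<^sup>2 \<partial>\<Omega>) \<le> B" by (rule conjunct2[OF r])
  have r: "integrable \<Omega> (\<lambda>x. (S x)\<^sup>2) \<and> (\<integral>x. (S x)\<^sup>2 \<partial>\<Omega>) \<le> B"
    by (rule bspec[OF R, of S]) simp
  show "integrable \<Omega> (\<lambda>x. (S x)\<^sup>2)" by (rule conjunct1[OF r])
  show "(\<integral>x. (S x)\<^sup>2 \<partial>\<Omega>) \<le> B" by (rule conjunct2[OF r])
  have r: "integrable \<Omega> (\<lambda>x. (S x * Y x)\<^sup>2) \<and> (\<integral>x. (S x * Y x)\<^sup>2 \<partial>\<Omega>) \<le> B"
    by (rule bspec[OF R, of "\<lambda>x. S x * Y x"]) simp
  show "integrable \<Omega> (\<lambda>x. (S x * Y x)\<^sup>2)" by (rule conjunct1[OF r])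
  show "(\<integral>x. (S x * Y x)\<^sup>2 \<partial>\<Omega>) \<le> B" by (rule conjunct2[OF r])
  show "prob_space \<Omega>" using assms unfolding stein_pair_def by (elim conjE) assumption
  show "Y \<in> borel_measurable \<Omega>" using assms unfolding stein_pair_def by (elim conjE) assumption
  show "T \<in> borel_measurable \<Omega>" using assms unfolding stein_pair_def by (elim conjE) assumption
  show "S \<in> borel_measurable \<Omega>" using assms unfolding stein_pair_def by (elim conjE) assumption
  show "integrable \<Omega> (\<lambda>x. Y x ^ 8)" using assms unfolding stein_pair_def by (elim conjE) assumption
  show "(\<integral>x. Y x ^ 8 \<partial>\<Omega>) \<le> B" using assms unfolding stein_pair_def by (elim conjE) assumption
  show "(\<integral>x. Y x \<partial>\<Omega>) = 0" using assms unfolding stein_pair_def by (elim conjE) assumption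
  show "(\<integral>x. (Y x)\<^sup>2 \<partial>\<Omega>) = 1" using assms unfolding stein_pair_def by (elim conjE) assumption
qed

lemma stein_pair_kernels:
  assumes "stein_pair \<Omega> Y T S B" "stein_test \<phi> \<phi>'"
  shows "(\<integral>x. Y x * \<phi> (Y x) \<partial>\<Omega>) = (\<integral>x. T x * \<phi>' (Y x) \<partial>\<Omega>)"
    "(\<integral>x. ((Y x)\<^sup>2 - 1) * \<phi> (Y x) \<partial>\<Omega>) = (\<integral>x. S x * \<phi>' (Y x) \<partial>\<Omega>)"
proof -
  have "\<forall>\<phi> \<phi>'. stein_test \<phi> \<phi>' \<longrightarrow>
        (\<integral>x. Y x * \<phi> (Y x) \<partial>\<Omega>) = (\<integral>x. T x * \<phi>' (Y x) \<partial>\<Omega>) \<and>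
        (\<integral>x. ((Y x)\<^sup>2 - 1) * \<phi> (Y x) \<partial>\<Omega>) = (\<integral>x. S x * \<phi>' (Y x) \<partial>\<Omega>)"
    using assms(1) unfolding stein_pair_def by (elim conjE) assumption
  note k = mp[OF spec[OF spec[OF this]] assms(2)]
  show "(\<integral>x. Y x * \<phi> (Y x) \<partial>\<Omega>) = (\<integral>x. T x * \<phi>' (Y x) \<partial>\<Omega>)" by (rule conjunct1[OF k])
  show "(\<integral>x. ((Y x)\<^sup>2 - 1) * \<phi> (Y x) \<partial>\<Omega>) = (\<integral>x. S x * \<phi>' (Y x) \<partial>\<Omega>)" by (rule conjunct2[OF k])
qed

text \<open>The two kernel means come from the tests \<open>x\<close>, which returns the variance 1,
  and \<open>x^2 / 2\<close>, which returns half of E (Y^2 - 1) Y^2.\<close>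

lemma stein_pair_moments:
  assumes sp: "stein_pair \<Omega> Y T S B"
  shows "integrable \<Omega> (\<lambda>x. Y x ^ 4)" "integrable \<Omega> (\<lambda>x. (Y x)\<^sup>2)" "integrable \<Omega> Y"
    "integrable \<Omega> T" "integrable \<Omega> S" "integrable \<Omega> (\<lambda>x. T x * Y x)" "integrable \<Omega> (\<lambda>x. S x * Y x)"
    "1 \<le> B \<Longrightarrow> (\<integral>x. Y x ^ 4 \<partial>\<Omega>) \<le> B" "(\<integral>x. T x \<partial>\<Omega>) = 1"
    "(\<integral>x. S x * Y x \<partial>\<Omega>) = ((\<integral>x. Y x ^ 4 \<partial>\<Omega>) - 1) / 2"
proof -
  note s = stein_pairD[OF sp]
  interpret prob_space \<Omega> by (rule s(1))
  note [measurable] = s(2,3,4)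
  show i4: "integrable \<Omega> (\<lambda>x. Y x ^ 4)" by (rule integrable_of_square[OF s(1)]) (use s(5) in \<open>auto\<close>)
  show i2: "integrable \<Omega> (\<lambda>x. (Y x)\<^sup>2)" by (rule integrable_of_square[OF s(1)]) (use i4 in \<open>auto\<close>)
  show "integrable \<Omega> Y" by (rule integrable_of_square[OF s(1) s(2) i2])
  show "integrable \<Omega> T" by (rule integrable_of_square[OF s(1) s(3) s(9)])
  show "integrable \<Omega> S" by (rule integrable_of_square[OF s(1) s(4) s(13)])
  show "integrable \<Omega> (\<lambda>x. T x * Y x)" by (rule integrable_of_square[OF s(1) _ s(11)]) measurable
  show "integrable \<Omega> (\<lambda>x. S x * Y x)" by (rule integrable_of_square[OF s(1) _ s(15)]) measurable
  show "(\<integral>x. Y x ^ 4 \<partial>\<Omega>) \<le> B" if "1 \<le> B"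
  proof -
    have "(\<integral>x. Y x ^ 4 \<partial>\<Omega>) \<le> (\<integral>x. (1 + Y x ^ 8) / 2 \<partial>\<Omega>)"
    proof (rule integral_mono[OF i4])
      fix x
      have "0 \<le> (Y x ^ 4 - 1)\<^sup>2" by simp
      then show "Y x ^ 4 \<le> (1 + Y x ^ 8) / 2" by (simp add: power2_diff)
    qed (use s(5) in auto)
    also have "\<dots> = (1 + (\<integral>x. Y x ^ 8 \<partial>\<Omega>)) / 2" using s(5) prob_space by simp
    also have "\<dots> \<le> (1 + B) / 2" using s(6) by simp
    also have "\<dots> \<le> B" using that by simp
    finally show ?thesis .
  qed
  show "(\<integral>x. T x \<partial>\<Omega>) = 1" using stein_pair_kernels(1)[OF sp stein_test_id] s(8) by (simp add: power2_eq_square)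
  have "(\<integral>x. S x * Y x \<partial>\<Omega>) = (\<integral>x. ((Y x)\<^sup>2 - 1) * ((Y x)\<^sup>2 / 2) \<partial>\<Omega>)"
    by (rule stein_pair_kernels(2)[OF sp stein_test_half_square, symmetric])
  also have "\<dots> = (\<integral>x. (Y x ^ 4 - (Y x)\<^sup>2) / 2 \<partial>\<Omega>)"
    by (intro integral_cong refl) (simp add: power4_eq_xxxx power2_eq_square algebra_simps)
  also have "\<dots> = ((\<integral>x. Y x ^ 4 \<partial>\<Omega>) - 1) / 2" using i4 i2 s(8) by simp
  finally show "(\<integral>x. S x * Y x \<partial>\<Omega>) = ((\<integral>x. Y x ^ 4 \<partial>\<Omega>) - 1) / 2" .
qed

text \<open>The polynomial approximants have variance exactly 1, but their fourth moments miss the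
  target by up to \<open>\<eta>\<close>; \<open>1 + v\<close> plays the role of the common fourth
  moment of the original entries.\<close>

locale stein_array =
  fixes n d :: nat and \<Omega> :: "nat \<times> nat \<Rightarrow> 'a measure" and Y T S :: "nat \<times> nat \<Rightarrow> 'a \<Rightarrow> real" and B v \<eta> :: real
  assumes d: "1 \<le> d" and B: "1 \<le> B" and v: "0 < v"
    and sp: "\<And>\<kappa>. stein_pair (\<Omega> \<kappa>) (Y \<kappa>) (T \<kappa>) (S \<kappa>) B"
    and bias: "\<And>\<kappa>. \<bar>(\<integral>x. Y \<kappa> x ^ 4 \<partial>\<Omega> \<kappa>) - 1 - v\<bar> \<le> \<eta>"
begin

definition K :: "(nat \<times> nat) set" where "K = {..<n} \<times> {..<d}"
definition J :: "(nat \<times> nat) set" where "J = {(i, j). i \<le> j \<and> j < n}"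
definition Prod :: "(nat \<times> nat \<Rightarrow> 'a) measure" where "Prod = PiM K \<Omega>"

lemma finK: "finite K" by (simp add: K_def)
lemma finJ: "finite J"
  by (rule finite_subset[of _ "{..<n} \<times> {..<n}"]) (auto simp: J_def)

lemma prob_\<Omega>: "prob_space (\<Omega> \<kappa>)" by (rule stein_pairD(1)[OF sp])

lemma product_prob: "product_prob_space \<Omega>"
  by (rule product_prob_spaceI) (rule prob_\<Omega>)

lemma prob_Prod: "prob_space Prod"
  unfolding Prod_def by (intro prob_space_PiM prob_\<Omega>)

lemma measurable_Prod_comp:
  fixes f :: "'a \<Rightarrow> real"
  assumes "f \<in> borel_measurable (\<Omega> \<kappa>)" shows "(\<lambda>\<omega>. f (\<omega> \<kappa>)) \<in> borel_measurable Prod"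
proof (cases "\<kappa> \<in> K")
  case True
  show ?thesis unfolding Prod_def
    by (rule measurable_compose[OF measurable_component_singleton[OF True, of \<Omega>] assms])
next
  case False
  then have "\<And>\<omega>. \<omega> \<in> space Prod \<Longrightarrow> f (\<omega> \<kappa>) = f undefined"
    by (cases \<kappa>) (auto simp: Prod_def space_PiM PiE_def extensional_def)
  then have "(\<lambda>\<omega>. f (\<omega> \<kappa>)) \<in> borel_measurable Prod \<longleftrightarrow> (\<lambda>_. f undefined) \<in> borel_measurable Prod"
    by (rule measurable_cong)
  then show ?thesis by simp
qed

definition y :: "(nat \<times> nat \<Rightarrow> 'a) \<Rightarrow> nat \<times> nat \<Rightarrow> real" where "y \<omega> = (\<lambda>\<kappa>. Y \<kappa> (\<omega> \<kappa>))"

lemma y_measurable [measurable]: "(\<lambda>\<omega>. y \<omega> \<kappa>) \<in> borel_measurable Prod"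
  unfolding y_def by (rule measurable_Prod_comp[OF stein_pairD(2)[OF sp]])

text \<open>\<open>kern i j k\<close> is the kernel attached to the product of the entries \<open>(i, k)\<close> and \<open>(j, k)\<close>,
  obtained by integrating by parts in the entry \<open>(i, k)\<close>.\<close>

definition kern :: "nat \<Rightarrow> nat \<Rightarrow> nat \<Rightarrow> (nat \<times> nat \<Rightarrow> 'a) \<Rightarrow> real" where
  "kern i j k \<omega> = (if i = j then S (i, k) (\<omega> (i, k)) else T (i, k) (\<omega> (i, k)) * y \<omega> (j, k))"

text \<open>Differentiating an entry with rows \<open>i\<close> and \<open>l\<close> in the data
  coordinate \<open>(i, k)\<close> leaves the factor \<open>y \<omega> (l, k)\<close>, up to
  \<open>1 / sqrt d\<close>; this is its product with the kernel.\<close>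

definition trm :: "nat \<Rightarrow> nat \<Rightarrow> nat \<Rightarrow> nat \<Rightarrow> (nat \<times> nat \<Rightarrow> 'a) \<Rightarrow> real" where
  "trm i j l k \<omega> = kern i j k \<omega> * y \<omega> (l, k)"

text \<open>The share of coordinate \<open>\<kappa>\<close> in \<open>trm\<close>. Since
  \<open>trm\<close> is a product over independent coordinates, its moments factorise even when some
  of the rows \<open>i\<close>, \<open>j\<close>, \<open>l\<close> coincide and their factors merge
  at one coordinate.\<close>

definition fac :: "nat \<Rightarrow> nat \<Rightarrow> nat \<Rightarrow> nat \<Rightarrow> nat \<times> nat \<Rightarrow> 'a \<Rightarrow> real" where
  "fac i j l k \<kappa> x = (if \<kappa> = (i, k) then (if i = j then S \<kappa> x else T \<kappa> x) else 1) *
     (if \<kappa> = (j, k) \<and> i \<noteq> j then Y \<kappa> x else 1) * (if \<kappa> = (l, k) then Y \<kappa> x else 1)"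

lemma kern_measurable [measurable]: "kern i j k \<in> borel_measurable Prod"
proof -
  have "(\<lambda>\<omega>. S (i, k) (\<omega> (i, k))) \<in> borel_measurable Prod" "(\<lambda>\<omega>. T (i, k) (\<omega> (i, k))) \<in> borel_measurable Prod"
    by (rule measurable_Prod_comp[OF stein_pairD(4)[OF sp]], rule measurable_Prod_comp[OF stein_pairD(3)[OF sp]])
  then show ?thesis unfolding kern_def[abs_def] by (cases "i = j") auto
qed

lemma trm_measurable [measurable]: "trm i j l k \<in> borel_measurable Prod"
  unfolding trm_def[abs_def] by measurable

lemma trm_eq_prod:
  assumes "i < n" "j < n" "l < n" "k < d"
  shows "trm i j l k \<omega> = (\<Prod>\<kappa>\<in>K. fac i j l k \<kappa> (\<omega> \<kappa>))"
proof -
  have K: "(i, k) \<in> K" "(j, k) \<in> K" "(l, k) \<in> K" using assms by (auto simp: K_def)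
  have 2: "(\<Prod>\<kappa>\<in>K. if \<kappa> = (j, k) \<and> i \<noteq> j then Y \<kappa> (\<omega> \<kappa>) else 1) = (if i \<noteq> j then Y (j, k) (\<omega> (j, k)) else 1)"
    using finK K by (cases "i = j") (auto simp: prod.delta)
  show ?thesis
    unfolding fac_def prod.distrib 2 using finK K
    by (simp add: prod.delta trm_def kern_def y_def)
qed

lemma fac_cases:
  shows "\<kappa> \<notin> {(i, k), (j, k), (l, k)} \<Longrightarrow> fac i j l k \<kappa> = (\<lambda>x. 1)"
    and "i = j \<Longrightarrow> l = i \<Longrightarrow> fac i j l k (i, k) = (\<lambda>x. S (i, k) x * Y (i, k) x)"
    and "i = j \<Longrightarrow> l \<noteq> i \<Longrightarrow> fac i j l k (i, k) = S (i, k)"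
    and "l \<noteq> i \<Longrightarrow> l \<noteq> j \<Longrightarrow> fac i j l k (l, k) = Y (l, k)"
    and "i \<noteq> j \<Longrightarrow> l = i \<Longrightarrow> fac i j l k (i, k) = (\<lambda>x. T (i, k) x * Y (i, k) x)"
    and "i \<noteq> j \<Longrightarrow> l \<noteq> j \<Longrightarrow> fac i j l k (j, k) = Y (j, k)"
    and "i \<noteq> j \<Longrightarrow> l \<noteq> i \<Longrightarrow> fac i j l k (i, k) = T (i, k)"
    and "i \<noteq> j \<Longrightarrow> l = j \<Longrightarrow> fac i j l k (j, k) = (\<lambda>x. (Y (j, k) x)\<^sup>2)"
  by (auto simp: fac_def fun_eq_iff power2_eq_square)

lemma fac_kinds:
  obtains "fac i j l k \<kappa> = (\<lambda>x. 1)" | "fac i j l k \<kappa> = (\<lambda>x. S \<kappa> x * Y \<kappa> x)" | "fac i j l k \<kappa> = S \<kappa>"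
    | "fac i j l k \<kappa> = Y \<kappa>" | "fac i j l k \<kappa> = (\<lambda>x. T \<kappa> x * Y \<kappa> x)" | "fac i j l k \<kappa> = T \<kappa>"
    | "fac i j l k \<kappa> = (\<lambda>x. (Y \<kappa> x)\<^sup>2)"
proof -
  consider "\<kappa> \<notin> {(i, k), (j, k), (l, k)}" | "\<kappa> = (i, k)" | "\<kappa> = (j, k)" "i \<noteq> j" | "\<kappa> = (l, k)" "l \<noteq> i" "l \<noteq> j"
    by auto
  then show thesis
  proof cases
    case 1 then show thesis using fac_cases(1) that(1) by blast
  next
    case 2
    then show thesis using fac_cases(2,3,5,7)[of i j l k] that(2,3,5,6) by blast
  next
    case 3
    then show thesis using fac_cases(6,8)[of i j l k] that(4,7) by blast
  next
    case 4
    then show thesis using fac_cases(4)[of l i j k] that(4) by blast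
  qed
qed

lemma fac_integrable: "integrable (\<Omega> \<kappa>) (fac i j l k \<kappa>)"
proof -
  interpret prob_space "\<Omega> \<kappa>" by (rule prob_\<Omega>)
  note m = stein_pair_moments[OF sp[of \<kappa>]]
  show ?thesis by (rule fac_kinds[of i j l k \<kappa>]) (simp_all add: m)
qed

lemma fac_square_integrable: "integrable (\<Omega> \<kappa>) (\<lambda>x. (fac i j l k \<kappa> x)\<^sup>2)"
proof -
  interpret prob_space "\<Omega> \<kappa>" by (rule prob_\<Omega>)
  note m = stein_pair_moments[OF sp[of \<kappa>]] and s = stein_pairD[OF sp[of \<kappa>]]
  show ?thesis by (rule fac_kinds[of i j l k \<kappa>]) (use m(1,2) s(9,11,13,15) in \<open>simp_all\<close>)
qed

lemma trm_integral:
  assumes "i < n" "j < n" "l < n" "k < d"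
  shows "integrable Prod (trm i j l k)"
    and "(\<integral>\<omega>. trm i j l k \<omega> \<partial>Prod) = (\<Prod>\<kappa>\<in>{(i, k), (j, k), (l, k)}. \<integral>x. fac i j l k \<kappa> x \<partial>\<Omega> \<kappa>)"
    and "integrable Prod (\<lambda>\<omega>. (trm i j l k \<omega>)\<^sup>2)"
    and "(\<integral>\<omega>. (trm i j l k \<omega>)\<^sup>2 \<partial>Prod) = (\<Prod>\<kappa>\<in>{(i, k), (j, k), (l, k)}. \<integral>x. (fac i j l k \<kappa> x)\<^sup>2 \<partial>\<Omega> \<kappa>)"
proof -
  interpret product_prob_space \<Omega> by (rule product_prob)
  have sub: "{(i, k), (j, k), (l, k)} \<subseteq> K" using assms by (auto simp: K_def)
  have one: "measure (\<Omega> \<kappa>) (space (\<Omega> \<kappa>)) = 1" for \<kappa> by (rule prob_space.prob_space[OF prob_\<Omega>])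
  have t: "trm i j l k = (\<lambda>\<omega>. \<Prod>\<kappa>\<in>K. fac i j l k \<kappa> (\<omega> \<kappa>))" by (rule ext) (rule trm_eq_prod[OF assms])
  have t2: "(\<lambda>\<omega>. (trm i j l k \<omega>)\<^sup>2) = (\<lambda>\<omega>. \<Prod>\<kappa>\<in>K. (fac i j l k \<kappa> (\<omega> \<kappa>))\<^sup>2)"
    unfolding t by (simp add: prod_power_distrib)
  show "integrable Prod (trm i j l k)"
    unfolding t Prod_def by (rule product_integrable_prod[OF finK fac_integrable])
  show "integrable Prod (\<lambda>\<omega>. (trm i j l k \<omega>)\<^sup>2)"
    unfolding t2 Prod_def by (rule product_integrable_prod[OF finK, where f="\<lambda>\<kappa> x. (fac i j l k \<kappa> x)\<^sup>2"]) (rule fac_square_integrable)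
  have "(\<integral>\<omega>. trm i j l k \<omega> \<partial>Prod) = (\<Prod>\<kappa>\<in>K. \<integral>x. fac i j l k \<kappa> x \<partial>\<Omega> \<kappa>)"
    unfolding t Prod_def by (rule product_integral_prod[OF finK fac_integrable])
  also have "\<dots> = (\<Prod>\<kappa>\<in>{(i, k), (j, k), (l, k)}. \<integral>x. fac i j l k \<kappa> x \<partial>\<Omega> \<kappa>)"
    by (rule prod.mono_neutral_right[OF finK sub]) (auto simp: fac_cases(1) one)
  finally show "(\<integral>\<omega>. trm i j l k \<omega> \<partial>Prod) = (\<Prod>\<kappa>\<in>{(i, k), (j, k), (l, k)}. \<integral>x. fac i j l k \<kappa> x \<partial>\<Omega> \<kappa>)" .
  have "(\<integral>\<omega>. (trm i j l k \<omega>)\<^sup>2 \<partial>Prod) = (\<Prod>\<kappa>\<in>K. \<integral>x. (fac i j l k \<kappa> x)\<^sup>2 \<partial>\<Omega> \<kappa>)"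
    unfolding t2 Prod_def
    by (rule product_integral_prod[OF finK, where f="\<lambda>\<kappa> x. (fac i j l k \<kappa> x)\<^sup>2"]) (rule fac_square_integrable)
  also have "\<dots> = (\<Prod>\<kappa>\<in>{(i, k), (j, k), (l, k)}. \<integral>x. (fac i j l k \<kappa> x)\<^sup>2 \<partial>\<Omega> \<kappa>)"
    by (rule prod.mono_neutral_right[OF finK sub]) (auto simp: fac_cases(1) one)
  finally show "(\<integral>\<omega>. (trm i j l k \<omega>)\<^sup>2 \<partial>Prod) = (\<Prod>\<kappa>\<in>{(i, k), (j, k), (l, k)}. \<integral>x. (fac i j l k \<kappa> x)\<^sup>2 \<partial>\<Omega> \<kappa>)" .
qed

text \<open>Different columns use disjoint coordinates, so at each \<open>\<kappa>\<close> at least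
  one of the two factors is constantly 1.\<close>

lemma trm_uncorrelated:
  assumes "i < n" "j < n" "l < n" "k < d" "k' < d" "k \<noteq> k'"
  shows "(\<integral>\<omega>. trm i j l k \<omega> * trm i j l k' \<omega> \<partial>Prod) = (\<integral>\<omega>. trm i j l k \<omega> \<partial>Prod) * (\<integral>\<omega>. trm i j l k' \<omega> \<partial>Prod)"
proof -
  interpret product_prob_space \<Omega> by (rule product_prob)
  have one: "measure (\<Omega> \<kappa>) (space (\<Omega> \<kappa>)) = 1" for \<kappa> by (rule prob_space.prob_space[OF prob_\<Omega>])
  have t: "trm i j l k = (\<lambda>\<omega>. \<Prod>\<kappa>\<in>K. fac i j l k \<kappa> (\<omega> \<kappa>))" if "k < d" for k
    using assms that by (intro ext trm_eq_prod)
  have triv: "fac i j l k \<kappa> = (\<lambda>x. 1) \<or> fac i j l k' \<kappa> = (\<lambda>x. 1)" for \<kappa>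
  proof (cases "snd \<kappa> = k")
    case True
    with assms have "\<kappa> \<notin> {(i, k'), (j, k'), (l, k')}" by auto
    then show ?thesis using fac_cases(1) by blast
  next
    case False
    then have "\<kappa> \<notin> {(i, k), (j, k), (l, k)}" by auto
    then show ?thesis using fac_cases(1) by blast
  qed
  have int: "integrable (\<Omega> \<kappa>) (\<lambda>x. fac i j l k \<kappa> x * fac i j l k' \<kappa> x)" for \<kappa>
    using triv[of \<kappa>] fac_integrable[of \<kappa> i j l k] fac_integrable[of \<kappa> i j l k'] by auto
  have val: "(\<integral>x. fac i j l k \<kappa> x * fac i j l k' \<kappa> x \<partial>\<Omega> \<kappa>) = (\<integral>x. fac i j l k \<kappa> x \<partial>\<Omega> \<kappa>) * (\<integral>x. fac i j l k' \<kappa> x \<partial>\<Omega> \<kappa>)" for \<kappa>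
    using triv[of \<kappa>] one[of \<kappa>] by auto
  have "(\<integral>\<omega>. trm i j l k \<omega> * trm i j l k' \<omega> \<partial>Prod) = (\<integral>\<omega>. (\<Prod>\<kappa>\<in>K. fac i j l k \<kappa> (\<omega> \<kappa>) * fac i j l k' \<kappa> (\<omega> \<kappa>)) \<partial>Prod)"
    unfolding t[OF assms(4)] t[OF assms(5)] by (simp add: prod.distrib)
  also have "\<dots> = (\<Prod>\<kappa>\<in>K. \<integral>x. fac i j l k \<kappa> x * fac i j l k' \<kappa> x \<partial>\<Omega> \<kappa>)"
    unfolding Prod_def by (rule product_integral_prod[OF finK int])
  also have "\<dots> = (\<Prod>\<kappa>\<in>K. \<integral>x. fac i j l k \<kappa> x \<partial>\<Omega> \<kappa>) * (\<Prod>\<kappa>\<in>K. \<integral>x. fac i j l k' \<kappa> x \<partial>\<Omega> \<kappa>)"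
    by (simp add: val prod.distrib)
  also have "\<dots> = (\<integral>\<omega>. trm i j l k \<omega> \<partial>Prod) * (\<integral>\<omega>. trm i j l k' \<omega> \<partial>Prod)"
    unfolding t[OF assms(4)] t[OF assms(5)] Prod_def
    by (simp only: product_integral_prod[OF finK fac_integrable])
  finally show ?thesis .
qed

text \<open>The square of \<open>B\<close> stems from the case \<open>l = j\<close> with
  \<open>i \<noteq> j\<close>, where the second moment of a kernel meets a fourth moment of an
  entry.\<close>

lemma trm_square_bound:
  assumes "i < n" "j < n" "l < n" "k < d"
  shows "(\<integral>\<omega>. (trm i j l k \<omega>)\<^sup>2 \<partial>Prod) \<le> B\<^sup>2"
proof -
  note m = stein_pair_moments[OF sp] and s = stein_pairD[OF sp]
  have BB: "B \<le> B\<^sup>2" using B by (simp add: power2_eq_square)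
  consider "i = j" "l = i" | "i = j" "l \<noteq> i" | "i \<noteq> j" "l = i" | "i \<noteq> j" "l = j" | "i \<noteq> j" "l \<noteq> i" "l \<noteq> j" by auto
  then show ?thesis
  proof cases
    case 1
    then show ?thesis unfolding trm_integral(4)[OF assms] using fac_cases(2)[of i j l k] s(16)[of "(i, k)"] BB by simp
  next
    case 2
    then show ?thesis unfolding trm_integral(4)[OF assms]
      using fac_cases(3)[of i j l k] fac_cases(4)[of l i j k] s(14)[of "(i, k)"] s(8)[of "(l, k)"] BB by simp
  next
    case 3
    then have "{(i, k), (j, k), (l, k)} = {(i, k), (j, k)}" by auto
    with 3 show ?thesis unfolding trm_integral(4)[OF assms]
      using fac_cases(5)[of i j l k] fac_cases(6)[of i j l k] s(12)[of "(i, k)"] s(8)[of "(j, k)"] BB by simp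
  next
    case 4
    have "(\<integral>x. (T (i, k) x)\<^sup>2 \<partial>\<Omega> (i, k)) * (\<integral>x. Y (j, k) x ^ 4 \<partial>\<Omega> (j, k)) \<le> B * B"
      using s(10)[of "(i, k)"] m(8)[OF B, of "(j, k)"] B by (intro mult_mono) auto
    with 4 show ?thesis unfolding trm_integral(4)[OF assms]
      using fac_cases(7)[of i j l k] fac_cases(8)[of i j l k] by (simp add: power2_eq_square[of B])
  next
    case 5
    then show ?thesis unfolding trm_integral(4)[OF assms]
      using fac_cases(7)[of i j l k] fac_cases(6)[of i j l k] fac_cases(4)[of l i j k] s(10)[of "(i, k)"] s(8)[of "(j, k)"] s(8)[of "(l, k)"] BB by simp
  qed
qed

text \<open>The intended mean of \<open>trm\<close>. The value \<open>v / 2\<close> is E S Y, namely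
  half of E Y^4 - 1; the value 1 is E T times E Y^2; in the remaining cases a centred entry splits
  off as an independent factor.\<close>

definition targ :: "nat \<Rightarrow> nat \<Rightarrow> nat \<Rightarrow> real" where
  "targ i j l = (if i = j then (if l = i then v / 2 else 0) else if l = j then 1 else 0)"

lemma eta_nonneg: "0 \<le> \<eta>" using bias[of "(0, 0)"] by (rule order_trans[OF abs_ge_zero])

lemma trm_mean:
  assumes "i < n" "j < n" "l < n" "k < d"
  shows "\<bar>(\<integral>\<omega>. trm i j l k \<omega> \<partial>Prod) - targ i j l\<bar> \<le> \<eta>"
proof -
  note m = stein_pair_moments[OF sp] and s = stein_pairD[OF sp]
  consider "i = j" "l = i" | "i = j" "l \<noteq> i" | "i \<noteq> j" "l = i" | "i \<noteq> j" "l = j" | "i \<noteq> j" "l \<noteq> i" "l \<noteq> j" by auto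
  then show ?thesis
  proof cases
    case 1
    then have "(\<integral>\<omega>. trm i j l k \<omega> \<partial>Prod) - targ i j l = ((\<integral>x. Y (i, k) x ^ 4 \<partial>\<Omega> (i, k)) - 1 - v) / 2"
      unfolding trm_integral(2)[OF assms] using fac_cases(2)[of i j l k] m(10)[of "(i, k)"]
      by (simp add: targ_def field_simps)
    moreover have "\<bar>((\<integral>x. Y (i, k) x ^ 4 \<partial>\<Omega> (i, k)) - 1 - v) / 2\<bar> \<le> \<eta> / 1"
      unfolding abs_divide using bias[of "(i, k)"] eta_nonneg by (intro frac_le) auto
    ultimately show ?thesis by simp
  next
    case 2
    then show ?thesis unfolding trm_integral(2)[OF assms]
      using fac_cases(3)[of i j l k] fac_cases(4)[of l i j k] s(7)[of "(l, k)"] eta_nonneg by (simp add: targ_def)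
  next
    case 3
    then have "{(i, k), (j, k), (l, k)} = {(i, k), (j, k)}" by auto
    with 3 show ?thesis unfolding trm_integral(2)[OF assms]
      using fac_cases(5)[of i j l k] fac_cases(6)[of i j l k] s(7)[of "(j, k)"] eta_nonneg by (simp add: targ_def)
  next
    case 4
    then show ?thesis unfolding trm_integral(2)[OF assms]
      using fac_cases(7)[of i j l k] fac_cases(8)[of i j l k] m(9)[of "(i, k)"] s(8)[of "(j, k)"] eta_nonneg by (simp add: targ_def)
  next
    case 5
    then show ?thesis unfolding trm_integral(2)[OF assms]
      using fac_cases(7)[of i j l k] fac_cases(6)[of i j l k] fac_cases(4)[of l i j k] s(7)[of "(l, k)"] eta_nonneg by (simp add: targ_def)
  qed
qed

lemma trm_average:
  assumes "i < n" "j < n" "l < n"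
  shows "integrable Prod (\<lambda>\<omega>. ((\<Sum>k<d. trm i j l k \<omega>) / real d - targ i j l)\<^sup>2)"
    and "(\<integral>\<omega>. ((\<Sum>k<d. trm i j l k \<omega>) / real d - targ i j l)\<^sup>2 \<partial>Prod) \<le> B\<^sup>2 / real d + \<eta>\<^sup>2"
proof -
  note A = trm_measurable trm_integral(3)[OF assms] trm_square_bound[OF assms] trm_uncorrelated[OF assms] trm_mean[OF assms]
  show "integrable Prod (\<lambda>\<omega>. ((\<Sum>k<d. trm i j l k \<omega>) / real d - targ i j l)\<^sup>2)"
    by (rule mean_square_average(1)[OF prob_Prod d A])
  show "(\<integral>\<omega>. ((\<Sum>k<d. trm i j l k \<omega>) / real d - targ i j l)\<^sup>2 \<partial>Prod) \<le> B\<^sup>2 / real d + \<eta>\<^sup>2"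
    by (rule mean_square_average(2)[OF prob_Prod d A])
qed

definition sg :: "nat \<times> nat \<Rightarrow> real" where "sg c = (if fst c = snd c then sqrt v else 1)"

lemma sg_pos: "0 < sg c" using v by (simp add: sg_def)

text \<open>The Stein matrix of the covariance entries: the kernel of entry \<open>b\<close> paired
  with the derivative of entry \<open>c\<close> in row \<open>fst b\<close>. For diagonal
  \<open>c\<close> in that row both conditions hold, which accounts for the 2 in the derivative of a
  square.\<close>

definition tau :: "nat \<times> nat \<Rightarrow> nat \<times> nat \<Rightarrow> (nat \<times> nat \<Rightarrow> 'a) \<Rightarrow> real" where
  "tau b c \<omega> = (if fst c = fst b then (\<Sum>k<d. trm (fst b) (snd b) (snd c) k \<omega>) / real d else 0) +
     (if snd c = fst b then (\<Sum>k<d. trm (fst b) (snd b) (fst c) k \<omega>) / real d else 0)"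

text \<open>The deviation of the Stein matrix from the Gaussian covariance. The columns are divided
  by \<open>sg c\<close> because \<open>matrix_bound\<close> works with standard coordinates
  \<open>z c\<close>.\<close>

definition amat :: "nat \<times> nat \<Rightarrow> nat \<times> nat \<Rightarrow> (nat \<times> nat \<Rightarrow> 'a) \<Rightarrow> real" where
  "amat b c \<omega> = (tau b c \<omega> - (if b = c then (sg b)\<^sup>2 else 0)) / sg c"

text \<open>On the diagonal two halves \<open>v / 2\<close> add up to \<open>v\<close>. For
  \<open>i < j\<close> the order of the indices in \<open>J\<close> rules out the transposed match,
  so exactly \<open>c = b\<close> gives 1.\<close>

lemma tau_target:
  assumes "b \<in> J" "c \<in> J"
  shows "(if b = c then (sg b)\<^sup>2 else 0) =
    (if fst c = fst b then targ (fst b) (snd b) (snd c) else 0) + (if snd c = fst b then targ (fst b) (snd b) (fst c) else 0)"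
proof -
  obtain i j l m where bc: "b = (i, j)" "c = (l, m)" by (cases b, cases c) auto
  have ord: "i \<le> j" "l \<le> m" using assms by (auto simp: bc J_def)
  have v2: "(sqrt v)\<^sup>2 = v" using v by simp
  show ?thesis
  proof (cases "i = j")
    case True
    then show ?thesis using ord v2 by (cases "l = i"; cases "m = i") (simp_all add: bc targ_def sg_def)
  next
    case False
    then have "i < j" using ord by simp
    then show ?thesis using ord
      by (cases "l = i"; cases "m = i"; cases "m = j"; cases "l = j") (simp_all add: bc targ_def sg_def)
  qed
qed

text \<open>If \<open>c\<close> does not meet row \<open>fst b\<close>, both \<open>tau\<close> and
  its target vanish, whence the indicators in the bound. The 2 comes from squaring a sum of two
  terms, and \<open>min 1 v\<close> is a lower bound for the squared scale.\<close>

lemma amat_moment: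
  assumes b: "b \<in> J" and c: "c \<in> J"
  shows "integrable Prod (\<lambda>\<omega>. (amat b c \<omega>)\<^sup>2)"
    and "(\<integral>\<omega>. (amat b c \<omega>)\<^sup>2 \<partial>Prod) \<le>
      2 * ((if fst c = fst b then 1 else 0) + (if snd c = fst b then 1 else 0)) * (B\<^sup>2 / real d + \<eta>\<^sup>2) / min 1 v"
proof -
  obtain i j l m where bc: "b = (i, j)" "c = (l, m)" by (cases b, cases c) auto
  have lt: "i < n" "j < n" "l < n" "m < n" using assms by (auto simp: bc J_def)
  define e where "e h \<omega> = (\<Sum>k<d. trm i j h k \<omega>) / real d - targ i j h" for h \<omega>
  have e: "integrable Prod (\<lambda>\<omega>. (e h \<omega>)\<^sup>2)" "(\<integral>\<omega>. (e h \<omega>)\<^sup>2 \<partial>Prod) \<le> B\<^sup>2 / real d + \<eta>\<^sup>2" if "h < n" for h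
    unfolding e_def by (rule trm_average[OF lt(1,2) that])+
  have em [measurable]: "e h \<in> borel_measurable Prod" for h unfolding e_def[abs_def] by measurable
  define p where "p = (if l = i then 1 else 0 :: real)"
  define q where "q = (if m = i then 1 else 0 :: real)"
  have a: "amat b c \<omega> = (p * e m \<omega> + q * e l \<omega>) / sg c" for \<omega>
    unfolding amat_def tau_target[OF assms] by (simp add: bc tau_def p_def q_def e_def)
  have sgc: "min 1 v \<le> (sg c)\<^sup>2" "0 < min 1 v" using v by (auto simp: sg_def)
  have int: "integrable Prod (\<lambda>\<omega>. 2 * (p * (e m \<omega>)\<^sup>2 + q * (e l \<omega>)\<^sup>2) / min 1 v)"
    using e(1)[OF lt(3)] e(1)[OF lt(4)] by simp
  have le: "(amat b c \<omega>)\<^sup>2 \<le> 2 * (p * (e m \<omega>)\<^sup>2 + q * (e l \<omega>)\<^sup>2) / min 1 v" for \<omega>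
  proof -
    have "0 \<le> (p * e m \<omega> - q * e l \<omega>)\<^sup>2" by simp
    then have "(p * e m \<omega> + q * e l \<omega>)\<^sup>2 \<le> 2 * (p\<^sup>2 * (e m \<omega>)\<^sup>2 + q\<^sup>2 * (e l \<omega>)\<^sup>2)"
      by (simp add: power2_sum power2_diff power_mult_distrib)
    moreover have "p\<^sup>2 = p" "q\<^sup>2 = q" by (auto simp: p_def q_def)
    ultimately have "(p * e m \<omega> + q * e l \<omega>)\<^sup>2 \<le> 2 * (p * (e m \<omega>)\<^sup>2 + q * (e l \<omega>)\<^sup>2)" by simp
    moreover have "0 \<le> 2 * (p * (e m \<omega>)\<^sup>2 + q * (e l \<omega>)\<^sup>2)" by (simp add: p_def q_def)
    ultimately show ?thesis unfolding a power_divide using sgc by (intro frac_le) simp_all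
  qed
  show i: "integrable Prod (\<lambda>\<omega>. (amat b c \<omega>)\<^sup>2)"
  proof (rule integrable_bound[OF int])
    show "(\<lambda>\<omega>. (amat b c \<omega>)\<^sup>2) \<in> borel_measurable Prod" unfolding a by measurable
    show "AE \<omega> in Prod. norm ((amat b c \<omega>)\<^sup>2) \<le> norm (2 * (p * (e m \<omega>)\<^sup>2 + q * (e l \<omega>)\<^sup>2) / min 1 v)"
      using le by (intro AE_I2) (simp only: real_norm_def, intro order_trans[OF _ abs_ge_self], simp)
  qed
  have "(\<integral>\<omega>. (amat b c \<omega>)\<^sup>2 \<partial>Prod) \<le> (\<integral>\<omega>. 2 * (p * (e m \<omega>)\<^sup>2 + q * (e l \<omega>)\<^sup>2) / min 1 v \<partial>Prod)"
    by (rule integral_mono[OF i int le])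
  also have "\<dots> = 2 * (p * (\<integral>\<omega>. (e m \<omega>)\<^sup>2 \<partial>Prod) + q * (\<integral>\<omega>. (e l \<omega>)\<^sup>2 \<partial>Prod)) / min 1 v"
    using e(1)[OF lt(3)] e(1)[OF lt(4)] by simp
  also have "\<dots> \<le> 2 * (p * (B\<^sup>2 / real d + \<eta>\<^sup>2) + q * (B\<^sup>2 / real d + \<eta>\<^sup>2)) / min 1 v"
    using sgc(2) e(2)[OF lt(3)] e(2)[OF lt(4)]
    by (intro divide_right_mono mult_left_mono add_mono) (auto simp: p_def q_def)
  finally show "(\<integral>\<omega>. (amat b c \<omega>)\<^sup>2 \<partial>Prod) \<le>
      2 * ((if fst c = fst b then 1 else 0) + (if snd c = fst b then 1 else 0)) * (B\<^sup>2 / real d + \<eta>\<^sup>2) / min 1 v"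
    by (simp only: bc fst_conv snd_conv p_def q_def distrib_right mult.assoc)
qed

lemma amat_total:
  "(\<Sum>b\<in>J. \<Sum>c\<in>J. \<integral>\<omega>. (amat b c \<omega>)\<^sup>2 \<partial>Prod) \<le> 4 * real n ^ 3 * (B\<^sup>2 / real d + \<eta>\<^sup>2) / min 1 v"
proof -
  define \<beta> where "\<beta> = (B\<^sup>2 / real d + \<eta>\<^sup>2) / min 1 v"
  have \<beta>: "0 \<le> \<beta>" using v by (simp add: \<beta>_def)
  have c1: "(\<Sum>c\<in>J. if fst c = i then 1 else 0 :: real) \<le> real n" for i
  proof -
    have "(\<Sum>c\<in>J. if fst c = i then 1 else 0 :: real) = real (card {c\<in>J. fst c = i})"
      using finJ by (simp add: sum.If_cases Int_def)
    also have "card {c\<in>J. fst c = i} \<le> card ({i} \<times> {..<n})"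
      by (intro card_mono) (auto simp: J_def)
    finally show ?thesis by simp
  qed
  have c2: "(\<Sum>c\<in>J. if snd c = i then 1 else 0 :: real) \<le> real n" for i
  proof -
    have "(\<Sum>c\<in>J. if snd c = i then 1 else 0 :: real) = real (card {c\<in>J. snd c = i})"
      using finJ by (simp add: sum.If_cases Int_def)
    also have "card {c\<in>J. snd c = i} \<le> card ({..<n} \<times> {i})"
      by (intro card_mono) (auto simp: J_def)
    finally show ?thesis by simp
  qed
  have cJ: "card J \<le> n * n"
  proof -
    have "card J \<le> card ({..<n} \<times> {..<n})" by (intro card_mono) (auto simp: J_def)
    then show ?thesis by simp
  qed
  have "(\<Sum>b\<in>J. \<Sum>c\<in>J. \<integral>\<omega>. (amat b c \<omega>)\<^sup>2 \<partial>Prod) \<le>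
     (\<Sum>b\<in>J. \<Sum>c\<in>J. 2 * ((if fst c = fst b then 1 else 0) + (if snd c = fst b then 1 else 0)) * \<beta>)"
  proof (intro sum_mono)
    fix b c assume "b \<in> J" "c \<in> J"
    from amat_moment(2)[OF this]
    show "(\<integral>\<omega>. (amat b c \<omega>)\<^sup>2 \<partial>Prod) \<le> 2 * ((if fst c = fst b then 1 else 0) + (if snd c = fst b then 1 else 0)) * \<beta>"
      by (simp only: \<beta>_def times_divide_eq_right)
  qed
  also have "\<dots> = (\<Sum>b\<in>J. 2 * \<beta> * ((\<Sum>c\<in>J. if fst c = fst b then 1 else 0) + (\<Sum>c\<in>J. if snd c = fst b then 1 else 0)))"
    unfolding sum.distrib[symmetric] sum_distrib_left by (intro sum.cong refl) simp
  \<comment> \<open>For fixed \<open>b\<close> each of the two row conditions is met by at most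
    \<open>n\<close> indices \<open>c\<close>.\<close>
  also have "\<dots> \<le> (\<Sum>b\<in>J. 2 * \<beta> * (real n + real n))"
    using \<beta> by (intro sum_mono mult_left_mono add_mono c1 c2) auto
  also have "\<dots> = real (card J) * (4 * \<beta> * real n)" by simp
  also have "\<dots> \<le> real (n * n) * (4 * \<beta> * real n)"
    using cJ \<beta> by (intro mult_right_mono) (auto simp del: of_nat_mult)
  also have "\<dots> = 4 * real n ^ 3 * (B\<^sup>2 / real d + \<eta>\<^sup>2) / min 1 v"
    by (simp add: \<beta>_def power3_eq_cube)
  finally show ?thesis .
qed

end

lemma PiM_UNIV_compose:
  assumes "F \<in> borel_measurable (borels UNIV)" "\<And>i. (\<lambda>x. V x i) \<in> borel_measurable M"
  shows "(\<lambda>x. F (V x) :: real) \<in> borel_measurable M"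
proof -
  have "V \<in> measurable M (borels UNIV)"
    using assms(2) by (intro measurable_PiM_single') auto
  from measurable_compose[OF this assms(1)] show ?thesis .
qed

lemma integrable_mult_bounded:
  fixes f h :: "'a \<Rightarrow> real"
  assumes "integrable M f" "h \<in> borel_measurable M" "\<And>x. \<bar>h x\<bar> \<le> C"
  shows "integrable M (\<lambda>x. f x * h x)"
proof (rule integrable_bound)
  show "integrable M (\<lambda>x. C * f x)" using assms(1) by simp
  show "(\<lambda>x. f x * h x) \<in> borel_measurable M" using assms(1,2) by measurable
  show "AE x in M. norm (f x * h x) \<le> norm (C * f x)"
  proof (rule AE_I2)
    fix x
    have "\<bar>f x\<bar> * \<bar>h x\<bar> \<le> \<bar>f x\<bar> * \<bar>C\<bar>" using assms(3)[of x] by (intro mult_left_mono) auto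
    then show "norm (f x * h x) \<le> norm (C * f x)" by (simp add: abs_mult mult.commute)
  qed
qed

lemma integrable_if:
  fixes f :: "'a \<Rightarrow> real"
  assumes "P \<Longrightarrow> integrable M f" shows "integrable M (\<lambda>x. if P then f x else 0)"
  using assms by (cases P) auto

lemma integrable_pair_fst:
  fixes f :: "'a \<Rightarrow> real"
  assumes "prob_space M" "prob_space N" "integrable M f"
  shows "integrable (M \<Otimes>\<^sub>M N) (\<lambda>p. f (fst p))"
proof -
  have "integrable (distr (M \<Otimes>\<^sub>M N) M fst) f" unfolding prob_space.distr_pair_fst[OF assms(2)] by (rule assms(3))
  then show ?thesis by (rule integrable_distr[OF measurable_fst])
qed

lemma integrable_pair_snd:
  fixes f :: "'b \<Rightarrow> real"
  assumes M: "prob_space M" and N: "prob_space N" and f: "integrable N f"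
  shows "integrable (M \<Otimes>\<^sub>M N) (\<lambda>p. f (snd p))"
proof -
  interpret M: prob_space M by fact
  interpret N: prob_space N by fact
  interpret pair_sigma_finite M N ..
  show ?thesis by (rule Fubini_integrable) (use f in auto)
qed

section \<open>Derivatives of covariance entries and Stein identities on the product space\<close>

context stein_array
begin

definition wis :: "(nat \<times> nat \<Rightarrow> real) \<Rightarrow> nat \<times> nat \<Rightarrow> real" where
  "wis u c = (\<Sum>k<d. u (fst c, k) * u (snd c, k) - (if fst c = snd c then 1 else 0)) / sqrt (real d)"

definition dwis :: "nat \<times> nat \<Rightarrow> nat \<Rightarrow> nat \<Rightarrow> (nat \<times> nat \<Rightarrow> real) \<Rightarrow> real" where
  "dwis c i k u = ((if fst c = i then u (snd c, k) else 0) + (if snd c = i then u (fst c, k) else 0)) / sqrt (real d)"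

lemma DERIV_coord: "((\<lambda>t. (u(\<kappa> := t)) p) has_real_derivative (if p = \<kappa> then 1 else 0)) (at (t0 :: real))"
  by (cases "p = \<kappa>") auto

lemma wis_deriv:
  assumes k: "k < d"
  shows "((\<lambda>t. wis (u((i, k) := t)) c) has_real_derivative dwis c i k (u((i, k) := t0))) (at t0)"
proof -
  obtain a b where c: "c = (a, b)" by (cases c)
  let ?u = "u((i, k) := t0)"
  have "((\<lambda>t. (\<Sum>k'<d. (u((i, k) := t)) (a, k') * (u((i, k) := t)) (b, k') - (if a = b then 1 else 0))) has_real_derivative
     (\<Sum>k'<d. ((if (a, k') = (i, k) then 1 else 0) * ?u (b, k') + (if (b, k') = (i, k) then 1 else 0) * ?u (a, k')) - 0)) (at t0)"
    by (intro DERIV_sum DERIV_diff DERIV_mult DERIV_coord DERIV_const)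
  also have "(\<Sum>k'<d. ((if (a, k') = (i, k) then 1 else 0) * ?u (b, k') + (if (b, k') = (i, k) then 1 else 0) * ?u (a, k')) - 0) =
     (\<Sum>k'<d. if k' = k then (if a = i then ?u (b, k) else 0) + (if b = i then ?u (a, k) else 0) else 0)"
    by (intro sum.cong refl) (auto simp del: fun_upd_apply)
  also have "\<dots> = (if a = i then ?u (b, k) else 0) + (if b = i then ?u (a, k) else 0)"
    using k by (simp del: fun_upd_apply)
  finally show ?thesis unfolding wis_def dwis_def c fst_conv snd_conv by (rule DERIV_cdivide)
qed

lemma wis_measurable [measurable]: "(\<lambda>\<omega>. wis (y \<omega>) c) \<in> borel_measurable Prod"
  unfolding wis_def by measurable

lemma comp_integrable:
  fixes f :: "'a \<Rightarrow> real"
  assumes \<kappa>: "\<kappa> \<in> K" and f: "integrable (\<Omega> \<kappa>) f"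
  shows "integrable Prod (\<lambda>\<omega>. f (\<omega> \<kappa>))"
proof -
  interpret product_prob_space \<Omega> by (rule product_prob)
  have i: "integrable (\<Omega> \<kappa>') (\<lambda>x. if \<kappa>' = \<kappa> then f x else 1)" for \<kappa>'
  proof -
    interpret prob_space "\<Omega> \<kappa>'" by (rule prob_\<Omega>)
    show ?thesis using f by (cases "\<kappa>' = \<kappa>") auto
  qed
  have "integrable Prod (\<lambda>\<omega>. \<Prod>\<kappa>'\<in>K. if \<kappa>' = \<kappa> then f (\<omega> \<kappa>') else 1)"
    unfolding Prod_def by (rule product_integrable_prod[OF finK, where f="\<lambda>\<kappa>' x. if \<kappa>' = \<kappa> then f x else 1"]) (rule i)
  then show ?thesis using finK \<kappa> by (simp add: prod.delta)
qed

lemma y_mult_integrable: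
  assumes "a \<in> K" "b \<in> K" shows "integrable Prod (\<lambda>\<omega>. y \<omega> a * y \<omega> b)"
proof -
  have i: "integrable Prod (\<lambda>\<omega>. (y \<omega> \<kappa>)\<^sup>2)" if "\<kappa> \<in> K" for \<kappa>
    unfolding y_def by (rule comp_integrable[OF that, of "\<lambda>x. (Y \<kappa> x)\<^sup>2"]) (rule stein_pair_moments(2)[OF sp])
  show ?thesis
    by (rule Cauchy_Schwarz_integral(1)[OF y_measurable y_measurable i[OF assms(1)] i[OF assms(2)]])
qed

lemma wis_term_integrable:
  assumes "i < n" "j < n" "k < d"
  shows "integrable Prod (\<lambda>\<omega>. y \<omega> (i, k) * y \<omega> (j, k) - (if i = j then 1 else 0))"
proof -
  interpret prob_space Prod by (rule prob_Prod)
  show ?thesis using assms by (intro integrable_diff y_mult_integrable) (auto simp: K_def)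
qed

lemma wis_integrable: "c \<in> J \<Longrightarrow> integrable Prod (\<lambda>\<omega>. wis (y \<omega>) c)"
  unfolding wis_def
  by (intro integrable_divide integrable_sum wis_term_integrable) (auto simp: J_def)

text \<open>Fubini freezes all coordinates but \<open>\<kappa>\<close>, where the one-dimensional
  Stein identity applies. The kernels may depend on the whole point of
  \<open>\<Omega> \<kappa>\<close>; the test function only sees it through
  \<open>Y \<kappa>\<close>.\<close>

lemma kernel_product:
  assumes \<kappa>: "\<kappa> \<in> K"
    and der: "\<And>u t. ((\<lambda>s. \<Phi> (u(\<kappa> := s))) has_real_derivative \<Phi>' (u(\<kappa> := t))) (at t)"
    and gr: "\<And>u. \<exists>c. \<forall>t. \<bar>\<Phi>' (u(\<kappa> := t))\<bar> \<le> c * (1 + t\<^sup>2)"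
  shows "integrable Prod (\<lambda>\<omega>. y \<omega> \<kappa> * \<Phi> (y \<omega>)) \<Longrightarrow> integrable Prod (\<lambda>\<omega>. T \<kappa> (\<omega> \<kappa>) * \<Phi>' (y \<omega>)) \<Longrightarrow>
      (\<integral>\<omega>. y \<omega> \<kappa> * \<Phi> (y \<omega>) \<partial>Prod) = (\<integral>\<omega>. T \<kappa> (\<omega> \<kappa>) * \<Phi>' (y \<omega>) \<partial>Prod)"
    and "integrable Prod (\<lambda>\<omega>. ((y \<omega> \<kappa>)\<^sup>2 - 1) * \<Phi> (y \<omega>)) \<Longrightarrow> integrable Prod (\<lambda>\<omega>. S \<kappa> (\<omega> \<kappa>) * \<Phi>' (y \<omega>)) \<Longrightarrow>
      (\<integral>\<omega>. ((y \<omega> \<kappa>)\<^sup>2 - 1) * \<Phi> (y \<omega>) \<partial>Prod) = (\<integral>\<omega>. S \<kappa> (\<omega> \<kappa>) * \<Phi>' (y \<omega>) \<partial>Prod)"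
proof -
  interpret product_prob_space \<Omega> by (rule product_prob)
  have K: "K = insert \<kappa> (K - {\<kappa>})" using \<kappa> by auto
  have ins: "(\<integral>\<omega>. f \<omega> \<partial>Prod) = (\<integral>x. (\<integral>z. f (x(\<kappa> := z)) \<partial>\<Omega> \<kappa>) \<partial>PiM (K - {\<kappa>}) \<Omega>)"
    if "integrable Prod f" for f :: "(nat \<times> nat \<Rightarrow> 'a) \<Rightarrow> real"
    using product_integral_insert[of "K - {\<kappa>}" \<kappa> f] that finK unfolding Prod_def K[symmetric] by simp
  have yu: "y (x(\<kappa> := z)) = (y x)(\<kappa> := Y \<kappa> z)" for x z by (rule ext) (simp add: y_def)
  have test: "stein_test (\<lambda>s. \<Phi> ((y x)(\<kappa> := s))) (\<lambda>s. \<Phi>' ((y x)(\<kappa> := s)))" for x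
    unfolding stein_test_def using der gr by blast
  note k = stein_pair_kernels[OF sp[of \<kappa>] test]
  show "(\<integral>\<omega>. y \<omega> \<kappa> * \<Phi> (y \<omega>) \<partial>Prod) = (\<integral>\<omega>. T \<kappa> (\<omega> \<kappa>) * \<Phi>' (y \<omega>) \<partial>Prod)"
    if "integrable Prod (\<lambda>\<omega>. y \<omega> \<kappa> * \<Phi> (y \<omega>))" "integrable Prod (\<lambda>\<omega>. T \<kappa> (\<omega> \<kappa>) * \<Phi>' (y \<omega>))"
    unfolding ins[OF that(1)] ins[OF that(2)] yu fun_upd_same k(1) ..
  show "(\<integral>\<omega>. ((y \<omega> \<kappa>)\<^sup>2 - 1) * \<Phi> (y \<omega>) \<partial>Prod) = (\<integral>\<omega>. S \<kappa> (\<omega> \<kappa>) * \<Phi>' (y \<omega>) \<partial>Prod)"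
    if "integrable Prod (\<lambda>\<omega>. ((y \<omega> \<kappa>)\<^sup>2 - 1) * \<Phi> (y \<omega>))" "integrable Prod (\<lambda>\<omega>. S \<kappa> (\<omega> \<kappa>) * \<Phi>' (y \<omega>))"
    unfolding ins[OF that(1)] ins[OF that(2)] yu fun_upd_same k(2) ..
qed

end

section \<open>Gaussian interpolation\<close>

text \<open>\<open>G\<close> is smoothed at scale \<open>e\<close> so that the interpolated mean can
  be differentiated at every angle; \<open>e\<close> is absent from the resulting estimate.\<close>

locale stein_smooth = stein_array +
  fixes G :: "(nat \<times> nat \<Rightarrow> real) \<Rightarrow> real" and L e :: real
  assumes Gm: "G \<in> borel_measurable (borels UNIV)" and Gl: "lip_on J L G" and L: "0 \<le> L" and e: "0 < e"
begin

lemma Gn: "nice J G" by (rule lip_on_nice[OF finJ Gm Gl L])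

definition gs :: "(nat \<times> nat \<Rightarrow> real) \<Rightarrow> real" where "gs = smooth J (\<lambda>_. e) G"
definition g :: "nat \<times> nat \<Rightarrow> (nat \<times> nat \<Rightarrow> real) \<Rightarrow> real" where "g b = smooth_grad J (\<lambda>_. e) G b"

lemma gs_measurable: "gs \<in> borel_measurable (borels UNIV)"
  unfolding gs_def by (rule smooth_measurable(1)[OF finJ Gn])
lemma g_measurable: "g b \<in> borel_measurable (borels UNIV)"
  unfolding g_def by (rule smooth_measurable(2)[OF finJ Gn])
lemma g_norm: "(\<Sum>b\<in>J. (g b u)\<^sup>2) \<le> L\<^sup>2"
  unfolding g_def by (rule smooth_grad_norm[OF finJ Gn Gl L]) (rule e)
lemma g_bounded: "b \<in> J \<Longrightarrow> \<bar>g b u\<bar> \<le> L"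
  unfolding g_def by (rule smooth_grad_bounded[OF finJ Gn Gl L]) (auto intro: e)
lemma g_nice: "b \<in> J \<Longrightarrow> nice J (g b)"
  by (rule nice_bounded[OF g_measurable _ g_bounded]) (auto simp: g_def intro: smooth_cong(2)[OF Gn])
lemma gs_lip: "lip_on J L gs"
  unfolding gs_def by (rule smooth_lip[OF finJ Gn Gl])

text \<open>\<open>A\<close> averages \<open>g b\<close> over the Gaussian part of the interpolation
  point, as a function of the data. This average is itself a smoothing, at scale
  \<open>cos \<theta> * sg c\<close>, so \<open>g b\<close> need not be differentiated: the
  derivative of \<open>A\<close> is expressed through \<open>sgr\<close>, where a Gaussian
  coordinate replaces the second derivative.\<close>

definition sgr :: "real \<Rightarrow> nat \<times> nat \<Rightarrow> nat \<times> nat \<Rightarrow> (nat \<times> nat \<Rightarrow> real) \<Rightarrow> real" where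
  "sgr \<theta> b c u = smooth_grad J (\<lambda>c. cos \<theta> * sg c) (g b) c (\<lambda>c. sin \<theta> * wis u c)"
definition A :: "real \<Rightarrow> nat \<times> nat \<Rightarrow> (nat \<times> nat \<Rightarrow> real) \<Rightarrow> real" where
  "A \<theta> b u = smooth J (\<lambda>c. cos \<theta> * sg c) (g b) (\<lambda>c. sin \<theta> * wis u c)"
definition m1 :: real where "m1 = (\<integral>z. (\<Sum>c\<in>J. \<bar>z c\<bar>) \<partial>gam J)"

lemma abs_sum_integrable: "integrable (gam J) (\<lambda>z. (\<Sum>c\<in>J. \<bar>z c\<bar>))"
  by (intro nice_integrable[OF finJ] nice_sum nice_abs nice_var finJ)

lemma g_affine_nice: "b \<in> J \<Longrightarrow> nice J (\<lambda>z. g b (\<lambda>c. x c + s c * z c))"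
  by (rule nice_affine[OF finJ g_nice])

text \<open>A crude bound that explodes as \<open>cos \<theta>\<close> tends to 0. It serves for
  integrability and growth only and does not enter the final estimate.\<close>

lemma sgr_bounded:
  assumes \<theta>: "0 < cos \<theta>" and b: "b \<in> J" and c: "c \<in> J"
  shows "\<bar>sgr \<theta> b c u\<bar> \<le> L * m1 / (cos \<theta> * sg c)"
proof -
  let ?N = "\<lambda>z. \<lambda>c. sin \<theta> * wis u c + cos \<theta> * sg c * z c"
  have i: "integrable (gam J) (\<lambda>z. g b (?N z) * z c)"
    by (rule nice_integrable[OF finJ nice_mult[OF g_affine_nice[OF b] nice_var[OF finJ c]]])
  have "\<bar>\<integral>z. g b (?N z) * z c \<partial>gam J\<bar> \<le> (\<integral>z. \<bar>g b (?N z) * z c\<bar> \<partial>gam J)" by (rule integral_abs_bound)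
  also have "\<dots> \<le> (\<integral>z. L * (\<Sum>c\<in>J. \<bar>z c\<bar>) \<partial>gam J)"
  proof (rule integral_mono)
    fix z :: "nat \<times> nat \<Rightarrow> real"
    have "\<bar>z c\<bar> \<le> (\<Sum>c\<in>J. \<bar>z c\<bar>)" using c finJ by (intro member_le_sum) auto
    then show "\<bar>g b (?N z) * z c\<bar> \<le> L * (\<Sum>c\<in>J. \<bar>z c\<bar>)"
      unfolding abs_mult using L by (intro mult_mono g_bounded[OF b]) auto
  qed (use i abs_sum_integrable in \<open>auto intro!: integrable_abs\<close>)
  finally have "\<bar>\<integral>z. g b (?N z) * z c \<partial>gam J\<bar> \<le> L * m1" by (simp add: m1_def)
  then show ?thesis unfolding sgr_def smooth_grad_def abs_divide
    using \<theta> sg_pos[of c] by (simp add: divide_right_mono)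
qed

lemma A_bounded:
  assumes b: "b \<in> J" shows "\<bar>A \<theta> b u\<bar> \<le> L"
proof -
  interpret prob_space "gam J" by (rule prob_gam)
  let ?N = "\<lambda>z. \<lambda>c. sin \<theta> * wis u c + cos \<theta> * sg c * z c"
  have i: "integrable (gam J) (\<lambda>z. g b (?N z))" by (rule nice_integrable[OF finJ g_affine_nice[OF b]])
  have "\<bar>A \<theta> b u\<bar> \<le> (\<integral>z. \<bar>g b (?N z)\<bar> \<partial>gam J)" unfolding A_def smooth_def by (rule integral_abs_bound)
  also have "\<dots> \<le> (\<integral>z. L \<partial>gam J)"
    by (rule integral_mono[OF integrable_abs[OF i] integrable_const g_bounded[OF b]])
  finally show ?thesis using prob_space by simp
qed

lemma sgr_measurable [measurable]: "b \<in> J \<Longrightarrow> (\<lambda>\<omega>. sgr \<theta> b c (y \<omega>)) \<in> borel_measurable Prod"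
  unfolding sgr_def by (rule PiM_UNIV_compose[OF smooth_measurable(2)[OF finJ g_nice]]) measurable

lemma A_measurable [measurable]: "b \<in> J \<Longrightarrow> (\<lambda>\<omega>. A \<theta> b (y \<omega>)) \<in> borel_measurable Prod"
  unfolding A_def by (rule PiM_UNIV_compose[OF smooth_measurable(1)[OF finJ g_nice]]) measurable

definition dA :: "real \<Rightarrow> nat \<times> nat \<Rightarrow> nat \<Rightarrow> nat \<Rightarrow> (nat \<times> nat \<Rightarrow> real) \<Rightarrow> real" where
  "dA \<theta> b i k u = (\<Sum>c\<in>J. (sin \<theta> * dwis c i k u) * sgr \<theta> b c u)"

lemma A_deriv:
  assumes \<theta>: "0 < cos \<theta>" and b: "b \<in> J" and k: "k < d"
  shows "((\<lambda>t. A \<theta> b (u((i, k) := t))) has_real_derivative dA \<theta> b i k (u((i, k) := t0))) (at t0)"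
  unfolding A_def dA_def sgr_def
proof (rule smooth_curve[where y="\<lambda>c t. sin \<theta> * wis (u((i, k) := t)) c" and y'="\<lambda>c t. sin \<theta> * dwis c i k (u((i, k) := t))",
      OF finJ g_nice[OF b]])
  show "0 < cos \<theta> * sg c" for c using \<theta> sg_pos by simp
  show "((\<lambda>t. sin \<theta> * wis (u((i, k) := t)) c) has_real_derivative sin \<theta> * dwis c i k (u((i, k) := t))) (at t)" for c t
    by (rule DERIV_cmult[OF wis_deriv[OF k]])
  fix c
  have "isCont (\<lambda>t. (u((i, k) := t)) p) t0" for p by (rule DERIV_isCont[OF DERIV_coord])
  then show "isCont (\<lambda>t. sin \<theta> * dwis c i k (u((i, k) := t))) t0"
    unfolding dwis_def using d by (cases "fst c = i"; cases "snd c = i") (auto intro!: continuous_intros simp del: fun_upd_apply)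
qed

lemma growth_sum:
  assumes "\<And>c. c \<in> C \<Longrightarrow> \<exists>k. \<forall>t. \<bar>f c t\<bar> \<le> k * (1 + t\<^sup>2)"
  shows "\<exists>k. \<forall>t::real. \<bar>\<Sum>c\<in>C. f c t :: real\<bar> \<le> k * (1 + t\<^sup>2)"
proof -
  have "\<forall>c\<in>C. \<exists>k. \<forall>t. \<bar>f c t\<bar> \<le> k * (1 + t\<^sup>2)" using assms by blast
  then obtain k where k: "\<And>c t. c \<in> C \<Longrightarrow> \<bar>f c t\<bar> \<le> k c * (1 + t\<^sup>2)" by (metis bchoice)
  have "\<bar>\<Sum>c\<in>C. f c t\<bar> \<le> (\<Sum>c\<in>C. k c) * (1 + t\<^sup>2)" for t
  proof -
    have "\<bar>\<Sum>c\<in>C. f c t\<bar> \<le> (\<Sum>c\<in>C. \<bar>f c t\<bar>)" by (rule sum_abs)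
    also have "\<dots> \<le> (\<Sum>c\<in>C. k c * (1 + t\<^sup>2))" by (intro sum_mono k)
    finally show ?thesis by (simp add: sum_distrib_right)
  qed
  then show ?thesis by blast
qed

lemma dA_growth:
  assumes \<theta>: "0 < cos \<theta>" and b: "b \<in> J"
  shows "\<exists>c. \<forall>t. \<bar>dA \<theta> b i k (u((i, k) := t))\<bar> \<le> c * (1 + t\<^sup>2)"
  unfolding dA_def
proof (rule growth_sum)
  fix c assume c: "c \<in> J"
  have one: "\<bar>(u((i, k) := t)) p\<bar> \<le> (\<bar>u p\<bar> + 1) * (1 + t\<^sup>2)" for p t
  proof (cases "p = (i, k)")
    case True
    have "0 \<le> (\<bar>t\<bar> - 1)\<^sup>2" by simp
    then have "\<bar>t\<bar> \<le> 1 * (1 + t\<^sup>2)" by (simp add: power2_diff)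
    also have "\<dots> \<le> (\<bar>u p\<bar> + 1) * (1 + t\<^sup>2)" by (intro mult_right_mono) auto
    finally show ?thesis using True by simp
  next
    case False
    have "(\<bar>u p\<bar> + 1) * 1 \<le> (\<bar>u p\<bar> + 1) * (1 + t\<^sup>2)" by (intro mult_left_mono) auto
    then show ?thesis using False by simp
  qed
  define M where "M = (\<bar>u (snd c, k)\<bar> + 1) + (\<bar>u (fst c, k)\<bar> + 1)"
  define N where "N = L * m1 / (cos \<theta> * sg c)"
  have sd: "1 \<le> sqrt (real d)" using d by simp
  have "\<bar>(sin \<theta> * dwis c i k (u((i, k) := t))) * sgr \<theta> b c (u((i, k) := t))\<bar> \<le> (M * N) * (1 + t\<^sup>2)" for t
  proof -
    have "\<bar>dwis c i k (u((i, k) := t))\<bar> \<le> \<bar>(if fst c = i then (u((i, k) := t)) (snd c, k) else 0) + (if snd c = i then (u((i, k) := t)) (fst c, k) else 0)\<bar> / 1"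
      unfolding dwis_def abs_divide using sd by (intro frac_le) auto
    also have "\<dots> \<le> \<bar>(u((i, k) := t)) (snd c, k)\<bar> + \<bar>(u((i, k) := t)) (fst c, k)\<bar>"
      by (auto simp del: fun_upd_apply)
    also have "\<dots> \<le> M * (1 + t\<^sup>2)" unfolding M_def distrib_right[of "_ + 1" "_ + 1"] by (intro add_mono one)
    finally have D: "\<bar>dwis c i k (u((i, k) := t))\<bar> \<le> M * (1 + t\<^sup>2)" .
    have "\<bar>sin \<theta> * dwis c i k (u((i, k) := t))\<bar> \<le> 1 * (M * (1 + t\<^sup>2))"
      unfolding abs_mult using D by (intro mult_mono) auto
    then have "\<bar>sin \<theta> * dwis c i k (u((i, k) := t))\<bar> * \<bar>sgr \<theta> b c (u((i, k) := t))\<bar> \<le> (M * (1 + t\<^sup>2)) * N"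
      using sgr_bounded[OF \<theta> b c, of "u((i, k) := t)"] by (intro mult_mono) (auto simp: N_def M_def)
    then show ?thesis by (simp add: abs_mult mult_ac)
  qed
  then show "\<exists>m. \<forall>t. \<bar>(sin \<theta> * dwis c i k (u((i, k) := t))) * sgr \<theta> b c (u((i, k) := t))\<bar> \<le> m * (1 + t\<^sup>2)" by blast
qed

lemma kern_dwis:
  "kern i j k \<omega> * dwis c i k (y \<omega>) = ((if fst c = i then trm i j (snd c) k \<omega> else 0) + (if snd c = i then trm i j (fst c) k \<omega> else 0)) / sqrt (real d)"
  by (simp add: dwis_def trm_def distrib_left)

lemma kern_dA_eq:
  "kern i j k \<omega> * dA \<theta> b i k (y \<omega>) = (\<Sum>c\<in>J. (sin \<theta> * (kern i j k \<omega> * dwis c i k (y \<omega>))) * sgr \<theta> b c (y \<omega>))"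
  unfolding dA_def sum_distrib_left by (intro sum.cong refl) simp

lemma kern_dA_integrable:
  assumes \<theta>: "0 < cos \<theta>" and b: "b \<in> J" and ij: "i < n" "j < n" and k: "k < d"
  shows "integrable Prod (\<lambda>\<omega>. kern i j k \<omega> * dA \<theta> b i k (y \<omega>))"
  unfolding kern_dA_eq
proof (intro integrable_sum)
  fix c assume c: "c \<in> J"
  then have lt: "fst c < n" "snd c < n" by (auto simp: J_def)
  have "integrable Prod (\<lambda>\<omega>. kern i j k \<omega> * dwis c i k (y \<omega>))"
    unfolding kern_dwis using trm_integral(1)[OF ij lt(1) k] trm_integral(1)[OF ij lt(2) k]
    by (intro integrable_divide integrable_add integrable_if)
  then have "integrable Prod (\<lambda>\<omega>. sin \<theta> * (kern i j k \<omega> * dwis c i k (y \<omega>)))" by simp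
  then show "integrable Prod (\<lambda>\<omega>. (sin \<theta> * (kern i j k \<omega> * dwis c i k (y \<omega>))) * sgr \<theta> b c (y \<omega>))"
    by (rule integrable_mult_bounded[OF _ sgr_measurable[OF b] sgr_bounded[OF \<theta> b c]])
qed

text \<open>A diagonal product is a centred square of one entry, handled by \<open>S\<close>. Off
  the diagonal \<open>y (j, k)\<close> is constant in the coordinate \<open>(i, k)\<close>, so it
  joins the test function and \<open>T\<close> applies.\<close>

lemma ibp_entry:
  assumes \<theta>: "0 < cos \<theta>" and b: "b \<in> J" and ij: "i < n" "j < n" and k: "k < d"
  shows "(\<integral>\<omega>. (y \<omega> (i, k) * y \<omega> (j, k) - (if i = j then 1 else 0)) * A \<theta> b (y \<omega>) \<partial>Prod) =
    (\<integral>\<omega>. kern i j k \<omega> * dA \<theta> b i k (y \<omega>) \<partial>Prod)"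
proof (cases "i = j")
  case True
  have K: "(i, k) \<in> K" using ij k by (auto simp: K_def)
  have "integrable Prod (\<lambda>\<omega>. ((y \<omega> (i, k))\<^sup>2 - 1) * A \<theta> b (y \<omega>))"
    using integrable_mult_bounded[OF wis_term_integrable[OF ij k] A_measurable[OF b] A_bounded[OF b], of \<theta>] True
    by (simp add: power2_eq_square)
  moreover have "integrable Prod (\<lambda>\<omega>. S (i, k) (\<omega> (i, k)) * dA \<theta> b i k (y \<omega>))"
    using kern_dA_integrable[OF \<theta> b ij k] True by (simp add: kern_def)
  ultimately have "(\<integral>\<omega>. ((y \<omega> (i, k))\<^sup>2 - 1) * A \<theta> b (y \<omega>) \<partial>Prod) = (\<integral>\<omega>. S (i, k) (\<omega> (i, k)) * dA \<theta> b i k (y \<omega>) \<partial>Prod)"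
    by (rule kernel_product(2)[OF K A_deriv[OF \<theta> b k] dA_growth[OF \<theta> b]])
  then show ?thesis using True by (simp add: kern_def power2_eq_square)
next
  case False
  have K: "(i, k) \<in> K" "(j, k) \<in> K" using ij k by (auto simp: K_def)
  let ?\<Phi> = "\<lambda>u. u (j, k) * A \<theta> b u" and ?\<Phi>' = "\<lambda>u. u (j, k) * dA \<theta> b i k u"
  have "integrable Prod (\<lambda>\<omega>. (y \<omega> (i, k) * y \<omega> (j, k)) * A \<theta> b (y \<omega>))"
    by (rule integrable_mult_bounded[OF y_mult_integrable[OF K] A_measurable[OF b] A_bounded[OF b]])
  then have 1: "integrable Prod (\<lambda>\<omega>. y \<omega> (i, k) * ?\<Phi> (y \<omega>))" by (simp add: mult.assoc)
  have 2: "integrable Prod (\<lambda>\<omega>. T (i, k) (\<omega> (i, k)) * ?\<Phi>' (y \<omega>))"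
    using kern_dA_integrable[OF \<theta> b ij k] False by (simp add: kern_def mult.assoc)
  have "(\<integral>\<omega>. y \<omega> (i, k) * ?\<Phi> (y \<omega>) \<partial>Prod) = (\<integral>\<omega>. T (i, k) (\<omega> (i, k)) * ?\<Phi>' (y \<omega>) \<partial>Prod)"
  proof (rule kernel_product(1)[OF K(1) _ _ 1 2])
    fix u :: "nat \<times> nat \<Rightarrow> real" and t :: real
    have up: "(u((i, k) := s)) (j, k) = u (j, k)" for s using False by simp
    show "((\<lambda>s. (u((i, k) := s)) (j, k) * A \<theta> b (u((i, k) := s))) has_real_derivative
        (u((i, k) := t)) (j, k) * dA \<theta> b i k (u((i, k) := t))) (at t)"
      unfolding up by (rule DERIV_cmult[OF A_deriv[OF \<theta> b k]])
    obtain c where c: "\<And>t. \<bar>dA \<theta> b i k (u((i, k) := t))\<bar> \<le> c * (1 + t\<^sup>2)" using dA_growth[OF \<theta> b] by blast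
    have "\<bar>(u((i, k) := t)) (j, k) * dA \<theta> b i k (u((i, k) := t))\<bar> \<le> (\<bar>u (j, k)\<bar> * c) * (1 + t\<^sup>2)" for t
      unfolding up abs_mult mult.assoc by (rule mult_left_mono[OF c]) simp
    then show "\<exists>c. \<forall>t. \<bar>(u((i, k) := t)) (j, k) * dA \<theta> b i k (u((i, k) := t))\<bar> \<le> c * (1 + t\<^sup>2)" by blast
  qed
  then show ?thesis using False by (simp add: kern_def mult.assoc)
qed

lemma tau_measurable [measurable]: "tau b c \<in> borel_measurable Prod"
  unfolding tau_def[abs_def] by measurable

lemma tau_integrable: "b \<in> J \<Longrightarrow> c \<in> J \<Longrightarrow> integrable Prod (tau b c)"
  unfolding tau_def[abs_def]
  by (intro integrable_add integrable_if integrable_divide integrable_sum trm_integral(1))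
    (auto simp: J_def)

lemma ibp_wis:
  assumes \<theta>: "0 < cos \<theta>" and b: "b \<in> J"
  shows "(\<integral>\<omega>. wis (y \<omega>) b * A \<theta> b (y \<omega>) \<partial>Prod) = (\<integral>\<omega>. (\<Sum>c\<in>J. (sin \<theta> * tau b c \<omega>) * sgr \<theta> b c (y \<omega>)) \<partial>Prod)"
proof -
  obtain i j where bij: "b = (i, j)" by (cases b)
  with b have ij: "i < n" "j < n" by (auto simp: J_def)
  let ?E = "\<lambda>k \<omega>. (y \<omega> (i, k) * y \<omega> (j, k) - (if i = j then 1 else 0)) * A \<theta> b (y \<omega>)"
  have iE: "integrable Prod (?E k)" if "k < d" for k
    by (rule integrable_mult_bounded[OF wis_term_integrable[OF ij that] A_measurable[OF b] A_bounded[OF b]])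
  have "(\<integral>\<omega>. wis (y \<omega>) b * A \<theta> b (y \<omega>) \<partial>Prod) = (\<integral>\<omega>. (\<Sum>k<d. ?E k \<omega>) / sqrt (real d) \<partial>Prod)"
    by (simp add: wis_def bij sum_distrib_right)
  also have "\<dots> = (\<Sum>k<d. \<integral>\<omega>. ?E k \<omega> \<partial>Prod) / sqrt (real d)"
    using iE by (simp only: integral_divide_zero) (subst integral_sum, auto)
  also have "\<dots> = (\<Sum>k<d. \<integral>\<omega>. kern i j k \<omega> * dA \<theta> b i k (y \<omega>) \<partial>Prod) / sqrt (real d)"
    using ibp_entry[OF \<theta> b ij] by simp
  also have "\<dots> = (\<integral>\<omega>. (\<Sum>k<d. kern i j k \<omega> * dA \<theta> b i k (y \<omega>)) / sqrt (real d) \<partial>Prod)"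
    using kern_dA_integrable[OF \<theta> b ij] by (simp only: integral_divide_zero) (subst integral_sum, auto)
  also have "\<dots> = (\<integral>\<omega>. (\<Sum>c\<in>J. (sin \<theta> * tau b c \<omega>) * sgr \<theta> b c (y \<omega>)) \<partial>Prod)"
  proof (intro integral_cong refl)
    fix \<omega>
    \<comment> \<open>One factor \<open>1 / sqrt d\<close> comes from \<open>wis\<close>, the other
      from its derivative; together they make \<open>tau\<close> an average over the
      columns.\<close>
    have tau: "(\<Sum>k<d. kern i j k \<omega> * dwis c i k (y \<omega>)) / sqrt (real d) = tau b c \<omega>" for c
    proof -
      have "(\<Sum>k<d. kern i j k \<omega> * dwis c i k (y \<omega>)) / sqrt (real d) =
        (\<Sum>k<d. (if fst c = i then trm i j (snd c) k \<omega> else 0) + (if snd c = i then trm i j (fst c) k \<omega> else 0)) / (sqrt (real d) * sqrt (real d))"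
        unfolding kern_dwis sum_divide_distrib[symmetric] by simp
      also have "sqrt (real d) * sqrt (real d) = real d" by simp
      also have "(\<Sum>k<d. (if fst c = i then trm i j (snd c) k \<omega> else 0) + (if snd c = i then trm i j (fst c) k \<omega> else 0)) / real d = tau b c \<omega>"
        by (simp add: tau_def bij sum.distrib add_divide_distrib)
      finally show ?thesis .
    qed
    have "(\<Sum>k<d. kern i j k \<omega> * dA \<theta> b i k (y \<omega>)) / sqrt (real d) =
      (\<Sum>c\<in>J. \<Sum>k<d. (sin \<theta> * (kern i j k \<omega> * dwis c i k (y \<omega>))) * sgr \<theta> b c (y \<omega>)) / sqrt (real d)"
      unfolding kern_dA_eq by (subst sum.swap) (rule refl)
    also have "\<dots> = (\<Sum>c\<in>J. (sin \<theta> * ((\<Sum>k<d. kern i j k \<omega> * dwis c i k (y \<omega>)) / sqrt (real d))) * sgr \<theta> b c (y \<omega>))"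
      by (simp add: sum_divide_distrib sum_distrib_left sum_distrib_right)
    finally show "(\<Sum>k<d. kern i j k \<omega> * dA \<theta> b i k (y \<omega>)) / sqrt (real d) = (\<Sum>c\<in>J. (sin \<theta> * tau b c \<omega>) * sgr \<theta> b c (y \<omega>))"
      unfolding tau .
  qed
  finally show ?thesis .
qed

text \<open>This is where a Lipschitz bound suffices. The Gaussian coordinate is attached to the
  matrix, so the sum is the mean of the product of the gradient with the vector of linear forms
  \<open>\<Sum>c\<in>J. a b c * z c\<close>. The squared gradient is at most \<open>L^2\<close>, the
  mean square of that vector is the squared Hilbert-Schmidt norm of \<open>a\<close>, and Young's
  inequality with weight \<open>r\<close> separates the two. The weight stays free so that it can be
  chosen after averaging over the data.\<close>

lemma matrix_bound:
  fixes a :: "nat \<times> nat \<Rightarrow> nat \<times> nat \<Rightarrow> real"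
  assumes lam: "0 < r"
  shows "\<bar>\<Sum>b\<in>J. \<Sum>c\<in>J. a b c * (\<integral>z. g b (\<lambda>c. x c + s c * z c) * z c \<partial>gam J)\<bar> \<le> r * L\<^sup>2 / 2 + (\<Sum>b\<in>J. \<Sum>c\<in>J. (a b c)\<^sup>2) / (2 * r)"
proof -
  interpret prob_space "gam J" by (rule prob_gam)
  let ?g = "\<lambda>b z. g b (\<lambda>c. x c + s c * z c)"
  let ?v = "\<lambda>b z. \<Sum>c\<in>J. a b c * z c"
  have nv: "nice J (?v b)" for b by (intro nice_sum nice_mult[OF nice_const] nice_var finJ)
  have ig: "integrable (gam J) (\<lambda>z. a b c * (?g b z * z c))" if "b \<in> J" "c \<in> J" for b c
    by (rule nice_integrable[OF finJ nice_mult[OF nice_const nice_mult[OF g_affine_nice[OF that(1)] nice_var[OF finJ that(2)]]]])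
  have i1: "integrable (gam J) (\<lambda>z. \<Sum>b\<in>J. ?g b z * ?v b z)"
    by (intro nice_integrable[OF finJ] nice_sum nice_mult[OF g_affine_nice nv])
  have i2: "integrable (gam J) (\<lambda>z. \<Sum>b\<in>J. (?v b z)\<^sup>2)"
    by (intro nice_integrable[OF finJ] nice_sum nice_power nv)
  have "(\<Sum>b\<in>J. \<Sum>c\<in>J. a b c * (\<integral>z. ?g b z * z c \<partial>gam J)) = (\<Sum>b\<in>J. \<Sum>c\<in>J. \<integral>z. a b c * (?g b z * z c) \<partial>gam J)"
    by simp
  also have "\<dots> = (\<integral>z. (\<Sum>b\<in>J. \<Sum>c\<in>J. a b c * (?g b z * z c)) \<partial>gam J)"
  proof -
    have "(\<integral>z. (\<Sum>b\<in>J. \<Sum>c\<in>J. a b c * (?g b z * z c)) \<partial>gam J) = (\<Sum>b\<in>J. \<integral>z. (\<Sum>c\<in>J. a b c * (?g b z * z c)) \<partial>gam J)"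
      by (intro integral_sum integrable_sum ig)
    also have "\<dots> = (\<Sum>b\<in>J. \<Sum>c\<in>J. \<integral>z. a b c * (?g b z * z c) \<partial>gam J)"
      by (intro sum.cong refl integral_sum ig)
    finally show ?thesis ..
  qed
  also have "\<dots> = (\<integral>z. (\<Sum>b\<in>J. ?g b z * ?v b z) \<partial>gam J)"
    unfolding sum_distrib_left by (intro integral_cong refl sum.cong) simp
  finally have eq: "(\<Sum>b\<in>J. \<Sum>c\<in>J. a b c * (\<integral>z. ?g b z * z c \<partial>gam J)) = (\<integral>z. (\<Sum>b\<in>J. ?g b z * ?v b z) \<partial>gam J)" .
  have "\<bar>\<integral>z. (\<Sum>b\<in>J. ?g b z * ?v b z) \<partial>gam J\<bar> \<le> (\<integral>z. \<bar>\<Sum>b\<in>J. ?g b z * ?v b z\<bar> \<partial>gam J)"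
    by (rule integral_abs_bound)
  also have "\<dots> \<le> (\<integral>z. r * L\<^sup>2 / 2 + (\<Sum>b\<in>J. (?v b z)\<^sup>2) / (2 * r) \<partial>gam J)"
  proof (rule integral_mono)
    show "integrable (gam J) (\<lambda>z. r * L\<^sup>2 / 2 + (\<Sum>b\<in>J. (?v b z)\<^sup>2) / (2 * r))" using i2 by simp
    fix z
    have "\<bar>?g b z * ?v b z\<bar> \<le> r / 2 * (?g b z)\<^sup>2 + (?v b z)\<^sup>2 / (2 * r)" for b
    proof -
      have "0 \<le> (r * \<bar>?g b z\<bar> - \<bar>?v b z\<bar>)\<^sup>2 / (2 * r)" using lam by simp
      also have "\<dots> = r / 2 * (?g b z)\<^sup>2 + (?v b z)\<^sup>2 / (2 * r) - \<bar>?g b z * ?v b z\<bar>"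
        using lam by (simp add: power2_diff power_mult_distrib abs_mult add_divide_distrib diff_divide_distrib power2_eq_square[of r])
      finally show ?thesis by simp
    qed
    then have "(\<Sum>b\<in>J. \<bar>?g b z * ?v b z\<bar>) \<le> (\<Sum>b\<in>J. r / 2 * (?g b z)\<^sup>2 + (?v b z)\<^sup>2 / (2 * r))" by (intro sum_mono)
    also have "\<dots> = r / 2 * (\<Sum>b\<in>J. (?g b z)\<^sup>2) + (\<Sum>b\<in>J. (?v b z)\<^sup>2) / (2 * r)"
      by (simp only: sum.distrib sum_distrib_left sum_divide_distrib)
    also have "\<dots> \<le> r / 2 * L\<^sup>2 + (\<Sum>b\<in>J. (?v b z)\<^sup>2) / (2 * r)"
      using lam by (intro add_right_mono mult_left_mono g_norm) auto
    finally have F: "(\<Sum>b\<in>J. \<bar>?g b z * ?v b z\<bar>) \<le> r / 2 * L\<^sup>2 + (\<Sum>b\<in>J. (?v b z)\<^sup>2) / (2 * r)" .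
    show "\<bar>\<Sum>b\<in>J. ?g b z * ?v b z\<bar> \<le> r * L\<^sup>2 / 2 + (\<Sum>b\<in>J. (?v b z)\<^sup>2) / (2 * r)"
      using order_trans[OF sum_abs F] by (simp only: times_divide_eq_left)
  qed (use i1 in \<open>auto intro!: integrable_abs\<close>)
  also have "\<dots> = r * L\<^sup>2 / 2 + (\<integral>z. (\<Sum>b\<in>J. (?v b z)\<^sup>2) \<partial>gam J) / (2 * r)"
    using i2 prob_space by simp
  also have "(\<integral>z. (\<Sum>b\<in>J. (?v b z)\<^sup>2) \<partial>gam J) = (\<Sum>b\<in>J. \<integral>z. (?v b z)\<^sup>2 \<partial>gam J)"
    by (intro integral_sum nice_integrable[OF finJ] nice_power nv)
  also have "\<dots> = (\<Sum>b\<in>J. \<Sum>c\<in>J. (a b c)\<^sup>2)" by (simp add: gam_linear_square[OF finJ])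
  finally show ?thesis unfolding eq .
qed

end

text \<open>No integrability of \<open>f\<close> is needed, since the integral of a non-integrable function is \<open>0\<close>.\<close>

lemma integral_norm_bound_dominated:
  fixes f h :: "'a \<Rightarrow> real"
  assumes "integrable M h" "\<And>x. norm (f x) \<le> h x"
  shows "\<bar>\<integral>x. f x \<partial>M\<bar> \<le> (\<integral>x. h x \<partial>M)"
proof (cases "integrable M f")
  case True
  have "\<bar>\<integral>x. f x \<partial>M\<bar> \<le> (\<integral>x. \<bar>f x\<bar> \<partial>M)" by (rule integral_abs_bound)
  also have "\<dots> \<le> (\<integral>x. h x \<partial>M)"
    by (rule integral_mono[OF integrable_abs[OF True] assms(1)]) (use assms(2) in simp)
  finally show ?thesis .
next
  case False
  have "0 \<le> h x" for x using assms(2)[of x] by (rule order_trans[OF norm_ge_zero])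
  then have "0 \<le> (\<integral>x. h x \<partial>M)" by simp
  with False show ?thesis by (simp add: not_integrable_integral_eq)
qed

section \<open>The derivative along the quarter circle\<close>

context stein_smooth
begin

definition M2 :: "((nat \<times> nat \<Rightarrow> 'a) \<times> (nat \<times> nat \<Rightarrow> real)) measure" where "M2 = Prod \<Otimes>\<^sub>M gam J"

definition pt :: "real \<Rightarrow> (nat \<times> nat \<Rightarrow> 'a) \<Rightarrow> (nat \<times> nat \<Rightarrow> real) \<Rightarrow> nat \<times> nat \<Rightarrow> real" where
  "pt \<theta> \<omega> z = (\<lambda>c. sin \<theta> * wis (y \<omega>) c + cos \<theta> * sg c * z c)"

definition dpt :: "real \<Rightarrow> (nat \<times> nat \<Rightarrow> 'a) \<Rightarrow> (nat \<times> nat \<Rightarrow> real) \<Rightarrow> nat \<times> nat \<Rightarrow> real" where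
  "dpt \<theta> \<omega> z = (\<lambda>c. cos \<theta> * wis (y \<omega>) c - sin \<theta> * sg c * z c)"

text \<open>An integrable majorant, uniform in the angle, of the derivative along the path and, up
  to the constant \<open>gs (\<lambda>_. 0)\<close>, of the smoothed function itself.\<close>

definition env :: "(nat \<times> nat \<Rightarrow> 'a) \<times> (nat \<times> nat \<Rightarrow> real) \<Rightarrow> real" where
  "env p = L * (\<Sum>b\<in>J. \<bar>wis (y (fst p)) b\<bar> + sg b * \<bar>snd p b\<bar>)"

lemma M2_coord [measurable]:
  "(\<lambda>p. wis (y (fst p)) c) \<in> borel_measurable M2" "(\<lambda>p. snd p c) \<in> borel_measurable M2"
  unfolding M2_def
  by (rule measurable_compose[OF measurable_fst wis_measurable], rule measurable_compose[OF measurable_snd measurable_gam_component])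

lemma pt_measurable [measurable]: "(\<lambda>p. pt \<theta> (fst p) (snd p) c) \<in> borel_measurable M2"
  "(\<lambda>p. dpt \<theta> (fst p) (snd p) c) \<in> borel_measurable M2"
  unfolding pt_def dpt_def by measurable

lemma env_integrable: "integrable M2 env"
  unfolding env_def[abs_def]
proof (intro integrable_mult_right integrable_sum integrable_add)
  fix b assume b: "b \<in> J"
  show "integrable M2 (\<lambda>p. \<bar>wis (y (fst p)) b\<bar>)"
    unfolding M2_def by (rule integrable_pair_fst[OF prob_Prod prob_gam integrable_abs[OF wis_integrable[OF b]]])
  have "integrable (gam J) (\<lambda>z. \<bar>z b\<bar>)" by (rule nice_integrable[OF finJ nice_abs[OF nice_var[OF finJ b]]])
  then show "integrable M2 (\<lambda>p. \<bar>snd p b\<bar>)"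
    unfolding M2_def by (rule integrable_pair_snd[OF prob_Prod prob_gam])
qed

lemma abs_trig_le: "\<bar>sin \<theta> * a + cos \<theta> * s * x\<bar> \<le> \<bar>a\<bar> + s * \<bar>x\<bar>" "\<bar>cos \<theta> * a - sin \<theta> * s * x\<bar> \<le> \<bar>a\<bar> + s * \<bar>x\<bar>"
  if "0 \<le> s" for s :: real
proof -
  have 1: "\<bar>c * x\<bar> \<le> \<bar>x\<bar>" if "\<bar>c\<bar> \<le> 1" for c x :: real
    using that mult_right_mono[of "\<bar>c\<bar>" 1 "\<bar>x\<bar>"] by (simp add: abs_mult)
  have 2: "\<bar>c * s * x\<bar> \<le> s * \<bar>x\<bar>" if "\<bar>c\<bar> \<le> 1" for c x :: real
    using 1[OF that, of "s * x"] \<open>0 \<le> s\<close> by (simp add: abs_mult mult.assoc)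
  show "\<bar>sin \<theta> * a + cos \<theta> * s * x\<bar> \<le> \<bar>a\<bar> + s * \<bar>x\<bar>"
    using 1[of "sin \<theta>" a] 2[of "cos \<theta>" x] by simp
  show "\<bar>cos \<theta> * a - sin \<theta> * s * x\<bar> \<le> \<bar>a\<bar> + s * \<bar>x\<bar>"
    using 1[of "cos \<theta>" a] 2[of "sin \<theta>" x] by simp
qed

lemma gs_pt_integrable: "integrable M2 (\<lambda>p. gs (pt \<theta> (fst p) (snd p)))"
proof -
  interpret prob_space M2 unfolding M2_def by (rule prob_space_pair[OF prob_Prod prob_gam])
  show ?thesis
  proof (rule integrable_bound)
    show "integrable M2 (\<lambda>p. \<bar>gs (\<lambda>_. 0)\<bar> + env p)" using env_integrable by simp
    show "(\<lambda>p. gs (pt \<theta> (fst p) (snd p))) \<in> borel_measurable M2"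
      by (rule PiM_UNIV_compose[OF gs_measurable pt_measurable(1)])
    show "AE p in M2. norm (gs (pt \<theta> (fst p) (snd p))) \<le> norm (\<bar>gs (\<lambda>_. 0)\<bar> + env p)"
    proof (rule AE_I2)
      fix p
      let ?x = "pt \<theta> (fst p) (snd p)"
      have "\<bar>gs ?x - gs (\<lambda>_. 0)\<bar> \<le> L * (\<Sum>c\<in>J. \<bar>?x c - 0\<bar>)" by (rule lip_on_le_sum[OF gs_lip L])
      also have "\<dots> \<le> env p" unfolding env_def using L sg_pos
        by (intro mult_left_mono sum_mono) (simp_all add: pt_def abs_trig_le less_imp_le)
      finally show "norm (gs ?x) \<le> norm (\<bar>gs (\<lambda>_. 0)\<bar> + env p)" by simp
    qed
  qed
qed

definition \<Psi> :: "real \<Rightarrow> real" where "\<Psi> \<theta> = (\<integral>p. gs (pt \<theta> (fst p) (snd p)) \<partial>M2)"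

lemma Psi_deriv:
  shows "integrable M2 (\<lambda>p. \<Sum>b\<in>J. dpt \<theta> (fst p) (snd p) b * g b (pt \<theta> (fst p) (snd p)))"
    and "(\<Psi> has_real_derivative (\<integral>p. (\<Sum>b\<in>J. dpt \<theta> (fst p) (snd p) b * g b (pt \<theta> (fst p) (snd p))) \<partial>M2)) (at \<theta>)"
proof -
  have int: "integrable M2 (\<lambda>p. gs (pt t (fst p) (snd p)))" for t by (rule gs_pt_integrable)
  have der: "((\<lambda>t. gs (pt t (fst p) (snd p))) has_real_derivative
      (\<Sum>b\<in>J. dpt t (fst p) (snd p) b * g b (pt t (fst p) (snd p)))) (at t)" for t p
    unfolding gs_def g_def pt_def dpt_def
    by (rule smooth_curve[OF finJ Gn]) (auto intro!: derivative_eq_intros continuous_intros simp: e)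
  have bd: "\<bar>\<Sum>b\<in>J. dpt t (fst p) (snd p) b * g b (pt t (fst p) (snd p))\<bar> \<le> env p" for t p
  proof -
    have "\<bar>\<Sum>b\<in>J. dpt t (fst p) (snd p) b * g b (pt t (fst p) (snd p))\<bar> \<le>
      (\<Sum>b\<in>J. \<bar>dpt t (fst p) (snd p) b * g b (pt t (fst p) (snd p))\<bar>)" by (rule sum_abs)
    also have "\<dots> \<le> (\<Sum>b\<in>J. (\<bar>wis (y (fst p)) b\<bar> + sg b * \<bar>snd p b\<bar>) * L)"
    proof (rule sum_mono)
      fix b assume b: "b \<in> J"
      have "\<bar>dpt t (fst p) (snd p) b\<bar> \<le> \<bar>wis (y (fst p)) b\<bar> + sg b * \<bar>snd p b\<bar>"
        unfolding dpt_def by (rule abs_trig_le(2)) (rule less_imp_le[OF sg_pos])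
      then show "\<bar>dpt t (fst p) (snd p) b * g b (pt t (fst p) (snd p))\<bar> \<le> (\<bar>wis (y (fst p)) b\<bar> + sg b * \<bar>snd p b\<bar>) * L"
        unfolding abs_mult using g_bounded[OF b] less_imp_le[OF sg_pos[of b]] by (intro mult_mono) auto
    qed
    also have "\<dots> = env p" unfolding env_def by (simp add: sum_distrib_left mult.commute)
    finally show ?thesis .
  qed
  show "integrable M2 (\<lambda>p. \<Sum>b\<in>J. dpt \<theta> (fst p) (snd p) b * g b (pt \<theta> (fst p) (snd p)))"
    by (rule has_real_derivative_integral(1)[where f="\<lambda>t p. gs (pt t (fst p) (snd p))" and h=env and
          f'="\<lambda>t p. \<Sum>b\<in>J. dpt t (fst p) (snd p) b * g b (pt t (fst p) (snd p))" and \<delta>=1])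
       (simp, rule int, rule der, rule bd, rule env_integrable)
  show "(\<Psi> has_real_derivative (\<integral>p. (\<Sum>b\<in>J. dpt \<theta> (fst p) (snd p) b * g b (pt \<theta> (fst p) (snd p))) \<partial>M2)) (at \<theta>)"
    unfolding \<Psi>_def[abs_def]
    by (rule has_real_derivative_integral(2)[where f="\<lambda>t p. gs (pt t (fst p) (snd p))" and h=env and
          f'="\<lambda>t p. \<Sum>b\<in>J. dpt t (fst p) (snd p) b * g b (pt t (fst p) (snd p))" and \<delta>=1])
       (simp, rule int, rule der, rule bd, rule env_integrable)
qed

text \<open>Integration by parts in the data turns the first half of \<open>dpt\<close> into
  \<open>sin \<theta> * cos \<theta>\<close> times \<open>tau\<close> against \<open>sgr\<close>;
  the Gaussian half gives the same expression with minus the squared scales on the diagonal. Their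
  difference is governed by \<open>amat\<close>, and the factor \<open>cos \<theta> * sg c\<close>
  converts \<open>sgr\<close> back into a mean of \<open>g b\<close> times \<open>z c\<close>,
  leaving only \<open>sin \<theta>\<close>.\<close>

lemma Psi_deriv_eq:
  assumes \<theta>: "0 < cos \<theta>"
  shows "(\<integral>p. (\<Sum>b\<in>J. dpt \<theta> (fst p) (snd p) b * g b (pt \<theta> (fst p) (snd p))) \<partial>M2) =
    (\<integral>\<omega>. sin \<theta> * (\<Sum>b\<in>J. \<Sum>c\<in>J. amat b c \<omega> * (\<integral>z. g b (pt \<theta> \<omega> z) * z c \<partial>gam J)) \<partial>Prod)"
proof -
  interpret A: prob_space Prod by (rule prob_Prod)
  interpret B: prob_space "gam J" by (rule prob_gam)
  interpret pair_sigma_finite Prod "gam J" ..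
  have gz: "(\<integral>z. g b (pt \<theta> \<omega> z) * z c \<partial>gam J) = cos \<theta> * sg c * sgr \<theta> b c (y \<omega>)" for b c \<omega>
    unfolding sgr_def smooth_grad_def pt_def using \<theta> sg_pos[of c] by simp
  have gA: "(\<integral>z. g b (pt \<theta> \<omega> z) \<partial>gam J) = A \<theta> b (y \<omega>)" for b \<omega>
    unfolding A_def smooth_def pt_def by (simp add: mult.assoc)
  have ng: "nice J (\<lambda>z. g b (pt \<theta> \<omega> z))" if "b \<in> J" for b \<omega>
    unfolding pt_def by (rule g_affine_nice[OF that])
  have "(\<integral>p. (\<Sum>b\<in>J. dpt \<theta> (fst p) (snd p) b * g b (pt \<theta> (fst p) (snd p))) \<partial>M2) =
     (\<integral>\<omega>. (\<integral>z. (\<Sum>b\<in>J. dpt \<theta> \<omega> z b * g b (pt \<theta> \<omega> z)) \<partial>gam J) \<partial>Prod)"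
    using integral_fst'[OF Psi_deriv(1)[unfolded M2_def]] by (simp add: M2_def)
  also have "\<dots> = (\<integral>\<omega>. (\<Sum>b\<in>J. cos \<theta> * (wis (y \<omega>) b * A \<theta> b (y \<omega>)) - (sin \<theta> * cos \<theta> * (sg b)\<^sup>2) * sgr \<theta> b b (y \<omega>)) \<partial>Prod)"
  proof (intro integral_cong refl)
    fix \<omega>
    have i1: "integrable (gam J) (\<lambda>z. g b (pt \<theta> \<omega> z))" if "b \<in> J" for b
      by (rule nice_integrable[OF finJ ng[OF that]])
    have i2: "integrable (gam J) (\<lambda>z. g b (pt \<theta> \<omega> z) * z b)" if "b \<in> J" for b
      by (rule nice_integrable[OF finJ nice_mult[OF ng[OF that] nice_var[OF finJ that]]])
    have e: "dpt \<theta> \<omega> z b * g b (pt \<theta> \<omega> z) = (cos \<theta> * wis (y \<omega>) b) * g b (pt \<theta> \<omega> z) - (sin \<theta> * sg b) * (g b (pt \<theta> \<omega> z) * z b)" for z b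
      unfolding dpt_def by (simp add: algebra_simps)
    have "(\<integral>z. (\<Sum>b\<in>J. dpt \<theta> \<omega> z b * g b (pt \<theta> \<omega> z)) \<partial>gam J) =
       (\<Sum>b\<in>J. \<integral>z. (cos \<theta> * wis (y \<omega>) b) * g b (pt \<theta> \<omega> z) - (sin \<theta> * sg b) * (g b (pt \<theta> \<omega> z) * z b) \<partial>gam J)"
      unfolding e by (intro integral_sum integrable_diff integrable_mult_right i1 i2)
    also have "\<dots> = (\<Sum>b\<in>J. cos \<theta> * (wis (y \<omega>) b * A \<theta> b (y \<omega>)) - (sin \<theta> * cos \<theta> * (sg b)\<^sup>2) * sgr \<theta> b b (y \<omega>))"
    proof (rule sum.cong[OF refl])
      fix b assume b: "b \<in> J"
      have "(\<integral>z. (cos \<theta> * wis (y \<omega>) b) * g b (pt \<theta> \<omega> z) - (sin \<theta> * sg b) * (g b (pt \<theta> \<omega> z) * z b) \<partial>gam J) =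
         (cos \<theta> * wis (y \<omega>) b) * A \<theta> b (y \<omega>) - (sin \<theta> * sg b) * (cos \<theta> * sg b * sgr \<theta> b b (y \<omega>))"
        using i1[OF b] i2[OF b] by (simp add: gA gz)
      then show "(\<integral>z. (cos \<theta> * wis (y \<omega>) b) * g b (pt \<theta> \<omega> z) - (sin \<theta> * sg b) * (g b (pt \<theta> \<omega> z) * z b) \<partial>gam J) =
        cos \<theta> * (wis (y \<omega>) b * A \<theta> b (y \<omega>)) - (sin \<theta> * cos \<theta> * (sg b)\<^sup>2) * sgr \<theta> b b (y \<omega>)"
        by (simp add: power2_eq_square algebra_simps)
    qed
    finally show "(\<integral>z. (\<Sum>b\<in>J. dpt \<theta> \<omega> z b * g b (pt \<theta> \<omega> z)) \<partial>gam J) =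
      (\<Sum>b\<in>J. cos \<theta> * (wis (y \<omega>) b * A \<theta> b (y \<omega>)) - (sin \<theta> * cos \<theta> * (sg b)\<^sup>2) * sgr \<theta> b b (y \<omega>))" .
  qed
  also have "\<dots> = (\<Sum>b\<in>J. cos \<theta> * (\<integral>\<omega>. wis (y \<omega>) b * A \<theta> b (y \<omega>) \<partial>Prod) - (sin \<theta> * cos \<theta> * (sg b)\<^sup>2) * (\<integral>\<omega>. sgr \<theta> b b (y \<omega>) \<partial>Prod))"
  proof -
    have j1: "integrable Prod (\<lambda>\<omega>. wis (y \<omega>) b * A \<theta> b (y \<omega>))" if "b \<in> J" for b
      by (rule integrable_mult_bounded[OF wis_integrable[OF that] A_measurable[OF that] A_bounded[OF that]])
    have j2: "integrable Prod (\<lambda>\<omega>. sgr \<theta> b b (y \<omega>))" if "b \<in> J" for b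
      using integrable_mult_bounded[OF A.integrable_const[of 1] sgr_measurable[OF that] sgr_bounded[OF \<theta> that that]] by simp
    have "(\<integral>\<omega>. (\<Sum>b\<in>J. cos \<theta> * (wis (y \<omega>) b * A \<theta> b (y \<omega>)) - (sin \<theta> * cos \<theta> * (sg b)\<^sup>2) * sgr \<theta> b b (y \<omega>)) \<partial>Prod) =
      (\<Sum>b\<in>J. \<integral>\<omega>. cos \<theta> * (wis (y \<omega>) b * A \<theta> b (y \<omega>)) - (sin \<theta> * cos \<theta> * (sg b)\<^sup>2) * sgr \<theta> b b (y \<omega>) \<partial>Prod)"
      by (intro integral_sum integrable_diff integrable_mult_right j1 j2)
    then show ?thesis using j1 j2 by simp
  qed
  also have "\<dots> = (\<Sum>b\<in>J. cos \<theta> * (\<integral>\<omega>. (\<Sum>c\<in>J. (sin \<theta> * tau b c \<omega>) * sgr \<theta> b c (y \<omega>)) \<partial>Prod) - (sin \<theta> * cos \<theta> * (sg b)\<^sup>2) * (\<integral>\<omega>. sgr \<theta> b b (y \<omega>) \<partial>Prod))"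
    by (simp add: ibp_wis[OF \<theta>])
  also have "\<dots> = (\<Sum>b\<in>J. \<integral>\<omega>. sin \<theta> * (\<Sum>c\<in>J. amat b c \<omega> * (\<integral>z. g b (pt \<theta> \<omega> z) * z c \<partial>gam J)) \<partial>Prod)"
  proof (rule sum.cong[OF refl])
    fix b assume b: "b \<in> J"
    have j1: "integrable Prod (\<lambda>\<omega>. (\<Sum>c\<in>J. (sin \<theta> * tau b c \<omega>) * sgr \<theta> b c (y \<omega>)))"
      by (intro integrable_sum integrable_mult_bounded[OF _ sgr_measurable[OF b] sgr_bounded[OF \<theta> b]] integrable_mult_right tau_integrable b)
    have j2: "integrable Prod (\<lambda>\<omega>. sgr \<theta> b b (y \<omega>))"
      using integrable_mult_bounded[OF A.integrable_const[of 1] sgr_measurable[OF b] sgr_bounded[OF \<theta> b b]] by simp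
    have "cos \<theta> * (\<integral>\<omega>. (\<Sum>c\<in>J. (sin \<theta> * tau b c \<omega>) * sgr \<theta> b c (y \<omega>)) \<partial>Prod) - (sin \<theta> * cos \<theta> * (sg b)\<^sup>2) * (\<integral>\<omega>. sgr \<theta> b b (y \<omega>) \<partial>Prod) =
       (\<integral>\<omega>. cos \<theta> * (\<Sum>c\<in>J. (sin \<theta> * tau b c \<omega>) * sgr \<theta> b c (y \<omega>)) - (sin \<theta> * cos \<theta> * (sg b)\<^sup>2) * sgr \<theta> b b (y \<omega>) \<partial>Prod)"
      using j1 j2 by simp
    also have "\<dots> = (\<integral>\<omega>. sin \<theta> * (\<Sum>c\<in>J. amat b c \<omega> * (\<integral>z. g b (pt \<theta> \<omega> z) * z c \<partial>gam J)) \<partial>Prod)"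
    proof (intro integral_cong refl)
      fix \<omega>
      have "amat b c \<omega> * (cos \<theta> * sg c * sgr \<theta> b c (y \<omega>)) = cos \<theta> * (tau b c \<omega> * sgr \<theta> b c (y \<omega>)) - (if b = c then cos \<theta> * (sg b)\<^sup>2 * sgr \<theta> b b (y \<omega>) else 0)" for c
      proof -
        have *: "amat b c \<omega> * (cos \<theta> * sg c * sgr \<theta> b c (y \<omega>)) = (tau b c \<omega> - (if b = c then (sg b)\<^sup>2 else 0)) * (cos \<theta> * sgr \<theta> b c (y \<omega>))"
          unfolding amat_def using sg_pos[of c] by simp
        show ?thesis unfolding * by (cases "b = c") (simp_all add: algebra_simps)
      qed
      then have "(\<Sum>c\<in>J. amat b c \<omega> * (cos \<theta> * sg c * sgr \<theta> b c (y \<omega>))) = cos \<theta> * (\<Sum>c\<in>J. tau b c \<omega> * sgr \<theta> b c (y \<omega>)) - cos \<theta> * (sg b)\<^sup>2 * sgr \<theta> b b (y \<omega>)"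
        using finJ b by (simp add: sum_subtractf sum_distrib_left)
      then show "cos \<theta> * (\<Sum>c\<in>J. (sin \<theta> * tau b c \<omega>) * sgr \<theta> b c (y \<omega>)) - (sin \<theta> * cos \<theta> * (sg b)\<^sup>2) * sgr \<theta> b b (y \<omega>) =
        sin \<theta> * (\<Sum>c\<in>J. amat b c \<omega> * (\<integral>z. g b (pt \<theta> \<omega> z) * z c \<partial>gam J))"
        unfolding gz by (simp add: right_diff_distrib sum_distrib_left mult_ac)
    qed
    finally show "cos \<theta> * (\<integral>\<omega>. (\<Sum>c\<in>J. (sin \<theta> * tau b c \<omega>) * sgr \<theta> b c (y \<omega>)) \<partial>Prod) - (sin \<theta> * cos \<theta> * (sg b)\<^sup>2) * (\<integral>\<omega>. sgr \<theta> b b (y \<omega>) \<partial>Prod) =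
       (\<integral>\<omega>. sin \<theta> * (\<Sum>c\<in>J. amat b c \<omega> * (\<integral>z. g b (pt \<theta> \<omega> z) * z c \<partial>gam J)) \<partial>Prod)" .
  qed
  also have "\<dots> = (\<integral>\<omega>. sin \<theta> * (\<Sum>b\<in>J. \<Sum>c\<in>J. amat b c \<omega> * (\<integral>z. g b (pt \<theta> \<omega> z) * z c \<partial>gam J)) \<partial>Prod)"
  proof -
    have am: "integrable Prod (\<lambda>\<omega>. amat b c \<omega>)" if "b \<in> J" "c \<in> J" for b c
      unfolding amat_def by (intro integrable_divide integrable_diff tau_integrable that A.integrable_const)
    have j: "integrable Prod (\<lambda>\<omega>. sin \<theta> * (\<Sum>c\<in>J. amat b c \<omega> * (\<integral>z. g b (pt \<theta> \<omega> z) * z c \<partial>gam J)))" if b: "b \<in> J" for b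
    proof (intro integrable_mult_right integrable_sum)
      fix c assume c: "c \<in> J"
      have "integrable Prod (\<lambda>\<omega>. (cos \<theta> * sg c) * (amat b c \<omega> * sgr \<theta> b c (y \<omega>)))"
        by (intro integrable_mult_right integrable_mult_bounded[OF am[OF b c] sgr_measurable[OF b] sgr_bounded[OF \<theta> b c]])
      then show "integrable Prod (\<lambda>\<omega>. amat b c \<omega> * (\<integral>z. g b (pt \<theta> \<omega> z) * z c \<partial>gam J))"
        unfolding gz by (simp add: mult_ac)
    qed
    show ?thesis
      unfolding sum_distrib_left[of "sin \<theta>" _ J]
      using integral_sum[of J, OF j] by (simp add: sum_distrib_left)
  qed
  finally show ?thesis .
qed

lemma Psi_deriv_bound:
  assumes \<theta>: "0 < cos \<theta>" and r: "0 < r" and V: "(\<Sum>b\<in>J. \<Sum>c\<in>J. \<integral>\<omega>. (amat b c \<omega>)\<^sup>2 \<partial>Prod) \<le> V"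
  shows "\<bar>\<integral>p. (\<Sum>b\<in>J. dpt \<theta> (fst p) (snd p) b * g b (pt \<theta> (fst p) (snd p))) \<partial>M2\<bar> \<le> r * L\<^sup>2 / 2 + V / (2 * r)"
proof -
  interpret A: prob_space Prod by (rule prob_Prod)
  let ?R = "\<lambda>\<omega>. r * L\<^sup>2 / 2 + (\<Sum>b\<in>J. \<Sum>c\<in>J. (amat b c \<omega>)\<^sup>2) / (2 * r)"
  have a2: "integrable Prod (\<lambda>\<omega>. \<Sum>b\<in>J. \<Sum>c\<in>J. (amat b c \<omega>)\<^sup>2)"
    by (intro integrable_sum amat_moment(1))
  then have iR: "integrable Prod ?R" by simp
  have le: "norm (sin \<theta> * (\<Sum>b\<in>J. \<Sum>c\<in>J. amat b c \<omega> * (\<integral>z. g b (pt \<theta> \<omega> z) * z c \<partial>gam J))) \<le> ?R \<omega>" for \<omega>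
  proof -
    have "\<bar>\<Sum>b\<in>J. \<Sum>c\<in>J. amat b c \<omega> * (\<integral>z. g b (pt \<theta> \<omega> z) * z c \<partial>gam J)\<bar> \<le> ?R \<omega>"
      unfolding pt_def by (rule matrix_bound[OF r])
    then have "\<bar>sin \<theta>\<bar> * \<bar>\<Sum>b\<in>J. \<Sum>c\<in>J. amat b c \<omega> * (\<integral>z. g b (pt \<theta> \<omega> z) * z c \<partial>gam J)\<bar> \<le> 1 * ?R \<omega>"
      by (intro mult_mono) auto
    then show ?thesis by (simp add: abs_mult)
  qed
  have "\<bar>\<integral>\<omega>. sin \<theta> * (\<Sum>b\<in>J. \<Sum>c\<in>J. amat b c \<omega> * (\<integral>z. g b (pt \<theta> \<omega> z) * z c \<partial>gam J)) \<partial>Prod\<bar> \<le> (\<integral>\<omega>. ?R \<omega> \<partial>Prod)"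
    by (rule integral_norm_bound_dominated[OF iR le])
  also have "\<dots> = r * L\<^sup>2 / 2 + (\<Sum>b\<in>J. \<Sum>c\<in>J. \<integral>\<omega>. (amat b c \<omega>)\<^sup>2 \<partial>Prod) / (2 * r)"
  proof -
    have "(\<integral>\<omega>. (\<Sum>b\<in>J. \<Sum>c\<in>J. (amat b c \<omega>)\<^sup>2) \<partial>Prod) = (\<Sum>b\<in>J. \<integral>\<omega>. (\<Sum>c\<in>J. (amat b c \<omega>)\<^sup>2) \<partial>Prod)"
      by (intro integral_sum integrable_sum amat_moment(1))
    also have "\<dots> = (\<Sum>b\<in>J. \<Sum>c\<in>J. \<integral>\<omega>. (amat b c \<omega>)\<^sup>2 \<partial>Prod)"
      by (intro sum.cong refl integral_sum amat_moment(1))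
    finally show ?thesis using a2 A.prob_space by simp
  qed
  also have "\<dots> \<le> r * L\<^sup>2 / 2 + V / (2 * r)" using V r by (intro add_left_mono divide_right_mono) auto
  finally show ?thesis unfolding Psi_deriv_eq[OF \<theta>] .
qed

lemma smooth_comparison:
  assumes r: "0 < r" and V: "(\<Sum>b\<in>J. \<Sum>c\<in>J. \<integral>\<omega>. (amat b c \<omega>)\<^sup>2 \<partial>Prod) \<le> V"
  shows "\<bar>(\<integral>\<omega>. gs (wis (y \<omega>)) \<partial>Prod) - (\<integral>z. gs (\<lambda>c. sg c * z c) \<partial>gam J)\<bar> \<le> pi / 2 * (r * L\<^sup>2 / 2 + V / (2 * r))"
proof -
  interpret A: prob_space Prod by (rule prob_Prod)
  interpret B: prob_space "gam J" by (rule prob_gam)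
  interpret pair_sigma_finite Prod "gam J" ..
  have f: "\<Psi> \<theta> = (\<integral>\<omega>. (\<integral>z. gs (pt \<theta> \<omega> z) \<partial>gam J) \<partial>Prod)" for \<theta>
    unfolding \<Psi>_def M2_def using integral_fst'[OF gs_pt_integrable[unfolded M2_def]] by simp
  have 0: "\<Psi> 0 = (\<integral>z. gs (\<lambda>c. sg c * z c) \<partial>gam J)" unfolding f using A.prob_space by (simp add: pt_def)
  have 1: "\<Psi> (pi/2) = (\<integral>\<omega>. gs (wis (y \<omega>)) \<partial>Prod)" unfolding f using B.prob_space by (simp add: pt_def)
  \<comment> \<open>The mean value theorem needs the derivative at one interior angle only, where
    \<open>cos t\<close> is positive; the endpoint pi/2, where the Gaussian smoothing degenerates,
    is avoided.\<close>
  obtain t where t: "0 < t" "t < pi/2"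
    "\<Psi> (pi/2) - \<Psi> 0 = (pi/2 - 0) * (\<integral>p. (\<Sum>b\<in>J. dpt t (fst p) (snd p) b * g b (pt t (fst p) (snd p))) \<partial>M2)"
    using MVT2[of 0 "pi/2" \<Psi>, OF _ Psi_deriv(2)] by auto
  have "0 < cos t" using t by (intro cos_gt_zero)
  note bound = Psi_deriv_bound[OF this r V]
  have eq: "(\<integral>\<omega>. gs (wis (y \<omega>)) \<partial>Prod) - (\<integral>z. gs (\<lambda>c. sg c * z c) \<partial>gam J) =
      pi/2 * (\<integral>p. (\<Sum>b\<in>J. dpt t (fst p) (snd p) b * g b (pt t (fst p) (snd p))) \<partial>M2)"
    using t(3) unfolding 0 1 by simp
  have "\<bar>pi/2\<bar> = pi/2" by simp
  then show ?thesis unfolding eq abs_mult using mult_left_mono[OF bound, of "pi/2"] by simp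
qed

end

section \<open>Removal of the smoothing\<close>

context stein_array
begin

text \<open>Replacing \<open>G\<close> by its smoothing costs at most \<open>L * e * m\<close> on
  either side, while the comparison of the smoothed functions is uniform in
  \<open>e\<close>.\<close>

theorem lipschitz_comparison:
  assumes Gm: "G \<in> borel_measurable (borels UNIV)" and Gl: "lip_on J L G" and L: "0 < L"
    and V: "4 * real n ^ 3 * (B\<^sup>2 / real d + \<eta>\<^sup>2) / min 1 v \<le> V" and V0: "0 < V"
  shows "\<bar>(\<integral>\<omega>. G (wis (y \<omega>)) \<partial>Prod) - (\<integral>z. G (\<lambda>c. sg c * z c) \<partial>gam J)\<bar> \<le> pi / 2 * (L * sqrt V)"
proof -
  interpret A: prob_space Prod by (rule prob_Prod)
  interpret B: prob_space "gam J" by (rule prob_gam)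
  define m where "m = (\<integral>z. (\<Sum>c\<in>J. \<bar>z c\<bar>) \<partial>gam J)"
  have Gn: "nice J G" using lip_on_nice[OF finJ Gm Gl] L by simp
  have m0: "0 \<le> m" unfolding m_def by (intro integral_nonneg_AE AE_I2) (simp add: sum_nonneg)
  have Ai: "integrable Prod (\<lambda>\<omega>. H (wis (y \<omega>)))" if "H \<in> borel_measurable (borels UNIV)" "lip_on J L H" for H
  proof (rule integrable_bound)
    show "integrable Prod (\<lambda>\<omega>. \<bar>H (\<lambda>_. 0)\<bar> + L * (\<Sum>c\<in>J. \<bar>wis (y \<omega>) c\<bar>))"
      by (intro integrable_add A.integrable_const integrable_mult_right integrable_sum integrable_abs wis_integrable)
    show "(\<lambda>\<omega>. H (wis (y \<omega>))) \<in> borel_measurable Prod" by (rule PiM_UNIV_compose[OF that(1) wis_measurable])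
    show "AE \<omega> in Prod. norm (H (wis (y \<omega>))) \<le> norm (\<bar>H (\<lambda>_. 0)\<bar> + L * (\<Sum>c\<in>J. \<bar>wis (y \<omega>) c\<bar>))"
    proof (rule AE_I2)
      fix \<omega>
      have "\<bar>H (wis (y \<omega>)) - H (\<lambda>_. 0)\<bar> \<le> L * (\<Sum>c\<in>J. \<bar>wis (y \<omega>) c - 0\<bar>)"
        using lip_on_le_sum[OF that(2)] L by (simp only: less_imp_le)
      then show "norm (H (wis (y \<omega>))) \<le> norm (\<bar>H (\<lambda>_. 0)\<bar> + L * (\<Sum>c\<in>J. \<bar>wis (y \<omega>) c\<bar>))" by simp
    qed
  qed
  have Bi: "integrable (gam J) (\<lambda>z. H (\<lambda>c. sg c * z c))" if "nice J H" for H
    using nice_integrable[OF finJ nice_affine[OF finJ that, of "\<lambda>_. 0" sg]] by simp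
  have main: "\<bar>(\<integral>\<omega>. G (wis (y \<omega>)) \<partial>Prod) - (\<integral>z. G (\<lambda>c. sg c * z c) \<partial>gam J)\<bar> \<le> pi / 2 * (L * sqrt V) + (2 * L * m) * e"
    if e: "0 < e" for e
  proof -
    interpret S: stein_smooth n d \<Omega> Y T S B v \<eta> G L e
      using Gm Gl L e by unfold_locales auto
    \<comment> \<open>The weight that makes the two terms of the bound equal.\<close>
    define r where "r = sqrt V / L"
    have r: "0 < r" using V0 L by (simp add: r_def)
    have cmp: "\<bar>(\<integral>\<omega>. S.gs (wis (y \<omega>)) \<partial>Prod) - (\<integral>z. S.gs (\<lambda>c. sg c * z c) \<partial>gam J)\<bar> \<le> pi / 2 * (r * L\<^sup>2 / 2 + V / (2 * r))"
      by (rule S.smooth_comparison[OF r order_trans[OF amat_total V]])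
    have rV: "r * L\<^sup>2 / 2 + V / (2 * r) = L * sqrt V"
    proof -
      have "r * L\<^sup>2 = L * sqrt V" using L by (simp add: r_def power2_eq_square)
      moreover have "V / r = L * sqrt V"
        using V0 L real_sqrt_mult_self[of V] by (simp add: r_def field_simps)
      ultimately show ?thesis by (simp add: divide_divide_eq_left' mult.commute[of 2])
    qed
    have close: "\<bar>S.gs u - G u\<bar> \<le> L * e * m" for u
      unfolding S.gs_def m_def using L e by (intro smooth_close[OF finJ Gn Gl]) auto
    have c1: "\<bar>(\<integral>\<omega>. G (wis (y \<omega>)) \<partial>Prod) - (\<integral>\<omega>. S.gs (wis (y \<omega>)) \<partial>Prod)\<bar> \<le> L * e * m"
    proof -
      note i = Ai[OF Gm Gl] Ai[OF S.gs_measurable S.gs_lip]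
      have "\<bar>(\<integral>\<omega>. G (wis (y \<omega>)) \<partial>Prod) - (\<integral>\<omega>. S.gs (wis (y \<omega>)) \<partial>Prod)\<bar> = \<bar>\<integral>\<omega>. G (wis (y \<omega>)) - S.gs (wis (y \<omega>)) \<partial>Prod\<bar>"
        using i by simp
      also have "\<dots> \<le> (\<integral>\<omega>. \<bar>G (wis (y \<omega>)) - S.gs (wis (y \<omega>))\<bar> \<partial>Prod)" by (rule integral_abs_bound)
      also have "\<dots> \<le> (\<integral>\<omega>. L * e * m \<partial>Prod)"
        by (rule integral_mono[OF integrable_abs[OF integrable_diff[OF i]] A.integrable_const])
           (use close in \<open>simp add: abs_minus_commute\<close>)
      finally show ?thesis using A.prob_space by simp
    qed
    have c2: "\<bar>(\<integral>z. S.gs (\<lambda>c. sg c * z c) \<partial>gam J) - (\<integral>z. G (\<lambda>c. sg c * z c) \<partial>gam J)\<bar> \<le> L * e * m"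
    proof -
      have gsn: "nice J S.gs" by (rule lip_on_nice[OF finJ S.gs_measurable S.gs_lip]) (use L in simp)
      note i = Bi[OF gsn] Bi[OF Gn]
      have "\<bar>(\<integral>z. S.gs (\<lambda>c. sg c * z c) \<partial>gam J) - (\<integral>z. G (\<lambda>c. sg c * z c) \<partial>gam J)\<bar> = \<bar>\<integral>z. S.gs (\<lambda>c. sg c * z c) - G (\<lambda>c. sg c * z c) \<partial>gam J\<bar>"
        using i by simp
      also have "\<dots> \<le> (\<integral>z. \<bar>S.gs (\<lambda>c. sg c * z c) - G (\<lambda>c. sg c * z c)\<bar> \<partial>gam J)" by (rule integral_abs_bound)
      also have "\<dots> \<le> (\<integral>z. L * e * m \<partial>gam J)"
        by (rule integral_mono[OF integrable_abs[OF integrable_diff[OF i]] B.integrable_const close])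
      finally show ?thesis using B.prob_space by simp
    qed
    have "L * e * m + pi / 2 * (L * sqrt V) + L * e * m = pi / 2 * (L * sqrt V) + (2 * L * m) * e" by simp
    with cmp[unfolded rV] c1 c2 show ?thesis by linarith
  qed
  show ?thesis
  proof (rule field_le_epsilon)
    fix \<epsilon> :: real assume \<epsilon>: "0 < \<epsilon>"
    \<comment> \<open>The \<open>+ 1\<close> keeps the divisor positive when \<open>m\<close> is
      0.\<close>
    have Lm: "0 < 2 * L * m + 1" using L m0 by (simp add: add_nonneg_pos)
    have "(2 * L * m) * (\<epsilon> / (2 * L * m + 1)) \<le> (2 * L * m + 1) * (\<epsilon> / (2 * L * m + 1))"
      using Lm \<epsilon> by (intro mult_right_mono) auto
    also have "\<dots> = \<epsilon>" using Lm by simp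
    finally show "\<bar>(\<integral>\<omega>. G (wis (y \<omega>)) \<partial>Prod) - (\<integral>z. G (\<lambda>c. sg c * z c) \<partial>gam J)\<bar> \<le> pi / 2 * (L * sqrt V) + \<epsilon>"
      using main[of "\<epsilon> / (2 * L * m + 1)"] \<epsilon> Lm by (smt (verit) divide_pos_pos)
  qed
qed

end

section \<open>Identification of Gaussian vectors\<close>

lemma std_cos_integral: "(\<integral>x. cos (a * x + s) \<partial>std_normal) = cos s * exp (- a\<^sup>2 / 2)"
proof -
  interpret prob_space std_normal by (rule prob_std)
  have i: "integrable std_normal (\<lambda>x. iexp (a * x))" by (rule integrable_iexp) auto
  have c: "(\<integral>x. iexp (a * x) \<partial>std_normal) = complex_of_real (exp (- a\<^sup>2 / 2))"
    using fun_cong[OF char_std_normal_distribution, of a] by (simp add: char_def)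
  have co: "(\<integral>x. cos (a * x) \<partial>std_normal) = exp (- a\<^sup>2 / 2)"
    using integral_Re[OF i] unfolding c by (simp add: Re_exp)
  have si: "(\<integral>x. sin (a * x) \<partial>std_normal) = 0"
    using integral_Im[OF i] unfolding c by (simp add: Im_exp)
  have ic: "integrable std_normal (\<lambda>x. cos (a * x))" "integrable std_normal (\<lambda>x. sin (a * x))"
    by (rule integrable_const_bound[where B=1]; simp)+
  have "(\<integral>x. cos (a * x + s) \<partial>std_normal) = (\<integral>x. cos s * cos (a * x) - sin s * sin (a * x) \<partial>std_normal)"
    by (simp add: cos_add mult.commute)
  also have "\<dots> = cos s * exp (- a\<^sup>2 / 2)" using ic co si by simp
  finally show ?thesis .
qed

text \<open>The phase \<open>s\<close> carries the real part (\<open>s = 0\<close>) and the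
  imaginary part (\<open>s = pi/2\<close>) of the characteristic function in one real
  identity.\<close>

lemma law_std_of_cos:
  assumes N: "prob_space N" and V: "V \<in> borel_measurable N"
    and c: "\<And>a s. (\<integral>x. cos (a * V x + s) \<partial>N) = cos s * exp (- a\<^sup>2 / 2)"
  shows "distr N borel V = std_normal"
proof (rule Levy_uniqueness[OF prob_space.real_distribution_distr[OF N V] real_dist_normal_dist], rule ext)
  fix a
  interpret prob_space N by (rule N)
  have i: "integrable N (\<lambda>x. iexp (a * V x))" by (rule integrable_iexp) (use V in auto)
  have "char (distr N borel V) a = (\<integral>x. iexp (a * V x) \<partial>N)"
    unfolding char_def using V by (intro integral_distr) auto
  also have "\<dots> = complex_of_real (exp (- a\<^sup>2 / 2))"
  proof (rule complex_eqI)
    have "Re (\<integral>x. iexp (a * V x) \<partial>N) = (\<integral>x. cos (a * V x + 0) \<partial>N)"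
      using integral_Re[OF i] by (simp add: Re_exp)
    then show "Re (\<integral>x. iexp (a * V x) \<partial>N) = Re (complex_of_real (exp (- a\<^sup>2 / 2)))" unfolding c by simp
    have "(\<integral>x. cos (a * V x + pi/2) \<partial>N) = - (\<integral>x. sin (a * V x) \<partial>N)" by (simp add: cos_add)
    then have "(\<integral>x. sin (a * V x) \<partial>N) = 0" unfolding c by simp
    then show "Im (\<integral>x. iexp (a * V x) \<partial>N) = Im (complex_of_real (exp (- a\<^sup>2 / 2)))"
      using integral_Im[OF i] by (simp add: Im_exp)
  qed
  finally show "char (distr N borel V) a = char std_normal a"
    by (simp add: char_std_normal_distribution)
qed

lemma weighted_prob:
  fixes w :: "'a \<Rightarrow> real"
  assumes N: "prob_space N" and w: "w \<in> borel_measurable N" "\<And>x. 0 \<le> w x" "\<And>x. w x \<le> C" "(\<integral>x. w x \<partial>N) = 1"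
  shows "prob_space (density N (\<lambda>x. ennreal (w x)))"
    and "f \<in> borel_measurable N \<Longrightarrow> (\<integral>x. f x \<partial>density N (\<lambda>x. ennreal (w x))) = (\<integral>x. w x * f x \<partial>N :: real)"
proof -
  interpret prob_space N by (rule N)
  have i: "integrable N w"
    by (rule integrable_const_bound[where B=C]) (use w(1,2,3) in auto)
  show "prob_space (density N (\<lambda>x. ennreal (w x)))"
  proof (rule prob_spaceI)
    have "emeasure (density N (\<lambda>x. ennreal (w x))) (space N) = (\<integral>\<^sup>+x. ennreal (w x) * indicator (space N) x \<partial>N)"
      using w(1) by (intro emeasure_density) auto
    also have "\<dots> = (\<integral>\<^sup>+x. ennreal (w x) \<partial>N)" by (intro nn_integral_cong) simp
    also have "\<dots> = ennreal (\<integral>x. w x \<partial>N)" using i w(2) by (intro nn_integral_eq_integral) auto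
    finally show "emeasure (density N (\<lambda>x. ennreal (w x))) (space (density N (\<lambda>x. ennreal (w x)))) = 1" using w(4) by simp
  qed
  show "(\<integral>x. f x \<partial>density N (\<lambda>x. ennreal (w x))) = (\<integral>x. w x * f x \<partial>N)" if "f \<in> borel_measurable N"
    by (subst integral_density) (use that w(1,2) in auto)
qed

text \<open>The characteristic function of a standard Gaussian vector in real form. Uniqueness of
  the joint law is reduced below to one-dimensional Levy uniqueness under changed measures.\<close>

definition cos_gaussian :: "'w measure \<Rightarrow> 'i set \<Rightarrow> ('i \<Rightarrow> 'w \<Rightarrow> real) \<Rightarrow> bool" where
  "cos_gaussian N I V \<longleftrightarrow> (\<forall>t s. (\<integral>x. cos ((\<Sum>i\<in>I. t i * V i x) + s) \<partial>N) = cos s * exp (- (\<Sum>i\<in>I. (t i)\<^sup>2) / 2))"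

lemma cos_gaussianD:
  "cos_gaussian N I V \<Longrightarrow> (\<integral>x. cos ((\<Sum>i\<in>I. t i * V i x) + s) \<partial>N) = cos s * exp (- (\<Sum>i\<in>I. (t i)\<^sup>2) / 2)"
  unfolding cos_gaussian_def by blast

lemma law_indicator:
  assumes N: "prob_space N" and V: "V \<in> borel_measurable N" and law: "distr N borel V = std_normal" and A: "A \<in> sets borel"
  shows "(\<integral>x. indicator A (V x) \<partial>N) = measure std_normal A"
proof -
  have "(\<integral>x. indicator A (V x) \<partial>N) = (\<integral>v. indicator A v \<partial>distr N borel V :: real)"
    by (subst integral_distr[OF V]) (use A in auto)
  also have "\<dots> = measure std_normal A" unfolding law using A by simp
  finally show ?thesis .
qed

text \<open>Reweighting by \<open>2 + cos\<close> of the other coordinates keeps the law of \<open>V j\<close>, which shows that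
  \<open>V j\<close> is independent of the trigonometric functions of the other coordinates.\<close>

lemma cos_gaussian_split:
  assumes N: "prob_space N" and fin: "finite I" and j: "j \<notin> I"
    and V: "\<And>i. i \<in> insert j I \<Longrightarrow> V i \<in> borel_measurable N" and H: "cos_gaussian N (insert j I) V" and A: "A \<in> sets borel"
  shows "(\<integral>x. indicator A (V j x) \<partial>N) = measure std_normal A"
    and "(\<integral>x. indicator A (V j x) * cos ((\<Sum>i\<in>I. t i * V i x) + s) \<partial>N) =
      measure std_normal A * (cos s * exp (- (\<Sum>i\<in>I. (t i)\<^sup>2) / 2))"
proof -
  interpret prob_space N by (rule N)
  have Vj [measurable]: "V j \<in> borel_measurable N" and VI [measurable]: "\<And>i. i \<in> I \<Longrightarrow> V i \<in> borel_measurable N" using V by auto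
  have S [measurable]: "(\<lambda>x. \<Sum>i\<in>I. t i * V i x) \<in> borel_measurable N" for t :: "_ \<Rightarrow> real"
    by (intro borel_measurable_sum borel_measurable_times borel_measurable_const VI)
  have H': "(\<integral>x. cos (a * V j x + (\<Sum>i\<in>I. t i * V i x) + s) \<partial>N) = cos s * (exp (- a\<^sup>2 / 2) * exp (- (\<Sum>i\<in>I. (t i)\<^sup>2) / 2))" for a t s
  proof -
    have "(\<Sum>i\<in>insert j I. (t(j := a)) i * V i x) = a * V j x + (\<Sum>i\<in>I. t i * V i x)" for x
      using fin j by (auto intro!: sum.cong)
    moreover have "(\<Sum>i\<in>insert j I. ((t(j := a)) i)\<^sup>2) = a\<^sup>2 + (\<Sum>i\<in>I. (t i)\<^sup>2)"
      using fin j by (auto intro!: sum.cong)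
    ultimately show ?thesis using cos_gaussianD[OF H, of "t(j := a)" s]
      by (simp only: exp_add[symmetric]) (simp add: add_divide_distrib)
  qed
  have int: "integrable N (\<lambda>x. cos (f x))" if "f \<in> borel_measurable N" for f :: "_ \<Rightarrow> real"
    by (rule integrable_const_bound[where B=1]) (use that in auto)
  let ?p = "measure std_normal A"
  define e where "e = exp (- (\<Sum>i\<in>I. (t i)\<^sup>2) / 2)"
  define u where "u x = (\<Sum>i\<in>I. t i * V i x) + s" for x
  have um [measurable]: "u \<in> borel_measurable N" unfolding u_def by measurable
  have e1: "0 < e" "e \<le> 1" unfolding e_def by (auto simp: sum_nonneg)
  \<comment> \<open>The mean of \<open>2 + cos (u x)\<close>. The 2 keeps the weight nonnegative and
    its mean at least 1.\<close>
  define Z where "Z = 2 + cos s * e"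
  have "\<bar>cos s * e\<bar> \<le> 1 * 1" unfolding abs_mult using e1 by (intro mult_mono) auto
  then have Z: "1 \<le> Z" unfolding Z_def by linarith
  have cu: "(\<integral>x. cos (u x) \<partial>N) = cos s * e" using H'[of 0 t s] by (simp add: u_def e_def)
  have lawN: "distr N borel (V j) = std_normal"
    by (rule law_std_of_cos[OF N Vj]) (use H'[of _ "\<lambda>_. 0"] in simp)
  show pj: "(\<integral>x. indicator A (V j x) \<partial>N) = ?p" by (rule law_indicator[OF N Vj lawN A])
  define w where "w x = (2 + cos (u x)) / Z" for x
  have wm [measurable]: "w \<in> borel_measurable N" unfolding w_def[abs_def] by measurable
  have w0: "0 \<le> w x" "w x \<le> 3" for x
  proof -
    have "-1 \<le> cos (u x)" "cos (u x) \<le> 1" by auto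
    then have "0 \<le> 2 + cos (u x)" by linarith
    then show "0 \<le> w x" unfolding w_def by (rule divide_nonneg_nonneg) (use Z in linarith)
    have "(2 + cos (u x)) / Z \<le> 3 / 1" using Z \<open>-1 \<le> cos (u x)\<close> \<open>cos (u x) \<le> 1\<close> by (intro frac_le) auto
    then show "w x \<le> 3" by (simp add: w_def)
  qed
  have w1: "(\<integral>x. w x \<partial>N) = 1"
    unfolding w_def using int[OF um] Z by (simp add: cu prob_space flip: Z_def)
  note W = weighted_prob[OF N wm w0 w1]
  have law2: "distr (density N (\<lambda>x. ennreal (w x))) borel (V j) = std_normal"
  proof (rule law_std_of_cos[OF W(1)])
    fix a r
    \<comment> \<open>Product to sum: the weighted cosine is a combination of cosines of linear
      forms with coefficients \<open>t\<close> and \<open>- t\<close>, whose means are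
      known.\<close>
    have p: "w x * cos (a * V j x + r) = (2 * cos (a * V j x + r) + (cos (a * V j x + (\<Sum>i\<in>I. t i * V i x) + (r + s)) + cos (a * V j x + (\<Sum>i\<in>I. (- t i) * V i x) + (r - s))) / 2) / Z" for x
    proof -
      have 1: "a * V j x + (\<Sum>i\<in>I. t i * V i x) + (r + s) = (a * V j x + r) + u x"
        and 2: "a * V j x + (\<Sum>i\<in>I. (- t i) * V i x) + (r - s) = (a * V j x + r) - u x"
        by (simp_all add: u_def sum_negf)
      have 3: "cos ((a * V j x + r) + u x) + cos ((a * V j x + r) - u x) = 2 * (cos (a * V j x + r) * cos (u x))"
        unfolding cos_add[of "a * V j x + r"] cos_diff by simp
      show ?thesis unfolding 1 2 3 w_def by (simp add: distrib_left distrib_right mult.commute)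
    qed
    have "(\<integral>x. cos (a * V j x + r) \<partial>density N (\<lambda>x. ennreal (w x))) = (\<integral>x. w x * cos (a * V j x + r) \<partial>N)"
      by (rule W(2)) measurable
    also have "\<dots> = (2 * (cos r * exp (- a\<^sup>2 / 2)) + (cos (r + s) * (exp (- a\<^sup>2 / 2) * e) + cos (r - s) * (exp (- a\<^sup>2 / 2) * e)) / 2) / Z"
    proof -
      have i: "integrable N (\<lambda>x. cos (a * V j x + (\<Sum>i\<in>I. t' i * V i x) + s'))" "integrable N (\<lambda>x. cos (a * V j x + s'))" for t' s'
        by (rule int, measurable)+
      have v1: "(\<integral>x. cos (a * V j x + r) \<partial>N) = cos r * exp (- a\<^sup>2 / 2)" using H'[of a "\<lambda>_. 0" r] by simp
      have v2: "(\<integral>x. cos (a * V j x + (\<Sum>i\<in>I. t i * V i x) + (r + s)) \<partial>N) = cos (r + s) * (exp (- a\<^sup>2 / 2) * e)"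
        unfolding e_def by (rule H')
      have v3: "(\<integral>x. cos (a * V j x + (\<Sum>i\<in>I. (- t i) * V i x) + (r - s)) \<partial>N) = cos (r - s) * (exp (- a\<^sup>2 / 2) * e)"
        using H'[of a "\<lambda>i. - t i" "r - s"] by (simp add: e_def)
      show ?thesis unfolding p using i(1)[of t "r + s"] i(1)[of "\<lambda>i. - t i" "r - s"] i(2)[of r] v1 v2 v3 by simp
    qed
    also have "\<dots> = cos r * exp (- a\<^sup>2 / 2) * Z / Z"
    proof -
      have "cos (r + s) * (exp (- a\<^sup>2 / 2) * e) + cos (r - s) * (exp (- a\<^sup>2 / 2) * e) = 2 * (cos r * exp (- a\<^sup>2 / 2) * (cos s * e))"
        unfolding cos_add cos_diff by (simp add: distrib_right left_diff_distrib)
      then show ?thesis unfolding Z_def by (simp add: distrib_left)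
    qed
    also have "\<dots> = cos r * exp (- a\<^sup>2 / 2)" using Z by simp
    finally show "(\<integral>x. cos (a * V j x + r) \<partial>density N (\<lambda>x. ennreal (w x))) = cos r * exp (- a\<^sup>2 / 2)" .
  qed simp
  have ind: "(\<lambda>x. indicator A (V j x) :: real) \<in> borel_measurable N" using A by measurable
  have iA: "integrable N (\<lambda>x. indicator A (V j x) :: real)"
    by (rule integrable_const_bound[where B=1]) (use ind in \<open>auto simp: indicator_def\<close>)
  have iAc: "integrable N (\<lambda>x. indicator A (V j x) * cos (u x))"
    by (rule integrable_mult_bounded[OF iA, where C=1]) auto
  \<comment> \<open>\<open>V j\<close> has the same law under both measures; equating the two
    probabilities of \<open>A\<close> determines the mixed integral.\<close>
  have "?p = (\<integral>x. indicator A (V j x) \<partial>density N (\<lambda>x. ennreal (w x)))"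
    by (rule law_indicator[OF W(1) _ law2 A, symmetric]) simp
  also have "\<dots> = (\<integral>x. w x * indicator A (V j x) \<partial>N)" by (rule W(2)[OF ind])
  also have "\<dots> = (\<integral>x. (2 * indicator A (V j x) + indicator A (V j x) * cos (u x)) / Z \<partial>N)"
    by (simp add: w_def algebra_simps)
  also have "\<dots> = (2 * ?p + (\<integral>x. indicator A (V j x) * cos (u x) \<partial>N)) / Z"
    using iA iAc pj by simp
  finally have "(\<integral>x. indicator A (V j x) * cos (u x) \<partial>N) = ?p * Z - 2 * ?p" using Z by (simp add: field_simps)
  also have "\<dots> = ?p * (cos s * e)" by (simp add: Z_def algebra_simps)
  finally show "(\<integral>x. indicator A (V j x) * cos ((\<Sum>i\<in>I. t i * V i x) + s) \<partial>N) = ?p * (cos s * exp (- (\<Sum>i\<in>I. (t i)\<^sup>2) / 2))"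
    by (simp add: u_def e_def)
qed

text \<open>The measure varies in the induction. By \<open>cos_gaussian_split\<close>, reweighting
  with the event of \<open>V j\<close> leaves the other coordinates standard Gaussian, so the
  induction hypothesis holds for the original and the reweighted measure, and their comparison gives
  the product rule. The weight uses \<open>1 + indicator\<close> to avoid dividing by a probability
  that may be 0.\<close>

lemma cos_gaussian_box:
  assumes "finite I" "prob_space N" "\<And>i. i \<in> I \<Longrightarrow> V i \<in> borel_measurable N" "cos_gaussian N I V"
    "\<And>i. i \<in> I \<Longrightarrow> A i \<in> sets borel"
  shows "(\<integral>x. (\<Prod>i\<in>I. indicator (A i) (V i x)) \<partial>N) = (\<Prod>i\<in>I. measure std_normal (A i) :: real)"
  using assms
proof (induction I arbitrary: N rule: finite_induct)
  case empty
  interpret prob_space N by fact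
  show ?case using prob_space by simp
next
  case (insert j I)
  interpret prob_space N by fact
  have N: "prob_space N" by fact
  have Aj: "A j \<in> sets borel" using insert.prems by auto
  have V: "V i \<in> borel_measurable N" if "i \<in> insert j I" for i using insert.prems that by auto
  note sp = cos_gaussian_split[OF N insert.hyps(1,2) V insert.prems(3) Aj]
  let ?F = "\<lambda>x. \<Prod>i\<in>I. indicator (A i) (V i x) :: real"
  let ?P = "\<Prod>i\<in>I. measure std_normal (A i)"
  define p where "p = measure std_normal (A j)"
  have p: "0 \<le> p" by (simp add: p_def)
  have ind: "(\<lambda>x. indicator (A i) (V i x) :: real) \<in> borel_measurable N" if "i \<in> insert j I" for i
    using V[OF that] insert.prems(4)[OF that] by measurable
  have Fm: "?F \<in> borel_measurable N" using ind by (intro borel_measurable_prod) auto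
  have Fb: "\<bar>?F x\<bar> \<le> 1" for x unfolding abs_prod by (intro prod_le_1) (auto simp: indicator_def)
  have HI: "cos_gaussian N I V"
    unfolding cos_gaussian_def
  proof (intro allI)
    fix t s
    have "(\<Sum>i\<in>insert j I. (t(j := 0)) i * V i x) = (\<Sum>i\<in>I. t i * V i x)" for x
      using insert.hyps by (auto intro!: sum.cong)
    moreover have "(\<Sum>i\<in>insert j I. ((t(j := 0)) i)\<^sup>2) = (\<Sum>i\<in>I. (t i)\<^sup>2)"
      using insert.hyps by (auto intro!: sum.cong)
    ultimately show "(\<integral>x. cos ((\<Sum>i\<in>I. t i * V i x) + s) \<partial>N) = cos s * exp (- (\<Sum>i\<in>I. (t i)\<^sup>2) / 2)"
      using cos_gaussianD[OF insert.prems(3), of "t(j := 0)" s] by simp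
  qed
  have IH0: "(\<integral>x. ?F x \<partial>N) = ?P"
    using insert.prems by (intro insert.IH N HI) auto
  define w where "w x = (1 + indicator (A j) (V j x)) / (1 + p)" for x
  have wm: "w \<in> borel_measurable N" unfolding w_def[abs_def] using ind by measurable
  have w0: "0 \<le> w x" "w x \<le> 2" for x
  proof -
    show "0 \<le> w x" unfolding w_def using p by simp
    have "(1 + indicator (A j) (V j x)) / (1 + p) \<le> 2 / 1" using p by (intro frac_le) (auto simp: indicator_def)
    then show "w x \<le> 2" by (simp add: w_def)
  qed
  have iA: "integrable N (\<lambda>x. indicator (A j) (V j x) :: real)"
    by (rule integrable_const_bound[where B=1]) (use ind in \<open>auto simp: indicator_def\<close>)
  have w1: "(\<integral>x. w x \<partial>N) = 1"
    unfolding w_def using iA sp(1) p by (simp add: prob_space p_def[symmetric])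
  note W = weighted_prob[OF N wm w0 w1]
  have "cos_gaussian (density N (\<lambda>x. ennreal (w x))) I V"
    unfolding cos_gaussian_def
  proof (intro allI)
    fix t s
    let ?c = "\<lambda>x. cos ((\<Sum>i\<in>I. t i * V i x) + s)"
    have cm: "?c \<in> borel_measurable N"
      using V by (intro measurable_compose[OF _ borel_measurable_cos] borel_measurable_add borel_measurable_sum borel_measurable_times borel_measurable_const) auto
    have ic: "integrable N ?c" by (rule integrable_const_bound[where B=1, OF AE_I2 cm]) simp
    have iAc: "integrable N (\<lambda>x. indicator (A j) (V j x) * ?c x)"
      by (rule integrable_mult_bounded[OF iA cm, where C=1]) simp
    have "(\<integral>x. ?c x \<partial>density N (\<lambda>x. ennreal (w x))) = (\<integral>x. w x * ?c x \<partial>N)" by (rule W(2)[OF cm])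
    also have "\<dots> = (\<integral>x. (?c x + indicator (A j) (V j x) * ?c x) / (1 + p) \<partial>N)"
      by (simp add: w_def distrib_right)
    also have "\<dots> = (cos s * exp (- (\<Sum>i\<in>I. (t i)\<^sup>2) / 2) + p * (cos s * exp (- (\<Sum>i\<in>I. (t i)\<^sup>2) / 2))) / (1 + p)"
      using ic iAc sp(2)[of t s] cos_gaussianD[OF HI, of t s] by (simp add: p_def)
    also have "\<dots> = cos s * exp (- (\<Sum>i\<in>I. (t i)\<^sup>2) / 2)" using p by (simp add: field_simps)
    finally show "(\<integral>x. ?c x \<partial>density N (\<lambda>x. ennreal (w x))) = cos s * exp (- (\<Sum>i\<in>I. (t i)\<^sup>2) / 2)" .
  qed
  then have "(\<integral>x. ?F x \<partial>density N (\<lambda>x. ennreal (w x))) = ?P"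
    using insert.prems by (intro insert.IH W(1)) auto
  moreover have "(\<integral>x. ?F x \<partial>density N (\<lambda>x. ennreal (w x))) = (\<integral>x. w x * ?F x \<partial>N)" by (rule W(2)[OF Fm])
  moreover have "(\<integral>x. w x * ?F x \<partial>N) = (?P + (\<integral>x. indicator (A j) (V j x) * ?F x \<partial>N)) / (1 + p)"
  proof -
    have iF: "integrable N ?F" by (rule integrable_const_bound[where B=1, OF AE_I2 Fm]) (simp add: Fb)
    have iAF: "integrable N (\<lambda>x. indicator (A j) (V j x) * ?F x)" by (rule integrable_mult_bounded[OF iA Fm Fb])
    have "(\<integral>x. w x * ?F x \<partial>N) = (\<integral>x. (?F x + indicator (A j) (V j x) * ?F x) / (1 + p) \<partial>N)"
      by (simp add: w_def distrib_right)
    also have "\<dots> = ((\<integral>x. ?F x \<partial>N) + (\<integral>x. indicator (A j) (V j x) * ?F x \<partial>N)) / (1 + p)" using iF iAF by simp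
    finally show ?thesis unfolding IH0 .
  qed
  ultimately have "(?P + (\<integral>x. indicator (A j) (V j x) * ?F x \<partial>N)) / (1 + p) = ?P" by simp
  then have "(\<integral>x. indicator (A j) (V j x) * ?F x \<partial>N) = p * ?P" using p by (simp add: field_simps)
  then show ?case using insert.hyps by (simp add: p_def)
qed

lemma cos_gaussian_law:
  assumes fin: "finite I" and N: "prob_space N" and V: "\<And>i. i \<in> I \<Longrightarrow> V i \<in> borel_measurable N" and H: "cos_gaussian N I V"
  shows "distr N (borels I) (\<lambda>x. \<lambda>i\<in>I. V i x) = gam I"
proof -
  interpret prob_space N by (rule N)
  interpret S: prob_space std_normal by (rule prob_std)
  interpret std: product_prob_space "\<lambda>_. std_normal" by (rule product_prob_std)
  have m: "(\<lambda>x. \<lambda>i\<in>I. V i x) \<in> measurable N (borels I)" using V by (intro measurable_restrict)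
  show ?thesis unfolding gam_def
  proof (rule std.PiM_eqI[OF fin])
    show "sets (distr N (borels I) (\<lambda>x. \<lambda>i\<in>I. V i x)) = sets (PiM I (\<lambda>_. std_normal))"
      using sets_gam[of I] by (simp add: gam_def)
    fix A assume "\<And>i. i \<in> I \<Longrightarrow> A i \<in> sets std_normal"
    then have A: "\<And>i. i \<in> I \<Longrightarrow> A i \<in> sets borel" by simp
    have bx: "Pi\<^sub>E I A \<in> sets (borels I)" using A by (intro sets_PiM_I_finite fin)
    let ?E = "(\<lambda>x. \<lambda>i\<in>I. V i x) -` (Pi\<^sub>E I A) \<inter> space N"
    have E: "?E \<in> sets N" by (rule measurable_sets[OF m bx])
    have "measure N ?E = (\<integral>x. indicator ?E x \<partial>N)" using E by simp
    also have "\<dots> = (\<integral>x. (\<Prod>i\<in>I. indicator (A i) (V i x)) \<partial>N)"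
    proof (intro integral_cong refl)
      fix x assume x: "x \<in> space N"
      show "indicator ?E x = (\<Prod>i\<in>I. indicator (A i) (V i x) :: real)"
      proof (cases "\<forall>i\<in>I. V i x \<in> A i")
        case True
        then have "x \<in> ?E" using x by auto
        with True show ?thesis by simp
      next
        case False
        then obtain i where i: "i \<in> I" "V i x \<notin> A i" by blast
        then have "x \<notin> ?E" by (auto simp: PiE_def Pi_def)
        moreover have "(\<Prod>i\<in>I. indicator (A i) (V i x) :: real) = 0" using fin i by (intro prod_zero bexI[of _ i]) auto
        ultimately show ?thesis by simp
      qed
    qed
    also have "\<dots> = (\<Prod>i\<in>I. measure std_normal (A i))" by (rule cos_gaussian_box[OF fin N V H A])
    finally have "emeasure N ?E = ennreal (\<Prod>i\<in>I. measure std_normal (A i))" by (simp add: emeasure_eq_measure)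
    also have "\<dots> = (\<Prod>i\<in>I. emeasure std_normal (A i))"
      by (simp add: prod_ennreal[symmetric] S.emeasure_eq_measure)
    finally show "emeasure (distr N (borels I) (\<lambda>x. \<lambda>i\<in>I. V i x)) (Pi\<^sub>E I A) = (\<Prod>i\<in>I. emeasure std_normal (A i))"
      using emeasure_distr[OF m bx] by simp
  qed
qed

section \<open>Isonormal processes\<close>

lemma gaussian_rv_moments:
  assumes N: "prob_space M" and g: "gaussian_rv M Y 0 v"
  shows "integrable M (\<lambda>\<omega>. (Y \<omega>)\<^sup>2)" "(\<integral>\<omega>. (Y \<omega>)\<^sup>2 \<partial>M) = v"
    "(\<integral>\<omega>. cos (a * Y \<omega> + s) \<partial>M) = cos s * exp (- (a\<^sup>2 * v) / 2)"
proof -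
  interpret prob_space M by (rule N)
  have Ym [measurable]: "Y \<in> borel_measurable M" and v0: "0 \<le> v" using g unfolding gaussian_rv_def by auto
  have "integrable M (\<lambda>\<omega>. (Y \<omega>)\<^sup>2) \<and> (\<integral>\<omega>. (Y \<omega>)\<^sup>2 \<partial>M) = v \<and> (\<integral>\<omega>. cos (a * Y \<omega> + s) \<partial>M) = cos s * exp (- (a\<^sup>2 * v) / 2)"
  proof (cases "v = 0")
    case True
    then have ae: "AE \<omega> in M. Y \<omega> = 0" using g unfolding gaussian_rv_def by auto
    have ae2: "AE \<omega> in M. (Y \<omega>)\<^sup>2 = 0" "AE \<omega> in M. cos (a * Y \<omega> + s) = cos s"
      by (rule AE_mp[OF ae], simp)+
    have 1: "integrable M (\<lambda>\<omega>. (Y \<omega>)\<^sup>2) = integrable M (\<lambda>_. 0 :: real)"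
      by (rule integrable_cong_AE[OF _ _ ae2(1)]) measurable
    have 2: "(\<integral>\<omega>. (Y \<omega>)\<^sup>2 \<partial>M) = (\<integral>\<omega>. 0 \<partial>M)" by (rule integral_cong_AE[OF _ _ ae2(1)]) measurable
    have 3: "(\<integral>\<omega>. cos (a * Y \<omega> + s) \<partial>M) = (\<integral>\<omega>. cos s \<partial>M)" by (rule integral_cong_AE[OF _ _ ae2(2)]) measurable
    show ?thesis using 1 2 3 True prob_space by simp
  next
    case False
    define \<sigma> where "\<sigma> = sqrt v"
    have \<sigma>: "0 < \<sigma>" "\<sigma>\<^sup>2 = v" using False v0 by (auto simp: \<sigma>_def)
    define V where "V \<omega> = Y \<omega> / \<sigma>" for \<omega>
    have Vm [measurable]: "V \<in> borel_measurable M" unfolding V_def[abs_def] by measurable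
    have "distributed M lborel Y (normal_density 0 \<sigma>)" using g False unfolding gaussian_rv_def \<sigma>_def by simp
    then have D: "distributed M lborel V std_normal_density"
      using normal_standard_normal_convert[OF \<sigma>(1), of Y 0] by (simp add: V_def[abs_def])
    have "distr M borel V = distr M lborel V" by (rule distr_cong) auto
    also have "\<dots> = std_normal" by (rule distributed_distr_eq_density[OF D])
    finally have law: "distr M borel V = std_normal" .
    have tr: "(\<integral>\<omega>. h (V \<omega>) \<partial>M) = (\<integral>x. h x \<partial>std_normal)" if "h \<in> borel_measurable borel" for h :: "real \<Rightarrow> real"
      using integral_distr[OF Vm that] unfolding law by simp
    have ti: "integrable M (\<lambda>\<omega>. h (V \<omega>)) = integrable std_normal h" if "h \<in> borel_measurable borel" for h :: "real \<Rightarrow> real"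
      using integrable_distr_eq[OF Vm that] unfolding law by simp
    have Y: "Y \<omega> = \<sigma> * V \<omega>" for \<omega> using \<sigma> by (simp add: V_def)
    have i: "integrable M (\<lambda>\<omega>. (V \<omega>)\<^sup>2)" using ti[of "\<lambda>x. x\<^sup>2"] std_normal_distribution_even_moments(2)[of 1] by simp
    have e: "(\<integral>\<omega>. (V \<omega>)\<^sup>2 \<partial>M) = 1" using tr[of "\<lambda>x. x\<^sup>2"] std_normal_distribution_even_moments(1)[of 1] by simp
    have c: "(\<integral>\<omega>. cos ((a * \<sigma>) * V \<omega> + s) \<partial>M) = cos s * exp (- (a * \<sigma>)\<^sup>2 / 2)"
      using tr[of "\<lambda>x. cos ((a * \<sigma>) * x + s)"] std_cos_integral[of "a * \<sigma>" s] by simp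
    show ?thesis using i e c \<sigma> by (simp add: Y power_mult_distrib mult.assoc)
  qed
  then show "integrable M (\<lambda>\<omega>. (Y \<omega>)\<^sup>2)" "(\<integral>\<omega>. (Y \<omega>)\<^sup>2 \<partial>M) = v"
    "(\<integral>\<omega>. cos (a * Y \<omega> + s) \<partial>M) = cos s * exp (- (a\<^sup>2 * v) / 2)" by blast+
qed

context
  fixes M :: "'w measure" and W :: "'h::{real_inner,polish_space} \<Rightarrow> 'w \<Rightarrow> real"
  assumes iso: "isonormal_process M W"
begin

lemma isonormal_prob: "prob_space M"
  using iso unfolding isonormal_process_def by blast

lemma isonormal_gaussian: "finite A \<Longrightarrow> \<exists>v. gaussian_rv M (\<lambda>\<omega>. \<Sum>h\<in>A. c h * W h \<omega>) 0 v"
  using iso unfolding isonormal_process_def by blast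

lemma isonormal_covariance: "(\<integral>\<omega>. W g \<omega> * W h \<omega> \<partial>M) = inner g h"
  using iso unfolding isonormal_process_def by blast

lemma isonormal_single: "W h \<in> borel_measurable M" "integrable M (\<lambda>\<omega>. (W h \<omega>)\<^sup>2)"
proof -
  obtain v where "gaussian_rv M (\<lambda>\<omega>. \<Sum>h\<in>{h}. 1 * W h \<omega>) 0 v" using isonormal_gaussian[of "{h}" "\<lambda>_. 1"] by auto
  then have g: "gaussian_rv M (W h) 0 v" by simp
  show "W h \<in> borel_measurable M" using g unfolding gaussian_rv_def by blast
  show "integrable M (\<lambda>\<omega>. (W h \<omega>)\<^sup>2)" by (rule gaussian_rv_moments(1)[OF isonormal_prob g])
qed

lemma isonormal_linear_square:
  assumes A: "finite A"
  shows "(\<integral>\<omega>. (\<Sum>h\<in>A. c h * W h \<omega>)\<^sup>2 \<partial>M) = (norm (\<Sum>h\<in>A. c h *\<^sub>R h))\<^sup>2"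
proof -
  have i: "integrable M (\<lambda>\<omega>. W g \<omega> * W h \<omega>)" for g h
    by (rule Cauchy_Schwarz_integral(1)[OF isonormal_single(1) isonormal_single(1) isonormal_single(2) isonormal_single(2)])
  have i': "integrable M (\<lambda>\<omega>. c g * c h * (W g \<omega> * W h \<omega>))" for g h
    using i by (rule integrable_mult_right)
  have "(\<integral>\<omega>. (\<Sum>h\<in>A. c h * W h \<omega>)\<^sup>2 \<partial>M) = (\<integral>\<omega>. (\<Sum>g\<in>A. \<Sum>h\<in>A. c g * c h * (W g \<omega> * W h \<omega>)) \<partial>M)"
    by (simp add: power2_eq_square sum_product mult.assoc mult.left_commute)
  also have "\<dots> = (\<Sum>g\<in>A. \<integral>\<omega>. (\<Sum>h\<in>A. c g * c h * (W g \<omega> * W h \<omega>)) \<partial>M)"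
    by (rule integral_sum) (rule integrable_sum, rule i')
  also have "\<dots> = (\<Sum>g\<in>A. \<Sum>h\<in>A. \<integral>\<omega>. c g * c h * (W g \<omega> * W h \<omega>) \<partial>M)"
    by (rule sum.cong[OF refl], rule integral_sum) (rule i')
  also have "\<dots> = (\<Sum>g\<in>A. \<Sum>h\<in>A. c g * c h * inner g h)"
    by (simp add: isonormal_covariance)
  also have "\<dots> = inner (\<Sum>h\<in>A. c h *\<^sub>R h) (\<Sum>h\<in>A. c h *\<^sub>R h)"
    by (simp add: inner_sum_left inner_sum_right sum_distrib_left mult.assoc mult.left_commute inner_commute)
  finally show ?thesis by (simp add: power2_norm_eq_inner)
qed

lemma isonormal_linear_cos:
  assumes A: "finite A"
  shows "(\<integral>\<omega>. cos ((\<Sum>h\<in>A. c h * W h \<omega>) + s) \<partial>M) = cos s * exp (- (norm (\<Sum>h\<in>A. c h *\<^sub>R h))\<^sup>2 / 2)"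
proof -
  obtain v where g: "gaussian_rv M (\<lambda>\<omega>. \<Sum>h\<in>A. c h * W h \<omega>) 0 v" using isonormal_gaussian[OF A] by blast
  have "v = (norm (\<Sum>h\<in>A. c h *\<^sub>R h))\<^sup>2"
    using gaussian_rv_moments(2)[OF isonormal_prob g] isonormal_linear_square[OF A, of c] by simp
  then show ?thesis using gaussian_rv_moments(3)[OF isonormal_prob g, of 1 s] by simp
qed

lemma isonormal_unit_law:
  assumes h: "norm h = 1" shows "distr M borel (W h) = std_normal"
proof (rule law_std_of_cos[OF isonormal_prob isonormal_single(1)])
  fix a s
  show "(\<integral>x. cos (a * W h x + s) \<partial>M) = cos s * exp (- a\<^sup>2 / 2)"
    using isonormal_linear_cos[of "{h}" "\<lambda>_. a" s] h by simp
qed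

lemma finite_orthonormal_expansion:
  fixes A :: "'h set"
  assumes "finite A"
  shows "\<exists>B. finite B \<and> (\<forall>a\<in>B. \<forall>b\<in>B. inner a b = (if a = b then 1 else 0)) \<and> (\<forall>h\<in>A. (\<Sum>b\<in>B. inner h b *\<^sub>R b) = h)"
  using assms
proof (induction A rule: finite_induct)
  case empty
  show ?case by (intro exI[of _ "{}"]) simp
next
  case (insert a A)
  then obtain B where fB: "finite B" and oB: "\<forall>a\<in>B. \<forall>b\<in>B. inner a b = (if a = b then 1 else 0)"
    and eB: "\<forall>h\<in>A. (\<Sum>b\<in>B. inner h b *\<^sub>R b) = h" by blast
  define r where "r = a - (\<Sum>b\<in>B. inner a b *\<^sub>R b)"
  have rb: "inner r b = 0" if "b \<in> B" for b
  proof -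
    have "(\<Sum>b'\<in>B. inner a b' * inner b' b) = (\<Sum>b'\<in>B. if b' = b then inner a b else 0)"
      using oB that by (intro sum.cong) auto
    also have "\<dots> = inner a b" using fB that by simp
    finally show ?thesis by (simp add: r_def inner_diff_left inner_sum_left)
  qed
  show ?case
  proof (cases "r = 0")
    case True
    then show ?thesis using fB oB eB by (intro exI[of _ B]) (auto simp: r_def)
  next
    case False
    define e where "e = r /\<^sub>R norm r"
    have ee: "inner e e = 1" using False by (simp add: e_def power2_norm_eq_inner[symmetric] power2_eq_square)
    have eb: "inner e b = 0" "inner b e = 0" if "b \<in> B" for b using rb[OF that] by (auto simp: e_def inner_commute)
    have eB': "e \<notin> B" using eb(1)[of e] ee by auto
    have he: "inner h e = 0" if "h \<in> A" for h
    proof -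
      have "inner h e = inner (\<Sum>b\<in>B. inner h b *\<^sub>R b) e" using eB that by simp
      also have "\<dots> = 0" by (simp add: inner_sum_left eb)
      finally show ?thesis .
    qed
    have "inner a e = inner (r + (\<Sum>b\<in>B. inner a b *\<^sub>R b)) e" by (simp add: r_def)
    also have "\<dots> = inner r e" by (simp add: inner_add_left inner_sum_left eb)
    also have "\<dots> = norm r" using False by (simp add: e_def power2_norm_eq_inner[symmetric] power2_eq_square)
    finally have "inner a e *\<^sub>R e = r" using False by (simp add: e_def)
    then have "(\<Sum>b\<in>insert e B. inner a b *\<^sub>R b) = a" using fB eB' by (simp add: r_def)
    moreover have "(\<Sum>b\<in>insert e B. inner h b *\<^sub>R b) = h" if "h \<in> A" for h
      using fB eB' he[OF that] eB that by simp
    moreover have "\<forall>a\<in>insert e B. \<forall>b\<in>insert e B. inner a b = (if a = b then 1 else 0)"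
      using oB ee eb eB' by auto
    ultimately show ?thesis using fB by (intro exI[of _ "insert e B"]) simp
  qed
qed

lemma isonormal_cos_gaussian:
  assumes fB: "finite B" and oB: "\<forall>a\<in>B. \<forall>b\<in>B. inner a b = (if a = b then 1 else 0)"
  shows "cos_gaussian M B W"
  unfolding cos_gaussian_def
proof (intro allI)
  fix t s
  have "(norm (\<Sum>b\<in>B. t b *\<^sub>R b))\<^sup>2 = (\<Sum>a\<in>B. \<Sum>b\<in>B. t a * (t b * inner a b))"
    by (simp add: power2_norm_eq_inner inner_sum_left inner_sum_right sum_distrib_left mult.left_commute inner_commute)
  also have "\<dots> = (\<Sum>a\<in>B. \<Sum>b\<in>B. if b = a then (t a)\<^sup>2 else 0)"
    using oB by (intro sum.cong refl) (auto simp: power2_eq_square)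
  also have "\<dots> = (\<Sum>a\<in>B. (t a)\<^sup>2)" using fB by simp
  finally show "(\<integral>x. cos ((\<Sum>b\<in>B. t b * W b x) + s) \<partial>M) = cos s * exp (- (\<Sum>b\<in>B. (t b)\<^sup>2) / 2)"
    using isonormal_linear_cos[OF fB, of t s] by simp
qed

text \<open>Almost sure linearity of \<open>W\<close>, from the covariance: the difference of both
  sides has variance equal to the squared norm of the zero vector.\<close>

lemma isonormal_expansion:
  assumes fB: "finite B" and h: "(\<Sum>b\<in>B. inner h b *\<^sub>R b) = h"
  shows "AE \<omega> in M. (\<Sum>b\<in>B. inner h b * W b \<omega>) = W h \<omega>"
proof -
  \<comment> \<open>One coefficient function for the whole difference, on the index set
    \<open>insert h B\<close>; it stays correct when \<open>h\<close> itself lies in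
    \<open>B\<close>.\<close>
  define c where "c x = (if x \<in> B then inner h x else 0) - (if x = h then 1 else 0 :: real)" for x
  have s1: "(\<Sum>x\<in>insert h B. c x * f x) = (\<Sum>b\<in>B. inner h b * f b) - f h" for f :: "'h \<Rightarrow> real"
  proof -
    have "(\<Sum>x\<in>insert h B. c x * f x) = (\<Sum>x\<in>insert h B. (if x \<in> B then inner h x * f x else 0)) - (\<Sum>x\<in>insert h B. if x = h then f x else 0)"
      unfolding sum_subtractf[symmetric] by (rule sum.cong) (auto simp: c_def algebra_simps)
    also have "(\<Sum>x\<in>insert h B. (if x \<in> B then inner h x * f x else 0)) = (\<Sum>b\<in>B. inner h b * f b)"
      using fB by (intro sum.mono_neutral_cong_right) auto
    finally show ?thesis using fB by simp
  qed
  have s2: "(\<Sum>x\<in>insert h B. c x *\<^sub>R x) = 0"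
  proof -
    have "(\<Sum>x\<in>insert h B. c x *\<^sub>R x) = (\<Sum>x\<in>insert h B. (if x \<in> B then inner h x *\<^sub>R x else 0)) - (\<Sum>x\<in>insert h B. if x = h then x else 0)"
      unfolding sum_subtractf[symmetric] by (rule sum.cong) (auto simp: c_def algebra_simps)
    also have "(\<Sum>x\<in>insert h B. (if x \<in> B then inner h x *\<^sub>R x else 0)) = (\<Sum>b\<in>B. inner h b *\<^sub>R b)"
      using fB by (intro sum.mono_neutral_cong_right) auto
    finally show ?thesis using fB h by simp
  qed
  have fin: "finite (insert h B)" using fB by simp
  have e: "(\<integral>\<omega>. (\<Sum>x\<in>insert h B. c x * W x \<omega>)\<^sup>2 \<partial>M) = 0"
    unfolding isonormal_linear_square[OF fin] s2 by simp
  obtain v where g: "gaussian_rv M (\<lambda>\<omega>. \<Sum>x\<in>insert h B. c x * W x \<omega>) 0 v" using isonormal_gaussian[OF fin] by blast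
  have i: "integrable M (\<lambda>\<omega>. (\<Sum>x\<in>insert h B. c x * W x \<omega>)\<^sup>2)" by (rule gaussian_rv_moments(1)[OF isonormal_prob g])
  have "AE \<omega> in M. (\<Sum>x\<in>insert h B. c x * W x \<omega>)\<^sup>2 = 0"
    using integral_nonneg_eq_0_iff_AE[OF i] e by simp
  then show ?thesis unfolding s1 by simp
qed

text \<open>Expanding the vectors of \<open>A\<close> in an orthonormal system makes the sum a
  polynomial of degree \<open>q\<close> in independent standard Gaussians, however many of them are
  needed. The mean is 0 by orthogonality to \<open>hermite 0\<close>.\<close>

lemma isonormal_hermite_sum:
  assumes A: "finite A" "A \<subseteq> sphere 0 1" and q: "1 \<le> q"
  obtains B :: "'h set" and P where "finite B" "pol B q P" "(\<integral>z. P z \<partial>gam B) = 0"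
    "distr M borel (\<lambda>\<omega>. \<Sum>h\<in>A. c h * hermite q (W h \<omega>)) = distr (gam B) borel P"
proof -
  interpret prob_space M by (rule isonormal_prob)
  obtain B :: "'h set" where fB: "finite B" and oB: "\<forall>a\<in>B. \<forall>b\<in>B. inner a b = (if a = b then 1 else 0)"
    and eB: "\<forall>h\<in>A. (\<Sum>b\<in>B. inner h b *\<^sub>R b) = h" using finite_orthonormal_expansion[OF A(1)] by blast
  have Wm [measurable]: "\<And>h. W h \<in> borel_measurable M" by (rule isonormal_single(1))
  define R where "R \<omega> = (\<lambda>b\<in>B. W b \<omega>)" for \<omega>
  have Rm: "R \<in> measurable M (gam B)" unfolding measurable_cong_sets[OF refl sets_gam] R_def[abs_def]
    by (intro measurable_restrict Wm)
  have "distr M (borels B) R = gam B" unfolding R_def[abs_def]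
    by (rule cos_gaussian_law[OF fB isonormal_prob Wm isonormal_cos_gaussian[OF fB oB]])
  moreover have "distr M (borels B) R = distr M (gam B) R" by (rule distr_cong) (simp_all add: sets_gam)
  ultimately have law: "distr M (gam B) R = gam B" by simp
  define L where "L h z = (\<Sum>b\<in>B. inner h b * z b)" for h and z :: "'h \<Rightarrow> real"
  have Lp: "pol B 1 (L h)" for h unfolding L_def[abs_def] by (intro pol_sum pol_cmult pol_proj)
  have Hp: "pol B q (\<lambda>z. hermite q (L h z))" for h by (rule pol_hermite[OF Lp])
  define P where "P z = (\<Sum>h\<in>A. c h * hermite q (L h z))" for z
  have Pp: "pol B q P" unfolding P_def[abs_def] by (intro pol_sum pol_cmult Hp)
  have LR: "L h (R \<omega>) = (\<Sum>b\<in>B. inner h b * W b \<omega>)" for h \<omega>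
    unfolding L_def R_def by (rule sum.cong) auto
  have ae: "AE \<omega> in M. L h (R \<omega>) = W h \<omega>" if "h \<in> A" for h
    unfolding LR by (rule isonormal_expansion[OF fB]) (use eB that in blast)
  have [measurable]: "P \<in> borel_measurable (gam B)" "(\<lambda>z. hermite q (L h z)) \<in> borel_measurable (gam B)" for h
    using nice_measurable_gam[OF pol_nice[OF Pp fB]] nice_measurable_gam[OF pol_nice[OF Hp fB]] by auto
  note [measurable] = Rm
  have "(\<integral>z. hermite q (L h z) \<partial>gam B) = 0" if h: "h \<in> A" for h
  proof -
    have "(\<integral>z. hermite q (L h z) \<partial>gam B) = (\<integral>z. hermite q (L h z) \<partial>distr M (gam B) R)" by (simp add: law)
    also have "\<dots> = (\<integral>\<omega>. hermite q (L h (R \<omega>)) \<partial>M)" by (rule integral_distr) measurable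
    also have "\<dots> = (\<integral>\<omega>. hermite q (W h \<omega>) \<partial>M)"
    proof (rule integral_cong_AE)
      show "AE \<omega> in M. hermite q (L h (R \<omega>)) = hermite q (W h \<omega>)" using ae[OF h] by eventually_elim simp
    qed measurable
    also have "\<dots> = (\<integral>x. hermite q x \<partial>distr M borel (W h))" by (rule integral_distr[symmetric]) measurable
    also have "\<dots> = (\<integral>x. hermite q x * hermite 0 x \<partial>std_normal)"
      using isonormal_unit_law[of h] A(2) h by auto
    also have "\<dots> = 0" unfolding hermite_orthogonal using q by simp
    finally show ?thesis .
  qed
  then have P0: "(\<integral>z. P z \<partial>gam B) = 0"
    unfolding P_def by (subst integral_sum) (auto intro!: integrable_mult_right pol_integrable[OF fB Hp])
  have "AE \<omega> in M. (\<Sum>h\<in>A. c h * hermite q (W h \<omega>)) = P (R \<omega>)"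
  proof -
    have "AE \<omega> in M. \<forall>h\<in>A. L h (R \<omega>) = W h \<omega>" using ae A(1) by (simp add: AE_finite_all)
    then show ?thesis by eventually_elim (simp add: P_def)
  qed
  then have "distr M borel (\<lambda>\<omega>. \<Sum>h\<in>A. c h * hermite q (W h \<omega>)) = distr M borel (\<lambda>\<omega>. P (R \<omega>))"
    by (intro distr_cong_AE) auto
  also have "\<dots> = distr (distr M (gam B) R) borel P" by (subst distr_distr) (auto simp: comp_def)
  also have "\<dots> = distr (gam B) borel P" by (simp only: law)
  finally show thesis by (rule that[OF fB Pp P0])
qed

end

section \<open>Approximation of multiple integrals by polynomials\<close>

lemma same_law_integral:
  fixes h :: "real \<Rightarrow> real"
  assumes law: "distr M borel Y = distr N borel P" and m: "Y \<in> borel_measurable M" "P \<in> borel_measurable N" "h \<in> borel_measurable borel"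
  shows "(\<integral>x. h (Y x) \<partial>M) = (\<integral>x. h (P x) \<partial>N)" "integrable M (\<lambda>x. h (Y x)) = integrable N (\<lambda>x. h (P x))"
  using integral_distr[OF m(1,3)] integral_distr[OF m(2,3)] integrable_distr_eq[OF m(1,3)] integrable_distr_eq[OF m(2,3)]
  unfolding law by simp_all

text \<open>The difference of fourth powers is \<open>X - Y\<close> times a cubic factor
  \<open>g\<close>. Its mean square is controlled by the eighth moments, at most
  \<open>16 * (1 + B)\<close>, and Cauchy-Schwarz does the rest.\<close>

lemma fourth_moment_close:
  fixes X Y :: "'a \<Rightarrow> real"
  assumes M: "prob_space M" and m: "X \<in> borel_measurable M" "Y \<in> borel_measurable M"
    and i: "integrable M (\<lambda>x. X x ^ 8)" "integrable M (\<lambda>x. Y x ^ 8)"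
    and b: "(\<integral>x. X x ^ 8 \<partial>M) \<le> B" "(\<integral>x. Y x ^ 8 \<partial>M) \<le> B"
    and e: "integrable M (\<lambda>x. (X x - Y x)\<^sup>2)" "(\<integral>x. (X x - Y x)\<^sup>2 \<partial>M) \<le> c\<^sup>2" "0 \<le> c"
  shows "\<bar>(\<integral>x. Y x ^ 4 \<partial>M) - (\<integral>x. X x ^ 4 \<partial>M)\<bar> \<le> c * (4 * sqrt (1 + B))"
proof -
  interpret prob_space M by (rule M)
  note [measurable] = m
  have i4: "integrable M (\<lambda>x. X x ^ 4)" "integrable M (\<lambda>x. Y x ^ 4)"
    by (rule integrable_of_square[OF M]; use i in simp)+
  have B0: "0 \<le> B" by (rule order_trans[OF _ b(1)]) simp
  define g where "g x = (X x + Y x) * ((X x)\<^sup>2 + (Y x)\<^sup>2)" for x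
  have gm [measurable]: "g \<in> borel_measurable M" unfolding g_def[abs_def] by measurable
  have cube: "a ^ 3 \<le> 1 + a ^ 4" if "0 \<le> a" for a :: real
  proof (cases "a \<le> 1")
    case True
    then have "a ^ 3 \<le> 1" using that by (simp add: power_le_one)
    then show ?thesis using that by (simp add: add_increasing2)
  next
    case False
    then have "a ^ 3 \<le> a ^ 4" by (intro power_increasing) auto
    then show ?thesis by simp
  qed
  have gb: "(g x)\<^sup>2 \<le> 8 * (2 + X x ^ 8 + Y x ^ 8)" for x
  proof -
    define s t where "s = (X x)\<^sup>2" and "t = (Y x)\<^sup>2"
    have st: "0 \<le> s" "0 \<le> t" by (auto simp: s_def t_def)
    have p8: "s ^ 4 = X x ^ 8" "t ^ 4 = Y x ^ 8" by (auto simp: s_def t_def power_mult[symmetric])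
    have "2 * (s + t) = (X x + Y x)\<^sup>2 + (X x - Y x)\<^sup>2" unfolding s_def t_def by (simp add: power2_sum power2_diff)
    then have "(X x + Y x)\<^sup>2 \<le> 2 * (s + t)" by simp
    then have "(X x + Y x)\<^sup>2 * (s + t)\<^sup>2 \<le> 2 * (s + t) * (s + t)\<^sup>2" by (rule mult_right_mono) simp
    also have "\<dots> = 2 * (s + t) ^ 3" by (simp add: power2_eq_square power3_eq_cube)
    also have "(s + t) ^ 3 \<le> 4 * (s ^ 3 + t ^ 3)"
    proof -
      have "4 * (s ^ 3 + t ^ 3) - (s + t) ^ 3 = 3 * ((s + t) * (s - t)\<^sup>2)" by (simp add: power2_eq_square power3_eq_cube algebra_simps)
      moreover have "0 \<le> (s + t) * (s - t)\<^sup>2" using st by simp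
      ultimately show ?thesis by linarith
    qed
    finally have "(g x)\<^sup>2 \<le> 8 * (s ^ 3 + t ^ 3)" by (simp add: g_def power_mult_distrib s_def t_def)
    also have "\<dots> \<le> 8 * ((1 + X x ^ 8) + (1 + Y x ^ 8))"
      using cube[OF st(1)] cube[OF st(2)] unfolding p8 by (intro mult_left_mono add_mono) auto
    also have "\<dots> = 8 * (2 + X x ^ 8 + Y x ^ 8)" by simp
    finally show ?thesis .
  qed
  have ib: "integrable M (\<lambda>x. 8 * (2 + X x ^ 8 + Y x ^ 8))" using i by simp
  have ig: "integrable M (\<lambda>x. (g x)\<^sup>2)"
  proof (rule integrable_bound[OF ib])
    show "AE x in M. norm ((g x)\<^sup>2) \<le> norm (8 * (2 + X x ^ 8 + Y x ^ 8))"
    proof (rule AE_I2)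
      fix x show "norm ((g x)\<^sup>2) \<le> norm (8 * (2 + X x ^ 8 + Y x ^ 8))"
        using gb[of x] unfolding real_norm_def by (metis abs_ge_self abs_of_nonneg order_trans zero_le_power2)
    qed
  qed measurable
  have "(\<integral>x. (g x)\<^sup>2 \<partial>M) \<le> (\<integral>x. 8 * (2 + X x ^ 8 + Y x ^ 8) \<partial>M)" by (rule integral_mono[OF ig ib gb])
  also have "\<dots> = 8 * (2 + (\<integral>x. X x ^ 8 \<partial>M) + (\<integral>x. Y x ^ 8 \<partial>M))" using i by (simp add: prob_space)
  also have "\<dots> \<le> (4 * sqrt (1 + B))\<^sup>2" using b B0 by (simp add: power_mult_distrib)
  finally have g2: "(\<integral>x. (g x)\<^sup>2 \<partial>M) \<le> (4 * sqrt (1 + B))\<^sup>2" .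
  have d0: "0 \<le> 4 * sqrt (1 + B)" using B0 by simp
  have "(\<integral>x. (X x - Y x) * g x \<partial>M) \<le> c * (4 * sqrt (1 + B))"
    by (rule Cauchy_Schwarz_bound[OF _ gm e(1) ig e(2) g2 e(3) d0]) measurable
  moreover have "(\<integral>x. (Y x - X x) * g x \<partial>M) \<le> c * (4 * sqrt (1 + B))"
    by (rule Cauchy_Schwarz_bound[OF _ gm _ ig _ g2 e(3) d0]) (use e in \<open>simp_all add: power2_commute\<close>)
  moreover have alg: "(a - b) * ((a + b) * (a\<^sup>2 + b\<^sup>2)) = a ^ 4 - b ^ 4" for a b :: real
    by (simp add: power2_eq_square power4_eq_xxxx algebra_simps)
  moreover have "(X x - Y x) * g x = X x ^ 4 - Y x ^ 4" "(Y x - X x) * g x = Y x ^ 4 - X x ^ 4" for x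
    using alg[of "X x" "Y x"] alg[of "Y x" "X x"] by (simp_all add: g_def add.commute)
  ultimately show ?thesis using i4 by (simp add: abs_le_iff)
qed

text \<open>Convergence in L^2 gives an almost surely convergent subsequence, along which Fatou's
  lemma applies.\<close>

lemma eighth_moment_limit:
  fixes X :: "'a \<Rightarrow> real" and Y :: "nat \<Rightarrow> 'a \<Rightarrow> real"
  assumes m: "X \<in> borel_measurable M" "\<And>n. Y n \<in> borel_measurable M"
    and i: "\<And>n. integrable M (\<lambda>x. Y n x ^ 8)" and b: "\<And>n. (\<integral>x. Y n x ^ 8 \<partial>M) \<le> B"
    and e: "\<And>n. integrable M (\<lambda>x. (X x - Y n x)\<^sup>2)" "\<And>n. (\<integral>x. (X x - Y n x)\<^sup>2 \<partial>M) \<le> inverse (real (Suc n))"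
  shows "integrable M (\<lambda>x. X x ^ 8)" "(\<integral>x. X x ^ 8 \<partial>M) \<le> B"
proof -
  note [measurable] = m
  have B0: "0 \<le> B" by (rule order_trans[OF _ b[of 0]]) simp
  have "(\<lambda>n. \<integral>x. norm ((X x - Y n x)\<^sup>2) \<partial>M) \<longlonglongrightarrow> 0"
    by (rule tendsto_sandwich[OF _ _ tendsto_const LIMSEQ_inverse_real_of_nat])
       (use e(2) in \<open>auto intro!: always_eventually\<close>)
  then obtain r where "AE x in M. (\<lambda>n. (X x - Y (r n) x)\<^sup>2) \<longlonglongrightarrow> 0"
    using tendsto_L1_AE_subseq[of M "\<lambda>n x. (X x - Y n x)\<^sup>2"] e(1) by blast
  then have ae: "AE x in M. ennreal (X x ^ 8) = liminf (\<lambda>n. ennreal (Y (r n) x ^ 8))"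
  proof eventually_elim
    case (elim x)
    have "(\<lambda>n. \<bar>X x - Y (r n) x\<bar>) \<longlonglongrightarrow> 0" using tendsto_real_sqrt[OF elim] by simp
    then have "(\<lambda>n. X x - Y (r n) x) \<longlonglongrightarrow> 0" by (rule tendsto_rabs_zero_cancel)
    then have "(\<lambda>n. X x - (X x - Y (r n) x)) \<longlonglongrightarrow> X x - 0" by (intro tendsto_diff tendsto_const)
    then have "(\<lambda>n. Y (r n) x) \<longlonglongrightarrow> X x" by simp
    then have "(\<lambda>n. ennreal (Y (r n) x ^ 8)) \<longlonglongrightarrow> ennreal (X x ^ 8)" by (intro tendsto_ennrealI tendsto_power)
    then show ?case by (intro lim_imp_Liminf[symmetric]) simp_all
  qed
  have "(\<integral>\<^sup>+x. ennreal (X x ^ 8) \<partial>M) = (\<integral>\<^sup>+x. liminf (\<lambda>n. ennreal (Y (r n) x ^ 8)) \<partial>M)"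
    by (rule nn_integral_cong_AE[OF ae])
  also have "\<dots> \<le> liminf (\<lambda>n. \<integral>\<^sup>+x. ennreal (Y (r n) x ^ 8) \<partial>M)" by (rule nn_integral_liminf) measurable
  also have "\<dots> \<le> limsup (\<lambda>n. \<integral>\<^sup>+x. ennreal (Y (r n) x ^ 8) \<partial>M)" by (rule Liminf_le_Limsup) simp
  also have "\<dots> \<le> ennreal B"
  proof (rule Limsup_bounded, rule always_eventually, rule allI)
    fix n
    have "(\<integral>\<^sup>+x. ennreal (Y (r n) x ^ 8) \<partial>M) = ennreal (\<integral>x. Y (r n) x ^ 8 \<partial>M)"
      by (rule nn_integral_eq_integral[OF i]) simp
    also have "\<dots> \<le> ennreal B" by (rule ennreal_leI[OF b])
    finally show "(\<integral>\<^sup>+x. ennreal (Y (r n) x ^ 8) \<partial>M) \<le> ennreal B" .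
  qed
  finally have nn: "(\<integral>\<^sup>+x. ennreal (X x ^ 8) \<partial>M) \<le> ennreal B" .
  show iX: "integrable M (\<lambda>x. X x ^ 8)"
    by (rule integrableI_nonneg) (use nn in \<open>auto simp: less_top[symmetric] top_unique\<close>)
  have "ennreal (\<integral>x. X x ^ 8 \<partial>M) \<le> ennreal B"
    using nn nn_integral_eq_integral[OF iX] by simp
  then show "(\<integral>x. X x ^ 8 \<partial>M) \<le> B" using B0 by simp
qed

text \<open>The approximating Hermite sum is divided by its L^2 norm \<open>r\<close>, because a
  Stein pair must have variance exactly 1; the work lies in keeping it close to \<open>X\<close>
  after this.\<close>

lemma multiple_integral_approx:
  fixes W :: "'h::{real_inner,polish_space} \<Rightarrow> 'w \<Rightarrow> real"
  assumes iso: "isonormal_process M W" and q: "1 \<le> q" and mi: "is_multiple_integral M W q f X"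
    and X2: "(\<integral>\<omega>. (X \<omega>)\<^sup>2 \<partial>M) = 1" and \<delta>: "0 < \<delta>"
  obtains B :: "'h set" and P Y where "finite B" "pol B q P" "(\<integral>z. P z \<partial>gam B) = 0" "(\<integral>z. (P z)\<^sup>2 \<partial>gam B) = 1"
    "Y \<in> borel_measurable M" "distr M borel Y = distr (gam B) borel P"
    "integrable M (\<lambda>\<omega>. (X \<omega> - Y \<omega>)\<^sup>2)" "(\<integral>\<omega>. (X \<omega> - Y \<omega>)\<^sup>2 \<partial>M) < \<delta>"
proof -
  interpret prob_space M by (rule isonormal_prob[OF iso])
  \<comment> \<open>Below 1/5 the square of \<open>1 - r\<close> stays under 1/4, which forces
    \<open>r \<ge> 1/2\<close>; then dividing by \<open>r\<close> costs at most a factor 2, hence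
    \<open>\<delta>/2\<close>.\<close>
  define \<epsilon> where "\<epsilon> = min (1/5) (\<delta>/2)"
  have \<epsilon>: "0 < \<epsilon>" "\<epsilon> \<le> 1/5" "2 * \<epsilon> \<le> \<delta>" using \<delta> by (auto simp: \<epsilon>_def)
  have Xm [measurable]: "X \<in> borel_measurable M" and iX: "integrable M (\<lambda>\<omega>. (X \<omega>)\<^sup>2)"
    using mi unfolding is_multiple_integral_def by auto
  obtain A c where A: "finite A" "A \<subseteq> sphere 0 1"
    and e: "(\<integral>\<omega>. (X \<omega> - (\<Sum>h\<in>A. c h * hermite q (W h \<omega>)))\<^sup>2 \<partial>M) < \<epsilon>"
    using mi \<epsilon>(1) unfolding is_multiple_integral_def by blast
  define Y0 where "Y0 \<omega> = (\<Sum>h\<in>A. c h * hermite q (W h \<omega>))" for \<omega>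
  have Wm [measurable]: "\<And>h. W h \<in> borel_measurable M" by (rule isonormal_single(1)[OF iso])
  have Ym [measurable]: "Y0 \<in> borel_measurable M" unfolding Y0_def[abs_def] by measurable
  obtain B :: "'h set" and P0 where fB: "finite B" and P0: "pol B q P0" "(\<integral>z. P0 z \<partial>gam B) = 0"
    and law: "distr M borel Y0 = distr (gam B) borel P0"
    using isonormal_hermite_sum[OF iso A q, of c] unfolding Y0_def[abs_def] by blast
  have P0m [measurable]: "P0 \<in> borel_measurable (gam B)" by (rule nice_measurable_gam[OF pol_nice[OF P0(1) fB]])
  have sq: "integrable (gam B) (\<lambda>z. (P0 z)\<^sup>2)" by (rule pol_integrable[OF fB pol_power[OF P0(1)]])
  have sl: "(\<integral>\<omega>. (Y0 \<omega>)\<^sup>2 \<partial>M) = (\<integral>z. (P0 z)\<^sup>2 \<partial>gam B)" "integrable M (\<lambda>\<omega>. (Y0 \<omega>)\<^sup>2) = integrable (gam B) (\<lambda>z. (P0 z)\<^sup>2)"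
    by (rule same_law_integral[OF law Ym P0m, where h="\<lambda>x. x\<^sup>2"], measurable)+
  have iY: "integrable M (\<lambda>\<omega>. (Y0 \<omega>)\<^sup>2)" using sl(2) sq by simp
  have iXY: "integrable M (\<lambda>\<omega>. X \<omega> * Y0 \<omega>)" by (rule Cauchy_Schwarz_integral(1)[OF Xm Ym iX iY])
  define r where "r = sqrt (\<integral>\<omega>. (Y0 \<omega>)\<^sup>2 \<partial>M)"
  define p where "p = (\<integral>\<omega>. X \<omega> * Y0 \<omega> \<partial>M)"
  have r0: "0 \<le> r" and r2: "(\<integral>\<omega>. (Y0 \<omega>)\<^sup>2 \<partial>M) = r\<^sup>2" by (simp_all add: r_def)
  have sqd: "integrable M (\<lambda>\<omega>. (X \<omega> - t * Y0 \<omega>)\<^sup>2) \<and> (\<integral>\<omega>. (X \<omega> - t * Y0 \<omega>)\<^sup>2 \<partial>M) = 1 - 2 * t * p + t\<^sup>2 * r\<^sup>2" for t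
  proof -
    have eq: "(X \<omega> - t * Y0 \<omega>)\<^sup>2 = (X \<omega>)\<^sup>2 - 2 * t * (X \<omega> * Y0 \<omega>) + t\<^sup>2 * (Y0 \<omega>)\<^sup>2" for \<omega>
      by (simp add: power2_diff power_mult_distrib)
    show ?thesis unfolding eq using iX iY iXY X2 r2 by (simp add: p_def)
  qed
  have e': "1 - 2 * p + r\<^sup>2 < \<epsilon>" using e sqd[of 1] by (simp add: Y0_def)
  have cs: "p \<le> 1 * r" unfolding p_def
    by (rule Cauchy_Schwarz_bound[OF Xm Ym iX iY]) (use X2 r2 r0 in auto)
  have "(1 - r)\<^sup>2 < 1/5" using e' cs \<epsilon>(2) by (simp add: power2_diff)
  have r: "1/2 \<le> r"
  proof (rule ccontr)
    assume "\<not> 1/2 \<le> r"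
    then have "(1/2)\<^sup>2 \<le> (1 - r)\<^sup>2" by (intro power_mono) auto
    with \<open>(1 - r)\<^sup>2 < 1/5\<close> show False by (simp add: power2_eq_square)
  qed
  define Y where "Y \<omega> = (1 / r) * Y0 \<omega>" for \<omega>
  define P where "P z = (1 / r) * P0 z" for z
  have "1 - 2 * (1 / r) * p + (1 / r)\<^sup>2 * r\<^sup>2 < \<delta>"
  proof -
    have "1 - 2 * (1 / r) * p + (1 / r)\<^sup>2 * r\<^sup>2 = 2 - 2 * p / r" using r by (simp add: power_divide)
    also have "\<dots> = (2 * r - 2 * p) / r" using r by (simp add: diff_divide_distrib)
    also have "\<dots> \<le> (1 - 2 * p + r\<^sup>2) / r"
    proof (rule divide_right_mono)
      have "0 \<le> (1 - r)\<^sup>2" by simp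
      then show "2 * r - 2 * p \<le> 1 - 2 * p + r\<^sup>2" by (simp add: power2_diff)
    qed (use r in simp)
    also have "\<dots> < \<epsilon> / r" using e' r by (intro divide_strict_right_mono) auto
    also have "\<dots> \<le> \<epsilon> / (1/2)" using r \<epsilon> by (intro divide_left_mono) auto
    also have "\<dots> \<le> \<delta>" using \<epsilon> by simp
    finally show ?thesis .
  qed
  then have d: "integrable M (\<lambda>\<omega>. (X \<omega> - Y \<omega>)\<^sup>2)" "(\<integral>\<omega>. (X \<omega> - Y \<omega>)\<^sup>2 \<partial>M) < \<delta>"
    using sqd[of "1 / r"] unfolding Y_def by simp_all
  have Yme: "Y \<in> borel_measurable M" unfolding Y_def[abs_def] by measurable
  have Pp: "pol B q P" unfolding P_def[abs_def] by (rule pol_cmult[OF P0(1)])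
  have Pz: "(\<integral>z. P z \<partial>gam B) = 0" using P0(2) by (simp add: P_def)
  have Po: "(\<integral>z. (P z)\<^sup>2 \<partial>gam B) = 1"
  proof -
    have "(\<integral>z. (P z)\<^sup>2 \<partial>gam B) = (1 / r)\<^sup>2 * (\<integral>z. (P0 z)\<^sup>2 \<partial>gam B)"
      unfolding P_def power_mult_distrib by (rule integral_mult_right_zero)
    also have "\<dots> = 1" unfolding sl(1)[symmetric] r2 using r by (simp add: power_divide)
    finally show ?thesis .
  qed
  have "distr M borel Y = distr (distr M borel Y0) borel (\<lambda>x. (1 / r) * x)"
    by (subst distr_distr) (auto simp: comp_def Y_def[abs_def])
  also have "\<dots> = distr (gam B) borel P"
    unfolding law by (subst distr_distr) (auto simp: comp_def P_def[abs_def])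
  finally show thesis by (rule that[OF fB Pp Pz Po Yme _ d])
qed

text \<open>The order of the quantifiers matters: \<open>C\<close> depends on the degree and is
  fixed before \<open>f\<close>, \<open>X\<close> and \<open>\<delta>\<close>, so refining the
  approximation does not change the moment bounds.\<close>

theorem chaos_approx:
  fixes W :: "'h::{real_inner,polish_space} \<Rightarrow> 'w \<Rightarrow> real"
  assumes iso: "isonormal_process M W" and q: "1 \<le> q"
  obtains C :: real where "1 \<le> C"
    "\<And>f X \<delta>. is_multiple_integral M W q f X \<Longrightarrow> (\<integral>\<omega>. (X \<omega>)\<^sup>2 \<partial>M) = 1 \<Longrightarrow> 0 < \<delta> \<Longrightarrow>
      \<exists>(\<Omega> :: (real \<times> ('h \<Rightarrow> real) \<times> ('h \<Rightarrow> real)) measure) Y' T S Y. stein_pair \<Omega> Y' T S C \<and>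
        Y \<in> borel_measurable M \<and> distr M borel Y = distr \<Omega> borel Y' \<and>
        integrable M (\<lambda>\<omega>. (X \<omega> - Y \<omega>)\<^sup>2) \<and> (\<integral>\<omega>. (X \<omega> - Y \<omega>)\<^sup>2 \<partial>M) < \<delta> \<and>
        \<bar>(\<integral>x. Y' x ^ 4 \<partial>\<Omega>) - (\<integral>\<omega>. X \<omega> ^ 4 \<partial>M)\<bar> \<le> \<delta>"
proof -
  interpret prob_space M by (rule isonormal_prob[OF iso])
  obtain C where C: "1 \<le> C"
    "\<And>(I :: 'h set) P. finite I \<Longrightarrow> pol I q P \<Longrightarrow> (\<integral>z. P z \<partial>gam I) = 0 \<Longrightarrow> (\<integral>z. (P z)\<^sup>2 \<partial>gam I) = 1 \<Longrightarrow>
       \<exists>T S. stein_pair (cov_space I) (\<lambda>p. P (fst (snd p))) T S C"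
    using stein_pair_exists[of q] by blast
  have ex: "\<exists>(\<Omega> :: (real \<times> ('h \<Rightarrow> real) \<times> ('h \<Rightarrow> real)) measure) Y' T S Y. stein_pair \<Omega> Y' T S C \<and>
        Y \<in> borel_measurable M \<and> distr M borel Y = distr \<Omega> borel Y' \<and>
        integrable M (\<lambda>\<omega>. (X \<omega> - Y \<omega>)\<^sup>2) \<and> (\<integral>\<omega>. (X \<omega> - Y \<omega>)\<^sup>2 \<partial>M) < \<delta>"
    if X: "is_multiple_integral M W q f X" "(\<integral>\<omega>. (X \<omega>)\<^sup>2 \<partial>M) = 1" "0 < \<delta>" for f X \<delta>
  proof -
    obtain B :: "'h set" and P Y where h: "finite B" "pol B q P" "(\<integral>z. P z \<partial>gam B) = 0" "(\<integral>z. (P z)\<^sup>2 \<partial>gam B) = 1"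
      "Y \<in> borel_measurable M" "distr M borel Y = distr (gam B) borel P"
      "integrable M (\<lambda>\<omega>. (X \<omega> - Y \<omega>)\<^sup>2)" "(\<integral>\<omega>. (X \<omega> - Y \<omega>)\<^sup>2 \<partial>M) < \<delta>"
      by (rule multiple_integral_approx[OF iso q X])
    obtain T S where sp: "stein_pair (cov_space B) (\<lambda>p. P (fst (snd p))) T S C" using C(2)[OF h(1-4)] by blast
    have Pm: "P \<in> borel_measurable (gam B)" by (rule nice_measurable_gam[OF pol_nice[OF h(2,1)]])
    have "distr (cov_space B) borel (\<lambda>p. P (fst (snd p))) = distr (distr (cov_space B) (gam B) (\<lambda>p. fst (snd p))) borel P"
      by (subst distr_distr[OF Pm first_measurable]) (simp add: comp_def)
    then have "distr M borel Y = distr (cov_space B) borel (\<lambda>p. P (fst (snd p)))" unfolding distr_cov_first h(6) by simp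
    with sp h(5,7,8) show ?thesis by blast
  qed
  have m8: "integrable \<Omega> (\<lambda>x. Y' x ^ 8)" "integrable M (\<lambda>\<omega>. Y \<omega> ^ 8)" "(\<integral>\<omega>. Y \<omega> ^ 8 \<partial>M) \<le> C"
      "(\<integral>\<omega>. Y \<omega> ^ 4 \<partial>M) = (\<integral>x. Y' x ^ 4 \<partial>\<Omega>)"
    if h: "stein_pair \<Omega> Y' T S C" "Y \<in> borel_measurable M" "distr M borel Y = distr \<Omega> borel Y'"
    for \<Omega> :: "(real \<times> ('h \<Rightarrow> real) \<times> ('h \<Rightarrow> real)) measure" and Y' T S Y
  proof -
    note s = stein_pairD[OF h(1)]
    show "integrable \<Omega> (\<lambda>x. Y' x ^ 8)" by (rule s(5))
    then show "integrable M (\<lambda>\<omega>. Y \<omega> ^ 8)" using same_law_integral(2)[OF h(3,2) s(2), of "\<lambda>x. x ^ 8"] by simp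
    show "(\<integral>\<omega>. Y \<omega> ^ 8 \<partial>M) \<le> C" using same_law_integral(1)[OF h(3,2) s(2), of "\<lambda>x. x ^ 8"] s(6) by simp
    show "(\<integral>\<omega>. Y \<omega> ^ 4 \<partial>M) = (\<integral>x. Y' x ^ 4 \<partial>\<Omega>)" using same_law_integral(1)[OF h(3,2) s(2), of "\<lambda>x. x ^ 4"] by simp
  qed
  show thesis
  proof (rule that[OF C(1)])
    fix f X and \<delta> :: real
    assume X: "is_multiple_integral M W q f X" "(\<integral>\<omega>. (X \<omega>)\<^sup>2 \<partial>M) = 1" and \<delta>: "0 < \<delta>"
    have Xm: "X \<in> borel_measurable M" using X(1) unfolding is_multiple_integral_def by blast
    \<comment> \<open>A first sequence of approximants transfers the eighth-moment bound to
      \<open>X\<close> itself; the approximant that is delivered is chosen afterwards.\<close>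
    define R where "R n Y \<longleftrightarrow> Y \<in> borel_measurable M \<and> integrable M (\<lambda>\<omega>. Y \<omega> ^ 8) \<and> (\<integral>\<omega>. Y \<omega> ^ 8 \<partial>M) \<le> C \<and>
        integrable M (\<lambda>\<omega>. (X \<omega> - Y \<omega>)\<^sup>2) \<and> (\<integral>\<omega>. (X \<omega> - Y \<omega>)\<^sup>2 \<partial>M) \<le> inverse (real (Suc n))" for n Y
    have "\<exists>Y. R n Y" for n
    proof -
      have "0 < inverse (real (Suc n))" by simp
      from ex[OF X this] obtain \<Omega> :: "(real \<times> ('h \<Rightarrow> real) \<times> ('h \<Rightarrow> real)) measure" and Y' T S Y
        where h: "stein_pair \<Omega> Y' T S C" "Y \<in> borel_measurable M" "distr M borel Y = distr \<Omega> borel Y'"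
        "integrable M (\<lambda>\<omega>. (X \<omega> - Y \<omega>)\<^sup>2)" "(\<integral>\<omega>. (X \<omega> - Y \<omega>)\<^sup>2 \<partial>M) < inverse (real (Suc n))" by blast
      have "R n Y" unfolding R_def using h(2) m8(2,3)[OF h(1-3)] h(4) less_imp_le[OF h(5)] by (intro conjI)
      then show ?thesis by (rule exI[of "R n"])
    qed
    then have "\<exists>Yn. \<forall>n. R n (Yn n)" by (intro choice allI)
    then obtain Yn where "\<forall>n. R n (Yn n)" by (rule exE)
    then have RY: "R n (Yn n)" for n by (rule spec)
    have Yn: "Yn n \<in> borel_measurable M" "integrable M (\<lambda>\<omega>. Yn n \<omega> ^ 8)" "(\<integral>\<omega>. Yn n \<omega> ^ 8 \<partial>M) \<le> C"
        "integrable M (\<lambda>\<omega>. (X \<omega> - Yn n \<omega>)\<^sup>2)" "(\<integral>\<omega>. (X \<omega> - Yn n \<omega>)\<^sup>2 \<partial>M) \<le> inverse (real (Suc n))" for n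
      using RY[of n] unfolding R_def by - ((elim conjE, assumption)+)
    note X8 = eighth_moment_limit[OF Xm Yn]
    \<comment> \<open>The second bound is solved from the requirement
      \<open>sqrt \<delta>' * (4 * sqrt (1 + C)) \<le> \<delta>\<close> in the comparison of fourth
      moments.\<close>
    define \<delta>' where "\<delta>' = min \<delta> (\<delta>\<^sup>2 / (16 * (1 + C)))"
    have \<delta>': "0 < \<delta>'" "\<delta>' \<le> \<delta>" "\<delta>' \<le> \<delta>\<^sup>2 / (16 * (1 + C))" using \<delta> C(1) by (auto simp: \<delta>'_def)
    from ex[OF X \<delta>'(1)] obtain \<Omega> :: "(real \<times> ('h \<Rightarrow> real) \<times> ('h \<Rightarrow> real)) measure" and Y' T S Y
        where h: "stein_pair \<Omega> Y' T S C" "Y \<in> borel_measurable M" "distr M borel Y = distr \<Omega> borel Y'"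
        "integrable M (\<lambda>\<omega>. (X \<omega> - Y \<omega>)\<^sup>2)" "(\<integral>\<omega>. (X \<omega> - Y \<omega>)\<^sup>2 \<partial>M) < \<delta>'" by blast
    note Y8 = m8[OF h(1-3)]
    have c: "(\<integral>\<omega>. (X \<omega> - Y \<omega>)\<^sup>2 \<partial>M) \<le> (sqrt \<delta>')\<^sup>2" using h(5) \<delta>'(1) by simp
    have "\<bar>(\<integral>\<omega>. Y \<omega> ^ 4 \<partial>M) - (\<integral>\<omega>. X \<omega> ^ 4 \<partial>M)\<bar> \<le> sqrt \<delta>' * (4 * sqrt (1 + C))"
      by (rule fourth_moment_close[OF isonormal_prob[OF iso] Xm h(2) X8(1) Y8(2) X8(2) Y8(3) h(4) c]) (use \<delta>' in simp)
    also have "\<dots> \<le> \<delta>"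
    proof (rule power2_le_imp_le)
      have "(sqrt \<delta>' * (4 * sqrt (1 + C)))\<^sup>2 = \<delta>' * (16 * (1 + C))" using \<delta>' C(1) by (simp add: power_mult_distrib)
      also have "\<dots> \<le> \<delta>\<^sup>2 / (16 * (1 + C)) * (16 * (1 + C))" using \<delta>' C(1) by (intro mult_right_mono) auto
      finally show "(sqrt \<delta>' * (4 * sqrt (1 + C)))\<^sup>2 \<le> \<delta>\<^sup>2" using C(1) by simp
    qed (use \<delta> in simp)
    finally have "\<bar>(\<integral>x. Y' x ^ 4 \<partial>\<Omega>) - (\<integral>\<omega>. X \<omega> ^ 4 \<partial>M)\<bar> \<le> \<delta>" unfolding Y8(4) .
    moreover have "(\<integral>\<omega>. (X \<omega> - Y \<omega>)\<^sup>2 \<partial>M) < \<delta>" using h(5) \<delta>'(2) by linarith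
    ultimately show "\<exists>(\<Omega> :: (real \<times> ('h \<Rightarrow> real) \<times> ('h \<Rightarrow> real)) measure) Y' T S Y. stein_pair \<Omega> Y' T S C \<and>
        Y \<in> borel_measurable M \<and> distr M borel Y = distr \<Omega> borel Y' \<and>
        integrable M (\<lambda>\<omega>. (X \<omega> - Y \<omega>)\<^sup>2) \<and> (\<integral>\<omega>. (X \<omega> - Y \<omega>)\<^sup>2 \<partial>M) < \<delta> \<and>
        \<bar>(\<integral>x. Y' x ^ 4 \<partial>\<Omega>) - (\<integral>\<omega>. X \<omega> ^ 4 \<partial>M)\<bar> \<le> \<delta>" using h(1-4) by blast
  qed
qed

text \<open>If \<open>m\<close> were at most 1, the square of \<open>Y\<close> would be close to 1
  in L^2. For the test function \<open>3 * x - x^3\<close> the derivative vanishes where the square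
  of \<open>x\<close> is 1, so Stein's identity would make E (3 Y^2 - Y^4) small, although it is
  about 2. The kernel bound \<open>C\<close>, uniform in the approximation, makes this
  quantitative.\<close>

lemma kurtosis_gt_one:
  assumes C: "1 \<le> C"
    and ex: "\<And>\<delta>. 0 < \<delta> \<Longrightarrow> \<exists>(\<Omega> :: 'a measure) Y T S. stein_pair \<Omega> Y T S C \<and> \<bar>(\<integral>x. Y x ^ 4 \<partial>\<Omega>) - m\<bar> \<le> \<delta>"
  shows "1 < m"
proof (rule ccontr)
  assume m: "\<not> 1 < m"
  \<comment> \<open>Chosen so that \<open>sqrt C * sqrt \<delta> = 1/3\<close>. Stein's identity
    then gives \<open>3 - \<mu> \<le> 1\<close>, against \<open>\<mu> \<le> 1 + 1/9\<close>.\<close>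
  define \<delta> where "\<delta> = 1 / (9 * C)"
  have \<delta>: "0 < \<delta>" "\<delta> \<le> 1/9" using C by (auto simp: \<delta>_def intro!: divide_left_mono)
  obtain \<Omega> :: "'a measure" and Y T S where sp: "stein_pair \<Omega> Y T S C" and close: "\<bar>(\<integral>x. Y x ^ 4 \<partial>\<Omega>) - m\<bar> \<le> \<delta>"
    using ex[OF \<delta>(1)] by blast
  note s = stein_pairD[OF sp]
  note mo = stein_pair_moments[OF sp]
  interpret prob_space \<Omega> by (rule s(1))
  note [measurable] = s(2,3,4)
  define \<mu> where "\<mu> = (\<integral>x. Y x ^ 4 \<partial>\<Omega>)"
  have \<mu>: "\<mu> \<le> 1 + \<delta>" using close m by (simp add: \<mu>_def)
  have test: "stein_test (\<lambda>x. 3 * x - x ^ 3) (\<lambda>x. 3 * (1 - x\<^sup>2))"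
    unfolding stein_test_def
  proof (intro conjI allI exI[of _ 3])
    fix x :: real
    show "((\<lambda>x. 3 * x - x ^ 3) has_real_derivative 3 * (1 - x\<^sup>2)) (at x)"
      by (auto intro!: derivative_eq_intros)
    show "\<bar>3 * (1 - x\<^sup>2)\<bar> \<le> 3 * (1 + x\<^sup>2)" unfolding abs_le_iff by simp
  qed
  have sqe: "(1 - (Y x)\<^sup>2)\<^sup>2 = 1 - 2 * (Y x)\<^sup>2 + Y x ^ 4" for x
    by (simp add: power2_diff power_mult[symmetric])
  have i: "integrable \<Omega> (\<lambda>x. (1 - (Y x)\<^sup>2)\<^sup>2)" and e: "(\<integral>x. (1 - (Y x)\<^sup>2)\<^sup>2 \<partial>\<Omega>) = \<mu> - 1"
    unfolding sqe using mo(1,2) s(8) by (simp_all add: \<mu>_def prob_space)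
  have "(\<integral>x. Y x * (3 * Y x - Y x ^ 3) \<partial>\<Omega>) = (\<integral>x. 3 * (Y x)\<^sup>2 - Y x ^ 4 \<partial>\<Omega>)"
    by (intro integral_cong refl) (simp add: power2_eq_square power4_eq_xxxx power3_eq_cube right_diff_distrib)
  also have "\<dots> = 3 - \<mu>" using mo(1,2) s(8) by (simp add: \<mu>_def)
  finally have "3 - \<mu> = (\<integral>x. T x * (3 * (1 - (Y x)\<^sup>2)) \<partial>\<Omega>)"
    using stein_pair_kernels(1)[OF sp test] by simp
  also have "\<dots> = 3 * (\<integral>x. T x * (1 - (Y x)\<^sup>2) \<partial>\<Omega>)"
    by (subst integral_mult_right_zero[symmetric]) (simp add: mult.left_commute)
  also have "(\<integral>x. T x * (1 - (Y x)\<^sup>2) \<partial>\<Omega>) \<le> sqrt C * sqrt \<delta>"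
    by (rule Cauchy_Schwarz_bound[OF s(3) _ s(9) i]) (use s(10) e \<mu> C \<delta> in auto)
  also have "sqrt C * sqrt \<delta> = 1/3"
  proof -
    have "sqrt C * sqrt \<delta> = sqrt (1/9)" using C by (simp add: real_sqrt_mult[symmetric] \<delta>_def)
    also have "\<dots> = 1/3" by (rule real_sqrt_unique) (simp_all add: power2_eq_square)
    finally show ?thesis .
  qed
  finally show False using \<mu> \<delta> by simp
qed

section \<open>Transfer to independent arrays\<close>

lemma distr_PiM_coordinatewise:
  fixes f :: "'i \<Rightarrow> 'a \<Rightarrow> real"
  assumes fin: "finite K" and N: "\<And>k. prob_space (\<Omega> k)" and f: "\<And>k. f k \<in> borel_measurable (\<Omega> k)"
  shows "distr (PiM K \<Omega>) (borels K) (\<lambda>\<omega>. \<lambda>k\<in>K. f k (\<omega> k)) = PiM K (\<lambda>k. distr (\<Omega> k) borel (f k))"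
proof -
  have pD: "prob_space (distr (\<Omega> k) borel (f k))" for k by (rule prob_space.prob_space_distr[OF N f])
  interpret A: product_prob_space \<Omega> by (rule product_prob_spaceI) (rule N)
  interpret D: product_prob_space "\<lambda>k. distr (\<Omega> k) borel (f k)" by (rule product_prob_spaceI) (rule pD)
  have m: "(\<lambda>\<omega>. \<lambda>k\<in>K. f k (\<omega> k)) \<in> measurable (PiM K \<Omega>) (borels K)"
  proof (rule measurable_restrict)
    fix k assume k: "k \<in> K"
    show "(\<lambda>\<omega>. f k (\<omega> k)) \<in> borel_measurable (PiM K \<Omega>)"
      by (rule measurable_compose[OF measurable_component_singleton[OF k, of \<Omega>] f[of k]])
  qed
  show ?thesis
  proof (rule D.PiM_eqI[OF fin])
    show "sets (distr (PiM K \<Omega>) (borels K) (\<lambda>\<omega>. \<lambda>k\<in>K. f k (\<omega> k))) = sets (PiM K (\<lambda>k. distr (\<Omega> k) borel (f k)))"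
      unfolding sets_distr by (rule sets_PiM_cong) simp_all
    fix A assume "\<And>k. k \<in> K \<Longrightarrow> A k \<in> sets (distr (\<Omega> k) borel (f k))"
    then have A: "\<And>k. k \<in> K \<Longrightarrow> A k \<in> sets borel" by simp
    have bx: "Pi\<^sub>E K A \<in> sets (borels K)" using A by (intro sets_PiM_I_finite fin)
    let ?B = "\<lambda>k. f k -` A k \<inter> space (\<Omega> k)"
    have "(\<lambda>\<omega>. \<lambda>k\<in>K. f k (\<omega> k)) -` (Pi\<^sub>E K A) \<inter> space (PiM K \<Omega>) = Pi\<^sub>E K ?B"
      by (auto simp: space_PiM PiE_def Pi_def)
    then have "emeasure (distr (PiM K \<Omega>) (borels K) (\<lambda>\<omega>. \<lambda>k\<in>K. f k (\<omega> k))) (Pi\<^sub>E K A) = emeasure (PiM K \<Omega>) (Pi\<^sub>E K ?B)"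
      using emeasure_distr[OF m bx] by simp
    also have "\<dots> = (\<Prod>k\<in>K. emeasure (\<Omega> k) (?B k))"
      by (rule A.emeasure_PiM[OF fin]) (rule measurable_sets[OF f A])
    also have "\<dots> = (\<Prod>k\<in>K. emeasure (distr (\<Omega> k) borel (f k)) (A k))"
      by (rule prod.cong[OF refl]) (simp add: emeasure_distr[OF f A])
    finally show "emeasure (distr (PiM K \<Omega>) (borels K) (\<lambda>\<omega>. \<lambda>k\<in>K. f k (\<omega> k))) (Pi\<^sub>E K A) =
        (\<Prod>k\<in>K. emeasure (distr (\<Omega> k) borel (f k)) (A k))" .
  qed
qed

lemma integral_of_family:
  fixes F :: "('i \<Rightarrow> real) \<Rightarrow> real"
  assumes F: "F \<in> borel_measurable (borels UNIV)" and loc: "\<And>u. F (restrict u K) = F u"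
    and V: "\<And>c. c \<in> K \<Longrightarrow> V c \<in> borel_measurable N"
    and law: "distr N (borels K) (\<lambda>\<omega>. \<lambda>c\<in>K. V c \<omega>) = Q"
  shows "(\<integral>\<omega>. F (\<lambda>c. V c \<omega>) \<partial>N) = (\<integral>u. F u \<partial>Q)"
proof -
  have m: "(\<lambda>\<omega>. \<lambda>c\<in>K. V c \<omega>) \<in> measurable N (borels K)" using V by (intro measurable_restrict)
  have c: "(\<lambda>u :: 'i \<Rightarrow> real. u c) \<in> borel_measurable (borels K)" for c
    using measurable_gam_component[where i=c and I=K] unfolding measurable_cong_sets[OF sets_gam refl] .
  have FK: "F \<in> borel_measurable (borels K)" by (rule PiM_UNIV_compose[OF F, of "\<lambda>u. u"]) (rule c)
  have "(\<integral>\<omega>. F (\<lambda>c. V c \<omega>) \<partial>N) = (\<integral>\<omega>. F (\<lambda>c\<in>K. V c \<omega>) \<partial>N)"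
    by (rule integral_cong[OF refl]) (rule loc[symmetric])
  also have "\<dots> = (\<integral>u. F u \<partial>distr N (borels K) (\<lambda>\<omega>. \<lambda>c\<in>K. V c \<omega>))"
    by (rule integral_distr[OF m FK, symmetric])
  finally show ?thesis unfolding law .
qed

text \<open>This definition and the next two are \<open>J\<close>, \<open>sg\<close> and
  \<open>wis\<close> without the parameters of the locale, so that arrays on different probability
  spaces can be compared.\<close>

definition upper :: "nat \<Rightarrow> (nat \<times> nat) set" where "upper n = {(i, j). i \<le> j \<and> j < n}"

definition entry_scale :: "real \<Rightarrow> nat \<times> nat \<Rightarrow> real" where
  "entry_scale v c = (if fst c = snd c then sqrt v else 1)"

definition cov_entry :: "nat \<Rightarrow> (nat \<times> nat \<Rightarrow> real) \<Rightarrow> nat \<times> nat \<Rightarrow> real" where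
  "cov_entry d u c = (\<Sum>k<d. u (fst c, k) * u (snd c, k) - (if fst c = snd c then 1 else 0)) / sqrt (real d)"

lemma finite_upper: "finite (upper n)"
  by (rule finite_subset[of _ "{..<n} \<times> {..<n}"]) (auto simp: upper_def)

lemma cov_entry_restrict:
  assumes "c \<in> upper n"
  shows "cov_entry d (restrict u ({..<n} \<times> {..<d})) c = cov_entry d u c"
proof -
  obtain i j where c: "c = (i, j)" "i < n" "j < n" using assms by (auto simp: upper_def)
  show ?thesis unfolding cov_entry_def c(1)
    by (intro arg_cong2[where f="(/)"] refl sum.cong) (use c in auto)
qed

lemma lip_on_local:
  assumes "lip_on I L G" "\<And>c. c \<in> I \<Longrightarrow> u c = v c"
  shows "G u = G v"
proof -
  have "(\<Sum>c\<in>I. (u c - v c)\<^sup>2) = (\<Sum>c\<in>I. 0)" by (rule sum.cong) (simp_all add: assms(2))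
  then show ?thesis using assms(1)[unfolded lip_on_def, rule_format, of u v] by simp
qed

text \<open>The factor \<open>1 / sqrt d\<close> is simply bounded by 1, since the differences of
  the data can be made arbitrarily small for fixed \<open>n\<close> and \<open>d\<close>.\<close>

lemma cov_entry_diff:
  assumes d: "1 \<le> d"
  shows "\<bar>cov_entry d u c - cov_entry d w c\<bar> \<le>
    (\<Sum>k<d. \<bar>u (fst c, k)\<bar> * \<bar>u (snd c, k) - w (snd c, k)\<bar> + \<bar>u (fst c, k) - w (fst c, k)\<bar> * \<bar>w (snd c, k)\<bar>)"
proof -
  let ?D = "\<Sum>k<d. u (fst c, k) * u (snd c, k) - w (fst c, k) * w (snd c, k)"
  have "cov_entry d u c - cov_entry d w c = ?D / sqrt (real d)"
    by (simp add: cov_entry_def diff_divide_distrib[symmetric] sum_subtractf)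
  then have "\<bar>cov_entry d u c - cov_entry d w c\<bar> = \<bar>?D\<bar> / sqrt (real d)" by (simp add: abs_divide)
  also have "\<dots> \<le> \<bar>?D\<bar> / 1" using d by (intro divide_left_mono) auto
  also have "\<bar>?D\<bar> / 1 \<le> (\<Sum>k<d. \<bar>u (fst c, k) * u (snd c, k) - w (fst c, k) * w (snd c, k)\<bar>)" by simp
  also have "\<dots> \<le> (\<Sum>k<d. \<bar>u (fst c, k)\<bar> * \<bar>u (snd c, k) - w (snd c, k)\<bar> + \<bar>u (fst c, k) - w (fst c, k)\<bar> * \<bar>w (snd c, k)\<bar>)"
  proof (rule sum_mono)
    fix k
    have "u (fst c, k) * u (snd c, k) - w (fst c, k) * w (snd c, k) =
      u (fst c, k) * (u (snd c, k) - w (snd c, k)) + (u (fst c, k) - w (fst c, k)) * w (snd c, k)" by (simp add: right_diff_distrib left_diff_distrib)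
    then show "\<bar>u (fst c, k) * u (snd c, k) - w (fst c, k) * w (snd c, k)\<bar> \<le>
      \<bar>u (fst c, k)\<bar> * \<bar>u (snd c, k) - w (snd c, k)\<bar> + \<bar>u (fst c, k) - w (fst c, k)\<bar> * \<bar>w (snd c, k)\<bar>"
      using abs_triangle_ineq[of "u (fst c, k) * (u (snd c, k) - w (snd c, k))" "(u (fst c, k) - w (fst c, k)) * w (snd c, k)"]
      by (simp add: abs_mult)
  qed
  finally show ?thesis .
qed

lemma integral_abs_mult_le:
  fixes f g :: "'a \<Rightarrow> real"
  assumes m: "f \<in> borel_measurable M" "g \<in> borel_measurable M"
    and i: "integrable M (\<lambda>x. (f x)\<^sup>2)" "integrable M (\<lambda>x. (g x)\<^sup>2)"
    and b: "(\<integral>x. (f x)\<^sup>2 \<partial>M) \<le> c\<^sup>2" "(\<integral>x. (g x)\<^sup>2 \<partial>M) \<le> d\<^sup>2" "0 \<le> c" "0 \<le> d"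
  shows "integrable M (\<lambda>x. \<bar>f x\<bar> * \<bar>g x\<bar>)" "(\<integral>x. \<bar>f x\<bar> * \<bar>g x\<bar> \<partial>M) \<le> c * d"
proof -
  have m': "(\<lambda>x. \<bar>f x\<bar>) \<in> borel_measurable M" "(\<lambda>x. \<bar>g x\<bar>) \<in> borel_measurable M" using m by measurable
  have i': "integrable M (\<lambda>x. \<bar>f x\<bar>\<^sup>2)" "integrable M (\<lambda>x. \<bar>g x\<bar>\<^sup>2)" using i by simp_all
  show "integrable M (\<lambda>x. \<bar>f x\<bar> * \<bar>g x\<bar>)" by (rule Cauchy_Schwarz_integral(1)[OF m' i'])
  show "(\<integral>x. \<bar>f x\<bar> * \<bar>g x\<bar> \<partial>M) \<le> c * d"
    by (rule Cauchy_Schwarz_bound[OF m' i']) (use b in simp_all)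
qed

text \<open>The approximants \<open>Y \<kappa>\<close> live on \<open>M\<close> but need not be
  independent there. On the product \<open>Pr\<close> of copies of \<open>M\<close>, coordinate
  \<open>\<kappa>\<close> carries both \<open>X \<kappa>\<close> and \<open>Y \<kappa>\<close>: the
  L^2 distances are kept, the \<open>X\<close> array has its original law by independence, and the
  \<open>Y\<close> array is independent by construction. It thus has the law of the Stein array on
  \<open>A.Prod\<close>, where the kernels are defined.\<close>

lemma wishart_comparison:
  fixes X :: "nat \<times> nat \<Rightarrow> 'w \<Rightarrow> real"
  assumes M: "prob_space M" and ind: "prob_space.indep_vars M (\<lambda>_. borel) X UNIV"
    and Xm: "\<And>\<kappa>. X \<kappa> \<in> borel_measurable M" and iX: "\<And>\<kappa>. integrable M (\<lambda>\<omega>. (X \<kappa> \<omega>)\<^sup>2)" and X2: "\<And>\<kappa>. (\<integral>\<omega>. (X \<kappa> \<omega>)\<^sup>2 \<partial>M) = 1"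
    and v: "0 < v" and B: "1 \<le> B"
    and approx: "\<And>\<kappa> \<delta>. 0 < \<delta> \<Longrightarrow> \<exists>(\<Omega> :: 'a measure) Y' T S Y. stein_pair \<Omega> Y' T S B \<and>
        Y \<in> borel_measurable M \<and> distr M borel Y = distr \<Omega> borel Y' \<and>
        integrable M (\<lambda>\<omega>. (X \<kappa> \<omega> - Y \<omega>)\<^sup>2) \<and> (\<integral>\<omega>. (X \<kappa> \<omega> - Y \<omega>)\<^sup>2 \<partial>M) < \<delta> \<and>
        \<bar>(\<integral>x. Y' x ^ 4 \<partial>\<Omega>) - (1 + v)\<bar> \<le> \<delta>"
    and n: "1 \<le> n" and d: "1 \<le> d"
    and Gm: "G \<in> borel_measurable (borels UNIV)" and Gl: "lip_on (upper n) L G" and L: "0 < L"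
  shows "\<bar>(\<integral>\<omega>. G (cov_entry d (\<lambda>\<kappa>. X \<kappa> \<omega>)) \<partial>M) - (\<integral>z. G (\<lambda>c. entry_scale v c * z c) \<partial>gam (upper n))\<bar>
    \<le> pi / 2 * (L * sqrt (8 * real n ^ 3 * B\<^sup>2 / real d / min 1 v))"
proof (rule field_le_epsilon)
  fix \<epsilon> :: real assume \<epsilon>: "0 < \<epsilon>"
  define K where "K = {..<n} \<times> {..<d}"
  have fK: "finite K" by (simp add: K_def)
  have "(0, 0) \<in> K" using n d by (simp add: K_def)
  then have Kne: "K \<noteq> {}" by blast
  \<comment> \<open>There are \<open>card (upper n) * d\<close> data terms, each with mean at most
    \<open>2 * sqrt \<delta>\<close>; the \<open>+ 1\<close> gives \<open>c \<ge> 1\<close>.\<close>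
  define c where "c = L * (real (card (upper n)) * (real d * 2)) + 1"
  have c: "1 \<le> c" "L * (real (card (upper n)) * (real d * 2)) \<le> c" using L by (simp_all add: c_def)
  \<comment> \<open>The first bound keeps the squared bias of the fourth moments below
    \<open>B^2 / d\<close>, which turns the constant 4 of the array into 8; the second makes the
    coupling error at most \<open>\<epsilon>\<close>.\<close>
  define \<delta> where "\<delta> = min (B / sqrt (real d)) ((\<epsilon> / c)\<^sup>2)"
  have \<delta>: "0 < \<delta>" "\<delta> \<le> B / sqrt (real d)" "\<delta> \<le> (\<epsilon> / c)\<^sup>2" using B d \<epsilon> c by (auto simp: \<delta>_def)
  have s\<delta>: "sqrt \<delta> \<le> \<epsilon> / c" using real_sqrt_le_mono[OF \<delta>(3)] \<epsilon> c by simp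
  have \<delta>2: "\<delta>\<^sup>2 \<le> B\<^sup>2 / real d" using power_mono[OF \<delta>(2), of 2] \<delta>(1) by (simp add: power_divide)
  define R where "R \<kappa> \<Omega> Y' T S Y \<longleftrightarrow> stein_pair \<Omega> Y' T S B \<and>
        Y \<in> borel_measurable M \<and> distr M borel Y = distr \<Omega> borel Y' \<and>
        integrable M (\<lambda>\<omega>. (X \<kappa> \<omega> - Y \<omega>)\<^sup>2) \<and> (\<integral>\<omega>. (X \<kappa> \<omega> - Y \<omega>)\<^sup>2 \<partial>M) < \<delta> \<and>
        \<bar>(\<integral>x. Y' x ^ 4 \<partial>\<Omega>) - (1 + v)\<bar> \<le> \<delta>" for \<kappa> and \<Omega> :: "'a measure" and Y' T S Y
  have "\<exists>p. R \<kappa> (fst p) (fst (snd p)) (fst (snd (snd p))) (fst (snd (snd (snd p)))) (snd (snd (snd (snd p))))" for \<kappa>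
  proof -
    obtain \<Omega> Y' T S Y where "R \<kappa> \<Omega> Y' T S Y" using approx[OF \<delta>(1), of \<kappa>] unfolding R_def by blast
    then show ?thesis by (intro exI[of _ "(\<Omega>, Y', T, S, Y)"]) (simp only: fst_conv snd_conv)
  qed
  then obtain p where p: "\<And>\<kappa>. R \<kappa> (fst (p \<kappa>)) (fst (snd (p \<kappa>))) (fst (snd (snd (p \<kappa>)))) (fst (snd (snd (snd (p \<kappa>))))) (snd (snd (snd (snd (p \<kappa>)))))"
    by metis
  define \<Omega> where "\<Omega> \<kappa> = fst (p \<kappa>)" for \<kappa>
  define Y' where "Y' \<kappa> = fst (snd (p \<kappa>))" for \<kappa>
  define T where "T \<kappa> = fst (snd (snd (p \<kappa>)))" for \<kappa>
  define S where "S \<kappa> = fst (snd (snd (snd (p \<kappa>))))" for \<kappa>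
  define Y where "Y \<kappa> = snd (snd (snd (snd (p \<kappa>))))" for \<kappa>
  have R: "R \<kappa> (\<Omega> \<kappa>) (Y' \<kappa>) (T \<kappa>) (S \<kappa>) (Y \<kappa>)" for \<kappa>
    unfolding \<Omega>_def Y'_def T_def S_def Y_def by (rule p)
  have sp: "stein_pair (\<Omega> \<kappa>) (Y' \<kappa>) (T \<kappa>) (S \<kappa>) B" for \<kappa> using R[of \<kappa>] unfolding R_def by (elim conjE)
  have Ym: "Y \<kappa> \<in> borel_measurable M" for \<kappa> using R[of \<kappa>] unfolding R_def by (elim conjE)
  have law: "distr M borel (Y \<kappa>) = distr (\<Omega> \<kappa>) borel (Y' \<kappa>)" for \<kappa> using R[of \<kappa>] unfolding R_def by (elim conjE)
  have iXY: "integrable M (\<lambda>\<omega>. (X \<kappa> \<omega> - Y \<kappa> \<omega>)\<^sup>2)" for \<kappa> using R[of \<kappa>] unfolding R_def by (elim conjE)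
  have XY: "(\<integral>\<omega>. (X \<kappa> \<omega> - Y \<kappa> \<omega>)\<^sup>2 \<partial>M) < \<delta>" for \<kappa> using R[of \<kappa>] unfolding R_def by (elim conjE)
  have bias: "\<bar>(\<integral>x. Y' \<kappa> x ^ 4 \<partial>\<Omega> \<kappa>) - (1 + v)\<bar> \<le> \<delta>" for \<kappa> using R[of \<kappa>] unfolding R_def by (elim conjE)
  have bias': "\<bar>(\<integral>x. Y' \<kappa> x ^ 4 \<partial>\<Omega> \<kappa>) - 1 - v\<bar> \<le> \<delta>" for \<kappa> using bias[of \<kappa>] by (simp only: diff_diff_eq)
  interpret A: stein_array n d \<Omega> Y' T S B v \<delta>
    by (rule stein_array.intro[OF d B v sp bias'])
  have AJ: "A.J = upper n" by (simp add: A.J_def upper_def)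
  have AW: "A.wis = cov_entry d" by (intro ext) (simp only: A.wis_def cov_entry_def)
  have AS: "A.sg = entry_scale v" by (intro ext) (simp only: A.sg_def entry_scale_def)
  let ?Z = "\<integral>z. G (\<lambda>c. entry_scale v c * z c) \<partial>gam (upper n)"
  let ?V = "8 * real n ^ 3 * B\<^sup>2 / real d / min 1 v"
  have main: "\<bar>(\<integral>\<omega>. G (cov_entry d (A.y \<omega>)) \<partial>A.Prod) - ?Z\<bar> \<le> pi / 2 * (L * sqrt ?V)"
  proof -
    have "4 * real n ^ 3 * (B\<^sup>2 / real d + \<delta>\<^sup>2) \<le> 4 * real n ^ 3 * (B\<^sup>2 / real d + B\<^sup>2 / real d)"
      using \<delta>2 by (intro mult_left_mono add_mono order_refl) auto
    also have "\<dots> = 8 * real n ^ 3 * B\<^sup>2 / real d" by simp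
    finally have V: "4 * real n ^ 3 * (B\<^sup>2 / real d + \<delta>\<^sup>2) / min 1 v \<le> ?V"
      by (rule divide_right_mono) (use v in simp)
    have "0 < ?V" using n d B v by (intro divide_pos_pos mult_pos_pos zero_less_power) auto
    then show ?thesis using A.lipschitz_comparison[OF Gm _ L V] Gl unfolding AJ AW AS by blast
  qed
  define F where "F u = G (cov_entry d u)" for u
  have Fm: "F \<in> borel_measurable (borels UNIV)"
    unfolding F_def[abs_def] by (rule PiM_UNIV_compose[OF Gm]) (unfold cov_entry_def, measurable)
  have Floc: "F (restrict u K) = F u" for u
    unfolding F_def K_def by (rule lip_on_local[OF Gl]) (rule cov_entry_restrict)
  define Pr where "Pr = PiM K (\<lambda>_ :: nat \<times> nat. M)"
  have pPr: "prob_space Pr" unfolding Pr_def by (intro prob_space_PiM M)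
  interpret Pr: prob_space Pr by (rule pPr)
  have comp: "(\<lambda>\<omega>. \<omega> \<kappa>) \<in> measurable Pr M" if "\<kappa> \<in> K" for \<kappa>
    unfolding Pr_def by (rule measurable_component_singleton[OF that])
  have compm: "(\<lambda>\<omega>. h (\<omega> \<kappa>)) \<in> borel_measurable Pr" if "\<kappa> \<in> K" "h \<in> borel_measurable M" for \<kappa> and h :: "'w \<Rightarrow> real"
    by (rule measurable_compose[OF comp[OF that(1)] that(2)])
  have lX: "distr M (borels K) (\<lambda>\<omega>. \<lambda>\<kappa>\<in>K. X \<kappa> \<omega>) = PiM K (\<lambda>\<kappa>. distr M borel (X \<kappa>))"
    using prob_space.indep_vars_iff_distr_eq_PiM'[OF M Kne, of X "\<lambda>_. borel"] Xm prob_space.indep_vars_subset[OF M ind, of K] by blast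
  have e1: "(\<integral>\<omega>. F (\<lambda>\<kappa>. X \<kappa> \<omega>) \<partial>M) = (\<integral>u. F u \<partial>PiM K (\<lambda>\<kappa>. distr M borel (X \<kappa>)))"
    by (rule integral_of_family[OF Fm Floc Xm lX])
  have e2: "(\<integral>\<omega>. F (\<lambda>\<kappa>. X \<kappa> (\<omega> \<kappa>)) \<partial>Pr) = (\<integral>u. F u \<partial>PiM K (\<lambda>\<kappa>. distr M borel (X \<kappa>)))"
    by (rule integral_of_family[OF Fm Floc compm[OF _ Xm]])
       (assumption, unfold Pr_def, rule distr_PiM_coordinatewise[OF fK M Xm])
  have e3: "(\<integral>\<omega>. F (\<lambda>\<kappa>. Y \<kappa> (\<omega> \<kappa>)) \<partial>Pr) = (\<integral>u. F u \<partial>PiM K (\<lambda>\<kappa>. distr M borel (Y \<kappa>)))"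
    by (rule integral_of_family[OF Fm Floc compm[OF _ Ym]])
       (assumption, unfold Pr_def, rule distr_PiM_coordinatewise[OF fK M Ym])
  have Y'm: "(\<lambda>\<omega>. Y' \<kappa> (\<omega> \<kappa>)) \<in> borel_measurable (PiM K \<Omega>)" if "\<kappa> \<in> K" for \<kappa>
    by (rule measurable_compose[OF measurable_component_singleton[OF that, of \<Omega>] stein_pairD(2)[OF sp[of \<kappa>]]])
  have e4: "(\<integral>\<omega>. F (A.y \<omega>) \<partial>A.Prod) = (\<integral>u. F u \<partial>PiM K (\<lambda>\<kappa>. distr (\<Omega> \<kappa>) borel (Y' \<kappa>)))"
    unfolding A.y_def A.Prod_def A.K_def K_def[symmetric]
    by (rule integral_of_family[OF Fm Floc Y'm])
       (assumption, rule distr_PiM_coordinatewise[OF fK A.prob_\<Omega> stein_pairD(2)[OF sp]])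
  have Y2: "(\<integral>\<omega>. (Y \<kappa> \<omega>)\<^sup>2 \<partial>M) = 1" "integrable M (\<lambda>\<omega>. (Y \<kappa> \<omega>)\<^sup>2)" for \<kappa>
    using same_law_integral[OF law Ym stein_pairD(2)[OF sp], of "\<lambda>x. x\<^sup>2" \<kappa>] stein_pairD(8)[OF sp, of \<kappa>] stein_pair_moments(2)[OF sp, of \<kappa>]
    by simp_all
  have tr: "integrable Pr (\<lambda>\<omega>. h (\<omega> \<kappa>))" "(\<integral>\<omega>. h (\<omega> \<kappa>) \<partial>Pr) = (\<integral>x. h x \<partial>M)"
    if "\<kappa> \<in> K" "integrable M h" for \<kappa> and h :: "'w \<Rightarrow> real"
  proof -
    have D: "distr Pr M (\<lambda>\<omega>. \<omega> \<kappa>) = M" unfolding Pr_def by (rule distr_PiM_component[OF M that(1)])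
    have hm: "h \<in> borel_measurable M" using that(2) by simp
    show "integrable Pr (\<lambda>\<omega>. h (\<omega> \<kappa>))" using integrable_distr_eq[OF comp[OF that(1)] hm] that(2) unfolding D by simp
    show "(\<integral>\<omega>. h (\<omega> \<kappa>) \<partial>Pr) = (\<integral>x. h x \<partial>M)" using integral_distr[OF comp[OF that(1)] hm] unfolding D by simp
  qed
  have idx: "(fst c, k) \<in> K" "(snd c, k) \<in> K" if "c \<in> upper n" "k < d" for c k
    using that by (auto simp: upper_def K_def)
  have Fi: "integrable Pr (\<lambda>\<omega>. F (\<lambda>\<kappa>. U \<kappa> (\<omega> \<kappa>)))"
    if Um: "\<And>\<kappa>. U \<kappa> \<in> borel_measurable M" and Ui: "\<And>\<kappa>. integrable M (\<lambda>\<omega>. (U \<kappa> \<omega>)\<^sup>2)" for U :: "nat \<times> nat \<Rightarrow> 'w \<Rightarrow> real"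
  proof (rule integrable_bound)
    have t: "integrable Pr (\<lambda>\<omega>. U (fst c, k) (\<omega> (fst c, k)) * U (snd c, k) (\<omega> (snd c, k)))" if "c \<in> upper n" "k < d" for c k
      by (rule Cauchy_Schwarz_integral(1)[OF compm[OF idx(1)[OF that] Um] compm[OF idx(2)[OF that] Um] tr(1)[OF idx(1)[OF that] Ui] tr(1)[OF idx(2)[OF that] Ui]])
    have ce: "integrable Pr (\<lambda>\<omega>. cov_entry d (\<lambda>\<kappa>. U \<kappa> (\<omega> \<kappa>)) c)" if "c \<in> upper n" for c
      unfolding cov_entry_def
      by (intro integrable_divide integrable_sum integrable_diff Pr.integrable_const t[OF that]) auto
    show "integrable Pr (\<lambda>\<omega>. \<bar>G (\<lambda>_. 0)\<bar> + L * (\<Sum>c\<in>upper n. \<bar>cov_entry d (\<lambda>\<kappa>. U \<kappa> (\<omega> \<kappa>)) c\<bar>))"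
      by (intro integrable_add Pr.integrable_const integrable_mult_right integrable_sum integrable_abs ce)
    have m: "(\<lambda>\<omega>. \<lambda>\<kappa>\<in>K. U \<kappa> (\<omega> \<kappa>)) \<in> measurable Pr (borels K)"
      by (rule measurable_restrict) (rule compm[OF _ Um])
    have cc: "(\<lambda>u :: nat \<times> nat \<Rightarrow> real. u c) \<in> borel_measurable (borels K)" for c
      using measurable_gam_component[where i=c and I=K] unfolding measurable_cong_sets[OF sets_gam refl] .
    have FK: "F \<in> borel_measurable (borels K)" by (rule PiM_UNIV_compose[OF Fm, of "\<lambda>u. u"]) (rule cc)
    have "(\<lambda>\<omega>. F (\<lambda>\<kappa>\<in>K. U \<kappa> (\<omega> \<kappa>))) \<in> borel_measurable Pr" by (rule measurable_compose[OF m FK])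
    then show "(\<lambda>\<omega>. F (\<lambda>\<kappa>. U \<kappa> (\<omega> \<kappa>))) \<in> borel_measurable Pr" unfolding Floc .
    show "AE \<omega> in Pr. norm (F (\<lambda>\<kappa>. U \<kappa> (\<omega> \<kappa>))) \<le> norm (\<bar>G (\<lambda>_. 0)\<bar> + L * (\<Sum>c\<in>upper n. \<bar>cov_entry d (\<lambda>\<kappa>. U \<kappa> (\<omega> \<kappa>)) c\<bar>))"
    proof (rule AE_I2)
      fix \<omega>
      have "\<bar>G (cov_entry d (\<lambda>\<kappa>. U \<kappa> (\<omega> \<kappa>))) - G (\<lambda>_. 0)\<bar> \<le> L * (\<Sum>c\<in>upper n. \<bar>cov_entry d (\<lambda>\<kappa>. U \<kappa> (\<omega> \<kappa>)) c - 0\<bar>)"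
        by (rule lip_on_le_sum[OF Gl]) (use L in simp)
      then show "norm (F (\<lambda>\<kappa>. U \<kappa> (\<omega> \<kappa>))) \<le> norm (\<bar>G (\<lambda>_. 0)\<bar> + L * (\<Sum>c\<in>upper n. \<bar>cov_entry d (\<lambda>\<kappa>. U \<kappa> (\<omega> \<kappa>)) c\<bar>))"
        unfolding F_def real_norm_def by simp
    qed
  qed
  define t where "t c k \<omega> = \<bar>X (fst c, k) (\<omega> (fst c, k))\<bar> * \<bar>X (snd c, k) (\<omega> (snd c, k)) - Y (snd c, k) (\<omega> (snd c, k))\<bar>
      + \<bar>X (fst c, k) (\<omega> (fst c, k)) - Y (fst c, k) (\<omega> (fst c, k))\<bar> * \<bar>Y (snd c, k) (\<omega> (snd c, k))\<bar>" for c k \<omega>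
  have ti: "integrable Pr (t c k) \<and> (\<integral>\<omega>. t c k \<omega> \<partial>Pr) \<le> 2 * sqrt \<delta>" if ck: "c \<in> upper n" "k < d" for c k
  proof -
    note ix = idx[OF ck]
    have XYm: "(\<lambda>\<omega>. X \<kappa> \<omega> - Y \<kappa> \<omega>) \<in> borel_measurable M" for \<kappa> using Xm Ym by measurable
    have b: "(\<integral>\<omega>. (X \<kappa> (\<omega> \<kappa>))\<^sup>2 \<partial>Pr) \<le> 1\<^sup>2" "(\<integral>\<omega>. (Y \<kappa> (\<omega> \<kappa>))\<^sup>2 \<partial>Pr) \<le> 1\<^sup>2" "(\<integral>\<omega>. (X \<kappa> (\<omega> \<kappa>) - Y \<kappa> (\<omega> \<kappa>))\<^sup>2 \<partial>Pr) \<le> (sqrt \<delta>)\<^sup>2"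
      if "\<kappa> \<in> K" for \<kappa>
      using tr(2)[OF that iX] tr(2)[OF that Y2(2)] tr(2)[OF that iXY] X2[of \<kappa>] Y2(1)[of \<kappa>] XY[of \<kappa>] \<delta>(1) by simp_all
    have s0: "0 \<le> sqrt \<delta>" using \<delta>(1) by simp
    note p1 = integral_abs_mult_le[OF compm[OF ix(1) Xm] compm[OF ix(2) XYm] tr(1)[OF ix(1) iX] tr(1)[OF ix(2) iXY] b(1)[OF ix(1)] b(3)[OF ix(2)] zero_le_one s0]
    note p2 = integral_abs_mult_le[OF compm[OF ix(1) XYm] compm[OF ix(2) Ym] tr(1)[OF ix(1) iXY] tr(1)[OF ix(2) Y2(2)] b(3)[OF ix(1)] b(2)[OF ix(2)] s0 zero_le_one]
    have "integrable Pr (t c k)" unfolding t_def[abs_def] by (rule integrable_add[OF p1(1) p2(1)])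
    moreover have "(\<integral>\<omega>. t c k \<omega> \<partial>Pr) \<le> 1 * sqrt \<delta> + sqrt \<delta> * 1"
      unfolding t_def integral_add[OF p1(1) p2(1)] by (rule add_mono[OF p1(2) p2(2)])
    ultimately show ?thesis by simp
  qed
  note FX = Fi[OF Xm iX] and FY = Fi[OF Ym Y2(2)]
  have it: "integrable Pr (\<lambda>\<omega>. L * (\<Sum>c\<in>upper n. \<Sum>k<d. t c k \<omega>))"
    by (intro integrable_mult_right integrable_sum) (use ti in auto)
  have "\<bar>(\<integral>\<omega>. F (\<lambda>\<kappa>. X \<kappa> (\<omega> \<kappa>)) \<partial>Pr) - (\<integral>\<omega>. F (\<lambda>\<kappa>. Y \<kappa> (\<omega> \<kappa>)) \<partial>Pr)\<bar> = \<bar>\<integral>\<omega>. F (\<lambda>\<kappa>. X \<kappa> (\<omega> \<kappa>)) - F (\<lambda>\<kappa>. Y \<kappa> (\<omega> \<kappa>)) \<partial>Pr\<bar>"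
    using FX FY by simp
  also have "\<dots> \<le> (\<integral>\<omega>. \<bar>F (\<lambda>\<kappa>. X \<kappa> (\<omega> \<kappa>)) - F (\<lambda>\<kappa>. Y \<kappa> (\<omega> \<kappa>))\<bar> \<partial>Pr)" by (rule integral_abs_bound)
  also have "\<dots> \<le> (\<integral>\<omega>. L * (\<Sum>c\<in>upper n. \<Sum>k<d. t c k \<omega>) \<partial>Pr)"
  proof (rule integral_mono[OF integrable_abs[OF integrable_diff[OF FX FY]] it])
    fix \<omega>
    have "\<bar>F (\<lambda>\<kappa>. X \<kappa> (\<omega> \<kappa>)) - F (\<lambda>\<kappa>. Y \<kappa> (\<omega> \<kappa>))\<bar> \<le>
        L * (\<Sum>c\<in>upper n. \<bar>cov_entry d (\<lambda>\<kappa>. X \<kappa> (\<omega> \<kappa>)) c - cov_entry d (\<lambda>\<kappa>. Y \<kappa> (\<omega> \<kappa>)) c\<bar>)"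
      unfolding F_def by (rule lip_on_le_sum[OF Gl]) (use L in simp)
    also have "\<dots> \<le> L * (\<Sum>c\<in>upper n. \<Sum>k<d. t c k \<omega>)"
      unfolding t_def by (rule mult_left_mono[OF sum_mono[OF cov_entry_diff[OF d]]]) (use L in simp)
    finally show "\<bar>F (\<lambda>\<kappa>. X \<kappa> (\<omega> \<kappa>)) - F (\<lambda>\<kappa>. Y \<kappa> (\<omega> \<kappa>))\<bar> \<le> L * (\<Sum>c\<in>upper n. \<Sum>k<d. t c k \<omega>)" .
  qed
  also have "\<dots> = L * (\<Sum>c\<in>upper n. \<Sum>k<d. \<integral>\<omega>. t c k \<omega> \<partial>Pr)"
  proof -
    have "(\<integral>\<omega>. (\<Sum>c\<in>upper n. \<Sum>k<d. t c k \<omega>) \<partial>Pr) = (\<Sum>c\<in>upper n. \<integral>\<omega>. (\<Sum>k<d. t c k \<omega>) \<partial>Pr)"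
      by (rule integral_sum) (intro integrable_sum, use ti in auto)
    also have "\<dots> = (\<Sum>c\<in>upper n. \<Sum>k<d. \<integral>\<omega>. t c k \<omega> \<partial>Pr)"
      by (rule sum.cong[OF refl], rule integral_sum) (use ti in auto)
    finally show ?thesis by simp
  qed
  also have "\<dots> \<le> L * (\<Sum>c\<in>upper n. \<Sum>k<d. 2 * sqrt \<delta>)"
    using L by (intro mult_left_mono sum_mono) (use ti in auto)
  also have "\<dots> = L * (real (card (upper n)) * (real d * 2)) * sqrt \<delta>" by simp
  also have "\<dots> \<le> c * sqrt \<delta>" using c(2) \<delta>(1) by (intro mult_right_mono) auto
  also have "\<dots> \<le> c * (\<epsilon> / c)" using s\<delta> c by (intro mult_left_mono) auto
  also have "\<dots> = \<epsilon>" using c by simp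
  finally have diff: "\<bar>(\<integral>\<omega>. F (\<lambda>\<kappa>. X \<kappa> (\<omega> \<kappa>)) \<partial>Pr) - (\<integral>\<omega>. F (\<lambda>\<kappa>. Y \<kappa> (\<omega> \<kappa>)) \<partial>Pr)\<bar> \<le> \<epsilon>" .
  have "(\<integral>\<omega>. F (\<lambda>\<kappa>. X \<kappa> (\<omega> \<kappa>)) \<partial>Pr) = (\<integral>\<omega>. G (cov_entry d (\<lambda>\<kappa>. X \<kappa> \<omega>)) \<partial>M)"
    using e1 e2 unfolding F_def by simp
  moreover have "(\<integral>\<omega>. F (\<lambda>\<kappa>. Y \<kappa> (\<omega> \<kappa>)) \<partial>Pr) = (\<integral>\<omega>. G (cov_entry d (A.y \<omega>)) \<partial>A.Prod)"
    using e3 e4 unfolding law F_def by simp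
  ultimately show "\<bar>(\<integral>\<omega>. G (cov_entry d (\<lambda>\<kappa>. X \<kappa> \<omega>)) \<partial>M) - ?Z\<bar> \<le> pi / 2 * (L * sqrt ?V) + \<epsilon>"
    using diff main by linarith
qed

section \<open>Symmetric matrices\<close>

definition sym_mat :: "nat \<Rightarrow> (nat \<times> nat \<Rightarrow> real) \<Rightarrow> real mat" where
  "sym_mat n u = mat n n (\<lambda>(i, j). u (min i j, max i j))"

lemma sym_mat_carrier: "sym_mat n u \<in> carrier_mat n n"
  by (simp add: sym_mat_def)

lemma cov_entry_commute: "cov_entry d u (j, i) = cov_entry d u (i, j)"
  by (simp add: cov_entry_def mult.commute eq_commute[of j i])

lemma rescaled_wishart_entry:
  assumes ij: "i < n" "j < n"
  shows "rescaled_wishart X n d \<omega> $$ (i, j) = cov_entry d (\<lambda>\<kappa>. X (fst \<kappa>) (snd \<kappa>) \<omega>) (i, j)"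
proof -
  define s where "s = (\<Sum>k<d. X i k \<omega> * X j k \<omega>)"
  define e :: real where "e = (if i = j then 1 else 0)"
  have "rescaled_wishart X n d \<omega> $$ (i, j) = sqrt (real d) * (1 / real d * s - e)"
    using ij by (simp add: rescaled_wishart_def wishart_def data_matrix_def scalar_prod_def atLeast0LessThan s_def e_def)
  also have "\<dots> = (s - real d * e) / sqrt (real d)"
  \<comment> \<open>At \<open>d = 0\<close> both sides are 0, by \<open>sqrt 0 = 0\<close> and by
    division by zero. The sequences in the weak convergence include this index.\<close>
  proof (cases "d = 0")
    case True
    then show ?thesis by simp
  next
    case False
    then have r: "sqrt (real d) \<noteq> 0" "sqrt (real d) * sqrt (real d) = real d" by simp_all
    have "sqrt (real d) * (1 / real d * s - e) * sqrt (real d) = (sqrt (real d) * sqrt (real d)) * (1 / real d * s - e)"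
      by (simp only: mult.commute mult.left_commute)
    also have "\<dots> = s - real d * e" unfolding r(2) using False by (simp add: right_diff_distrib)
    finally show ?thesis using r(1) by (simp add: eq_divide_eq)
  qed
  also have "\<dots> = cov_entry d (\<lambda>\<kappa>. X (fst \<kappa>) (snd \<kappa>) \<omega>) (i, j)"
    by (simp add: cov_entry_def s_def e_def sum_subtractf)
  finally show ?thesis .
qed

lemma rescaled_wishart_eq:
  "rescaled_wishart X n d \<omega> = sym_mat n (cov_entry d (\<lambda>\<kappa>. X (fst \<kappa>) (snd \<kappa>) \<omega>))"
proof (rule eq_matI)
  fix i j assume "i < dim_row (sym_mat n (cov_entry d (\<lambda>\<kappa>. X (fst \<kappa>) (snd \<kappa>) \<omega>)))" "j < dim_col (sym_mat n (cov_entry d (\<lambda>\<kappa>. X (fst \<kappa>) (snd \<kappa>) \<omega>)))"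
  then have ij: "i < n" "j < n" by (simp_all add: sym_mat_def)
  show "rescaled_wishart X n d \<omega> $$ (i, j) = sym_mat n (cov_entry d (\<lambda>\<kappa>. X (fst \<kappa>) (snd \<kappa>) \<omega>)) $$ (i, j)"
    unfolding rescaled_wishart_entry[OF ij] using ij cov_entry_commute[of d "\<lambda>\<kappa>. X (fst \<kappa>) (snd \<kappa>) \<omega>" j i]
    by (cases "i \<le> j") (simp_all add: sym_mat_def min_def max_def)
qed (simp_all add: sym_mat_def rescaled_wishart_def wishart_def data_matrix_def)

lemma hs_norm_nonneg: "0 \<le> hs_norm A"
  by (simp add: hs_norm_def sum_nonneg)

lemma abs_entry_le_hs_norm:
  assumes "i < dim_row A" "j < dim_col A" shows "\<bar>A $$ (i, j)\<bar> \<le> hs_norm A"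
proof -
  have "(A $$ (i, j))\<^sup>2 \<le> (\<Sum>j<dim_col A. (A $$ (i, j))\<^sup>2)"
    by (rule member_le_sum[where f="\<lambda>j. (A $$ (i, j))\<^sup>2"]) (use assms in auto)
  also have "\<dots> \<le> (\<Sum>i<dim_row A. \<Sum>j<dim_col A. (A $$ (i, j))\<^sup>2)"
    by (rule member_le_sum[where f="\<lambda>i. \<Sum>j<dim_col A. (A $$ (i, j))\<^sup>2"]) (use assms in \<open>auto intro: sum_nonneg\<close>)
  finally have "sqrt ((A $$ (i, j))\<^sup>2) \<le> hs_norm A" unfolding hs_norm_def by (rule real_sqrt_le_mono)
  then show ?thesis by simp
qed

lemma lip_norm_le_one:
  assumes g: "lip_norm n g \<le> 1" and A: "A \<in> carrier_mat n n" and B: "B \<in> carrier_mat n n"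
  shows "\<bar>g A - g B\<bar> \<le> hs_norm (A - B)"
proof (cases "A = B")
  case True
  then show ?thesis by (simp add: hs_norm_nonneg)
next
  case False
  have "\<exists>i j. i < n \<and> j < n \<and> A $$ (i, j) \<noteq> B $$ (i, j)"
  proof (rule ccontr)
    assume *: "\<not> ?thesis"
    have "A = B" by (rule eq_matI) (use * A B in auto)
    with False show False ..
  qed
  then obtain i j where ij: "i < n" "j < n" "A $$ (i, j) \<noteq> B $$ (i, j)" by blast
  have "\<bar>(A - B) $$ (i, j)\<bar> \<le> hs_norm (A - B)" by (rule abs_entry_le_hs_norm) (use ij B in auto)
  moreover have "0 < \<bar>(A - B) $$ (i, j)\<bar>" using ij A B by simp
  ultimately have pos: "0 < hs_norm (A - B)" by linarith
  have "ennreal (\<bar>g A - g B\<bar> / hs_norm (A - B)) \<le> lip_norm n g"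
    unfolding lip_norm_def by (rule SUP_upper2[of "(A, B)"]) (use A B False in auto)
  then have "ennreal (\<bar>g A - g B\<bar> / hs_norm (A - B)) \<le> 1" using g by (rule order_trans)
  then have "\<bar>g A - g B\<bar> / hs_norm (A - B) \<le> 1" by simp
  then show ?thesis using pos by (simp add: divide_le_eq)
qed

text \<open>The Hilbert-Schmidt norm counts every off-diagonal entry twice, the upper triangle once;
  hence \<open>sqrt 2\<close>.\<close>

lemma lip_on_sym_mat:
  assumes g: "\<And>A B. A \<in> carrier_mat n n \<Longrightarrow> B \<in> carrier_mat n n \<Longrightarrow> \<bar>g A - g B\<bar> \<le> hs_norm (A - B)"
  shows "lip_on (upper n) (sqrt 2) (\<lambda>u. g (sym_mat n u))"
  unfolding lip_on_def
proof (intro allI)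
  fix u v :: "nat \<times> nat \<Rightarrow> real"
  define b where "b c = (u c - v c)\<^sup>2" for c
  have b0: "0 \<le> b c" for c by (simp add: b_def)
  have up: "(\<Sum>i<n. \<Sum>j<n. if i \<le> j then b (i, j) else 0) = sum b (upper n)"
  proof -
    have "(\<Sum>i<n. \<Sum>j<n. if i \<le> j then b (i, j) else 0) = (\<Sum>c\<in>{..<n} \<times> {..<n}. if fst c \<le> snd c then b c else 0)"
      unfolding sum.cartesian_product by (rule sum.cong) auto
    also have "\<dots> = sum b (upper n)"
      by (rule sum.mono_neutral_cong_right) (auto simp: upper_def)
    finally show ?thesis .
  qed
  have "(\<Sum>i<n. \<Sum>j<n. b (min i j, max i j)) \<le> (\<Sum>i<n. \<Sum>j<n. (if i \<le> j then b (i, j) else 0) + (if j \<le> i then b (j, i) else 0))"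
    by (intro sum_mono) (auto simp: min_def max_def b0)
  also have "\<dots> = (\<Sum>i<n. \<Sum>j<n. if i \<le> j then b (i, j) else 0) + (\<Sum>i<n. \<Sum>j<n. if j \<le> i then b (j, i) else 0)"
    by (simp only: sum.distrib)
  also have "(\<Sum>i<n. \<Sum>j<n. if j \<le> i then b (j, i) else 0) = (\<Sum>j<n. \<Sum>i<n. if j \<le> i then b (j, i) else 0)"
    by (rule sum.swap)
  finally have le: "(\<Sum>i<n. \<Sum>j<n. b (min i j, max i j)) \<le> 2 * sum b (upper n)" unfolding up by simp
  have "hs_norm (sym_mat n u - sym_mat n v) = sqrt (\<Sum>i<n. \<Sum>j<n. b (min i j, max i j))"
    unfolding hs_norm_def by (simp add: sym_mat_def b_def)
  also have "\<dots> \<le> sqrt (2 * sum b (upper n))" by (rule real_sqrt_le_mono[OF le])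
  also have "\<dots> = sqrt 2 * sqrt (\<Sum>c\<in>upper n. (u c - v c)\<^sup>2)" by (simp add: real_sqrt_mult b_def)
  finally show "\<bar>g (sym_mat n u) - g (sym_mat n v)\<bar> \<le> sqrt 2 * sqrt (\<Sum>c\<in>upper n. (u c - v c)\<^sup>2)"
    using g[OF sym_mat_carrier sym_mat_carrier, of u v] by linarith
qed

text \<open>The Lipschitz bound makes \<open>G\<close> continuous for the product topology, and over
  a countable index type the Borel sets of that topology are the product sigma-algebra.\<close>

lemma lip_on_measurable:
  fixes G :: "('i::countable \<Rightarrow> real) \<Rightarrow> real"
  assumes G: "lip_on I L G"
  shows "G \<in> borel_measurable (borels UNIV)"
proof -
  have "isCont G u0" for u0
    unfolding isCont_def
  proof (rule LIM_zero_cancel, rule Lim_null_comparison)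
    show "\<forall>\<^sub>F u in at u0. norm (G u - G u0) \<le> L * sqrt (\<Sum>c\<in>I. (u c - u0 c)\<^sup>2)"
      using G unfolding lip_on_def real_norm_def by (intro always_eventually) blast
    have "continuous_on UNIV (\<lambda>u :: 'i \<Rightarrow> real. u c)" for c by (rule continuous_on_product_coordinates)
    then have c: "((\<lambda>u. u c) \<longlongrightarrow> u0 c) (at u0)" for c unfolding continuous_on_eq_continuous_at[OF open_UNIV] isCont_def by blast
    have "((\<lambda>u. L * sqrt (\<Sum>c\<in>I. (u c - u0 c)\<^sup>2)) \<longlongrightarrow> L * sqrt (\<Sum>c\<in>I. (u0 c - u0 c)\<^sup>2)) (at u0)"
      by (intro tendsto_mult tendsto_const tendsto_real_sqrt tendsto_sum tendsto_power tendsto_diff c)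
    then show "((\<lambda>u. L * sqrt (\<Sum>c\<in>I. (u c - u0 c)\<^sup>2)) \<longlongrightarrow> 0) (at u0)" by simp
  qed
  then have "continuous_on UNIV G" by (intro continuous_at_imp_continuous_on) blast
  then have "G \<in> borel_measurable borel" by (rule borel_measurable_continuous_onI)
  then show ?thesis unfolding measurable_cong_sets[OF sets_PiM_equal_borel refl] .
qed

lemma gaussian_rv_law:
  assumes N: "prob_space N" and g: "gaussian_rv N V 0 (s\<^sup>2)" and s: "0 < s"
  shows "distr N borel V = distr std_normal borel (\<lambda>x. s * x)"
proof -
  have Vm [measurable]: "V \<in> borel_measurable N" using g unfolding gaussian_rv_def by blast
  have law: "distr N borel (\<lambda>x. V x / s) = std_normal"
  proof (rule law_std_of_cos[OF N])
    fix a r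
    show "(\<integral>x. cos (a * (V x / s) + r) \<partial>N) = cos r * exp (- a\<^sup>2 / 2)"
      using gaussian_rv_moments(3)[OF N g, of "a / s" r] s by (simp add: power_divide)
  qed measurable
  have "distr std_normal borel (\<lambda>x. s * x) = distr N borel (\<lambda>x. s * (V x / s))"
    unfolding law[symmetric] by (subst distr_distr) (auto simp: comp_def)
  then show ?thesis using s by simp
qed

lemma gaussian_sym_matrix_measurable:
  assumes gz: "gaussian_sym_matrix N n m4 Z" and ij: "i < n" "j < n"
  shows "(\<lambda>\<omega>. Z \<omega> $$ (i, j)) \<in> borel_measurable N"
proof -
  have up: "(\<lambda>\<omega>. Z \<omega> $$ (i, j)) \<in> borel_measurable N" if "i \<le> j" "j < n" for i j
    using gz that unfolding gaussian_sym_matrix_def gaussian_rv_def by (cases "i = j") auto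
  show ?thesis
  proof (cases "i \<le> j")
    case True
    then show ?thesis using up ij by blast
  next
    case False
    then have "j < i" by simp
    have "(\<lambda>\<omega>. Z \<omega> $$ (j, i)) \<in> borel_measurable N" using up False ij by simp
    moreover have "Z \<omega> $$ (i, j) = Z \<omega> $$ (j, i)" if "\<omega> \<in> space N" for \<omega>
      using gz that \<open>j < i\<close> ij unfolding gaussian_sym_matrix_def by blast
    ultimately show ?thesis by (simp cong: measurable_cong)
  qed
qed

lemma gaussian_sym_matrix_eq:
  assumes gz: "gaussian_sym_matrix N n m4 Z" and \<omega>: "\<omega> \<in> space N"
  shows "Z \<omega> = sym_mat n (\<lambda>c. Z \<omega> $$ c)"
proof -
  have c: "Z \<omega> \<in> carrier_mat n n" and s: "\<And>i j. i < n \<Longrightarrow> j < i \<Longrightarrow> Z \<omega> $$ (i, j) = Z \<omega> $$ (j, i)"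
    using gz \<omega> unfolding gaussian_sym_matrix_def by auto
  show ?thesis
  proof (rule eq_matI)
    fix i j assume "i < dim_row (sym_mat n (\<lambda>c. Z \<omega> $$ c))" "j < dim_col (sym_mat n (\<lambda>c. Z \<omega> $$ c))"
    then have "i < n" "j < n" by (simp_all add: sym_mat_def)
    then show "Z \<omega> $$ (i, j) = sym_mat n (\<lambda>c. Z \<omega> $$ c) $$ (i, j)"
      using s[of i j] by (cases "i \<le> j") (simp_all add: sym_mat_def min_def max_def)
  qed (use c in \<open>auto simp: sym_mat_def\<close>)
qed

lemma gaussian_sym_matrix_integral:
  assumes gz: "gaussian_sym_matrix N n (1 + v) Z" and v: "0 < v" and n: "1 \<le> n"
    and Gm: "G \<in> borel_measurable (borels UNIV)" and Gl: "lip_on (upper n) L G"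
  shows "(\<integral>\<omega>. G (\<lambda>c. Z \<omega> $$ c) \<partial>N) = (\<integral>z. G (\<lambda>c. entry_scale v c * z c) \<partial>gam (upper n))"
proof -
  have N: "prob_space N" using gz unfolding gaussian_sym_matrix_def by blast
  interpret prob_space N by (rule N)
  have ind: "indep_vars (\<lambda>_. borel) (\<lambda>(i, j) \<omega>. Z \<omega> $$ (i, j)) (upper n)"
    using gz unfolding gaussian_sym_matrix_def upper_def by blast
  have eq: "(\<lambda>(i, j) \<omega>. Z \<omega> $$ (i, j)) = (\<lambda>c \<omega>. Z \<omega> $$ c)" by (auto simp: fun_eq_iff)
  have Zm: "(\<lambda>\<omega>. Z \<omega> $$ c) \<in> borel_measurable N" if "c \<in> upper n" for c
    using gaussian_sym_matrix_measurable[OF gz, of "fst c" "snd c"] that by (auto simp: upper_def)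
  have "(0, 0) \<in> upper n" using n by (simp add: upper_def)
  then have ne: "upper n \<noteq> {}" by blast
  have loc: "G (restrict u (upper n)) = G u" for u by (rule lip_on_local[OF Gl]) simp
  have lawc: "distr N borel (\<lambda>\<omega>. Z \<omega> $$ c) = distr std_normal borel (\<lambda>x. entry_scale v c * x)" if c: "c \<in> upper n" for c
  proof (rule gaussian_rv_law[OF N])
    obtain i j where ij: "c = (i, j)" "i \<le> j" "j < n" using c by (auto simp: upper_def)
    show "gaussian_rv N (\<lambda>\<omega>. Z \<omega> $$ c) 0 ((entry_scale v c)\<^sup>2)"
      using gz v ij unfolding gaussian_sym_matrix_def entry_scale_def by (cases "i = j") auto
    show "0 < entry_scale v c" using v by (simp add: entry_scale_def)
  qed
  have "distr N (borels (upper n)) (\<lambda>\<omega>. \<lambda>c\<in>upper n. Z \<omega> $$ c) = PiM (upper n) (\<lambda>c. distr N borel (\<lambda>\<omega>. Z \<omega> $$ c))"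
    using indep_vars_iff_distr_eq_PiM'[OF ne, of "\<lambda>c \<omega>. Z \<omega> $$ c" "\<lambda>_. borel"] Zm ind unfolding eq by blast
  also have "\<dots> = PiM (upper n) (\<lambda>c. distr std_normal borel (\<lambda>x. entry_scale v c * x))"
    by (rule PiM_cong[OF refl lawc])
  finally have lawZ: "distr N (borels (upper n)) (\<lambda>\<omega>. \<lambda>c\<in>upper n. Z \<omega> $$ c) =
    PiM (upper n) (\<lambda>c. distr std_normal borel (\<lambda>x. entry_scale v c * x))" .
  have lawg: "distr (gam (upper n)) (borels (upper n)) (\<lambda>z. \<lambda>c\<in>upper n. entry_scale v c * z c) =
    PiM (upper n) (\<lambda>c. distr std_normal borel (\<lambda>x. entry_scale v c * x))"
    unfolding gam_def by (rule distr_PiM_coordinatewise[OF finite_upper prob_std, of "\<lambda>c x. entry_scale v c * x"]) simp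
  have gm: "(\<lambda>z. entry_scale v c * z c) \<in> borel_measurable (gam (upper n))" for c by measurable
  show ?thesis
    by (rule trans[OF integral_of_family[OF Gm loc Zm lawZ] integral_of_family[OF Gm loc gm lawg, symmetric]])
qed

lemma stein_pair_mono:
  assumes sp: "stein_pair \<Omega> Y T S B" and le: "B \<le> B'"
  shows "stein_pair \<Omega> Y T S B'"
proof -
  note s = stein_pairD[OF sp]
  have "\<forall>R \<in> {T, \<lambda>x. T x * Y x, S, \<lambda>x. S x * Y x}. integrable \<Omega> (\<lambda>x. (R x)\<^sup>2) \<and> (\<integral>x. (R x)\<^sup>2 \<partial>\<Omega>) \<le> B'"
    using s(9,11,13,15) order_trans[OF s(10) le] order_trans[OF s(12) le] order_trans[OF s(14) le] order_trans[OF s(16) le] by simp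
  moreover have "\<forall>\<phi> \<phi>'. stein_test \<phi> \<phi>' \<longrightarrow>
        (\<integral>x. Y x * \<phi> (Y x) \<partial>\<Omega>) = (\<integral>x. T x * \<phi>' (Y x) \<partial>\<Omega>) \<and>
        (\<integral>x. ((Y x)\<^sup>2 - 1) * \<phi> (Y x) \<partial>\<Omega>) = (\<integral>x. S x * \<phi>' (Y x) \<partial>\<Omega>)"
  proof (intro allI impI conjI)
    fix \<phi> \<phi>' assume t: "stein_test \<phi> \<phi>'"
    show "(\<integral>x. Y x * \<phi> (Y x) \<partial>\<Omega>) = (\<integral>x. T x * \<phi>' (Y x) \<partial>\<Omega>)" by (rule stein_pair_kernels(1)[OF sp t])
    show "(\<integral>x. ((Y x)\<^sup>2 - 1) * \<phi> (Y x) \<partial>\<Omega>) = (\<integral>x. S x * \<phi>' (Y x) \<partial>\<Omega>)" by (rule stein_pair_kernels(2)[OF sp t])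
  qed
  ultimately show ?thesis
    unfolding stein_pair_def using s(1-5) order_trans[OF s(6) le] s(7,8) by (intro conjI)
qed

lemma abs_cos_diff_le: "\<bar>cos a - cos b\<bar> \<le> \<bar>a - b :: real\<bar>"
proof -
  have "\<bar>cos a - cos b\<bar> = 2 * (\<bar>sin ((a + b) / 2)\<bar> * \<bar>sin ((b - a) / 2)\<bar>)" by (simp add: cos_diff_cos abs_mult)
  also have "\<dots> \<le> 2 * (1 * \<bar>(b - a) / 2\<bar>)" by (intro mult_left_mono mult_mono abs_sin_x_le_abs_x) auto
  finally show ?thesis by simp
qed

lemma abs_sin_diff_le: "\<bar>sin a - sin b\<bar> \<le> \<bar>a - b :: real\<bar>"
  using abs_cos_diff_le[of "pi / 2 - a" "pi / 2 - b"] by (simp add: cos_diff abs_minus_commute)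

lemma char_distr_Re_Im:
  assumes N: "prob_space N" and V: "V \<in> borel_measurable N"
  shows "Re (char (distr N borel V) t) = (\<integral>x. cos (t * V x) \<partial>N)" "Im (char (distr N borel V) t) = (\<integral>x. sin (t * V x) \<partial>N)"
proof -
  interpret prob_space N by (rule N)
  have i: "integrable N (\<lambda>x. iexp (t * V x))" by (rule integrable_iexp) (use V in auto)
  have e: "char (distr N borel V) t = (\<integral>x. iexp (t * V x) \<partial>N)"
    unfolding char_def using V by (intro integral_distr) auto
  show "Re (char (distr N borel V) t) = (\<integral>x. cos (t * V x) \<partial>N)" unfolding e using integral_Re[OF i] by (simp add: Re_exp)
  show "Im (char (distr N borel V) t) = (\<integral>x. sin (t * V x) \<partial>N)" unfolding e using integral_Im[OF i] by (simp add: Im_exp)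
qed

section \<open>The main theorem\<close>

theorem theorem1:
  fixes M :: "'w measure"
    and W :: "'h::{real_inner,polish_space} \<Rightarrow> 'w \<Rightarrow> real"
    and N0 :: nat and q :: "nat \<Rightarrow> nat"
    and f :: "nat \<Rightarrow> nat \<Rightarrow> 'h list \<Rightarrow> real"
    and X :: "nat \<Rightarrow> nat \<Rightarrow> 'w \<Rightarrow> real"
    and m4 :: real
    and N :: "nat \<Rightarrow> 'z measure"
    and Z :: "nat \<Rightarrow> 'z \<Rightarrow> real mat"
  assumes "isonormal_process M W"
    and "1 \<le> N0"
    and "\<And>i. q i \<in> {1..N0}"
    and "\<And>i j. f i j \<in> sym_tensor_power (q i)"
    and "\<And>i j. is_multiple_integral M W (q i) (f i j) (X i j)"
    and "prob_space.indep_vars M (\<lambda>_. borel) (\<lambda>(i, j). X i j) UNIV"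
    and "\<And>i j. (\<integral>\<omega>. (X i j \<omega>)^2 \<partial>M) = fact (q i) * (tensor_norm (q i) (f i j))^2"
    and "\<And>i j. fact (q i) * (tensor_norm (q i) (f i j))^2 = 1"
    and "\<And>i j. (\<integral>\<omega>. (X i j \<omega>)^4 \<partial>M) = m4"
    and "\<And>n. 1 \<le> n \<Longrightarrow> gaussian_sym_matrix (N n) n m4 (Z n)"
  shows "(\<forall>n\<ge>1. \<forall>i<n. \<forall>j<n.
            weak_conv_m (\<lambda>d. distr M borel (\<lambda>\<omega>. rescaled_wishart X n d \<omega> $$ (i, j)))
                        (distr (N n) borel (\<lambda>\<omega>. Z n \<omega> $$ (i, j))))
       \<and> (\<exists>C>0. \<forall>n\<ge>1. \<forall>d\<ge>1.
            wasserstein n M (rescaled_wishart X n d) (N n) (Z n)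
              \<le> ennreal (C * sqrt (real n ^ 3 / real d)))"
proof -
  note iso = assms(1) and qN = assms(3) and mi = assms(5) and gz = assms(10)
  have M: "prob_space M" by (rule isonormal_prob[OF iso])
  have X2: "(\<integral>\<omega>. (X i j \<omega>)\<^sup>2 \<partial>M) = 1" for i j using assms(7)[of i j] assms(8)[of i j] by simp
  have Xm: "X i j \<in> borel_measurable M" and iX: "integrable M (\<lambda>\<omega>. (X i j \<omega>)\<^sup>2)" for i j
    using mi[of i j] unfolding is_multiple_integral_def by blast+
  define P where "P r X \<delta> b \<longleftrightarrow> (\<exists>(\<Omega> :: (real \<times> ('h \<Rightarrow> real) \<times> ('h \<Rightarrow> real)) measure) Y' T S Y. stein_pair \<Omega> Y' T S b \<and>
        Y \<in> borel_measurable M \<and> distr M borel Y = distr \<Omega> borel Y' \<and>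
        integrable M (\<lambda>\<omega>. (X \<omega> - Y \<omega>)\<^sup>2) \<and> (\<integral>\<omega>. (X \<omega> - Y \<omega>)\<^sup>2 \<partial>M) < \<delta> \<and>
        \<bar>(\<integral>x. Y' x ^ 4 \<partial>\<Omega>) - r\<bar> \<le> \<delta>)" for r \<delta> b :: real and X
  \<comment> \<open>A bound \<open>b r\<close> for each degree \<open>r\<close>, fixed before the
    variables; for \<open>r = 0\<close> the value 1 is a placeholder.\<close>
  have "\<exists>b. 1 \<le> b \<and> (1 \<le> r \<longrightarrow> (\<forall>f X \<delta>. is_multiple_integral M W r f X \<longrightarrow> (\<integral>\<omega>. (X \<omega>)\<^sup>2 \<partial>M) = 1 \<longrightarrow> 0 < \<delta> \<longrightarrow> P (\<integral>\<omega>. X \<omega> ^ 4 \<partial>M) X \<delta> b))" for r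
  proof (cases "1 \<le> r")
    case True
    obtain C :: real where C: "1 \<le> C"
      "\<And>f X \<delta>. is_multiple_integral M W r f X \<Longrightarrow> (\<integral>\<omega>. (X \<omega>)\<^sup>2 \<partial>M) = 1 \<Longrightarrow> 0 < \<delta> \<Longrightarrow> P (\<integral>\<omega>. X \<omega> ^ 4 \<partial>M) X \<delta> C"
      unfolding P_def by (rule chaos_approx[OF iso True]) blast
    show ?thesis
      by (intro exI[of _ C] conjI impI allI C(1)) (rule C(2))
  next
    case False
    then show ?thesis by (intro exI[of _ 1]) simp
  qed
  then have "\<exists>b. \<forall>r. 1 \<le> b r \<and> (1 \<le> r \<longrightarrow> (\<forall>f X \<delta>. is_multiple_integral M W r f X \<longrightarrow> (\<integral>\<omega>. (X \<omega>)\<^sup>2 \<partial>M) = 1 \<longrightarrow> 0 < \<delta> \<longrightarrow> P (\<integral>\<omega>. X \<omega> ^ 4 \<partial>M) X \<delta> (b r)))"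
    by (intro choice allI)
  then obtain b where b1: "\<And>r. 1 \<le> b r"
    and bP: "\<And>r f X \<delta>. 1 \<le> r \<Longrightarrow> is_multiple_integral M W r f X \<Longrightarrow> (\<integral>\<omega>. (X \<omega>)\<^sup>2 \<partial>M) = 1 \<Longrightarrow> 0 < \<delta> \<Longrightarrow> P (\<integral>\<omega>. X \<omega> ^ 4 \<partial>M) X \<delta> (b r)"
    by blast
  \<comment> \<open>Only the degrees up to \<open>N0\<close> occur, and the sum dominates each of
    their bounds; this makes the final constant independent of \<open>n\<close> and
    \<open>d\<close>.\<close>
  define B where "B = (\<Sum>r\<in>{1..N0}. b r)"
  have bB: "b r \<le> B" if "r \<in> {1..N0}" for r
    unfolding B_def by (rule member_le_sum[where f=b]) (use that b1 in \<open>auto intro: order_trans[OF zero_le_one]\<close>)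
  have B: "1 \<le> B" using order_trans[OF b1 bB[OF qN[of 0]]] .
  have approx: "P m4 (X i j) \<delta> B" if \<delta>: "0 < \<delta>" for i j \<delta>
  proof -
    have "P (\<integral>\<omega>. X i j \<omega> ^ 4 \<partial>M) (X i j) \<delta> (b (q i))"
      by (rule bP[OF _ mi X2 \<delta>]) (use qN[of i] in simp)
    then show ?thesis unfolding P_def assms(9) using stein_pair_mono[OF _ bB[OF qN[of i]]] by blast
  qed
  \<comment> \<open>Any entry will do; the entry with both indices 0 is taken.\<close>
  have "1 < m4"
    by (rule kurtosis_gt_one[OF B]) (use approx[of _ 0 0] in \<open>unfold P_def, blast\<close>)
  define v where "v = m4 - 1"
  have v: "0 < v" and m4: "m4 = 1 + v" using \<open>1 < m4\<close> by (simp_all add: v_def)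
  define X' where "X' \<kappa> = X (fst \<kappa>) (snd \<kappa>)" for \<kappa>
  have ind: "prob_space.indep_vars M (\<lambda>_. borel) X' UNIV"
  proof -
    have "(\<lambda>(i, j). X i j) = X'" by (auto simp: X'_def fun_eq_iff)
    then show ?thesis using assms(6) by simp
  qed
  \<comment> \<open>The bound of \<open>wishart_comparison\<close> for the Lipschitz constant
    \<open>sqrt 2\<close>, with \<open>sqrt (n^3 / d)\<close> taken out.\<close>
  define C where "C = pi / 2 * (sqrt 2 * sqrt (8 * B\<^sup>2 / min 1 v))"
  have C: "0 < C" unfolding C_def using B v by (intro mult_pos_pos) auto
  have main: "\<bar>(\<integral>\<omega>. g (rescaled_wishart X n d \<omega>) \<partial>M) - (\<integral>\<omega>. g (Z n \<omega>) \<partial>N n)\<bar> \<le> C * sqrt (real n ^ 3 / real d)"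
    if g: "\<And>A B. A \<in> carrier_mat n n \<Longrightarrow> B \<in> carrier_mat n n \<Longrightarrow> \<bar>g A - g B\<bar> \<le> hs_norm (A - B)"
      and n: "1 \<le> n" and d: "1 \<le> d" for g :: "real mat \<Rightarrow> real" and n d
  proof -
    define G where "G u = g (sym_mat n u)" for u
    have Gl: "lip_on (upper n) (sqrt 2) G" unfolding G_def[abs_def] by (rule lip_on_sym_mat[OF g])
    have Gm: "G \<in> borel_measurable (borels UNIV)" by (rule lip_on_measurable[OF Gl])
    have "\<bar>(\<integral>\<omega>. G (cov_entry d (\<lambda>\<kappa>. X' \<kappa> \<omega>)) \<partial>M) - (\<integral>z. G (\<lambda>c. entry_scale v c * z c) \<partial>gam (upper n))\<bar>
        \<le> pi / 2 * (sqrt 2 * sqrt (8 * real n ^ 3 * B\<^sup>2 / real d / min 1 v))"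
    proof (rule wishart_comparison[OF M ind _ _ _ v B _ n d Gm Gl])
      fix \<kappa> and \<delta> :: real assume \<delta>: "0 < \<delta>"
      show "\<exists>(\<Omega> :: (real \<times> ('h \<Rightarrow> real) \<times> ('h \<Rightarrow> real)) measure) Y' T S Y. stein_pair \<Omega> Y' T S B \<and>
        Y \<in> borel_measurable M \<and> distr M borel Y = distr \<Omega> borel Y' \<and>
        integrable M (\<lambda>\<omega>. (X' \<kappa> \<omega> - Y \<omega>)\<^sup>2) \<and> (\<integral>\<omega>. (X' \<kappa> \<omega> - Y \<omega>)\<^sup>2 \<partial>M) < \<delta> \<and>
        \<bar>(\<integral>x. Y' x ^ 4 \<partial>\<Omega>) - (1 + v)\<bar> \<le> \<delta>"
        using approx[OF \<delta>, of "fst \<kappa>" "snd \<kappa>"] unfolding P_def X'_def m4 .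
    qed (simp_all add: X'_def Xm iX X2)
    moreover have "(\<integral>\<omega>. G (cov_entry d (\<lambda>\<kappa>. X' \<kappa> \<omega>)) \<partial>M) = (\<integral>\<omega>. g (rescaled_wishart X n d \<omega>) \<partial>M)"
      unfolding rescaled_wishart_eq G_def X'_def ..
    moreover have "(\<integral>z. G (\<lambda>c. entry_scale v c * z c) \<partial>gam (upper n)) = (\<integral>\<omega>. g (Z n \<omega>) \<partial>N n)"
    proof -
      have gz': "gaussian_sym_matrix (N n) n (1 + v) (Z n)" using gz[OF n] unfolding m4 .
      have "(\<integral>\<omega>. g (Z n \<omega>) \<partial>N n) = (\<integral>\<omega>. G (\<lambda>c. Z n \<omega> $$ c) \<partial>N n)"
        by (rule integral_cong[OF refl])
           (unfold G_def, rule arg_cong[where f=g], rule gaussian_sym_matrix_eq[OF gz'])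
      also have "\<dots> = (\<integral>z. G (\<lambda>c. entry_scale v c * z c) \<partial>gam (upper n))"
        by (rule gaussian_sym_matrix_integral[OF gz' v n Gm Gl])
      finally show ?thesis by (rule sym)
    qed
    moreover have "pi / 2 * (sqrt 2 * sqrt (8 * real n ^ 3 * B\<^sup>2 / real d / min 1 v)) = C * sqrt (real n ^ 3 / real d)"
    proof -
      have "8 * real n ^ 3 * B\<^sup>2 / real d / min 1 v = (8 * B\<^sup>2 / min 1 v) * (real n ^ 3 / real d)"
        by (simp add: mult.commute mult.left_commute)
      then have "sqrt (8 * real n ^ 3 * B\<^sup>2 / real d / min 1 v) = sqrt (8 * B\<^sup>2 / min 1 v) * sqrt (real n ^ 3 / real d)"
        by (simp only: real_sqrt_mult)
      then show ?thesis by (simp only: C_def mult.assoc)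
    qed
    ultimately show ?thesis by simp
  qed
  have weak: "weak_conv_m (\<lambda>d. distr M borel (\<lambda>\<omega>. rescaled_wishart X n d \<omega> $$ (i, j))) (distr (N n) borel (\<lambda>\<omega>. Z n \<omega> $$ (i, j)))"
    if n: "1 \<le> n" and ij: "i < n" "j < n" for n i j
  proof -
    have Nn: "prob_space (N n)" using gz[OF n] unfolding gaussian_sym_matrix_def by blast
    have Zm: "(\<lambda>\<omega>. Z n \<omega> $$ (i, j)) \<in> borel_measurable (N n)" by (rule gaussian_sym_matrix_measurable[OF gz[OF n] ij])
    have Um: "(\<lambda>\<omega>. rescaled_wishart X n d \<omega> $$ (i, j)) \<in> borel_measurable M" for d
      unfolding rescaled_wishart_entry[OF ij] cov_entry_def
      by (intro borel_measurable_divide borel_measurable_sum borel_measurable_diff borel_measurable_times borel_measurable_const Xm)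
    have lim: "(\<lambda>d. \<integral>\<omega>. h (t * rescaled_wishart X n d \<omega> $$ (i, j)) \<partial>M) \<longlonglongrightarrow> (\<integral>\<omega>. h (t * Z n \<omega> $$ (i, j)) \<partial>N n)"
      if h: "\<And>a b. \<bar>h a - h b\<bar> \<le> \<bar>a - b\<bar>" for h :: "real \<Rightarrow> real" and t
    proof (rule LIM_zero_cancel, rule Lim_null_comparison)
      \<comment> \<open>Dividing by \<open>r\<close> makes the test function 1-Lipschitz, as
        \<open>main\<close> requires; the \<open>+ 1\<close> keeps \<open>r\<close> positive at
        \<open>t = 0\<close>.\<close>
      define r where "r = \<bar>t\<bar> + 1"
      have r: "0 < r" "\<bar>t\<bar> \<le> r" by (auto simp: r_def)
      define g where "g A = h (t * A $$ (i, j)) / r" for A :: "real mat"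
      have gl: "\<bar>g A - g A'\<bar> \<le> hs_norm (A - A')" if "A \<in> carrier_mat n n" "A' \<in> carrier_mat n n" for A A'
      proof -
        have "\<bar>g A - g A'\<bar> = \<bar>h (t * A $$ (i, j)) - h (t * A' $$ (i, j))\<bar> / r"
          using r by (simp add: g_def diff_divide_distrib[symmetric] abs_divide)
        also have "\<dots> \<le> \<bar>t * A $$ (i, j) - t * A' $$ (i, j)\<bar> / r" using r by (intro divide_right_mono h) auto
        also have "\<dots> = \<bar>t\<bar> * \<bar>(A - A') $$ (i, j)\<bar> / r" using that ij by (simp add: right_diff_distrib[symmetric] abs_mult)
        also have "\<dots> \<le> r * hs_norm (A - A') / r"
          using r that ij by (intro divide_right_mono mult_mono abs_entry_le_hs_norm) auto
        finally show ?thesis using r by simp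
      qed
      show "\<forall>\<^sub>F d in sequentially. norm ((\<integral>\<omega>. h (t * rescaled_wishart X n d \<omega> $$ (i, j)) \<partial>M) - (\<integral>\<omega>. h (t * Z n \<omega> $$ (i, j)) \<partial>N n))
          \<le> r * C * sqrt (real n ^ 3 / real d)"
        using eventually_ge_at_top[of 1]
      proof eventually_elim
        case (elim d)
        have "\<bar>(\<integral>\<omega>. h (t * rescaled_wishart X n d \<omega> $$ (i, j)) \<partial>M) / r - (\<integral>\<omega>. h (t * Z n \<omega> $$ (i, j)) \<partial>N n) / r\<bar> \<le> C * sqrt (real n ^ 3 / real d)"
          using main[OF gl n elim] by (simp add: g_def)
        then have "\<bar>(\<integral>\<omega>. h (t * rescaled_wishart X n d \<omega> $$ (i, j)) \<partial>M) - (\<integral>\<omega>. h (t * Z n \<omega> $$ (i, j)) \<partial>N n)\<bar> / r \<le> C * sqrt (real n ^ 3 / real d)"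
          using r by (simp add: diff_divide_distrib[symmetric] abs_divide)
        then show ?case using r by (simp add: divide_le_eq mult.commute mult.left_commute)
      qed
      have "(\<lambda>d. sqrt (real n ^ 3 / real d)) \<longlonglongrightarrow> sqrt 0" by (rule tendsto_real_sqrt[OF lim_const_over_n])
      then have "(\<lambda>d. r * C * sqrt (real n ^ 3 / real d)) \<longlonglongrightarrow> r * C * sqrt 0" by (rule tendsto_mult_left)
      then show "(\<lambda>d. r * C * sqrt (real n ^ 3 / real d)) \<longlonglongrightarrow> 0" by simp
    qed
    show ?thesis
    proof (rule levy_continuity)
      show "real_distribution (distr M borel (\<lambda>\<omega>. rescaled_wishart X n d \<omega> $$ (i, j)))" for d
        by (rule prob_space.real_distribution_distr[OF M Um])
      show "real_distribution (distr (N n) borel (\<lambda>\<omega>. Z n \<omega> $$ (i, j)))"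
        by (rule prob_space.real_distribution_distr[OF Nn Zm])
      show "(\<lambda>d. char (distr M borel (\<lambda>\<omega>. rescaled_wishart X n d \<omega> $$ (i, j))) t) \<longlonglongrightarrow> char (distr (N n) borel (\<lambda>\<omega>. Z n \<omega> $$ (i, j))) t" for t
        unfolding tendsto_complex_iff char_distr_Re_Im[OF M Um] char_distr_Re_Im[OF Nn Zm]
        by (intro conjI lim abs_cos_diff_le abs_sin_diff_le)
    qed
  qed
  have "wasserstein n M (rescaled_wishart X n d) (N n) (Z n) \<le> ennreal (C * sqrt (real n ^ 3 / real d))" if "1 \<le> n" "1 \<le> d" for n d
    unfolding wasserstein_def
  proof (rule SUP_least)
    fix g assume "g \<in> {g. lip_norm n g \<le> 1}"
    then have g: "lip_norm n g \<le> 1" by simp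
    show "ennreal \<bar>(\<integral>\<omega>. g (rescaled_wishart X n d \<omega>) \<partial>M) - (\<integral>\<omega>. g (Z n \<omega>) \<partial>N n)\<bar> \<le> ennreal (C * sqrt (real n ^ 3 / real d))"
      by (rule ennreal_leI) (rule main[OF lip_norm_le_one[OF g] that])
  qed
  with weak C show ?thesis by blast
qed

end
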